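(* There is a constant $c>0$, independent of $u$, $\alpha$, $\boldsymbol{v}$ and the mesh sizes $H_\ell$, such that the following holds. Let $u \in X_v$ be the solution of $b(u,q) = \langle f,q\rangle_\Omega$ for all $q \in Y$, let $u_H \in X_H$ be the unique solution of the Galerkin variational formulation $$b(u_H,q_H) = \langle f,q_H\rangle_\Omega \quad \text{for all } q_H \in Y_H,$$ and assume $u \in H^2(\Omega)$. Assume further that $$c_v := \sup_{0 \neq q \in H^1_0(\Omega)} \frac{\|q\,\boldsymbol{v}\|_{L^2(\Omega)}}{\|\nabla q\|_{L^2(\Omega)}} < \infty$$ and $\operatorname{div} \boldsymbol{v}(x) \leq 0$ for almost all $x \in \Omega$. Then there holds the error estimate $$\|u-u_H\|_Y^2 \leq c \sum_{\ell=1}^N H_\ell^2 \left[ \sup_{x\in\tau_\ell} \alpha(x) + \frac{c_v^2}{\underline{\alpha}} \right] |u|_{H^2(\tau_\ell)}^2.$$ Moreover, when $\boldsymbol{v} \in [L^\infty(\Omega)]^n$ and $\operatorname{div}\boldsymbol{v}(x) = 0$ for almost all $x \in \Omega$, the error estimate $$\|u-u_H\|_Y^2 \leq c \sum_{\ell=1}^N \left[ H_\ell^2 \sup_{x\in\tau_\ell}\alpha(x) + H_\ell^4 \sup_{x\in\tau_\ell} \frac{|\boldsymbol{v}(x)|^2}{\alpha(x)} \right] |u|_{H^2(\tau_\ell)}^2$$ follows.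
   Context: $\Omega \subset \mathbb{R}^n$, $n=1,2,3$, is a bounded Lipschitz domain. The diffusion coefficient $\alpha:\Omega\to\mathbb{R}$ is measurable and satisfies $0 < \underline{\alpha} \leq \alpha(x) \leq \overline{\alpha}$ for all $x \in \Omega$, with constants $\underline\alpha,\overline\alpha$. $\boldsymbol{v}$ is a given, possibly unbounded, locally integrable velocity field on $\Omega$ with values in $\mathbb{R}^n$ whose divergence, understood in the weak sense, is a locally integrable function. $Y := H^1_0(\Omega)$ is equipped with the norm $\|q\|_Y^2 := \int_\Omega \alpha(x)\,|\nabla q(x)|^2\,dx$, and $Y^*=H^{-1}(\Omega)$ is its dual, with duality pairing $\langle\cdot,\cdot\rangle_\Omega$ extending the $L^2(\Omega)$ inner product; $f\in Y^*$ is given. The velocity dependent ansatz space is $X_v := \{u \in Y : \boldsymbol{v}\cdot\nabla u \in Y^*\}$. The bilinear form $b : X_v\times Y\to\mathbb{R}$ is $$b(u,q) := \int_\Omega \alpha(x)\,\nabla u(x)\cdot\nabla q(x)\,dx + \int_\Omega \boldsymbol{v}(x)\cdot\nabla u(x)\,q(x)\,dx,$$ where for $u \in X_v$ and $q \in Y$ the last integral is understood as the duality pairing $\langle \boldsymbol{v}\cdot\nabla u, q\rangle_\Omega$. $X_H = Y_H = S_H^1(\Omega)\cap H^1_0(\Omega)$ is the standard finite element space of piecewise linear continuous functions vanishing on $\partial\Omega$, defined with respect to an admissible (conforming) decomposition of $\Omega$ into shape regular simplicial finite elements $\tau_\ell$ of local mesh size $H_\ell$, $\ell=1,\ldots,N$.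 $|u|_{H^2(\tau_\ell)}$ denotes the $H^2$ seminorm on $\tau_\ell$. *)

theory Defs
  imports "HOL-Analysis.Analysis" "HOL-Probability.Essential_Supremum"
begin

text \<open>Functions on an open set \<open>\<Omega>\<close> are total functions whose values outside \<open>\<Omega>\<close> are irrelevant;
  all integrals are taken with respect to \<^term>\<open>lebesgue_on \<Omega>\<close>, and elements of function spaces
  are representatives (no quotient by equality almost everywhere is formed).\<close>

definition bounded_lipschitz_domain :: "'a::euclidean_space set \<Rightarrow> bool" where
  "bounded_lipschitz_domain \<Omega> \<longleftrightarrow>
     open \<Omega> \<and> connected \<Omega> \<and> \<Omega> \<noteq> {} \<and> bounded \<Omega> \<and>
     (\<forall>x\<in>frontier \<Omega>. \<exists>r>0. \<exists>e \<gamma> L. norm e = 1 \<and> L-lipschitz_on {z. z \<bullet> e = 0} \<gamma> \<and>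
        (\<forall>y\<in>ball x r. y \<in> \<Omega> \<longleftrightarrow> \<gamma> (y - (y \<bullet> e) *\<^sub>R e) < y \<bullet> e))"

primrec C_k :: "nat \<Rightarrow> ('a::euclidean_space \<Rightarrow> real) \<Rightarrow> bool" where
  "C_k 0 f \<longleftrightarrow> continuous_on UNIV f"
| "C_k (Suc k) f \<longleftrightarrow> (\<forall>x. f differentiable (at x)) \<and>
     (\<forall>i\<in>Basis. C_k k (\<lambda>x. frechet_derivative f (at x) i))"

definition test_functions :: "'a::euclidean_space set \<Rightarrow> ('a \<Rightarrow> real) set" where
  "test_functions \<Omega> =
     {\<phi>. (\<forall>k. C_k k \<phi>) \<and> compact (closure {x. \<phi> x \<noteq> 0}) \<and> closure {x. \<phi> x \<noteq> 0} \<subseteq> \<Omega>}"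

definition locally_integrable :: "'a::euclidean_space set \<Rightarrow> ('a \<Rightarrow> 'b::euclidean_space) \<Rightarrow> bool" where
  "locally_integrable \<Omega> f \<longleftrightarrow> f \<in> borel_measurable (lebesgue_on \<Omega>) \<and>
     (\<forall>K. compact K \<and> K \<subseteq> \<Omega> \<longrightarrow> integrable (lebesgue_on K) f)"

definition L2 :: "'a::euclidean_space set \<Rightarrow> ('a \<Rightarrow> 'b::euclidean_space) set" where
  "L2 \<Omega> = {f. f \<in> borel_measurable (lebesgue_on \<Omega>) \<and>
               integrable (lebesgue_on \<Omega>) (\<lambda>x. (norm (f x))\<^sup>2)}"

definition L2_norm :: "'a::euclidean_space set \<Rightarrow> ('a \<Rightarrow> 'b::euclidean_space) \<Rightarrow> ereal" where
  "L2_norm \<Omega> f =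
     (if f \<in> L2 \<Omega> then ereal (sqrt (\<integral>x. (norm (f x))\<^sup>2 \<partial>lebesgue_on \<Omega>)) else \<infinity>)"

definition Linf :: "'a::euclidean_space set \<Rightarrow> ('a \<Rightarrow> 'b::euclidean_space) set" where
  "Linf \<Omega> = {f. f \<in> borel_measurable (lebesgue_on \<Omega>) \<and>
                (\<exists>M. AE x in lebesgue_on \<Omega>. norm (f x) \<le> M)}"

text \<open>The real-valued essential supremum; it is only meaningful for measurable, essentially bounded
  functions, since \<^const>\<open>real_of_ereal\<close> sends infinite values to 0.\<close>

definition ess_sup_on :: "'a::euclidean_space set \<Rightarrow> ('a \<Rightarrow> real) \<Rightarrow> real" where
  "ess_sup_on S f = real_of_ereal (esssup (lebesgue_on S) (\<lambda>x. ereal (f x)))"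

definition weak_gradient ::
    "'a::euclidean_space set \<Rightarrow> ('a \<Rightarrow> real) \<Rightarrow> ('a \<Rightarrow> 'a) \<Rightarrow> bool" where
  "weak_gradient \<Omega> u g \<longleftrightarrow> locally_integrable \<Omega> u \<and> locally_integrable \<Omega> g \<and>
     (\<forall>\<phi>\<in>test_functions \<Omega>. \<forall>i\<in>Basis.
        (\<integral>x. u x * frechet_derivative \<phi> (at x) i \<partial>lebesgue_on \<Omega>)
          = - (\<integral>x. (g x \<bullet> i) * \<phi> x \<partial>lebesgue_on \<Omega>))"

text \<open>The weak gradient is unique almost everywhere on \<open>\<Omega>\<close>; a representative is chosen.\<close>

definition grad :: "'a::euclidean_space set \<Rightarrow> ('a \<Rightarrow> real) \<Rightarrow> 'a \<Rightarrow> 'a" where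
  "grad \<Omega> u = (SOME g. weak_gradient \<Omega> u g)"

text \<open>In the weak divergence, \<open>frechet_derivative \<phi> (at x) (v x)\<close> is \<open>v x \<bullet> \<nabla>\<phi> x\<close>.\<close>

definition weak_divergence ::
    "'a::euclidean_space set \<Rightarrow> ('a \<Rightarrow> 'a) \<Rightarrow> ('a \<Rightarrow> real) \<Rightarrow> bool" where
  "weak_divergence \<Omega> v d \<longleftrightarrow> locally_integrable \<Omega> v \<and> locally_integrable \<Omega> d \<and>
     (\<forall>\<phi>\<in>test_functions \<Omega>.
        (\<integral>x. frechet_derivative \<phi> (at x) (v x) \<partial>lebesgue_on \<Omega>)
          = - (\<integral>x. d x * \<phi> x \<partial>lebesgue_on \<Omega>))"

definition H1 :: "'a::euclidean_space set \<Rightarrow> ('a \<Rightarrow> real) set" where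
  "H1 \<Omega> = {u \<in> L2 \<Omega>. \<exists>g\<in>L2 \<Omega>. weak_gradient \<Omega> u g}"

definition H1_norm :: "'a::euclidean_space set \<Rightarrow> ('a \<Rightarrow> real) \<Rightarrow> real" where
  "H1_norm \<Omega> u = sqrt ((\<integral>x. (u x)\<^sup>2 \<partial>lebesgue_on \<Omega>) + (\<integral>x. (norm (grad \<Omega> u x))\<^sup>2 \<partial>lebesgue_on \<Omega>))"

definition H10 :: "'a::euclidean_space set \<Rightarrow> ('a \<Rightarrow> real) set" where
  "H10 \<Omega> = {u \<in> H1 \<Omega>. \<exists>\<phi>::nat \<Rightarrow> 'a \<Rightarrow> real. (\<forall>k. \<phi> k \<in> test_functions \<Omega>) \<and>
               (\<lambda>k. H1_norm \<Omega> (\<lambda>x. u x - \<phi> k x)) \<longlonglongrightarrow> 0}"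

definition H2 :: "'a::euclidean_space set \<Rightarrow> ('a \<Rightarrow> real) set" where
  "H2 \<Omega> = {u \<in> H1 \<Omega>. \<forall>i\<in>Basis. (\<lambda>x. grad \<Omega> u x \<bullet> i) \<in> H1 \<Omega>}"

definition H2_seminorm :: "'a::euclidean_space set \<Rightarrow> ('a \<Rightarrow> real) \<Rightarrow> real" where
  "H2_seminorm \<Omega> u = sqrt (\<Sum>i\<in>Basis. \<Sum>j\<in>Basis.
     (\<integral>x. (grad \<Omega> (\<lambda>y. grad \<Omega> u y \<bullet> i) x \<bullet> j)\<^sup>2 \<partial>lebesgue_on \<Omega>))"

definition Y_norm :: "'a::euclidean_space set \<Rightarrow> ('a \<Rightarrow> real) \<Rightarrow> ('a \<Rightarrow> real) \<Rightarrow> real" where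
  "Y_norm \<Omega> \<alpha> q = sqrt (\<integral>x. \<alpha> x * (norm (grad \<Omega> q x))\<^sup>2 \<partial>lebesgue_on \<Omega>)"

text \<open>The dual of \<open>Y = H10 \<Omega>\<close>. Functionals are applied to representatives; boundedness and linearity
  force equal values on representatives that agree almost everywhere on \<open>\<Omega>\<close>.\<close>

definition Y_dual :: "'a::euclidean_space set \<Rightarrow> ('a \<Rightarrow> real) \<Rightarrow> (('a \<Rightarrow> real) \<Rightarrow> real) set" where
  "Y_dual \<Omega> \<alpha> = {F.
     (\<forall>p\<in>H10 \<Omega>. \<forall>q\<in>H10 \<Omega>. F (\<lambda>x. p x + q x) = F p + F q) \<and>
     (\<forall>a. \<forall>q\<in>H10 \<Omega>. F (\<lambda>x. a * q x) = a * F q) \<and>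
     (\<exists>C. \<forall>q\<in>H10 \<Omega>. \<bar>F q\<bar> \<le> C * Y_norm \<Omega> \<alpha> q)}"

text \<open>A locally integrable function \<open>g\<close> belongs to the dual of \<open>Y\<close> if \<open>\<phi> \<mapsto> \<integral> g \<phi>\<close> on test functions
  extends to a bounded functional on \<open>Y\<close>. By density of the test functions the extension is unique on
  \<open>Y\<close>, and its values are the duality pairing with \<open>g\<close>.\<close>

definition extends_pairing ::
    "'a::euclidean_space set \<Rightarrow> ('a \<Rightarrow> real) \<Rightarrow> ('a \<Rightarrow> real) \<Rightarrow> (('a \<Rightarrow> real) \<Rightarrow> real) \<Rightarrow> bool" where
  "extends_pairing \<Omega> \<alpha> g F \<longleftrightarrow> F \<in> Y_dual \<Omega> \<alpha> \<and>
     (\<forall>\<phi>\<in>test_functions \<Omega>. F \<phi> = (\<integral>x. g x * \<phi> x \<partial>lebesgue_on \<Omega>))"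

definition in_Y_dual :: "'a::euclidean_space set \<Rightarrow> ('a \<Rightarrow> real) \<Rightarrow> ('a \<Rightarrow> real) \<Rightarrow> bool" where
  "in_Y_dual \<Omega> \<alpha> g \<longleftrightarrow> locally_integrable \<Omega> g \<and> (\<exists>F. extends_pairing \<Omega> \<alpha> g F)"

definition duality_pairing ::
    "'a::euclidean_space set \<Rightarrow> ('a \<Rightarrow> real) \<Rightarrow> ('a \<Rightarrow> real) \<Rightarrow> ('a \<Rightarrow> real) \<Rightarrow> real" where
  "duality_pairing \<Omega> \<alpha> g q = (SOME F. extends_pairing \<Omega> \<alpha> g F) q"

definition X_v ::
    "'a::euclidean_space set \<Rightarrow> ('a \<Rightarrow> real) \<Rightarrow> ('a \<Rightarrow> 'a) \<Rightarrow> ('a \<Rightarrow> real) set" where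
  "X_v \<Omega> \<alpha> v = {u \<in> H10 \<Omega>. in_Y_dual \<Omega> \<alpha> (\<lambda>x. v x \<bullet> grad \<Omega> u x)}"

definition b_form :: "'a::euclidean_space set \<Rightarrow> ('a \<Rightarrow> real) \<Rightarrow> ('a \<Rightarrow> 'a) \<Rightarrow>
    ('a \<Rightarrow> real) \<Rightarrow> ('a \<Rightarrow> real) \<Rightarrow> real" where
  "b_form \<Omega> \<alpha> v u q = (\<integral>x. \<alpha> x * (grad \<Omega> u x \<bullet> grad \<Omega> q x) \<partial>lebesgue_on \<Omega>)
     + duality_pairing \<Omega> \<alpha> (\<lambda>x. v x \<bullet> grad \<Omega> u x) q"

text \<open>\<^const>\<open>L2_norm\<close> is infinite for functions outside \<^const>\<open>L2\<close>, so finiteness of the following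
  supremum includes \<open>q v \<in> L2\<close> for all \<open>q \<in> H10\<close>.\<close>

definition c_v :: "'a::euclidean_space set \<Rightarrow> ('a \<Rightarrow> 'a) \<Rightarrow> ereal" where
  "c_v \<Omega> v = (SUP q \<in> {q \<in> H10 \<Omega>. \<not> (AE x in lebesgue_on \<Omega>. q x = 0)}.
     L2_norm \<Omega> (\<lambda>x. q x *\<^sub>R v x) / L2_norm \<Omega> (grad \<Omega> q))"

text \<open>Elements are closed simplices; \<^const>\<open>triangulation\<close> requires that two elements
  meet in a common face, that is, conformity.\<close>

definition simplicial_mesh :: "'a::euclidean_space set \<Rightarrow> 'a set set \<Rightarrow> bool" where
  "simplicial_mesh \<Omega> \<T> \<longleftrightarrow> triangulation \<T> \<and>
     (\<forall>\<tau>\<in>\<T>. int DIM('a) simplex \<tau>) \<and> \<Union>\<T> = closure \<Omega>"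

definition inradius :: "'a::euclidean_space set \<Rightarrow> real" where
  "inradius \<tau> = Sup {r. 0 \<le> r \<and> (\<exists>x. cball x r \<subseteq> \<tau>)}"

definition mesh_size :: "'a::euclidean_space set \<Rightarrow> real" where
  "mesh_size \<tau> = diameter \<tau>"

definition shape_regular :: "real \<Rightarrow> 'a::euclidean_space set set \<Rightarrow> bool" where
  "shape_regular \<sigma> \<T> \<longleftrightarrow> (\<forall>\<tau>\<in>\<T>. diameter \<tau> \<le> \<sigma> * inradius \<tau>)"

definition S_H :: "'a::euclidean_space set \<Rightarrow> 'a set set \<Rightarrow> ('a \<Rightarrow> real) set" where
  "S_H \<Omega> \<T> = {q. continuous_on (closure \<Omega>) q \<and>
     (\<forall>\<tau>\<in>\<T>. \<exists>a b. \<forall>x\<in>\<tau>. q x = a + b \<bullet> x)}"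

definition X_H :: "'a::euclidean_space set \<Rightarrow> 'a set set \<Rightarrow> ('a \<Rightarrow> real) set" where
  "X_H \<Omega> \<T> = S_H \<Omega> \<T> \<inter> H10 \<Omega>"

end

theory Submission
  imports Defs "HOL-Computational_Algebra.Polynomial" "HOL-Real_Asymp.Real_Asymp"
begin

text \<open>Let \<open>I\<close> be the nodal interpolant of \<open>u\<close>, \<open>\<eta> = u - I\<close> the interpolation error and \<open>w = I - u\<^sub>H\<close> the discrete
  part of the error. Testing both variational problems with \<open>w\<close> gives \<open>b(\<eta>, w) + b(w, w) = 0\<close>. The condition on the
  divergence enters through \<open>2 w v \<bullet> \<nabla>w = v \<bullet> \<nabla>(w\<^sup>2)\<close>, which makes the advection term of \<open>b(w, w)\<close> nonnegative
  (\<open>transport_self_nonneg\<close>), so that \<open>b(w, w)\<close> bounds the energy norm of \<open>w\<close> and only \<open>b(\<eta>, w)\<close> has to be estimated.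
  In the first case its advection term is at most \<open>\<parallel>\<nabla>\<eta>\<parallel> c_v \<parallel>\<nabla>w\<parallel>\<close>. In the second case the advection term is
  antisymmetric (\<open>transport_antisym\<close>); moving the derivative to \<open>w\<close> leaves the norm of \<open>\<eta> v / sqrt \<alpha>\<close>, which is of
  higher order in the mesh size. This is the content of \<open>error_estimate_bounded_multiplier\<close> and
  \<open>error_estimate_solenoidal\<close>.

  What remains are element-wise bounds for \<open>\<eta>\<close> and \<open>\<nabla>\<eta>\<close> (\<open>interpolation_error\<close>). The error on a simplex is
  expressed by the Taylor remainders of \<open>u\<close> from the variable point to the vertices, and these are bounded in \<open>L\<^sup>2\<close>
  directly on the simplex (\<open>taylor_remainder_L2\<close>, \<open>taylor_H2\<close>): up to dimension three the integral remainder can be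
  integrated over the base point with an explicit constant. Neither a reference element nor a compactness
  argument is involved, so the final constant \<open>256 (n + 1) (\<sigma>\<^sup>2 + 1)\<close> visibly depends on the dimension and the shape
  regularity only.

  The interpolant needs values of \<open>u\<close> at vertices, including those on the boundary. The same Taylor estimate, applied
  to differences of translates, yields a representative that is continuous up to the boundary
  (\<open>continuous_extension\<close>). Functions in \<open>H\<^sub>0\<^sup>1\<close> decay at the boundary at a rate (\<open>strip_estimate\<close>) that forces this
  representative to vanish there (\<open>H10_continuous_frontier_zero\<close>), and the geometry of a conforming mesh of a
  Lipschitz domain transfers the zero boundary values to the interpolant (\<open>frontier_face_vertices\<close>). That a
  piecewise affine function with zero boundary values is a limit of test functions follows by truncating its small
  values and mollifying (\<open>pw_affine_H10\<close>).\<close>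

section \<open>Partial derivatives and test functions\<close>

definition pd :: "'a::euclidean_space \<Rightarrow> ('a \<Rightarrow> real) \<Rightarrow> 'a \<Rightarrow> real" where
  "pd i f x = frechet_derivative f (at x) i"

lemma C_k_Suc_pd: "C_k (Suc k) f \<longleftrightarrow> (\<forall>x. f differentiable (at x)) \<and> (\<forall>i\<in>Basis. C_k k (pd i f))"
  by (simp add: pd_def[abs_def])

declare C_k.simps(2) [simp del]

lemma pd_eqI: "(f has_derivative D) (at x) \<Longrightarrow> pd i f x = D i"
  unfolding pd_def using frechet_derivative_at by metis

lemma has_derivative_pd:
  assumes "f differentiable (at x)"
  shows "(f has_derivative (\<lambda>d. \<Sum>i\<in>Basis. (d \<bullet> i) * pd i f x)) (at x)"
proof -
  have D: "(f has_derivative frechet_derivative f (at x)) (at x)"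
    using assms frechet_derivative_works by blast
  interpret bounded_linear "frechet_derivative f (at x)"
    using D by (rule has_derivative_bounded_linear)
  have "frechet_derivative f (at x) d = (\<Sum>i\<in>Basis. (d \<bullet> i) * pd i f x)" for d
  proof -
    have "frechet_derivative f (at x) d = frechet_derivative f (at x) (\<Sum>i\<in>Basis. (d \<bullet> i) *\<^sub>R i)"
      by (simp add: euclidean_representation)
    also have "\<dots> = (\<Sum>i\<in>Basis. (d \<bullet> i) * pd i f x)"
      by (simp add: sum scaleR pd_def)
    finally show ?thesis .
  qed
  then have "frechet_derivative f (at x) = (\<lambda>d. \<Sum>i\<in>Basis. (d \<bullet> i) * pd i f x)" by auto
  with D show ?thesis by simp
qed

lemma C_k_imp_continuous: "C_k k f \<Longrightarrow> continuous_on UNIV f"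
  by (cases k) (auto simp: C_k_Suc_pd intro!: continuous_at_imp_continuous_on differentiable_imp_continuous_within)

lemma C_k_SucD: "C_k (Suc k) f \<Longrightarrow> C_k k f"
proof (induction k arbitrary: f)
  case 0
  then show ?case using C_k_imp_continuous by fastforce
next
  case (Suc k)
  then show ?case by (subst C_k_Suc_pd) (simp add: C_k_Suc_pd[of "Suc k"])
qed

lemma C_k_const: "C_k k (\<lambda>x. c)"
proof (induction k arbitrary: c)
  case (Suc k)
  have "pd i (\<lambda>x. c) = (\<lambda>x. 0)" for i :: 'a
    by (intro ext pd_eqI[where D = "\<lambda>_. 0"]) auto
  with Suc show ?case by (simp add: C_k_Suc_pd)
qed auto

lemma C_k_inner: "C_k k (\<lambda>x. x \<bullet> c)"
proof (cases k)
  case (Suc m)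
  have "pd i (\<lambda>x. x \<bullet> c) = (\<lambda>x. i \<bullet> c)" for i :: 'a
    by (intro ext pd_eqI[where D = "\<lambda>d. d \<bullet> c"]) (auto intro!: derivative_eq_intros)
  moreover have "(\<lambda>x. x \<bullet> c) differentiable (at x)" for x :: 'a
    by (auto intro!: derivative_intros)
  ultimately show ?thesis by (simp add: C_k_Suc_pd Suc C_k_const)
qed (auto intro!: continuous_intros)

lemma pd_add:
  assumes "f differentiable (at x)" "g differentiable (at x)"
  shows "pd i (\<lambda>x. f x + g x) x = pd i f x + pd i g x"
  unfolding pd_def
  by (subst frechet_derivative_at[symmetric, OF has_derivative_add])
     (use assms frechet_derivative_works in blast)+

lemma pd_mult:
  assumes "f differentiable (at x)" "g differentiable (at x)"
  shows "pd i (\<lambda>x. f x * g x) x = f x * pd i g x + pd i f x * g x"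
  unfolding pd_def
  by (subst frechet_derivative_at[symmetric, OF has_derivative_mult])
     (use assms frechet_derivative_works in blast)+

lemma C_k_add: "C_k k f \<Longrightarrow> C_k k g \<Longrightarrow> C_k k (\<lambda>x. f x + g x)"
proof (induction k arbitrary: f g)
  case (Suc k)
  then have d: "\<And>x. f differentiable (at x)" "\<And>x. g differentiable (at x)" by (auto simp: C_k_Suc_pd)
  have "pd i (\<lambda>x. f x + g x) = (\<lambda>x. pd i f x + pd i g x)" for i
    using pd_add d by blast
  with Suc show ?case by (simp add: C_k_Suc_pd)
qed (auto intro!: continuous_intros)

lemma C_k_mult: "C_k k f \<Longrightarrow> C_k k g \<Longrightarrow> C_k k (\<lambda>x. f x * g x)"
proof (induction k arbitrary: f g)
  case (Suc k)
  then have d: "\<And>x. f differentiable (at x)" "\<And>x. g differentiable (at x)" by (auto simp: C_k_Suc_pd)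
  have "pd i (\<lambda>x. f x * g x) = (\<lambda>x. f x * pd i g x + pd i f x * g x)" for i
    using pd_mult d by blast
  moreover have "C_k k f" "C_k k g" using Suc.prems C_k_SucD by auto
  ultimately show ?case
    using Suc by (simp add: C_k_Suc_pd C_k_add)
qed (auto intro!: continuous_intros)

lemma pd_affine:
  assumes "f differentiable (at (a + c *\<^sub>R x))"
  shows "pd i (\<lambda>x. f (a + c *\<^sub>R x)) x = c * pd i f (a + c *\<^sub>R x)"
    and "(\<lambda>x. f (a + c *\<^sub>R x)) differentiable (at x)"
proof -
  have "((f \<circ> (\<lambda>x. a + c *\<^sub>R x)) has_derivative
     (\<lambda>d. \<Sum>i\<in>Basis. (d \<bullet> i) * pd i f (a + c *\<^sub>R x)) \<circ> (\<lambda>d. c *\<^sub>R d)) (at x)"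
    by (intro diff_chain_at has_derivative_pd assms) (auto intro!: derivative_eq_intros)
  then have D: "((\<lambda>x. f (a + c *\<^sub>R x)) has_derivative
     (\<lambda>d. \<Sum>i\<in>Basis. (d \<bullet> i) * pd i f (a + c *\<^sub>R x)) \<circ> (\<lambda>d. c *\<^sub>R d)) (at x)"
    by (simp add: o_def)
  show "(\<lambda>x. f (a + c *\<^sub>R x)) differentiable (at x)"
    using D by (auto simp: differentiable_def)
  have lin: "linear (\<lambda>d. \<Sum>i\<in>Basis. (d \<bullet> i) * pd i f (a + c *\<^sub>R x))"
    using has_derivative_pd[OF assms] by (simp add: bounded_linear.linear has_derivative_bounded_linear)
  have "frechet_derivative f (at (a + c *\<^sub>R x)) = (\<lambda>d. \<Sum>i\<in>Basis. (d \<bullet> i) * pd i f (a + c *\<^sub>R x))"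
    using frechet_derivative_at[OF has_derivative_pd[OF assms]] by simp
  then show "pd i (\<lambda>x. f (a + c *\<^sub>R x)) x = c * pd i f (a + c *\<^sub>R x)"
    using pd_eqI[OF D, of i] linear_scale[OF lin, of c i] unfolding o_def pd_def[of i f]
    by (simp only: real_scaleR_def)
qed

lemma C_k_affine: "C_k k f \<Longrightarrow> C_k k (\<lambda>x. f (a + c *\<^sub>R x))"
proof (induction k arbitrary: f)
  case 0
  then show ?case
    by (auto intro!: continuous_on_compose2[of UNIV f UNIV "\<lambda>x. a + c *\<^sub>R x"] continuous_intros)
next
  case (Suc k)
  have d: "f differentiable (at x)" for x using Suc.prems by (auto simp: C_k_Suc_pd)
  have "pd i (\<lambda>x. f (a + c *\<^sub>R x)) = (\<lambda>x. c * pd i f (a + c *\<^sub>R x))" for i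
    using pd_affine(1)[OF d] by blast
  then show ?case
    using Suc by (simp add: C_k_Suc_pd C_k_mult C_k_const pd_affine(2)[OF d])
qed

lemma pd_mvt:
  assumes "\<And>x. f differentiable (at x)"
  obtains t where "0 < t" "t < 1" "f (z + d) - f z = (\<Sum>i\<in>Basis. (d \<bullet> i) * pd i f (z + t *\<^sub>R d))"
proof -
  have "((\<lambda>t. f (z + t *\<^sub>R d)) has_derivative (\<lambda>h. \<Sum>i\<in>Basis. ((h *\<^sub>R d) \<bullet> i) * pd i f (z + t *\<^sub>R d))) (at t)" for t
  proof -
    have A: "((\<lambda>t. z + t *\<^sub>R d) has_derivative (\<lambda>h. h *\<^sub>R d)) (at t)"
      by (auto intro!: derivative_eq_intros)
    have "(f has_derivative (\<lambda>h. \<Sum>i\<in>Basis. (h \<bullet> i) * pd i f (z + t *\<^sub>R d))) (at ((\<lambda>t. z + t *\<^sub>R d) t))"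
      using has_derivative_pd[OF assms, of "z + t *\<^sub>R d"] by simp
    from diff_chain_at[OF A this] show ?thesis by (simp add: o_def)
  qed
  then have D: "((\<lambda>t. f (z + t *\<^sub>R d)) has_derivative (\<lambda>h. \<Sum>i\<in>Basis. ((h *\<^sub>R d) \<bullet> i) * pd i f (z + t *\<^sub>R d))) (at t within {0..1})" for t
    using has_derivative_at_withinI by blast
  from mvt_simple[of 0 1 "\<lambda>t. f (z + t *\<^sub>R d)"
      "\<lambda>t h. \<Sum>i\<in>Basis. ((h *\<^sub>R d) \<bullet> i) * pd i f (z + t *\<^sub>R d)", OF _ D]
  show ?thesis using that by auto
qed

text \<open>The functions \<open>p (1 / t) exp (- 1 / t)\<close>, extended by zero to \<open>t \<le> 0\<close>, with polynomials \<open>p\<close> are closed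
  under differentiation. So \<open>exp (- 1 / t)\<close> is smooth, and with it the bump function.\<close>

definition bump_profile :: "real poly \<Rightarrow> real \<Rightarrow> real" where
  "bump_profile p t = (if t > 0 then poly p (1 / t) * exp (- (1 / t)) else 0)"

lemma poly_times_exp_tendsto_0: "((\<lambda>s::real. s ^ k * (poly p s * exp (- s))) \<longlongrightarrow> 0) at_top"
proof (induction p arbitrary: k)
  case (pCons a p)
  have "((\<lambda>s. a * (s ^ k / exp s) + s ^ Suc k * (poly p s * exp (- s))) \<longlongrightarrow> a * 0 + 0) at_top"
    by (intro tendsto_intros tendsto_power_div_exp_0 pCons.IH)
  then show ?case by (simp add: algebra_simps exp_minus divide_inverse)
qed auto

lemma bump_profile_deriv:
  "(bump_profile p has_real_derivative bump_profile ([:0, 0, 1:] * (p - pderiv p)) t) (at t)"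
proof -
  consider "t > 0" | "t < 0" | "t = 0" by linarith
  then show ?thesis
  proof cases
    case 1
    have "((\<lambda>t. poly p (1 / t) * exp (- (1 / t))) has_real_derivative
        bump_profile ([:0, 0, 1:] * (p - pderiv p)) t) (at t)"
      unfolding bump_profile_def using 1
      by (auto intro!: derivative_eq_intros DERIV_chain2[OF poly_DERIV] simp: field_simps power2_eq_square)
    moreover have "eventually (\<lambda>s. s > 0) (nhds t)"
      using 1 by (simp add: eventually_nhds_in_open[of "{0<..}", simplified])
    then have "eventually (\<lambda>s. bump_profile p s = poly p (1 / s) * exp (- (1 / s))) (nhds t)"
      by eventually_elim (simp add: bump_profile_def)
    ultimately show ?thesis
      by (subst DERIV_cong_ev[OF refl _ refl]) auto
  next
    case 2
    have "eventually (\<lambda>s. s < 0) (nhds t)"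
      using 2 by (simp add: eventually_nhds_in_open[of "{..<0}", simplified])
    then have "eventually (\<lambda>s. bump_profile p s = 0) (nhds t)"
      by eventually_elim (simp add: bump_profile_def)
    then show ?thesis using 2
      by (subst DERIV_cong_ev[OF refl _ refl]) (auto simp: bump_profile_def)
  next
    case 3
    have "((\<lambda>h. bump_profile p h / h) \<longlongrightarrow> 0) (at_right 0)"
    proof -
      have "((\<lambda>h. inverse h ^ 1 * (poly p (inverse h) * exp (- inverse h))) \<longlongrightarrow> 0) (at_right (0::real))"
        by (rule filterlim_compose[OF poly_times_exp_tendsto_0 filterlim_inverse_at_top_right])
      then show ?thesis
        by (rule Lim_transform_eventually)
           (auto simp: eventually_at_right_less bump_profile_def field_simps
             intro!: eventually_mono[OF eventually_at_right_less])
    qed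
    moreover have "((\<lambda>h. bump_profile p h / h) \<longlongrightarrow> 0) (at_left 0)"
      by (rule tendsto_eventually)
         (auto simp: eventually_at_filter bump_profile_def)
    ultimately have "((\<lambda>h. bump_profile p h / h) \<longlongrightarrow> 0) (at 0)"
      using filterlim_split_at by blast
    then show ?thesis
      unfolding 3 DERIV_def by (simp add: bump_profile_def)
  qed
qed

definition bump :: "'a::euclidean_space \<Rightarrow> real" where
  "bump x = bump_profile 1 (1 - x \<bullet> x)"

lemma C_k_bump_profile: "C_k k (\<lambda>x::'a::euclidean_space. bump_profile p (1 - x \<bullet> x))"
proof (induction k arbitrary: p)
  have D: "((\<lambda>x. bump_profile p (1 - x \<bullet> x)) has_derivative
      (\<lambda>d. - 2 * (x \<bullet> d) * bump_profile ([:0, 0, 1:] * (p - pderiv p)) (1 - x \<bullet> x))) (at x)" for x :: 'a and p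
    by (rule derivative_eq_intros DERIV_compose_FDERIV[OF bump_profile_deriv] refl | simp)+
       (auto simp: inner_commute fun_eq_iff)
  have diff: "(\<lambda>x. bump_profile p (1 - x \<bullet> x)) differentiable (at x)" for x :: 'a and p
    using D by (rule differentiableI)
  {
    case 0
    show ?case using diff
      by (auto intro!: continuous_at_imp_continuous_on differentiable_imp_continuous_within)
  next
    case (Suc k)
    have "pd i (\<lambda>x. bump_profile p (1 - x \<bullet> x)) =
      (\<lambda>x. (- 2 * (x \<bullet> i)) * bump_profile ([:0, 0, 1:] * (p - pderiv p)) (1 - x \<bullet> x))" for i :: 'a
      by (intro ext, subst pd_eqI[OF D]) simp
    then show ?case unfolding C_k_Suc_pd using diff
      by (simp only:) (intro conjI allI ballI C_k_mult C_k_const C_k_inner Suc, simp_all)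
  }
qed

lemma bump_pos: "norm x < 1 \<Longrightarrow> bump x > 0" and bump_zero: "norm x \<ge> 1 \<Longrightarrow> bump x = 0"
  and bump_nonneg: "bump x \<ge> 0"
proof -
  have "0 < 1 - x \<bullet> x \<longleftrightarrow> norm x < 1"
    using abs_square_less_1[of "norm x"] by (simp add: dot_square_norm)
  then show "norm x < 1 \<Longrightarrow> bump x > 0" "norm x \<ge> 1 \<Longrightarrow> bump x = 0" "bump x \<ge> 0"
    by (auto simp: bump_def bump_profile_def)
qed

lemma test_functionsI:
  assumes "\<And>k. C_k k \<phi>" "compact K" "K \<subseteq> S" "\<And>x. x \<notin> K \<Longrightarrow> \<phi> x = 0"
  shows "\<phi> \<in> test_functions S"
proof -
  have "closure {x. \<phi> x \<noteq> 0} \<subseteq> K"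
    using assms by (intro closure_minimal) (auto simp: compact_imp_closed)
  moreover have "bounded {x. \<phi> x \<noteq> 0}"
    using assms(4) by (intro bounded_subset[OF compact_imp_bounded[OF assms(2)]]) auto
  ultimately show ?thesis
    using assms unfolding test_functions_def by auto
qed

lemma test_functionsE:
  assumes "\<phi> \<in> test_functions S"
  obtains K where "\<And>k. C_k k \<phi>" "compact K" "K \<subseteq> S" "\<And>x. x \<notin> K \<Longrightarrow> \<phi> x = 0"
proof (rule that[of "closure {x. \<phi> x \<noteq> 0}"])
  show "\<phi> x = 0" if "x \<notin> closure {x. \<phi> x \<noteq> 0}" for x
    using that closure_subset[of "{x. \<phi> x \<noteq> 0}"] by auto
qed (use assms in \<open>unfold test_functions_def, auto\<close>)

lemma test_functions_compact:
  assumes "\<phi> \<in> test_functions S"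
  obtains K where "compact K" "K \<subseteq> S" "\<And>x. x \<notin> K \<Longrightarrow> \<phi> x = 0"
  using assms by (rule test_functionsE) (rule that)

lemma test_functions_C_k: "\<phi> \<in> test_functions S \<Longrightarrow> C_k k \<phi>"
  by (simp add: test_functions_def)

lemma test_functions_mono: "S \<subseteq> S' \<Longrightarrow> \<phi> \<in> test_functions S \<Longrightarrow> \<phi> \<in> test_functions S'"
  by (auto simp: test_functions_def)

lemma test_functions_differentiable: "\<phi> \<in> test_functions S \<Longrightarrow> \<phi> differentiable (at x)"
  by (erule test_functionsE) (metis C_k.simps(2))

lemma test_functions_pd: assumes "\<phi> \<in> test_functions S" "i \<in> Basis" shows "pd i \<phi> \<in> test_functions S"
proof -
  obtain K where K: "\<And>k. C_k k \<phi>" "compact K" "K \<subseteq> S" "\<And>x. x \<notin> K \<Longrightarrow> \<phi> x = 0"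
    using test_functionsE[OF assms(1)] by blast
  have "pd i \<phi> x = 0" if "x \<notin> K" for x
  proof -
    have "open (- K)" using K by (simp add: compact_imp_closed open_Compl)
    then have "((\<lambda>x. 0) has_derivative (\<lambda>_. 0)) (at x)" by auto
    then have "(\<phi> has_derivative (\<lambda>_. 0)) (at x)"
      by (rule has_derivative_transform_within_open[OF _ \<open>open (- K)\<close>]) (use K that in auto)
    then show ?thesis by (rule pd_eqI)
  qed
  moreover have "C_k k (pd i \<phi>)" for k
    using K(1)[of "Suc k"] assms(2) C_k_Suc_pd by blast
  ultimately show ?thesis using K by (intro test_functionsI)
qed

lemma test_functions_continuous: "\<phi> \<in> test_functions S \<Longrightarrow> continuous_on T \<phi>"
  by (metis C_k_imp_continuous continuous_on_subset test_functionsE top_greatest)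

lemma test_functions_borel: "\<phi> \<in> test_functions S \<Longrightarrow> \<phi> \<in> borel_measurable borel"
  using test_functions_continuous borel_measurable_continuous_onI by blast

lemma test_functions_bounded:
  assumes "\<phi> \<in> test_functions S" obtains B where "B > 0" "\<And>x. \<bar>\<phi> x\<bar> \<le> B"
proof -
  obtain K where K: "\<And>k. C_k k \<phi>" "compact K" "K \<subseteq> S" "\<And>x. x \<notin> K \<Longrightarrow> \<phi> x = 0"
    using test_functionsE[OF assms(1)] by blast
  have "compact (\<phi> ` K)"
    using K test_functions_continuous[OF assms] by (intro compact_continuous_image)
  then obtain B where "B > 0" "\<And>x. x \<in> K \<Longrightarrow> norm (\<phi> x) \<le> B"
    using compact_imp_bounded bounded_pos by (metis imageI)
  then show ?thesis using K(4) that[of B] by (metis abs_zero less_eq_real_def real_norm_def)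
qed

lemma test_functions_lipschitz:
  assumes "\<phi> \<in> test_functions S" obtains L where "L > 0" "\<And>x d. \<bar>\<phi> (x + d) - \<phi> x\<bar> \<le> L * norm d"
proof -
  have "\<exists>B>0. \<forall>x. \<bar>pd i \<phi> x\<bar> \<le> B" if "i \<in> Basis" for i
    using test_functions_bounded[OF test_functions_pd[OF assms that]] by metis
  then obtain B where B: "\<And>i. i \<in> Basis \<Longrightarrow> B i > 0" "\<And>i x. i \<in> Basis \<Longrightarrow> \<bar>pd i \<phi> x\<bar> \<le> B i" by metis
  have "\<bar>\<phi> (x + d) - \<phi> x\<bar> \<le> (\<Sum>i\<in>Basis. B i) * norm d" for x d
  proof -
    obtain t where "\<phi> (x + d) - \<phi> x = (\<Sum>i\<in>Basis. (d \<bullet> i) * pd i \<phi> (x + t *\<^sub>R d))"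
      using pd_mvt[OF test_functions_differentiable[OF assms]] by metis
    also have "\<bar>\<dots>\<bar> \<le> (\<Sum>i\<in>Basis. \<bar>d \<bullet> i\<bar> * \<bar>pd i \<phi> (x + t *\<^sub>R d)\<bar>)"
      by (rule order_trans[OF sum_abs]) (simp add: abs_mult)
    also have "\<dots> \<le> (\<Sum>i\<in>Basis. norm d * B i)"
      by (intro sum_mono mult_mono B) (auto simp: Basis_le_norm)
    finally show ?thesis by (simp add: sum_distrib_left mult.commute)
  qed
  moreover have "(\<Sum>i\<in>Basis. B i) > 0" using B(1) by (intro sum_pos) auto
  ultimately show ?thesis using that by blast
qed

text \<open>The derivatives of a test function are bounded, so the remainder is quadratic uniformly in \<open>x\<close>. The
  uniformity is what allows differentiation of a convolution with a merely integrable function.\<close>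

lemma test_functions_taylor:
  assumes "\<phi> \<in> test_functions S"
  obtains M where "M > 0" "\<And>x d. \<bar>\<phi> (x + d) - \<phi> x - (\<Sum>i\<in>Basis. (d \<bullet> i) * pd i \<phi> x)\<bar> \<le> M * (norm d)\<^sup>2"
proof -
  have "\<exists>B>0. \<forall>x d. \<bar>pd i \<phi> (x + d) - pd i \<phi> x\<bar> \<le> B * norm d" if "i \<in> Basis" for i
    using test_functions_lipschitz[OF test_functions_pd[OF assms that]] by metis
  then obtain B where B: "\<And>i. i \<in> Basis \<Longrightarrow> B i > 0"
    "\<And>i x d. i \<in> Basis \<Longrightarrow> \<bar>pd i \<phi> (x + d) - pd i \<phi> x\<bar> \<le> B i * norm d" by metis
  have "\<bar>\<phi> (x + d) - \<phi> x - (\<Sum>i\<in>Basis. (d \<bullet> i) * pd i \<phi> x)\<bar> \<le> (\<Sum>i\<in>Basis. B i) * (norm d)\<^sup>2" for x d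
  proof -
    obtain t where t: "0 < t" "t < 1" "\<phi> (x + d) - \<phi> x = (\<Sum>i\<in>Basis. (d \<bullet> i) * pd i \<phi> (x + t *\<^sub>R d))"
      using pd_mvt[OF test_functions_differentiable[OF assms]] by metis
    have "\<phi> (x + d) - \<phi> x - (\<Sum>i\<in>Basis. (d \<bullet> i) * pd i \<phi> x)
       = (\<Sum>i\<in>Basis. (d \<bullet> i) * (pd i \<phi> (x + t *\<^sub>R d) - pd i \<phi> x))"
      by (simp add: t(3) right_diff_distrib sum_subtractf)
    also have "\<bar>\<dots>\<bar> \<le> (\<Sum>i\<in>Basis. \<bar>d \<bullet> i\<bar> * \<bar>pd i \<phi> (x + t *\<^sub>R d) - pd i \<phi> x\<bar>)"
      by (rule order_trans[OF sum_abs]) (simp add: abs_mult)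
    also have "\<dots> \<le> (\<Sum>i\<in>Basis. norm d * (B i * norm d))"
    proof (intro sum_mono mult_mono)
      fix i :: 'a assume i: "i \<in> Basis"
      have "norm (t *\<^sub>R d) \<le> norm d" using t by (simp add: mult_left_le_one_le)
      then show "\<bar>pd i \<phi> (x + t *\<^sub>R d) - pd i \<phi> x\<bar> \<le> B i * norm d"
        using B[OF i] by (meson mult_left_mono order_less_imp_le order_trans)
    qed (auto simp: Basis_le_norm)
    finally show ?thesis by (simp add: sum_distrib_left sum_distrib_right power2_eq_square ac_simps)
  qed
  moreover have "(\<Sum>i\<in>Basis. B i) > 0" using B(1) by (intro sum_pos) auto
  ultimately show ?thesis using that by blast
qed

section \<open>Continuity of translations\<close>

lemma nn_integral_affine:
  fixes f :: "'a::euclidean_space \<Rightarrow> ennreal"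
  assumes [measurable]: "f \<in> borel_measurable borel" and c: "c \<noteq> 0"
  shows "(\<integral>\<^sup>+x. f x \<partial>lborel) = ennreal (\<bar>c\<bar> ^ DIM('a)) * (\<integral>\<^sup>+x. f (t + c *\<^sub>R x) \<partial>lborel)"
  by (subst lborel_affine[OF c, of t])
     (simp add: nn_integral_density nn_integral_distr nn_integral_cmult)

lemma nn_integral_shift:
  fixes f :: "'a::euclidean_space \<Rightarrow> ennreal"
  assumes "f \<in> borel_measurable borel"
  shows "(\<integral>\<^sup>+x. f (x + h) \<partial>lborel) = (\<integral>\<^sup>+x. f x \<partial>lborel)"
  using nn_integral_affine[OF assms, of 1 h] by (simp add: add.commute)

lemma nn_integral_reflect:
  fixes f :: "'a::euclidean_space \<Rightarrow> ennreal"
  assumes "f \<in> borel_measurable borel"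
  shows "(\<integral>\<^sup>+x. f (h - x) \<partial>lborel) = (\<integral>\<^sup>+x. f x \<partial>lborel)"
  using nn_integral_affine[OF assms, of "-1" h] by simp

lemma integral_affine_unit:
  fixes f :: "'a::euclidean_space \<Rightarrow> real"
  assumes [measurable]: "f \<in> borel_measurable borel" and c: "\<bar>c\<bar> = 1"
  shows "(\<integral>x. f (t + c *\<^sub>R x) \<partial>lborel) = (\<integral>x. f x \<partial>lborel)"
proof -
  have "c \<noteq> 0" using c by auto
  have "(\<integral>x. f x \<partial>lborel) = (\<integral>x. f x \<partial>density (distr lborel borel (\<lambda>x. t + c *\<^sub>R x)) (\<lambda>_. 1))"
    by (subst lborel_affine[OF \<open>c \<noteq> 0\<close>, of t]) (simp add: c)
  also have "\<dots> = (\<integral>x. f (t + c *\<^sub>R x) \<partial>lborel)"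
    by (simp add: density_1 integral_distr)
  finally show ?thesis by simp
qed

lemma integral_shift:
  fixes f :: "'a::euclidean_space \<Rightarrow> real"
  assumes "f \<in> borel_measurable borel"
  shows "(\<integral>x. f (x + h) \<partial>lborel) = (\<integral>x. f x \<partial>lborel)"
  using integral_affine_unit[OF assms, of 1 h] by (simp add: add.commute)

lemma integral_reflect:
  fixes f :: "'a::euclidean_space \<Rightarrow> real"
  assumes "f \<in> borel_measurable borel"
  shows "(\<integral>x. f (h - x) \<partial>lborel) = (\<integral>x. f x \<partial>lborel)"
  using integral_affine_unit[OF assms, of "-1" h] by simp

definition transl_cont :: "('a::euclidean_space \<Rightarrow> real) \<Rightarrow> bool" where
  "transl_cont f \<longleftrightarrow> ((\<lambda>h. \<integral>\<^sup>+x. ennreal \<bar>f (x + h) - f x\<bar> \<partial>lborel) \<longlongrightarrow> 0) (at 0)"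

lemma tendsto_0_ennrealI:
  fixes F :: "'b \<Rightarrow> ennreal"
  assumes "\<And>e::real. e > 0 \<Longrightarrow> eventually (\<lambda>x. F x \<le> ennreal e) A"
  shows "(F \<longlongrightarrow> 0) A"
proof (rule order_tendstoI)
  fix a :: ennreal assume "0 < a"
  then obtain e where e: "0 < e" "ennreal e < a"
  proof (cases a)
    case (real r)
    with \<open>0 < a\<close> show ?thesis by (intro that[of "r/2"]) (auto simp: ennreal_less_iff)
  qed (auto intro: that[of 1])
  show "eventually (\<lambda>x. F x < a) A"
    using assms[OF e(1)] by eventually_elim (use e in auto)
qed auto

text \<open>By translation invariance both translates of \<open>f - g\<close> have the same integral, so continuity of
  translations passes to \<open>L\<^sup>1\<close> limits.\<close>

lemma transl_cont_approx:
  assumes f: "integrable lborel f"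
    and ap: "\<And>e::real. e > 0 \<Longrightarrow> \<exists>g. integrable lborel g \<and> transl_cont g \<and> (\<integral>\<^sup>+x. ennreal \<bar>f x - g x\<bar> \<partial>lborel) \<le> ennreal e"
  shows "transl_cont f"
  unfolding transl_cont_def
proof (rule tendsto_0_ennrealI)
  fix e :: real assume e: "e > 0"
  obtain g where g: "integrable lborel g" "transl_cont g" "(\<integral>\<^sup>+x. ennreal \<bar>f x - g x\<bar> \<partial>lborel) \<le> ennreal (e/3)"
    using ap[of "e/3"] e by auto
  have [measurable]: "f \<in> borel_measurable borel" "g \<in> borel_measurable borel"
    using f g(1) by auto
  have "eventually (\<lambda>h. (\<integral>\<^sup>+x. ennreal \<bar>g (x + h) - g x\<bar> \<partial>lborel) < ennreal (e/3)) (at 0)"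
    using g(2) e unfolding transl_cont_def by (intro order_tendstoD) auto
  then show "eventually (\<lambda>h. (\<integral>\<^sup>+x. ennreal \<bar>f (x + h) - f x\<bar> \<partial>lborel) \<le> ennreal e) (at 0)"
  proof eventually_elim
    case (elim h)
    have "(\<integral>\<^sup>+x. ennreal \<bar>f (x + h) - f x\<bar> \<partial>lborel)
      \<le> (\<integral>\<^sup>+x. ennreal \<bar>f (x + h) - g (x + h)\<bar> + ennreal \<bar>g (x + h) - g x\<bar> + ennreal \<bar>f x - g x\<bar> \<partial>lborel)"
      by (intro nn_integral_mono) (auto simp: ennreal_plus[symmetric] simp del: ennreal_plus intro!: ennreal_leI)
    also have "\<dots> = (\<integral>\<^sup>+x. ennreal \<bar>f (x + h) - g (x + h)\<bar> \<partial>lborel) + (\<integral>\<^sup>+x. ennreal \<bar>g (x + h) - g x\<bar> \<partial>lborel)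
       + (\<integral>\<^sup>+x. ennreal \<bar>f x - g x\<bar> \<partial>lborel)"
      by (simp add: nn_integral_add)
    also have "(\<integral>\<^sup>+x. ennreal \<bar>f (x + h) - g (x + h)\<bar> \<partial>lborel) = (\<integral>\<^sup>+x. ennreal \<bar>f x - g x\<bar> \<partial>lborel)"
      by (rule nn_integral_shift) measurable
    also have "(\<integral>\<^sup>+x. ennreal \<bar>f x - g x\<bar> \<partial>lborel) + (\<integral>\<^sup>+x. ennreal \<bar>g (x + h) - g x\<bar> \<partial>lborel) + (\<integral>\<^sup>+x. ennreal \<bar>f x - g x\<bar> \<partial>lborel)
      \<le> ennreal (e/3) + ennreal (e/3) + ennreal (e/3)"
      using g(3) elim by (intro add_mono) auto
    also have "\<dots> = ennreal e" using e by (simp add: ennreal_plus[symmetric] del: ennreal_plus)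
    finally show ?case .
  qed
qed

lemma transl_cont_open:
  fixes U :: "'a::euclidean_space set"
  assumes U: "open U" and fin: "emeasure lborel U < \<infinity>"
  shows "transl_cont (indicator U)"
  unfolding transl_cont_def tendsto_at_iff_sequentially comp_def
proof (intro allI impI)
  fix h :: "nat \<Rightarrow> 'a" assume "\<forall>i. h i \<in> UNIV - {0}" and h: "h \<longlonglongrightarrow> 0"
  have [measurable]: "U \<in> sets borel" using U by auto
  \<comment> \<open>Only the part lost by the translation is controlled pointwise; the part gained has the same measure.\<close>
  define L where "L k x = max 0 (indicator U x - indicator U (x + h k) :: real)" for k x
  have [measurable]: "L k \<in> borel_measurable borel" for k unfolding L_def by measurable
  have I: "integrable lborel (indicator U :: 'a \<Rightarrow> real)" "integrable lborel (\<lambda>x. indicator U (x + h k) :: real)" for k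
    using fin nn_integral_shift[of "\<lambda>x. ennreal (indicator U x)" "h k"]
    by (auto simp: integrable_iff_bounded ennreal_indicator)
  have IL: "integrable lborel (L k)" for k unfolding L_def using I by auto
  have "(\<lambda>k. integral\<^sup>L lborel (L k)) \<longlonglongrightarrow> integral\<^sup>L lborel (\<lambda>x::'a. 0::real)"
  proof (rule integral_dominated_convergence[where w = "indicator U"])
    show "AE x in lborel. (\<lambda>k. L k x) \<longlonglongrightarrow> 0"
    proof (rule AE_I2, rule tendsto_eventually)
      fix x
      have "(\<lambda>k. x + h k) \<longlonglongrightarrow> x + 0" by (intro tendsto_intros h)
      then have "x \<in> U \<Longrightarrow> eventually (\<lambda>k. x + h k \<in> U) sequentially"
        using U topological_tendstoD by fastforce
      then show "eventually (\<lambda>k. L k x = 0) sequentially"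
        by (cases "x \<in> U") (auto simp: L_def elim: eventually_mono)
    qed
  qed (use I in \<open>auto simp: L_def indicator_def\<close>)
  then have L0: "(\<lambda>k. 2 * integral\<^sup>L lborel (L k)) \<longlonglongrightarrow> 0" by (auto intro: tendsto_mult_right_zero)
  have "(\<integral>\<^sup>+x. ennreal \<bar>indicator U (x + h k) - indicator U x :: real\<bar> \<partial>lborel) = ennreal (2 * integral\<^sup>L lborel (L k))" for k
  proof -
    have "(\<integral>x. \<bar>indicator U (x + h k) - indicator U x :: real\<bar> \<partial>lborel)
      = (\<integral>x. 2 * L k x + (indicator U (x + h k) - indicator U x) \<partial>lborel)"
      by (intro Bochner_Integration.integral_cong) (auto simp: L_def indicator_def)
    also have "\<dots> = 2 * integral\<^sup>L lborel (L k) + ((\<integral>x. indicator U (x + h k) \<partial>lborel) - integral\<^sup>L lborel (indicator U))"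
      using I IL by (simp del: integral_indicator Bochner_Integration.integral_indicator)
    also have "(\<integral>x. indicator U (x + h k) \<partial>lborel) = integral\<^sup>L lborel (indicator U :: 'a \<Rightarrow> real)"
      by (rule integral_shift) simp
    finally show ?thesis using I by (subst nn_integral_eq_integral) auto
  qed
  then show "(\<lambda>k. \<integral>\<^sup>+x. ennreal \<bar>indicator U (x + h k) - indicator U x :: real\<bar> \<partial>lborel) \<longlonglongrightarrow> 0"
    using tendsto_ennrealI[OF L0] by simp
qed

lemma transl_cont_cmult:
  assumes [measurable]: "g \<in> borel_measurable borel" and "transl_cont g" shows "transl_cont (\<lambda>x. g x * c)"
proof -
  have "(\<integral>\<^sup>+x. ennreal \<bar>g (x + h) * c - g x * c\<bar> \<partial>lborel) = ennreal \<bar>c\<bar> * (\<integral>\<^sup>+x. ennreal \<bar>g (x + h) - g x\<bar> \<partial>lborel)" for h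
    by (subst nn_integral_cmult[symmetric])
       (auto simp: ennreal_mult'[symmetric] abs_mult[symmetric] algebra_simps intro!: nn_integral_cong)
  moreover have "((\<lambda>h. ennreal \<bar>c\<bar> * (\<integral>\<^sup>+x. ennreal \<bar>g (x + h) - g x\<bar> \<partial>lborel)) \<longlongrightarrow> ennreal \<bar>c\<bar> * 0) (at 0)"
    using assms(2) unfolding transl_cont_def by (intro ennreal_tendsto_cmult) auto
  ultimately show ?thesis unfolding transl_cont_def by simp
qed

text \<open>Integrable functions are approximated by simple functions, and by outer regularity measurable sets
  are approximated by open sets.\<close>

lemma integrable_transl_cont:
  fixes f :: "'a::euclidean_space \<Rightarrow> real"
  assumes "integrable lborel f" shows "transl_cont f"
  using assms
proof (induction rule: integrable_induct)
  case (base A c)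
  then have A[measurable]: "A \<in> sets borel" by simp
  have "transl_cont (indicator A)"
  proof (rule transl_cont_approx)
    show "integrable lborel (indicator A :: 'a \<Rightarrow> real)" using base by auto
    fix e :: real assume "e > 0"
    obtain U where U: "open U" "A \<subseteq> U" "emeasure lborel (U - A) < e"
      using outer_regular_lborel[OF A \<open>e > 0\<close>] .
    have [measurable]: "U \<in> sets borel" using U by auto
    have "emeasure lborel U = emeasure lborel A + emeasure lborel (U - A)"
      using U by (subst plus_emeasure) (auto simp: Un_absorb1)
    also have "\<dots> < \<infinity>" using base U(3) by (auto simp: less_top[symmetric] ennreal_add_eq_top)
    finally have fin: "emeasure lborel U < \<infinity>" .
    have "(\<integral>\<^sup>+x. ennreal \<bar>indicator A x - indicator U x :: real\<bar> \<partial>lborel) = (\<integral>\<^sup>+x. indicator (U - A) x \<partial>lborel)"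
      using U(2) by (intro nn_integral_cong) (auto simp: indicator_def)
    also have "\<dots> \<le> ennreal e" using U by simp
    finally show "\<exists>g::'a\<Rightarrow>real. integrable lborel g \<and> transl_cont g \<and> (\<integral>\<^sup>+x. ennreal \<bar>indicator A x - g x\<bar> \<partial>lborel) \<le> ennreal e"
      using fin transl_cont_open[OF U(1) fin] by (intro exI[of _ "indicator U"]) auto
  qed
  then show ?case using transl_cont_cmult[of "indicator A" c] by simp
next
  case (add f g)
  have [measurable]: "f \<in> borel_measurable borel" "g \<in> borel_measurable borel" using add by auto
  have le: "(\<integral>\<^sup>+x. ennreal \<bar>f (x + h) + g (x + h) - (f x + g x)\<bar> \<partial>lborel)
    \<le> (\<integral>\<^sup>+x. ennreal \<bar>f (x + h) - f x\<bar> \<partial>lborel) + (\<integral>\<^sup>+x. ennreal \<bar>g (x + h) - g x\<bar> \<partial>lborel)" for h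
    by (subst nn_integral_add[symmetric])
       (auto simp: ennreal_plus[symmetric] simp del: ennreal_plus intro!: nn_integral_mono ennreal_leI)
  have z: "((\<lambda>h. (\<integral>\<^sup>+x. ennreal \<bar>f (x + h) - f x\<bar> \<partial>lborel) + (\<integral>\<^sup>+x. ennreal \<bar>g (x + h) - g x\<bar> \<partial>lborel)) \<longlongrightarrow> 0 + 0) (at 0)"
    using add unfolding transl_cont_def by (intro tendsto_add)
  show ?case unfolding transl_cont_def
    by (rule tendsto_sandwich[OF _ _ tendsto_const z[simplified]]) (auto intro!: always_eventually le)
next
  case (lim f s)
  show ?case
  proof (rule transl_cont_approx)
    fix e :: real assume e: "e > 0"
    have "(\<lambda>i. (\<integral>\<^sup>+x. norm (f x - s i x) \<partial>lborel)) \<longlonglongrightarrow> 0"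
      by (rule nn_integral_dominated_convergence_norm[where w = "\<lambda>x. 2 * norm (f x)"])
         (use lim in \<open>auto simp: nn_integral_cmult ennreal_mult ennreal_mult_less_top integrable_iff_bounded\<close>)
    then have "eventually (\<lambda>i. (\<integral>\<^sup>+x. norm (f x - s i x) \<partial>lborel) < ennreal e) sequentially"
      using e by (intro order_tendstoD) auto
    then obtain i where "(\<integral>\<^sup>+x. norm (f x - s i x) \<partial>lborel) < ennreal e"
      by (auto simp: eventually_sequentially)
    then show "\<exists>g. integrable lborel g \<and> transl_cont g \<and> (\<integral>\<^sup>+x. ennreal \<bar>f x - g x\<bar> \<partial>lborel) \<le> ennreal e"
      using lim by (intro exI[of _ "s i"]) auto
  qed fact
qed

definition N2 :: "('a::euclidean_space \<Rightarrow> real) \<Rightarrow> ennreal" where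
  "N2 f = (\<integral>\<^sup>+x. ennreal ((f x)\<^sup>2) \<partial>lborel)"

text \<open>Most of the analysis takes place on the whole space, with Borel functions that are square integrable
  and vanish outside a ball. Such functions are also integrable, so they can be convolved.\<close>

definition cL2 :: "('a::euclidean_space \<Rightarrow> real) \<Rightarrow> bool" where
  "cL2 V \<longleftrightarrow> V \<in> borel_measurable borel \<and> integrable lborel (\<lambda>x. (V x)\<^sup>2) \<and> (\<exists>R. \<forall>x. norm x > R \<longrightarrow> V x = 0)"

text \<open>This reduces continuity of translations in \<open>L\<^sup>2\<close> to the case of \<open>L\<^sup>1\<close>, applied to the function
  \<open>V \<bar>V\<bar>\<close>.\<close>

lemma square_diff_le: "(a - b)\<^sup>2 \<le> 2 * \<bar>a * \<bar>a\<bar> - b * \<bar>b\<bar>\<bar>" for a b :: real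
proof (cases "a * b \<ge> 0")
  case True
  have "\<bar>a * \<bar>a\<bar> - b * \<bar>b\<bar>\<bar> = \<bar>a - b\<bar> * \<bar>a + b\<bar>"
    using True unfolding abs_mult[symmetric]
    by (cases "a \<ge> 0"; cases "b \<ge> 0") (auto simp: algebra_simps zero_le_mult_iff abs_if)
  moreover have "\<bar>a - b\<bar> \<le> \<bar>a + b\<bar>" using True by (auto simp: zero_le_mult_iff)
  then have "\<bar>a - b\<bar> * \<bar>a - b\<bar> \<le> \<bar>a - b\<bar> * \<bar>a + b\<bar>" by (intro mult_left_mono) auto
  ultimately show ?thesis by (simp add: power2_eq_square)
next
  case False
  then consider "0 \<le> a" "b \<le> 0" | "a \<le> 0" "0 \<le> b" by (auto simp: zero_le_mult_iff)
  then have "\<bar>a * \<bar>a\<bar> - b * \<bar>b\<bar>\<bar> = \<bar>a\<^sup>2 + b\<^sup>2\<bar>"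
    by cases (auto simp: power2_eq_square abs_minus_commute)
  then have "\<bar>a * \<bar>a\<bar> - b * \<bar>b\<bar>\<bar> = a\<^sup>2 + b\<^sup>2" by simp
  moreover have "0 \<le> (a + b)\<^sup>2" by simp
  ultimately show ?thesis by (simp add: power2_eq_square algebra_simps)
qed

lemma cL2_borel: "cL2 V \<Longrightarrow> V \<in> borel_measurable borel" by (simp add: cL2_def)

lemma N2_translation_tendsto:
  assumes "cL2 V" shows "((\<lambda>h. N2 (\<lambda>x. V (x + h) - V x)) \<longlongrightarrow> 0) (at 0)"
proof -
  have [measurable]: "V \<in> borel_measurable borel" using assms by (simp add: cL2_def)
  define f where "f x = V x * \<bar>V x\<bar>" for x
  have "integrable lborel f"
    by (rule Bochner_Integration.integrable_bound[where f = "\<lambda>x. (V x)\<^sup>2"])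
       (use assms in \<open>auto simp: cL2_def f_def[abs_def] power2_eq_square abs_mult\<close>)
  then have "((\<lambda>h. \<integral>\<^sup>+x. ennreal \<bar>f (x + h) - f x\<bar> \<partial>lborel) \<longlongrightarrow> 0) (at 0)"
    using integrable_transl_cont transl_cont_def by blast
  then have z: "((\<lambda>h. ennreal 2 * (\<integral>\<^sup>+x. ennreal \<bar>f (x + h) - f x\<bar> \<partial>lborel)) \<longlongrightarrow> ennreal 2 * 0) (at 0)"
    by (intro ennreal_tendsto_cmult) auto
  have "N2 (\<lambda>x. V (x + h) - V x) \<le> ennreal 2 * (\<integral>\<^sup>+x. ennreal \<bar>f (x + h) - f x\<bar> \<partial>lborel)" for h
    unfolding N2_def f_def
    by (subst nn_integral_cmult[symmetric], simp, intro nn_integral_mono, subst ennreal_mult'[symmetric])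
       (auto intro!: ennreal_leI square_diff_le)
  then show ?thesis
    by (intro tendsto_sandwich[OF _ _ tendsto_const z[simplified]]) (auto intro!: always_eventually)
qed

lemma N2_translation_small:
  assumes "cL2 V" "e > 0"
  obtains d where "d > 0" "\<And>h. norm h < d \<Longrightarrow> N2 (\<lambda>x. V (x + h) - V x) < ennreal e"
proof -
  have "eventually (\<lambda>h. N2 (\<lambda>x. V (x + h) - V x) < ennreal e) (at 0)"
    using assms by (intro order_tendstoD[OF N2_translation_tendsto]) auto
  then obtain d where "d > 0" "\<And>h. h \<noteq> 0 \<Longrightarrow> dist h 0 < d \<Longrightarrow> N2 (\<lambda>x. V (x + h) - V x) < ennreal e"
    unfolding eventually_at by auto
  moreover have "N2 (\<lambda>x. V (x + 0) - V x) < ennreal e" using assms by (simp add: N2_def)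
  ultimately have "N2 (\<lambda>x. V (x + h) - V x) < ennreal e" if "norm h < d" for h
    using that by (cases "h = 0") auto
  with \<open>d > 0\<close> show ?thesis by (rule that)
qed

lemma N2_eq_integral: "cL2 V \<Longrightarrow> N2 V = ennreal (\<integral>x. (V x)\<^sup>2 \<partial>lborel)"
  unfolding N2_def cL2_def by (intro nn_integral_eq_integral) auto

lemma cL2_add: assumes "cL2 f" "cL2 g" shows "cL2 (\<lambda>x. f x + g x)"
proof -
  obtain R S where "\<And>x. norm x > R \<Longrightarrow> f x = 0" "\<And>x. norm x > S \<Longrightarrow> g x = 0"
    using assms unfolding cL2_def by blast
  then have "\<forall>x. norm x > max R S \<longrightarrow> f x + g x = 0" by auto
  moreover have [measurable]: "f \<in> borel_measurable borel" "g \<in> borel_measurable borel"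
    using assms by (auto simp: cL2_def)
  have "integrable lborel (\<lambda>x. (f x + g x)\<^sup>2)"
  proof (rule Bochner_Integration.integrable_bound[where f = "\<lambda>x. 2 * (f x)\<^sup>2 + 2 * (g x)\<^sup>2"])
    have "(f x + g x)\<^sup>2 \<le> 2 * (f x)\<^sup>2 + 2 * (g x)\<^sup>2" for x
      using sum_squares_bound[of "f x" "g x"] by (simp add: power2_sum)
    then show "AE x in lborel. norm ((f x + g x)\<^sup>2) \<le> norm (2 * (f x)\<^sup>2 + 2 * (g x)\<^sup>2)" by auto
  qed (use assms in \<open>auto simp: cL2_def\<close>)
  ultimately show ?thesis unfolding cL2_def by (intro conjI exI[of _ "max R S"]) auto
qed

lemma cL2_cmult: "cL2 f \<Longrightarrow> cL2 (\<lambda>x. c * f x)"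
  unfolding cL2_def by (auto simp: power_mult_distrib)

lemma cL2_diff: "cL2 f \<Longrightarrow> cL2 g \<Longrightarrow> cL2 (\<lambda>x. f x - g x)"
  using cL2_add[of f "\<lambda>x. -1 * g x"] cL2_cmult[of g "-1"] by simp

lemma cL2_shift: assumes "cL2 f" shows "cL2 (\<lambda>x. f (h + x))"
proof -
  obtain R where R: "\<And>x. norm x > R \<Longrightarrow> f x = 0" using assms unfolding cL2_def by blast
  have [measurable]: "f \<in> borel_measurable borel" using assms by (auto simp: cL2_def)
  have "f (h + x) = 0" if "norm x > R + norm h" for x
    using that norm_triangle_ineq[of "h + x" "- h"] by (intro R) simp
  moreover have "integrable lborel (\<lambda>x. (f (h + x))\<^sup>2)"
    using assms nn_integral_shift[of "\<lambda>x. ennreal ((f x)\<^sup>2)" h]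
    by (auto simp: cL2_def integrable_iff_bounded add.commute)
  ultimately show ?thesis unfolding cL2_def by auto
qed

lemma cL2_integrable: assumes "cL2 V" shows "integrable lborel V"
proof -
  obtain R where R: "\<And>x. norm x > R \<Longrightarrow> V x = 0" using assms unfolding cL2_def by blast
  show ?thesis
  proof (rule Bochner_Integration.integrable_bound[where f = "\<lambda>x. indicator (cball 0 R) x + (V x)\<^sup>2"])
    show "integrable lborel (\<lambda>x. indicator (cball 0 R) x + (V x)\<^sup>2)"
      using assms by (auto simp: cL2_def intro!: integrable_real_indicator emeasure_bounded_finite)
    have "\<bar>V x\<bar> \<le> 1 + (V x)\<^sup>2" for x
      using sum_squares_bound[of "\<bar>V x\<bar>" 1] by simp
    then have "norm (V x) \<le> norm (indicator (cball 0 R) x + (V x)\<^sup>2)" for x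
      using R[of x] by (cases "norm x \<le> R") (auto simp: indicator_def)
    then show "AE x in lborel. norm (V x) \<le> norm (indicator (cball 0 R) x + (V x)\<^sup>2)" by simp
  qed (use assms in \<open>auto simp: cL2_def\<close>)
qed

lemma cL2_bounded:
  assumes "V \<in> borel_measurable borel" "\<And>x. \<bar>V x\<bar> \<le> B" "\<And>x. norm x > R \<Longrightarrow> V x = 0"
  shows "cL2 V"
proof -
  have "integrable lborel (\<lambda>x. (V x)\<^sup>2)"
  proof (rule Bochner_Integration.integrable_bound[where f = "\<lambda>x. B\<^sup>2 * indicator (cball 0 R) x"])
    show "integrable lborel (\<lambda>x. B\<^sup>2 * indicator (cball 0 R) x)"
      by (auto intro!: integrable_real_indicator emeasure_bounded_finite)
    have "norm ((V x)\<^sup>2) \<le> norm (B\<^sup>2 * indicator (cball 0 R) x)" for x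
      using assms(3)[of x] power_mono[OF assms(2)[of x], of 2] by (cases "norm x \<le> R") (auto simp: indicator_def)
    then show "AE x in lborel. norm ((V x)\<^sup>2) \<le> norm (B\<^sup>2 * indicator (cball 0 R) x)" by simp
  qed (use assms in auto)
  then show ?thesis using assms unfolding cL2_def by auto
qed

lemma test_functions_cL2: assumes "\<phi> \<in> test_functions \<Omega>" shows "cL2 \<phi>"
proof -
  obtain K where K: "compact K" "K \<subseteq> \<Omega>" "\<And>x. x \<notin> K \<Longrightarrow> \<phi> x = 0" by (rule test_functions_compact[OF assms]) (rule that)
  obtain R where "\<And>x. x \<in> K \<Longrightarrow> norm x \<le> R" using compact_imp_bounded[OF K(1)] bounded_iff by blast
  then have "norm x > R \<Longrightarrow> \<phi> x = 0" for x using K(3) not_less by blast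
  moreover obtain B where "\<And>x. \<bar>\<phi> x\<bar> \<le> B" using test_functions_bounded[OF assms] by blast
  ultimately show ?thesis
    using test_functions_borel[OF assms] by (intro cL2_bounded)
qed

lemma AE_lebesgue_open_ex:
  fixes U :: "'a::euclidean_space set"
  assumes "AE x in lebesgue. P x" "open U" "U \<noteq> {}"
  obtains x where "x \<in> U" "P x"
proof -
  obtain N where N: "{x. \<not> P x} \<subseteq> N" "N \<in> null_sets lebesgue"
    using assms(1) by (auto elim!: AE_E simp: null_sets_def)
  have "\<not> U \<subseteq> N"
    using N(2) assms(2,3) open_not_negligible negligible_subset unfolding negligible_iff_null_sets by blast
  then show ?thesis using N(1) that by auto
qed

lemma AE_lborel_open_ex:
  fixes U :: "'a::euclidean_space set"
  assumes "AE x in lborel. P x" "open U" "U \<noteq> {}"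
  obtains x where "x \<in> U" "P x"
  using AE_lebesgue_open_ex[OF AE_completion[OF assms(1)] assms(2,3)] .

section \<open>Mollifiers\<close>

definition rho :: "real \<Rightarrow> 'a::euclidean_space \<Rightarrow> real" where
  "rho e x = bump (inverse e *\<^sub>R x) / (\<integral>y. bump (inverse e *\<^sub>R (y::'a)) \<partial>lborel)"

lemma scaled_bump_test: "e > 0 \<Longrightarrow> (\<lambda>x. bump (inverse e *\<^sub>R x)) \<in> test_functions UNIV"
proof (rule test_functionsI[where K = "cball 0 e"])
  fix k
  show "C_k k (\<lambda>x::'a. bump (inverse e *\<^sub>R x))"
    using C_k_affine[OF C_k_bump_profile[of k 1], of 0 "inverse e"] by (simp add: bump_def)
  fix x :: 'a assume "e > 0" "x \<notin> cball 0 e"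
  then show "bump (inverse e *\<^sub>R x) = 0"
    by (intro bump_zero) (auto simp: field_simps)
qed auto

lemma integral_scaled_bump_pos:
  assumes "e > 0" shows "(\<integral>y. bump (inverse e *\<^sub>R (y::'a::euclidean_space)) \<partial>lborel) > 0"
proof -
  have int: "integrable lborel (\<lambda>y::'a. bump (inverse e *\<^sub>R y))"
    using test_functions_cL2[OF scaled_bump_test[OF assms]] cL2_integrable by blast
  have "(\<integral>y. bump (inverse e *\<^sub>R (y::'a)) \<partial>lborel) \<noteq> 0"
  proof
    assume "(\<integral>y. bump (inverse e *\<^sub>R (y::'a)) \<partial>lborel) = 0"
    then have "AE y in lborel. bump (inverse e *\<^sub>R y :: 'a) = 0"
      by (subst integral_nonneg_eq_0_iff_AE[symmetric]) (use int bump_nonneg in auto)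
    then obtain y :: 'a where "y \<in> ball 0 e" "bump (inverse e *\<^sub>R y) = 0"
      by (rule AE_lborel_open_ex[where U = "ball 0 e"]) (use assms in auto)
    moreover have "norm (inverse e *\<^sub>R y) < 1" using \<open>y \<in> ball 0 e\<close> assms by (simp add: field_simps)
    ultimately show False using bump_pos[of "inverse e *\<^sub>R y"] by simp
  qed
  moreover have "(\<integral>y. bump (inverse e *\<^sub>R (y::'a)) \<partial>lborel) \<ge> 0"
    by (intro integral_nonneg_AE) (auto simp: bump_nonneg)
  ultimately show ?thesis by simp
qed

lemma rho_test: "e > 0 \<Longrightarrow> rho e \<in> test_functions UNIV"
proof (rule test_functionsI[where K = "cball 0 e"])
  fix k assume e: "e > 0"
  have "C_k k (\<lambda>x::'a. bump (inverse e *\<^sub>R x) * (1 / (\<integral>y. bump (inverse e *\<^sub>R (y::'a)) \<partial>lborel)))"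
    by (intro C_k_mult C_k_const test_functions_C_k[OF scaled_bump_test[OF e]])
  then show "C_k k (rho e :: 'a \<Rightarrow> real)" by (simp add: rho_def[abs_def])
next
  fix x :: 'a assume "e > 0" "x \<notin> cball 0 e"
  then show "rho e x = 0"
    using bump_zero[of "inverse e *\<^sub>R x"] by (simp add: rho_def field_simps)
qed auto

lemma rho_zero: "e > 0 \<Longrightarrow> norm x \<ge> e \<Longrightarrow> rho e x = 0"
  using bump_zero[of "inverse e *\<^sub>R x"] by (simp add: rho_def field_simps)

lemma rho_nonneg: "rho e x \<ge> 0"
  unfolding rho_def by (intro divide_nonneg_nonneg bump_nonneg integral_nonneg_AE) (auto simp: bump_nonneg)

lemma rho_integrable: "e > 0 \<Longrightarrow> integrable lborel (rho e)"
  using test_functions_cL2[OF rho_test] cL2_integrable by blast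

lemma rho_borel: "e > 0 \<Longrightarrow> rho e \<in> borel_measurable borel"
  using test_functions_borel[OF rho_test] .

lemma rho_integral: "e > 0 \<Longrightarrow> (\<integral>x. rho e (x::'a::euclidean_space) \<partial>lborel) = 1"
  using integral_scaled_bump_pos[where 'a = 'a, of e] by (simp add: rho_def)

lemma rho_nn_integral: "e > 0 \<Longrightarrow> (\<integral>\<^sup>+x. ennreal (rho e (x::'a::euclidean_space)) \<partial>lborel) = 1"
  using nn_integral_eq_integral[OF rho_integrable, of e] by (simp add: rho_nonneg rho_integral)

section \<open>Convolution\<close>

definition conv :: "('a::euclidean_space \<Rightarrow> real) \<Rightarrow> ('a \<Rightarrow> real) \<Rightarrow> 'a \<Rightarrow> real" where
  "conv V \<psi> x = (\<integral>y. V y * \<psi> (x - y) \<partial>lborel)"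

lemma conv_integrable:
  assumes V: "integrable lborel V" and \<psi>: "\<psi> \<in> test_functions UNIV"
  shows "integrable lborel (\<lambda>y. V y * \<psi> (x - y))"
proof -
  obtain B where B: "\<And>x. \<bar>\<psi> x\<bar> \<le> B" using test_functions_bounded[OF \<psi>] by blast
  have [measurable]: "\<psi> \<in> borel_measurable borel" using \<psi> by (rule test_functions_borel)
  show ?thesis
  proof (rule Bochner_Integration.integrable_bound[where f = "\<lambda>y. B * V y"])
    have "norm (V y * \<psi> (x - y)) \<le> norm (B * V y)" for y
      using mult_right_mono[OF B[of "x - y"], of "\<bar>V y\<bar>"] order_trans[OF abs_ge_zero B]
      by (simp add: abs_mult mult.commute)
    then show "AE y in lborel. norm (V y * \<psi> (x - y)) \<le> norm (B * V y)" by simp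
  qed (use V in auto)
qed

lemma has_derivative_quadraticI:
  fixes f :: "'a::real_normed_vector \<Rightarrow> real"
  assumes "bounded_linear D" and b: "\<And>d. \<bar>f (x + d) - f x - D d\<bar> \<le> C * (norm d)\<^sup>2"
  shows "(f has_derivative D) (at x)"
  unfolding has_derivative_at
proof (intro conjI assms(1))
  have "((\<lambda>h::'a. C * norm h) \<longlongrightarrow> C * norm (0::'a)) (at 0)"
    by (intro tendsto_mult tendsto_const tendsto_norm tendsto_ident_at)
  then have z: "((\<lambda>h::'a. C * norm h) \<longlongrightarrow> 0) (at 0)" by simp
  have "norm (f (x + h) - f x - D h) / norm h \<le> C * norm h" for h
    using b[of h] by (cases "h = 0") (simp_all add: divide_le_eq power2_eq_square mult.assoc)
  then show "((\<lambda>h. norm (f (x + h) - f x - D h) / norm h) \<longlongrightarrow> 0) (at 0)"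
    by (intro tendsto_sandwich[OF _ _ tendsto_const z]) (auto intro!: always_eventually)
qed

lemma abs_integral_le:
  fixes f g :: "'b \<Rightarrow> real"
  assumes "integrable M f" "integrable M g" "AE x in M. \<bar>f x\<bar> \<le> g x"
  shows "\<bar>integral\<^sup>L M f\<bar> \<le> integral\<^sup>L M g"
proof -
  have "\<bar>integral\<^sup>L M f\<bar> \<le> (\<integral>x. \<bar>f x\<bar> \<partial>M)" by (rule integral_abs_bound)
  also have "\<dots> \<le> integral\<^sup>L M g" using assms by (intro integral_mono_AE) auto
  finally show ?thesis .
qed

text \<open>The derivative falls on the smooth factor; its quadratic Taylor remainder is uniform and is integrated
  against \<open>\<bar>V\<bar>\<close>.\<close>

lemma conv_has_derivative:
  assumes V: "integrable lborel V" and \<psi>: "\<psi> \<in> test_functions UNIV"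
  shows "(conv V \<psi> has_derivative (\<lambda>d. \<Sum>i\<in>Basis. (d \<bullet> i) * conv V (pd i \<psi>) x)) (at x)"
proof -
  obtain M where M: "\<And>x d. \<bar>\<psi> (x + d) - \<psi> x - (\<Sum>i\<in>Basis. (d \<bullet> i) * pd i \<psi> x)\<bar> \<le> M * (norm d)\<^sup>2"
    using test_functions_taylor[OF \<psi>] by blast
  note I = conv_integrable[OF V \<psi>] conv_integrable[OF V test_functions_pd[OF \<psi>]]
  show ?thesis
  proof (rule has_derivative_quadraticI)
    show "bounded_linear (\<lambda>d. \<Sum>i\<in>Basis. (d \<bullet> i) * conv V (pd i \<psi>) x)"
      by (intro bounded_linear_sum bounded_linear_mult_const bounded_linear_inner_left)
    fix d
    have "conv V \<psi> (x + d) - conv V \<psi> x - (\<Sum>i\<in>Basis. (d \<bullet> i) * conv V (pd i \<psi>) x)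
      = (\<integral>y. V y * \<psi> (x + d - y) - V y * \<psi> (x - y) - (\<Sum>i\<in>Basis. (d \<bullet> i) * (V y * pd i \<psi> (x - y))) \<partial>lborel)"
      unfolding conv_def using I by simp
    also have "\<dots> = (\<integral>y. V y * (\<psi> ((x - y) + d) - \<psi> (x - y) - (\<Sum>i\<in>Basis. (d \<bullet> i) * pd i \<psi> (x - y))) \<partial>lborel)"
      by (intro Bochner_Integration.integral_cong refl) (simp add: algebra_simps sum_distrib_left)
    finally have eq: "conv V \<psi> (x + d) - conv V \<psi> x - (\<Sum>i\<in>Basis. (d \<bullet> i) * conv V (pd i \<psi>) x)
      = (\<integral>y. V y * (\<psi> ((x - y) + d) - \<psi> (x - y) - (\<Sum>i\<in>Basis. (d \<bullet> i) * pd i \<psi> (x - y))) \<partial>lborel)" .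
    have "\<bar>\<dots>\<bar> \<le> (\<integral>y. \<bar>V y\<bar> * (M * (norm d)\<^sup>2) \<partial>lborel)"
    proof (rule abs_integral_le)
      have "integrable lborel (\<lambda>y. V y * \<psi> (x + d - y) - V y * \<psi> (x - y) - (\<Sum>i\<in>Basis. (d \<bullet> i) * (V y * pd i \<psi> (x - y))))"
        using I by auto
      then show "integrable lborel (\<lambda>y. V y * (\<psi> ((x - y) + d) - \<psi> (x - y) - (\<Sum>i\<in>Basis. (d \<bullet> i) * pd i \<psi> (x - y))))"
        by (simp add: algebra_simps sum_distrib_left)
      show "AE y in lborel. \<bar>V y * (\<psi> ((x - y) + d) - \<psi> (x - y) - (\<Sum>i\<in>Basis. (d \<bullet> i) * pd i \<psi> (x - y)))\<bar>
          \<le> \<bar>V y\<bar> * (M * (norm d)\<^sup>2)"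
        unfolding abs_mult by (intro AE_I2 mult_left_mono M) auto
    qed (use V in auto)
    then show "\<bar>conv V \<psi> (x + d) - conv V \<psi> x - (\<Sum>i\<in>Basis. (d \<bullet> i) * conv V (pd i \<psi>) x)\<bar>
       \<le> ((\<integral>y. \<bar>V y\<bar> \<partial>lborel) * M) * (norm d)\<^sup>2"
      unfolding eq by (simp add: mult.assoc)
  qed
qed

lemma pd_conv:
  assumes "integrable lborel V" and "\<psi> \<in> test_functions UNIV" "i \<in> Basis"
  shows "pd i (conv V \<psi>) x = conv V (pd i \<psi>) x"
  using pd_eqI[OF conv_has_derivative[OF assms(1,2)], of i x] assms(3)
  by (simp add: inner_Basis if_distrib[of "\<lambda>z. z * _"] cong: if_cong)

lemma C_k_conv:
  assumes V: "integrable lborel V" and "\<psi> \<in> test_functions UNIV"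
  shows "C_k k (conv V \<psi>)"
  using assms(2)
proof (induction k arbitrary: \<psi>)
  case 0
  have "conv V \<psi> differentiable (at x)" for x
    using conv_has_derivative[OF V 0] by (rule differentiableI)
  then show ?case by (auto intro!: continuous_at_imp_continuous_on differentiable_imp_continuous_within)
next
  case (Suc k)
  have "conv V \<psi> differentiable (at x)" for x
    using conv_has_derivative[OF V Suc.prems] by (rule differentiableI)
  moreover have "pd i (conv V \<psi>) = conv V (pd i \<psi>)" if "i \<in> Basis" for i
    using pd_conv[OF V Suc.prems that] by blast
  ultimately show ?case
    using Suc.IH test_functions_pd[OF Suc.prems] by (auto simp: C_k_Suc_pd)
qed

lemma conv_borel:
  assumes "integrable lborel V" "\<psi> \<in> test_functions UNIV" shows "conv V \<psi> \<in> borel_measurable borel"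
  using C_k_imp_continuous[OF C_k_conv[OF assms, of 0]] borel_measurable_continuous_onI by blast

lemma conv_commute:
  assumes [measurable]: "V \<in> borel_measurable borel" "\<psi> \<in> borel_measurable borel"
  shows "conv V \<psi> x = (\<integral>y. V (x - y) * \<psi> y \<partial>lborel)"
  unfolding conv_def using integral_reflect[of "\<lambda>y. V y * \<psi> (x - y)" x] by simp

lemma conv_rho_near:
  assumes e: "e > 0" and V: "integrable lborel V"
    and near: "AE y in lborel. dist x y < e \<longrightarrow> \<bar>V y - c\<bar> \<le> d"
  shows "\<bar>conv V (rho e) x - c\<bar> \<le> d"
proof -
  have [measurable]: "V \<in> borel_measurable borel" using V by auto
  note [measurable] = rho_borel[OF e]
  have Ir: "integrable lborel (\<lambda>y. rho e (x - y))" and r1: "(\<integral>y. rho e (x - y) \<partial>lborel) = 1"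
  proof -
    have "(\<integral>\<^sup>+y. ennreal (rho e (x - y)) \<partial>lborel) = 1"
      using nn_integral_reflect[of "\<lambda>y. ennreal (rho e y)" x] rho_nn_integral[OF e] by simp
    then show "integrable lborel (\<lambda>y. rho e (x - y))"
      by (simp add: integrable_iff_bounded rho_nonneg)
    show "(\<integral>y. rho e (x - y) \<partial>lborel) = 1"
      using integral_reflect[of "rho e" x] rho_integral[OF e] by simp
  qed
  have "conv V (rho e) x - c = (\<integral>y. V y * rho e (x - y) - c * rho e (x - y) \<partial>lborel)"
    unfolding conv_def using Ir conv_integrable[OF V rho_test[OF e]] r1 by simp
  also have "\<bar>\<dots>\<bar> \<le> (\<integral>y. d * rho e (x - y) \<partial>lborel)"
  proof (rule abs_integral_le)
    show "AE y in lborel. \<bar>V y * rho e (x - y) - c * rho e (x - y)\<bar> \<le> d * rho e (x - y)"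
      using near
    proof eventually_elim
      case (elim y)
      show ?case
      proof (cases "dist x y < e")
        case True
        then have "\<bar>V y - c\<bar> * rho e (x - y) \<le> d * rho e (x - y)" using elim by (intro mult_right_mono rho_nonneg) auto
        moreover have "V y * rho e (x - y) - c * rho e (x - y) = (V y - c) * rho e (x - y)" by (simp add: algebra_simps)
        ultimately show ?thesis by (simp add: abs_mult rho_nonneg)
      qed (use rho_zero[OF e, of "x - y"] in \<open>simp add: dist_norm\<close>)
    qed
  qed (use Ir conv_integrable[OF V rho_test[OF e]] in auto)
  also have "\<dots> = d" using r1 by simp
  finally show ?thesis .
qed

text \<open>Jensen's inequality for the square, with a weight of total mass at most 1. For a function that is not
  integrable the left-hand side is zero by convention.\<close>

lemma jensen_square:
  fixes w G :: "'a \<Rightarrow> real"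
  assumes [measurable]: "w \<in> borel_measurable M" "G \<in> borel_measurable M"
    and w: "\<And>y. w y \<ge> 0" "(\<integral>\<^sup>+y. ennreal (w y) \<partial>M) \<le> 1"
  shows "ennreal ((\<integral>y. G y * w y \<partial>M)\<^sup>2) \<le> (\<integral>\<^sup>+y. ennreal ((G y)\<^sup>2 * w y) \<partial>M)"
proof (cases "integrable M (\<lambda>y. G y * w y)")
  case True
  have "ennreal ((\<integral>y. G y * w y \<partial>M)\<^sup>2) = (ennreal \<bar>\<integral>y. G y * w y \<partial>M\<bar>)\<^sup>2"
    by (simp add: ennreal_power)
  also have "\<dots> \<le> (\<integral>\<^sup>+y. ennreal \<bar>G y * w y\<bar> \<partial>M)\<^sup>2"
    using integral_norm_bound_ennreal[OF True] by (intro power_mono) auto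
  also have "(\<integral>\<^sup>+y. ennreal \<bar>G y * w y\<bar> \<partial>M) = (\<integral>\<^sup>+y. ennreal (\<bar>G y\<bar> * sqrt (w y)) * ennreal (sqrt (w y)) \<partial>M)"
    using w(1) by (intro nn_integral_cong) (simp add: ennreal_mult'[symmetric] abs_mult mult.assoc)
  also have "\<dots>\<^sup>2 \<le> (\<integral>\<^sup>+y. (ennreal (\<bar>G y\<bar> * sqrt (w y)))\<^sup>2 \<partial>M) * (\<integral>\<^sup>+y. (ennreal (sqrt (w y)))\<^sup>2 \<partial>M)"
    by (rule Cauchy_Schwarz_nn_integral) measurable
  also have "\<dots> = (\<integral>\<^sup>+y. ennreal ((G y)\<^sup>2 * w y) \<partial>M) * (\<integral>\<^sup>+y. ennreal (w y) \<partial>M)"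
    using w(1) by (simp add: ennreal_power power_mult_distrib)
  also have "\<dots> \<le> (\<integral>\<^sup>+y. ennreal ((G y)\<^sup>2 * w y) \<partial>M) * 1"
    by (intro mult_left_mono w) auto
  finally show ?thesis by simp
qed (simp add: not_integrable_integral_eq)

text \<open>Minkowski's inequality in disguise: the mollification error is an average of translation errors,
  and the mollification itself an average of translates.\<close>

lemma nn_integral_kernel_le:
  fixes F :: "'a::euclidean_space \<Rightarrow> 'a \<Rightarrow> real"
  assumes e: "e > 0" and [measurable]: "(\<lambda>(x, y). F x y) \<in> borel_measurable (borel \<Otimes>\<^sub>M borel)"
    and B: "\<And>y. norm y < e \<Longrightarrow> N2 (\<lambda>x. F x y) \<le> B"
    and f: "\<And>x. f x = (\<integral>y. F x y * rho e y \<partial>lborel)"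
  shows "N2 f \<le> B"
proof -
  note [measurable] = rho_borel[OF e]
  have "N2 f \<le> (\<integral>\<^sup>+x. \<integral>\<^sup>+y. ennreal ((F x y)\<^sup>2 * rho e y) \<partial>lborel \<partial>lborel)"
    unfolding N2_def f
    by (intro nn_integral_mono jensen_square) (auto simp: rho_nonneg rho_nn_integral[OF e])
  also have "\<dots> = (\<integral>\<^sup>+y. \<integral>\<^sup>+x. ennreal ((F x y)\<^sup>2 * rho e y) \<partial>lborel \<partial>lborel)"
    by (rule lborel_pair.Fubini') measurable
  also have "\<dots> = (\<integral>\<^sup>+y. N2 (\<lambda>x. F x y) * ennreal (rho e y) \<partial>lborel)"
    unfolding N2_def by (subst nn_integral_multc[symmetric]) (auto simp: ennreal_mult rho_nonneg)
  also have "\<dots> \<le> (\<integral>\<^sup>+y. B * ennreal (rho e (y::'a)) \<partial>lborel)"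
  proof (intro nn_integral_mono)
    fix y :: 'a
    show "N2 (\<lambda>x. F x y) * ennreal (rho e y) \<le> B * ennreal (rho e y)"
      using B[of y] rho_zero[OF e, of y] by (cases "norm y < e") (auto intro: mult_right_mono)
  qed
  also have "\<dots> = B" by (simp add: nn_integral_cmult rho_nn_integral[OF e])
  finally show ?thesis .
qed

lemma N2_shift: "f \<in> borel_measurable borel \<Longrightarrow> N2 (\<lambda>x. f (x + h)) = N2 f"
  unfolding N2_def by (rule nn_integral_shift) measurable

lemma N2_conv_le:
  assumes e: "e > 0" and [measurable]: "V \<in> borel_measurable borel"
  shows "N2 (conv V (rho e)) \<le> N2 V"
proof (rule nn_integral_kernel_le[OF e, where F = "\<lambda>x y. V (x - y)"])
  show "N2 (\<lambda>x. V (x - y)) \<le> N2 V" for y using N2_shift[of V "- y"] by simp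
qed (use conv_commute[OF _ rho_borel[OF e], of V] in auto)

lemma N2_conv_tendsto:
  assumes V: "cL2 V" and e: "\<And>k. e k > 0" "e \<longlonglongrightarrow> (0::real)"
  shows "(\<lambda>k. N2 (\<lambda>x. conv V (rho (e k)) x - V x)) \<longlonglongrightarrow> 0"
proof (rule tendsto_0_ennrealI)
  fix r :: real assume r: "r > 0"
  have [measurable]: "V \<in> borel_measurable borel" using V by (simp add: cL2_def)
  obtain d where d: "d > 0" "\<And>h. norm h < d \<Longrightarrow> N2 (\<lambda>x. V (x + h) - V x) < ennreal r"
    using N2_translation_small[OF V r] by blast
  have "eventually (\<lambda>k. e k < d) sequentially" using e(2) d(1) by (intro order_tendstoD)
  then show "eventually (\<lambda>k. N2 (\<lambda>x. conv V (rho (e k)) x - V x) \<le> ennreal r) sequentially"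
  proof eventually_elim
    case (elim k)
    note [measurable] = rho_borel[OF e(1)]
    show ?case
    proof (rule nn_integral_kernel_le[OF e(1), where F = "\<lambda>x y. V (x - y) - V x"])
      show "N2 (\<lambda>x. V (x - y) - V x) \<le> ennreal r" if "norm y < e k" for y
        using d(2)[of "- y"] that elim by simp
      fix x
      have "integrable lborel (\<lambda>y. V (x - y) * rho (e k) y)"
        using conv_integrable[OF cL2_integrable[OF V] rho_test[OF e(1)[of k]], of x]
          nn_integral_reflect[of "\<lambda>y. ennreal \<bar>V y * rho (e k) (x - y)\<bar>" x]
        by (simp add: integrable_iff_bounded)
      then show "conv V (rho (e k)) x - V x = (\<integral>y. (V (x - y) - V x) * rho (e k) y \<partial>lborel)"
        by (simp add: conv_commute left_diff_distrib rho_integrable e rho_integral)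
    qed auto
  qed
qed

lemma cL2_conv:
  assumes V: "cL2 V" and e: "e > 0" shows "cL2 (conv V (rho e))"
proof -
  obtain R where R: "\<And>x. norm x > R \<Longrightarrow> V x = 0" using V unfolding cL2_def by blast
  have "conv V (rho e) x = 0" if "norm x > R + e" for x
  proof -
    have "(\<lambda>y. V y * rho e (x - y)) = (\<lambda>y. 0)"
    proof
      fix y
      show "V y * rho e (x - y) = 0"
        using R[of y] rho_zero[OF e, of "x - y"] that norm_triangle_ineq2[of x y]
        by (cases "norm y > R") auto
    qed
    then show ?thesis unfolding conv_def by (simp only:) simp
  qed
  moreover have b: "conv V (rho e) \<in> borel_measurable borel"
    by (intro conv_borel cL2_integrable V rho_test e)
  moreover have "N2 (conv V (rho e)) < \<infinity>"
    using N2_conv_le[OF e cL2_borel[OF V]] N2_eq_integral[OF V] by (simp add: order_le_less_trans)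
  ultimately show ?thesis
    unfolding cL2_def N2_def by (auto simp: integrable_iff_bounded)
qed

text \<open>Mollification spreads the support by \<open>e\<close> only.\<close>

lemma conv_test_function:
  assumes V: "integrable lborel V" and K: "compact K" "\<And>x. x \<notin> K \<Longrightarrow> V x = 0"
    and e: "e > 0" and sub: "\<And>x y. x \<in> K \<Longrightarrow> dist x y \<le> e \<Longrightarrow> y \<in> \<Omega>"
  shows "conv V (rho e) \<in> test_functions \<Omega>"
proof (rule test_functionsI)
  show "C_k k (conv V (rho e))" for k by (rule C_k_conv[OF V rho_test[OF e]])
  show "compact {x + y | x y. x \<in> K \<and> y \<in> cball 0 e}" using K by (intro compact_sums) auto
  show "{x + y | x y. x \<in> K \<and> y \<in> cball 0 e} \<subseteq> \<Omega>" using sub by (auto simp: dist_norm)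
  fix x assume x: "x \<notin> {x + y | x y. x \<in> K \<and> y \<in> cball 0 e}"
  have "V y * rho e (x - y) = 0" for y
  proof (cases "y \<in> K")
    case True
    then have "x - y \<notin> cball 0 e" using x by force
    then show ?thesis using rho_zero[OF e, of "x - y"] by auto
  qed (use K in auto)
  then have "(\<lambda>y. V y * rho e (x - y)) = (\<lambda>y. 0)" by auto
  then show "conv V (rho e) x = 0" unfolding conv_def by (simp only:) simp
qed

text \<open>The difference of two translates of a mollified function is itself a mollified function. Norms of the
  difference are therefore bounded by those of a difference of translates of \<open>V\<close>, uniformly in the mollifier.\<close>

lemma conv_diff_shift:
  assumes V: "cL2 V" and \<psi>: "\<psi> \<in> test_functions UNIV"
  shows "conv V \<psi> (x + z) - conv V \<psi> (y + z) = conv (\<lambda>w. V (x + w) - V (y + w)) \<psi> z"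
proof -
  have [measurable]: "V \<in> borel_measurable borel" using V by (simp add: cL2_def)
  note [measurable] = test_functions_borel[OF \<psi>]
  have s: "conv V \<psi> (x + z) = conv (\<lambda>w. V (x + w)) \<psi> z" for x
    unfolding conv_def using integral_shift[of "\<lambda>y. V y * \<psi> (x + z - y)" x]
    by (simp add: algebra_simps)
  show ?thesis
    unfolding s unfolding conv_def left_diff_distrib
    by (intro Bochner_Integration.integral_diff[symmetric] conv_integrable \<psi> cL2_integrable cL2_shift V)
qed

lemma N2_AE_subseq:
  assumes f: "\<And>k. cL2 (f k)" and lim: "(\<lambda>k. N2 (f k)) \<longlonglongrightarrow> 0"
  obtains r :: "nat \<Rightarrow> nat" where "strict_mono r" "AE x in lborel. (\<lambda>k. f (r k) x) \<longlonglongrightarrow> 0"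
proof -
  have "(\<lambda>k. \<integral>x. norm ((f k x)\<^sup>2) \<partial>lborel) \<longlonglongrightarrow> 0"
  proof -
    have "(\<lambda>k. ennreal (\<integral>x. (f k x)\<^sup>2 \<partial>lborel)) \<longlonglongrightarrow> ennreal 0"
      using lim N2_eq_integral[OF f] by simp
    then show ?thesis by (subst (asm) tendsto_ennreal_iff) auto
  qed
  then obtain r where r: "strict_mono r" "AE x in lborel. (\<lambda>k. (f (r k) x)\<^sup>2) \<longlonglongrightarrow> 0"
    using tendsto_L1_AE_subseq[of lborel "\<lambda>k x. (f k x)\<^sup>2"] f unfolding cL2_def by auto
  have "AE x in lborel. (\<lambda>k. f (r k) x) \<longlonglongrightarrow> 0"
    using r(2)
  proof eventually_elim
    case (elim x)
    from tendsto_real_sqrt[OF elim] show ?case by (simp add: tendsto_rabs_zero_iff)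
  qed
  with r(1) show ?thesis by (rule that)
qed

section \<open>Borel representatives extended by zero\<close>

lemma cball_measurable [measurable]: "cball a r \<in> sets borel"
  by (rule borel_closed) auto

lemma AE_lebesgue_on_iff:
  "S \<in> sets lebesgue \<Longrightarrow> (AE x in lebesgue_on S. P x) \<longleftrightarrow> (AE x in lebesgue. x \<in> S \<longrightarrow> P x)"
  by (simp add: AE_restrict_space_iff)

text \<open>Measurability on \<open>S\<close> is Lebesgue measurability, while convolution and Fubini's theorem ask for Borel functions
  on the whole space. Every function measurable on an open set is therefore replaced by a Borel function that agrees
  with it almost everywhere on \<open>S\<close> and vanishes outside \<open>S\<close>.\<close>

definition rep :: "'a::euclidean_space set \<Rightarrow> ('a \<Rightarrow> real) \<Rightarrow> ('a \<Rightarrow> real) \<Rightarrow> bool" where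
  "rep S u U \<longleftrightarrow> U \<in> borel_measurable borel \<and> (\<forall>x. x \<notin> S \<longrightarrow> U x = 0) \<and> (AE x in lebesgue_on S. u x = U x)"

lemma rep_ex:
  assumes S: "open S" and u: "u \<in> borel_measurable (lebesgue_on S)"
  obtains U where "rep S u U"
proof -
  have m: "S \<in> sets lebesgue" and [measurable]: "S \<in> sets borel" using S by auto
  have "(\<lambda>x. if x \<in> S then u x else 0) \<in> borel_measurable lebesgue"
    using u m by (intro borel_measurable_if_I)
  then obtain V where V: "V \<in> borel_measurable lborel" "AE x in lborel. (if x \<in> S then u x else 0) = V x"
    using completion_ex_borel_measurable_real by blast
  have "AE x in lebesgue. (if x \<in> S then u x else 0) = V x" using V(2) by (rule AE_completion)
  then have "AE x in lebesgue_on S. u x = (if x \<in> S then V x else 0)"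
    unfolding AE_lebesgue_on_iff[OF m] by eventually_elim auto
  moreover have "(\<lambda>x. if x \<in> S then V x else 0) \<in> borel_measurable borel"
    using V(1) by simp
  ultimately show ?thesis by (intro that) (auto simp: rep_def)
qed

lemma rep_borel: "rep S u U \<Longrightarrow> U \<in> borel_measurable borel" by (simp add: rep_def)

lemma rep_measurable:
  assumes "open S" "rep S u U" shows "U \<in> borel_measurable (lebesgue_on S)"
  using rep_borel[OF assms(2)] by (intro measurable_restrict_space1 measurable_completion) simp

lemma rep_integral:
  assumes S: "open S" and u: "u \<in> borel_measurable (lebesgue_on S)" and U: "rep S u U"
  shows "(\<integral>x. u x \<partial>lebesgue_on S) = (\<integral>x. U x \<partial>lborel)" "integrable (lebesgue_on S) u \<longleftrightarrow> integrable lborel U"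
proof -
  have m: "S \<in> sets lebesgue" using S by auto
  have U': "U \<in> borel_measurable lborel" "U \<in> borel_measurable (lebesgue_on S)"
    using rep_borel[OF U] rep_measurable[OF S U] by auto
  have eq: "(\<lambda>x. if x \<in> S then U x else 0) = U" using U by (auto simp: rep_def)
  have "(\<integral>x. u x \<partial>lebesgue_on S) = (\<integral>x. U x \<partial>lebesgue_on S)"
    using U U' u by (intro integral_cong_AE) (auto simp: rep_def)
  also have "\<dots> = (\<integral>x. U x \<partial>lebesgue)" using Lebesgue_Measure.integral_restrict_UNIV[OF m, of U] unfolding eq by simp
  also have "\<dots> = (\<integral>x. U x \<partial>lborel)" using U' by (simp add: integral_completion)
  finally show "(\<integral>x. u x \<partial>lebesgue_on S) = (\<integral>x. U x \<partial>lborel)" .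
  have "integrable (lebesgue_on S) u \<longleftrightarrow> integrable (lebesgue_on S) U"
    using U U' u by (intro integrable_cong_AE) (auto simp: rep_def)
  also have "\<dots> \<longleftrightarrow> integrable lebesgue U" using Lebesgue_Measure.integrable_restrict_UNIV[OF m, of U] unfolding eq by simp
  also have "\<dots> \<longleftrightarrow> integrable lborel U" using U' by (simp add: integrable_completion)
  finally show "integrable (lebesgue_on S) u \<longleftrightarrow> integrable lborel U" .
qed

lemma rep_mult: "rep S u U \<Longrightarrow> \<phi> \<in> borel_measurable borel \<Longrightarrow> rep S (\<lambda>x. u x * \<phi> x) (\<lambda>x. U x * \<phi> x)"
  unfolding rep_def by (auto elim: AE_mp)

lemma rep_square: "rep S u U \<Longrightarrow> rep S (\<lambda>x. (u x)\<^sup>2) (\<lambda>x. (U x)\<^sup>2)"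
  unfolding rep_def by (auto elim: AE_mp)

lemma borel_imp_lebesgue_on: "\<phi> \<in> borel_measurable borel \<Longrightarrow> \<phi> \<in> borel_measurable (lebesgue_on S)"
  by (intro measurable_restrict_space1 measurable_completion) simp

lemma rep_integral_mult:
  assumes "open S" "u \<in> borel_measurable (lebesgue_on S)" "rep S u U" "\<phi> \<in> borel_measurable borel"
  shows "(\<integral>x. u x * \<phi> x \<partial>lebesgue_on S) = (\<integral>x. U x * \<phi> x \<partial>lborel)"
  by (rule rep_integral(1)[OF assms(1) _ rep_mult[OF assms(3,4)]])
     (use assms(2) borel_imp_lebesgue_on[OF assms(4), of S] in measurable)

lemma L2_measurable: "f \<in> L2 S \<Longrightarrow> f \<in> borel_measurable (lebesgue_on S)"
  by (simp add: L2_def)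

lemma rep_L2:
  assumes S: "open S" "bounded S" and u: "u \<in> borel_measurable (lebesgue_on S)" and U: "rep S u U"
  shows "u \<in> L2 S \<longleftrightarrow> cL2 U"
proof -
  obtain R where "\<And>x. x \<in> S \<Longrightarrow> norm x \<le> R" using S(2) by (auto simp: bounded_iff)
  then have "\<exists>R. \<forall>x. norm x > R \<longrightarrow> U x = 0" using U unfolding rep_def by (meson not_le)
  moreover have "integrable (lebesgue_on S) (\<lambda>x. (u x)\<^sup>2) \<longleftrightarrow> integrable lborel (\<lambda>x. (U x)\<^sup>2)"
    by (rule rep_integral(2)[OF S(1) _ rep_square[OF U]]) (use u in measurable)
  ultimately show ?thesis using u rep_borel[OF U] by (auto simp: L2_def cL2_def)
qed

lemma rep_integral_square:
  assumes S: "open S" and u: "u \<in> borel_measurable (lebesgue_on S)" and U: "rep S u U"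
  shows "(\<integral>x. (u x)\<^sup>2 \<partial>lebesgue_on S) = (\<integral>x. (U x)\<^sup>2 \<partial>lborel)"
  by (rule rep_integral(1)[OF S(1) _ rep_square[OF U]]) (use u in measurable)

lemma integral_lebesgue_on_eq_lborel:
  fixes F :: "'a::euclidean_space \<Rightarrow> real"
  assumes "open S" "F \<in> borel_measurable borel" "\<And>x. x \<notin> S \<Longrightarrow> F x = 0"
  shows "(\<integral>x. F x \<partial>lebesgue_on S) = (\<integral>x. F x \<partial>lborel)"
  by (rule rep_integral(1)[OF assms(1)]) (use assms borel_imp_lebesgue_on in \<open>auto simp: rep_def\<close>)

section \<open>The fundamental lemma of the calculus of variations\<close>

lemma locally_integrable_component:
  "locally_integrable S g \<Longrightarrow> locally_integrable S (\<lambda>x. g x \<bullet> i)"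
  unfolding locally_integrable_def by auto

lemma integrable_on_cball_rep:
  assumes S: "open S" and g: "locally_integrable S (g :: 'a::euclidean_space \<Rightarrow> real)" and G: "rep S g G" and sub: "cball a r \<subseteq> S"
  shows "integrable lborel (\<lambda>x. G x * indicator (cball a r) x)"
proof -
  have m: "S \<in> sets lebesgue" using S by auto
  have [measurable]: "G \<in> borel_measurable borel" using G by (rule rep_borel)
  have "integrable (lebesgue_on (cball a r)) g" using g sub unfolding locally_integrable_def by auto
  moreover have "AE x in lebesgue_on (cball a r). g x = G x"
  proof -
    have "AE x in lebesgue. x \<in> S \<longrightarrow> g x = G x" using G m by (simp add: rep_def AE_lebesgue_on_iff)
    then have "AE x in lebesgue. x \<in> cball a r \<longrightarrow> g x = G x"
      by eventually_elim (use sub in auto)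
    then show ?thesis by (subst AE_lebesgue_on_iff) auto
  qed
  ultimately have "integrable (lebesgue_on (cball a r)) G"
    using borel_imp_lebesgue_on[OF rep_borel[OF G]] by (subst integrable_cong_AE[symmetric]) auto
  then have "integrable lebesgue (\<lambda>x. if x \<in> cball a r then G x else 0)"
    by (subst Lebesgue_Measure.integrable_restrict_UNIV) auto
  moreover have "(\<lambda>x. if x \<in> cball a r then G x else 0) = (\<lambda>x. G x * indicator (cball a r) x)"
    by (auto simp: indicator_def)
  moreover have "(\<lambda>x. G x * indicator (cball a r) x) \<in> borel_measurable lborel" by measurable
  ultimately show ?thesis by (simp add: integrable_completion)
qed

text \<open>Testing with mollifications of the sign of \<open>g\<close> on a ball bounds the integral of its absolute value there.\<close>

lemma fundamental_lemma_ball: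
  assumes S: "open S" and g: "locally_integrable S (g :: 'a::euclidean_space \<Rightarrow> real)"
    and z: "\<And>\<phi>. \<phi> \<in> test_functions S \<Longrightarrow> (\<integral>x. g x * \<phi> x \<partial>lebesgue_on S) = 0"
    and r: "r > 0" and sub: "cball a (2 * r) \<subseteq> S"
  shows "AE x in lebesgue. x \<in> cball a r \<longrightarrow> g x = 0"
proof -
  have m: "S \<in> sets lebesgue" using S by auto
  have gm: "g \<in> borel_measurable (lebesgue_on S)" using g by (simp add: locally_integrable_def)
  have sub': "cball a r \<subseteq> S" using sub r by (intro order_trans[OF subset_cball sub]) auto
  obtain G where G: "rep S g G" by (rule rep_ex[OF S gm])
  have [measurable]: "G \<in> borel_measurable borel" using G by (rule rep_borel)
  define w where "w x = sgn (G x) * indicator (cball a r) x" for x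
  define e where "e k = r / (real k + 2)" for k :: nat
  have e: "e k > 0" "e k < r" for k using r by (auto simp: e_def divide_less_eq add_pos_nonneg)
  have e0: "e \<longlonglongrightarrow> 0" unfolding e_def by real_asymp
  have [measurable]: "w \<in> borel_measurable borel" unfolding w_def by measurable
  have w1: "\<bar>w x\<bar> \<le> 1" for x by (simp add: w_def indicator_def sgn_if)
  have w: "cL2 w"
  proof (rule cL2_bounded[OF _ w1])
    show "w x = 0" if "norm x > norm a + r" for x
      using that norm_triangle_ineq2[of x a] by (auto simp: w_def indicator_def dist_norm norm_minus_commute)
  qed measurable
  have lim: "(\<lambda>k. N2 (\<lambda>x. conv w (rho (e k)) x - w x)) \<longlonglongrightarrow> 0"
    by (rule N2_conv_tendsto[OF w e(1) e0])
  obtain s where s: "strict_mono s" "AE x in lborel. (\<lambda>k. conv w (rho (e (s k))) x - w x) \<longlonglongrightarrow> 0"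
    by (rule N2_AE_subseq[OF _ lim]) (auto intro: cL2_diff cL2_conv w e)
  have test: "conv w (rho (e k)) \<in> test_functions (ball a (2 * r))" for k
  proof (rule conv_test_function[OF cL2_integrable[OF w], of "cball a r"])
    fix x y assume "x \<in> cball a r" "dist x y \<le> e k"
    then show "y \<in> ball a (2 * r)" using e(2)[of k] dist_triangle[of a y x] by (auto simp: dist_commute)
  qed (auto simp: w_def e)
  have test': "conv w (rho (e k)) \<in> test_functions S" for k
    using test_functions_mono[OF _ test] sub by (meson ball_subset_cball order_trans)
  have z': "(\<integral>x. G x * conv w (rho (e k)) x \<partial>lborel) = 0" for k
    using rep_integral_mult[OF S gm G test_functions_borel[OF test']] z[OF test'] by simp
  have supp: "conv w (rho (e k)) x = 0" if "x \<notin> cball a (2 * r)" for x k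
    using test[of k] that by (auto elim!: test_functions_compact dest: subsetD[of _ "ball a (2 * r)"])
  have int: "integrable lborel (\<lambda>x. G x * indicator (cball a (2 * r)) x)"
    by (rule integrable_on_cball_rep[OF S g G sub])
  have "(\<lambda>k. \<integral>x. G x * conv w (rho (e (s k))) x \<partial>lborel) \<longlonglongrightarrow> (\<integral>x. G x * w x \<partial>lborel)"
  proof (rule integral_dominated_convergence[where w = "\<lambda>x. \<bar>G x * indicator (cball a (2 * r)) x\<bar>"])
    show "AE x in lborel. (\<lambda>k. G x * conv w (rho (e (s k))) x) \<longlonglongrightarrow> G x * w x"
      using s(2) by eventually_elim (auto intro!: tendsto_mult_left simp: LIM_zero_iff)
    show "AE x in lborel. norm (G x * conv w (rho (e (s k))) x) \<le> \<bar>G x * indicator (cball a (2 * r)) x\<bar>" for k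
    proof (rule AE_I2)
      fix x
      have "\<bar>conv w (rho (e (s k))) x - 0\<bar> \<le> 1"
        by (rule conv_rho_near[OF e(1) cL2_integrable[OF w]]) (simp add: w1)
      then have "\<bar>G x\<bar> * \<bar>conv w (rho (e (s k))) x\<bar> \<le> \<bar>G x\<bar> * 1" by (intro mult_left_mono) auto
      then show "norm (G x * conv w (rho (e (s k))) x) \<le> \<bar>G x * indicator (cball a (2 * r)) x\<bar>"
        using supp[of x] by (cases "x \<in> cball a (2 * r)") (auto simp: abs_mult indicator_def)
    qed
    show "(\<lambda>x. G x * conv w (rho (e (s k))) x) \<in> borel_measurable lborel" for k
      using test_functions_borel[OF test, measurable] by measurable
  qed (use int in \<open>auto simp: w_def\<close>)
  then have "(\<integral>x. G x * w x \<partial>lborel) = 0" using z' by (simp add: LIMSEQ_const_iff)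
  moreover have Gw: "G x * w x = \<bar>G x * indicator (cball a r) x\<bar>" for x
    by (simp add: w_def indicator_def abs_if sgn_if)
  moreover have "integrable lborel (\<lambda>x. G x * indicator (cball a r) x)"
    by (rule integrable_on_cball_rep[OF S g G sub'])
  ultimately have "AE x in lborel. \<bar>G x * indicator (cball a r) x\<bar> = 0"
    by (subst integral_nonneg_eq_0_iff_AE[symmetric]) auto
  then have "AE x in lebesgue. G x * indicator (cball a r) x = 0"
    by (intro AE_completion) auto
  moreover have "AE x in lebesgue. x \<in> S \<longrightarrow> g x = G x"
    using G by (simp add: rep_def AE_lebesgue_on_iff m)
  ultimately show ?thesis
  proof eventually_elim
    case (elim x)
    with sub' show ?case by (auto simp: indicator_def)
  qed
qed

lemma negligible_iff_AE: "negligible {x. \<not> P x} \<longleftrightarrow> (AE x in lebesgue. P x)"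
  unfolding eventually_ae_filter_negligible by (blast intro: negligible_subset)

text \<open>By the Lindelof property, properties that hold almost everywhere locally hold almost everywhere.\<close>

lemma AE_locally:
  fixes S :: "'a::euclidean_space set"
  assumes "\<And>a. a \<in> S \<Longrightarrow> \<exists>r>0. AE x in lebesgue. x \<in> ball a r \<longrightarrow> P x"
  shows "AE x in lebesgue. x \<in> S \<longrightarrow> P x"
proof -
  have "negligible {x. \<not> (x \<in> S \<longrightarrow> P x)}"
  proof (subst locally_negligible_alt, intro ballI)
    fix a assume "a \<in> {x. \<not> (x \<in> S \<longrightarrow> P x)}"
    then obtain r where r: "r > 0" "AE x in lebesgue. x \<in> ball a r \<longrightarrow> P x" and a: "a \<in> S" "\<not> P a" using assms by blast
    have "negligible {x. \<not> (x \<in> ball a r \<longrightarrow> P x)}" using r(2) by (simp only: negligible_iff_AE)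
    then have "negligible ({x. \<not> (x \<in> S \<longrightarrow> P x)} \<inter> ball a r)" by (rule negligible_subset) auto
    moreover have "openin (top_of_set {x. \<not> (x \<in> S \<longrightarrow> P x)}) ({x. \<not> (x \<in> S \<longrightarrow> P x)} \<inter> ball a r)"
      by (rule openin_open_Int) auto
    ultimately show "\<exists>U. openin (top_of_set {x. \<not> (x \<in> S \<longrightarrow> P x)}) U \<and> a \<in> U \<and> negligible U"
      using a r(1) by (intro exI[of _ "{x. \<not> (x \<in> S \<longrightarrow> P x)} \<inter> ball a r"]) auto
  qed
  then show ?thesis by (simp only: negligible_iff_AE)
qed

lemma fundamental_lemma:
  assumes S: "open S" and g: "locally_integrable S (g :: 'a::euclidean_space \<Rightarrow> real)"
    and z: "\<And>\<phi>. \<phi> \<in> test_functions S \<Longrightarrow> (\<integral>x. g x * \<phi> x \<partial>lebesgue_on S) = 0"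
  shows "AE x in lebesgue_on S. g x = 0"
proof -
  have "AE x in lebesgue. x \<in> S \<longrightarrow> g x = 0"
  proof (rule AE_locally)
    fix a assume "a \<in> S"
    then obtain r where r: "r > 0" "cball a r \<subseteq> S" using S open_contains_cball by blast
    have "AE x in lebesgue. x \<in> cball a (r/2) \<longrightarrow> g x = 0"
      by (rule fundamental_lemma_ball[OF S g z]) (use r in auto)
    then have "AE x in lebesgue. x \<in> ball a (r/2) \<longrightarrow> g x = 0" by eventually_elim auto
    then show "\<exists>r>0. AE x in lebesgue. x \<in> ball a r \<longrightarrow> g x = 0" using r(1) by (intro exI[of _ "r/2"]) auto
  qed
  then show ?thesis using S by (subst AE_lebesgue_on_iff) auto
qed

section \<open>Weak gradients\<close>

lemma locally_integrable_mult_test: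
  assumes S: "open S" and g: "locally_integrable S (g :: 'a::euclidean_space \<Rightarrow> real)" and \<phi>: "\<phi> \<in> test_functions S"
  shows "integrable (lebesgue_on S) (\<lambda>x. g x * \<phi> x)"
proof -
  obtain K where K: "compact K" "K \<subseteq> S" "\<And>x. x \<notin> K \<Longrightarrow> \<phi> x = 0"
    by (rule test_functions_compact[OF \<phi>]) blast
  obtain B where B: "\<And>x. \<bar>\<phi> x\<bar> \<le> B" using test_functions_bounded[OF \<phi>] by blast
  have mK: "K \<in> sets lebesgue" and m: "S \<in> sets lebesgue" using K S by (auto simp: borel_compact)
  have "integrable (lebesgue_on K) g" using g K unfolding locally_integrable_def by auto
  then have "integrable (lebesgue_on K) (\<lambda>x. g x * B)" by auto
  then have I: "integrable (lebesgue_on K) (\<lambda>x. g x * \<phi> x)"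
  proof (rule Bochner_Integration.integrable_bound)
    show "AE x in lebesgue_on K. norm (g x * \<phi> x) \<le> norm (g x * B)"
      using B order_trans[OF abs_ge_zero B] by (intro AE_I2) (auto simp: abs_mult intro!: mult_left_mono)
    show "(\<lambda>x. g x * \<phi> x) \<in> borel_measurable (lebesgue_on K)"
      using \<open>integrable (lebesgue_on K) g\<close> borel_imp_lebesgue_on[OF test_functions_borel[OF \<phi>], of K] by auto
  qed
  then have "integrable lebesgue (\<lambda>x. if x \<in> K then g x * \<phi> x else 0)"
    using mK by (subst Lebesgue_Measure.integrable_restrict_UNIV)
  also have "(\<lambda>x. if x \<in> K then g x * \<phi> x else 0) = (\<lambda>x. if x \<in> S then g x * \<phi> x else 0)"
    by (intro ext) (use K in auto)
  finally show ?thesis using m by (subst (asm) Lebesgue_Measure.integrable_restrict_UNIV)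
qed

lemma locally_integrable_add:
  "locally_integrable S f \<Longrightarrow> locally_integrable S g \<Longrightarrow> locally_integrable S (\<lambda>x. f x + g x)"
  unfolding locally_integrable_def by auto

lemma locally_integrable_scaleR:
  "locally_integrable S f \<Longrightarrow> locally_integrable S (\<lambda>x. c *\<^sub>R f x)"
  unfolding locally_integrable_def by auto

lemma weak_gradientD:
  assumes "weak_gradient S u g"
  shows "locally_integrable S u" "locally_integrable S g"
    "\<And>\<phi> i. \<phi> \<in> test_functions S \<Longrightarrow> i \<in> Basis \<Longrightarrow>
      (\<integral>x. u x * pd i \<phi> x \<partial>lebesgue_on S) = - (\<integral>x. (g x \<bullet> i) * \<phi> x \<partial>lebesgue_on S)"
  using assms unfolding weak_gradient_def pd_def by blast+

lemma weak_gradientI: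
  assumes "locally_integrable S u" "locally_integrable S g"
    "\<And>\<phi> i. \<phi> \<in> test_functions S \<Longrightarrow> i \<in> Basis \<Longrightarrow>
      (\<integral>x. u x * pd i \<phi> x \<partial>lebesgue_on S) = - (\<integral>x. (g x \<bullet> i) * \<phi> x \<partial>lebesgue_on S)"
  shows "weak_gradient S u g"
  using assms unfolding weak_gradient_def pd_def by blast

lemma weak_gradient_add:
  fixes S :: "'a::euclidean_space set"
  assumes S: "open S" and u: "weak_gradient S u g" and v: "weak_gradient S v h"
  shows "weak_gradient S (\<lambda>x. u x + v x) (\<lambda>x. g x + h x)"
proof (rule weak_gradientI)
  fix \<phi> i assume \<phi>: "\<phi> \<in> test_functions S" and i: "i \<in> (Basis :: 'a set)"
  note I = locally_integrable_mult_test[OF S weak_gradientD(1)[OF u] test_functions_pd[OF \<phi> i]]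
    locally_integrable_mult_test[OF S weak_gradientD(1)[OF v] test_functions_pd[OF \<phi> i]]
    locally_integrable_mult_test[OF S locally_integrable_component[OF weak_gradientD(2)[OF u]] \<phi>, of i]
    locally_integrable_mult_test[OF S locally_integrable_component[OF weak_gradientD(2)[OF v]] \<phi>, of i]
  show "(\<integral>x. (u x + v x) * pd i \<phi> x \<partial>lebesgue_on S) = - (\<integral>x. ((g x + h x) \<bullet> i) * \<phi> x \<partial>lebesgue_on S)"
    using I weak_gradientD(3)[OF u \<phi> i] weak_gradientD(3)[OF v \<phi> i]
    by (simp add: inner_add_left distrib_right)
qed (use weak_gradientD(1,2)[OF u] weak_gradientD(1,2)[OF v] in \<open>auto intro: locally_integrable_add\<close>)

lemma weak_gradient_cmult:
  fixes S :: "'a::euclidean_space set"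
  assumes u: "weak_gradient S u g"
  shows "weak_gradient S (\<lambda>x. c * u x) (\<lambda>x. c *\<^sub>R g x)"
proof (rule weak_gradientI)
  fix \<phi> i assume \<phi>: "\<phi> \<in> test_functions S" and i: "i \<in> (Basis :: 'a set)"
  show "(\<integral>x. (c * u x) * pd i \<phi> x \<partial>lebesgue_on S) = - (\<integral>x. ((c *\<^sub>R g x) \<bullet> i) * \<phi> x \<partial>lebesgue_on S)"
    using weak_gradientD(3)[OF u \<phi> i] by (simp add: mult.assoc)
qed (use weak_gradientD(1,2)[OF u] locally_integrable_scaleR[of S u c] locally_integrable_scaleR[of S g c] in auto)

lemma weak_gradient_diff:
  fixes S :: "'a::euclidean_space set"
  assumes S: "open S" and u: "weak_gradient S u g" and v: "weak_gradient S v h"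
  shows "weak_gradient S (\<lambda>x. u x - v x) (\<lambda>x. g x - h x)"
  using weak_gradient_add[OF S u weak_gradient_cmult[OF v, of "-1"]] by simp

lemma weak_gradient_unique:
  fixes S :: "'a::euclidean_space set"
  assumes S: "open S" and g: "weak_gradient S u g" and h: "weak_gradient S u' h"
    and eq: "AE x in lebesgue_on S. u x = u' x"
  shows "AE x in lebesgue_on S. g x = h x"
proof -
  note d = weak_gradient_diff[OF S g h]
  have "AE x in lebesgue_on S. (g x - h x) \<bullet> i = 0" if i: "i \<in> Basis" for i
  proof (rule fundamental_lemma[OF S locally_integrable_component[OF weak_gradientD(2)[OF d]]])
    fix \<phi> assume \<phi>: "\<phi> \<in> test_functions S"
    have "(\<integral>x. (u x - u' x) * pd i \<phi> x \<partial>lebesgue_on S) = 0"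
      by (rule integral_eq_zero_AE) (use eq in eventually_elim, simp)
    then show "(\<integral>x. ((g x - h x) \<bullet> i) * \<phi> x \<partial>lebesgue_on S) = 0"
      using weak_gradientD(3)[OF d \<phi> i] by simp
  qed
  then have "AE x in lebesgue_on S. \<forall>i\<in>Basis. (g x - h x) \<bullet> i = 0"
    by (subst AE_ball_countable) (auto intro: countable_finite)
  then show ?thesis
  proof eventually_elim
    case (elim x)
    show ?case by (rule euclidean_eqI) (use elim in \<open>simp add: inner_diff_left\<close>)
  qed
qed

text \<open>By uniqueness the gradient chosen in the definition agrees almost everywhere with any known weak gradient;
  all computations with it go through this fact.\<close>

lemma grad_weak_gradient: "weak_gradient S u g \<Longrightarrow> weak_gradient S u (grad S u)"
  unfolding grad_def using someI[of "weak_gradient S u"] .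

lemma grad_AE_eq: "open S \<Longrightarrow> weak_gradient S u g \<Longrightarrow> AE x in lebesgue_on S. grad S u x = g x"
  by (rule weak_gradient_unique[OF _ grad_weak_gradient _ AE_I2[OF refl]])

lemma weak_gradient_restrict:
  fixes S :: "'a::euclidean_space set"
  assumes S: "open S" and u: "weak_gradient S u g" and sub: "S' \<subseteq> S" "open S'"
  shows "weak_gradient S' u g"
proof -
  have m: "S' \<in> sets lebesgue" "S \<in> sets lebesgue" using sub S by auto
  have li: "locally_integrable S' f" if "locally_integrable S f" for f :: "'a \<Rightarrow> 'b::euclidean_space"
    using that sub(1) unfolding locally_integrable_def
    by (auto intro: measurable_restrict_mono[of f lebesgue S])
  have int: "(\<integral>x. f x * \<psi> x \<partial>lebesgue_on S) = (\<integral>x. f x * \<psi> x \<partial>lebesgue_on S')"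
    if \<psi>: "\<psi> \<in> test_functions S'" for f \<psi> :: "'a \<Rightarrow> real"
  proof -
    obtain K where K: "K \<subseteq> S'" "\<And>x. x \<notin> K \<Longrightarrow> \<psi> x = 0" by (rule test_functions_compact[OF \<psi>]) blast
    have "(\<lambda>x. if x \<in> S then f x * \<psi> x else 0) = (\<lambda>x. if x \<in> S' then f x * \<psi> x else 0)"
      by (intro ext) (use K sub in auto)
    then show ?thesis
      by (simp only: Lebesgue_Measure.integral_restrict_UNIV[OF m(1), symmetric]
          Lebesgue_Measure.integral_restrict_UNIV[OF m(2), symmetric])
  qed
  show ?thesis
  proof (rule weak_gradientI)
    fix \<phi> i assume \<phi>: "\<phi> \<in> test_functions S'" and i: "i \<in> (Basis :: 'a set)"
    show "(\<integral>x. u x * pd i \<phi> x \<partial>lebesgue_on S') = - (\<integral>x. (g x \<bullet> i) * \<phi> x \<partial>lebesgue_on S')"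
      using weak_gradientD(3)[OF u test_functions_mono[OF sub(1) \<phi>] i] int[OF \<phi>, of "\<lambda>x. g x \<bullet> i"]
        int[OF test_functions_pd[OF \<phi> i], of u] by simp
  qed (use weak_gradientD(1,2)[OF u] li in auto)
qed

section \<open>The norm of square integrable functions\<close>

definition nrm :: "'a::euclidean_space set \<Rightarrow> ('a \<Rightarrow> 'b::euclidean_space) \<Rightarrow> real" where
  "nrm S f = sqrt (\<integral>x. (norm (f x))\<^sup>2 \<partial>lebesgue_on S)"

lemma nrm_nonneg [simp]: "nrm S f \<ge> 0"
  by (simp add: nrm_def integral_nonneg_AE)

lemma nrm_square: "(nrm S f)\<^sup>2 = (\<integral>x. (norm (f x))\<^sup>2 \<partial>lebesgue_on S)"
  by (simp add: nrm_def integral_nonneg_AE)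

lemma square_integrable_mult:
  fixes f g :: "'b \<Rightarrow> real"
  assumes [measurable]: "f \<in> borel_measurable M" "g \<in> borel_measurable M"
    and "integrable M (\<lambda>x. (f x)\<^sup>2)" "integrable M (\<lambda>x. (g x)\<^sup>2)"
  shows "integrable M (\<lambda>x. f x * g x)"
proof (rule Bochner_Integration.integrable_bound[where f = "\<lambda>x. (f x)\<^sup>2 + (g x)\<^sup>2"])
  have "\<bar>f x * g x\<bar> \<le> (f x)\<^sup>2 + (g x)\<^sup>2" for x
    using sum_squares_bound[of "\<bar>f x\<bar>" "\<bar>g x\<bar>"] mult_nonneg_nonneg[of "\<bar>f x\<bar>" "\<bar>g x\<bar>"]
    by (simp add: abs_mult del: mult_nonneg_nonneg)
  then show "AE x in M. norm (f x * g x) \<le> norm ((f x)\<^sup>2 + (g x)\<^sup>2)" by simp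
qed (use assms in auto)

lemma integral_mult_le:
  fixes f g :: "'b \<Rightarrow> real"
  assumes [measurable]: "f \<in> borel_measurable M" "g \<in> borel_measurable M"
    and I: "integrable M (\<lambda>x. (f x)\<^sup>2)" "integrable M (\<lambda>x. (g x)\<^sup>2)"
  shows "(\<integral>x. \<bar>f x * g x\<bar> \<partial>M) \<le> sqrt (\<integral>x. (f x)\<^sup>2 \<partial>M) * sqrt (\<integral>x. (g x)\<^sup>2 \<partial>M)"
proof -
  have "(\<integral>\<^sup>+x. ennreal \<bar>f x\<bar> * ennreal \<bar>g x\<bar> \<partial>M)\<^sup>2 \<le> (\<integral>\<^sup>+x. (ennreal \<bar>f x\<bar>)\<^sup>2 \<partial>M) * (\<integral>\<^sup>+x. (ennreal \<bar>g x\<bar>)\<^sup>2 \<partial>M)"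
    by (rule Cauchy_Schwarz_nn_integral) measurable
  moreover have "(\<integral>\<^sup>+x. ennreal \<bar>f x\<bar> * ennreal \<bar>g x\<bar> \<partial>M) = ennreal (\<integral>x. \<bar>f x * g x\<bar> \<partial>M)"
    using square_integrable_mult[OF assms]
    by (subst nn_integral_eq_integral[symmetric]) (auto simp: abs_mult[symmetric] ennreal_mult[symmetric])
  moreover have "(\<integral>\<^sup>+x. (ennreal \<bar>f x\<bar>)\<^sup>2 \<partial>M) = ennreal (\<integral>x. (f x)\<^sup>2 \<partial>M)"
    using I by (subst nn_integral_eq_integral[symmetric]) (auto simp: ennreal_power)
  moreover have "(\<integral>\<^sup>+x. (ennreal \<bar>g x\<bar>)\<^sup>2 \<partial>M) = ennreal (\<integral>x. (g x)\<^sup>2 \<partial>M)"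
    using I by (subst nn_integral_eq_integral[symmetric]) (auto simp: ennreal_power)
  ultimately have "ennreal ((\<integral>x. \<bar>f x * g x\<bar> \<partial>M)\<^sup>2) \<le> ennreal ((\<integral>x. (f x)\<^sup>2 \<partial>M) * (\<integral>x. (g x)\<^sup>2 \<partial>M))"
    by (simp add: ennreal_power ennreal_mult' integral_nonneg_AE)
  then have "(\<integral>x. \<bar>f x * g x\<bar> \<partial>M)\<^sup>2 \<le> (\<integral>x. (f x)\<^sup>2 \<partial>M) * (\<integral>x. (g x)\<^sup>2 \<partial>M)"
    by (subst (asm) ennreal_le_iff) (auto intro!: mult_nonneg_nonneg integral_nonneg_AE)
  then show ?thesis
    by (simp add: real_le_rsqrt real_sqrt_mult[symmetric])
qed

lemma L2_norm_integrable: "f \<in> L2 S \<Longrightarrow> integrable (lebesgue_on S) (\<lambda>x. (norm (f x))\<^sup>2)"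
  by (simp add: L2_def)

lemma L2_mult_bounded:
  fixes f :: "'a::euclidean_space \<Rightarrow> 'b::euclidean_space" and g :: "'a \<Rightarrow> 'c::euclidean_space"
  assumes f: "f \<in> L2 S" and g: "g \<in> borel_measurable (lebesgue_on S)"
    and le: "AE x in lebesgue_on S. norm (g x) \<le> C * norm (f x)" and C: "C \<ge> 0"
  shows "g \<in> L2 S" "nrm S g \<le> C * nrm S f"
proof -
  have le': "AE x in lebesgue_on S. (norm (g x))\<^sup>2 \<le> C\<^sup>2 * (norm (f x))\<^sup>2"
    using le by eventually_elim (metis norm_ge_zero power_mono power_mult_distrib)
  have I: "integrable (lebesgue_on S) (\<lambda>x. C\<^sup>2 * (norm (f x))\<^sup>2)" using L2_norm_integrable[OF f] by simp
  have I': "integrable (lebesgue_on S) (\<lambda>x. (norm (g x))\<^sup>2)"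
  proof (rule Bochner_Integration.integrable_bound[OF I])
    show "AE x in lebesgue_on S. norm ((norm (g x))\<^sup>2) \<le> norm (C\<^sup>2 * (norm (f x))\<^sup>2)"
      using le' by eventually_elim simp
  qed (use g in auto)
  then show "g \<in> L2 S" using g by (simp add: L2_def)
  have "(nrm S g)\<^sup>2 \<le> (C * nrm S f)\<^sup>2"
    unfolding nrm_square power_mult_distrib using integral_mono_AE[OF I' I le'] by simp
  then show "nrm S g \<le> C * nrm S f" by (rule power2_le_imp_le) (simp add: C)
qed

lemma L2_norm_fun: "f \<in> L2 S \<Longrightarrow> (\<lambda>x. norm (f x)) \<in> L2 S"
  by (auto simp: L2_def)

lemma nrm_cong_AE:
  assumes "f \<in> borel_measurable (lebesgue_on S)" "g \<in> borel_measurable (lebesgue_on S)"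
    "AE x in lebesgue_on S. f x = g x"
  shows "nrm S f = nrm S g"
proof -
  have "(\<integral>x. (norm (f x))\<^sup>2 \<partial>lebesgue_on S) = (\<integral>x. (norm (g x))\<^sup>2 \<partial>lebesgue_on S)"
  proof (rule integral_cong_AE)
    show "AE x in lebesgue_on S. (norm (f x))\<^sup>2 = (norm (g x))\<^sup>2"
      using assms(3) by eventually_elim simp
  qed (use assms in auto)
  then show ?thesis by (simp add: nrm_def)
qed

lemma L2_cong_AE:
  assumes "f \<in> L2 S" "g \<in> borel_measurable (lebesgue_on S)" "AE x in lebesgue_on S. f x = g x"
  shows "g \<in> L2 S"
proof (rule L2_mult_bounded(1)[OF assms(1,2), of 1])
  show "AE x in lebesgue_on S. norm (g x) \<le> 1 * norm (f x)"
    using assms(3) by eventually_elim simp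
qed simp

lemma L2_inner_integrable:
  assumes f: "f \<in> L2 S" and g: "g \<in> L2 S"
  shows "integrable (lebesgue_on S) (\<lambda>x. f x \<bullet> g x)"
    "\<bar>\<integral>x. f x \<bullet> g x \<partial>lebesgue_on S\<bar> \<le> nrm S f * nrm S g"
proof -
  have m: "f \<in> borel_measurable (lebesgue_on S)" "g \<in> borel_measurable (lebesgue_on S)"
    using f g by (auto simp: L2_def)
  have I: "integrable (lebesgue_on S) (\<lambda>x. norm (f x) * norm (g x))"
    using f g m by (intro square_integrable_mult) (auto simp: L2_def)
  show J: "integrable (lebesgue_on S) (\<lambda>x. f x \<bullet> g x)"
    by (rule Bochner_Integration.integrable_bound[OF I]) (use m in \<open>auto simp: Cauchy_Schwarz_ineq2\<close>)
  have "\<bar>\<integral>x. f x \<bullet> g x \<partial>lebesgue_on S\<bar> \<le> (\<integral>x. \<bar>norm (f x) * norm (g x)\<bar> \<partial>lebesgue_on S)"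
    using I by (intro abs_integral_le[OF J]) (auto simp: Cauchy_Schwarz_ineq2)
  also have "\<dots> \<le> nrm S f * nrm S g"
    unfolding nrm_def using f g m by (intro integral_mult_le) (auto simp: L2_def)
  finally show "\<bar>\<integral>x. f x \<bullet> g x \<partial>lebesgue_on S\<bar> \<le> nrm S f * nrm S g" .
qed

lemma L2_add:
  assumes f: "f \<in> L2 S" and g: "g \<in> L2 S"
  shows "(\<lambda>x. f x + g x) \<in> L2 S" "nrm S (\<lambda>x. f x + g x) \<le> nrm S f + nrm S g"
proof -
  have m: "f \<in> borel_measurable (lebesgue_on S)" "g \<in> borel_measurable (lebesgue_on S)"
    using f g by (auto simp: L2_def)
  have eq: "(norm (f x + g x))\<^sup>2 = (norm (f x))\<^sup>2 + 2 * (f x \<bullet> g x) + (norm (g x))\<^sup>2" for x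
    by (simp add: power2_norm_eq_inner inner_add_left inner_add_right inner_commute)
  have I: "integrable (lebesgue_on S) (\<lambda>x. (norm (f x + g x))\<^sup>2)"
    unfolding eq using L2_inner_integrable(1)[OF f g] f g by (auto simp: L2_def)
  then show "(\<lambda>x. f x + g x) \<in> L2 S" using m by (auto simp: L2_def)
  have "(nrm S (\<lambda>x. f x + g x))\<^sup>2 = (nrm S f)\<^sup>2 + 2 * (\<integral>x. f x \<bullet> g x \<partial>lebesgue_on S) + (nrm S g)\<^sup>2"
    unfolding nrm_square eq using L2_inner_integrable(1)[OF f g] f g by (simp add: L2_def)
  also have "\<dots> \<le> (nrm S f + nrm S g)\<^sup>2"
    using L2_inner_integrable(2)[OF f g] by (simp add: power2_sum)
  finally show "nrm S (\<lambda>x. f x + g x) \<le> nrm S f + nrm S g" by (rule power2_le_imp_le) auto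
qed

lemma L2_scaleR:
  assumes f: "f \<in> L2 S"
  shows "(\<lambda>x. c *\<^sub>R f x) \<in> L2 S" "nrm S (\<lambda>x. c *\<^sub>R f x) = \<bar>c\<bar> * nrm S f"
  using f by (auto simp: L2_def nrm_def power_mult_distrib real_sqrt_mult)

lemma L2_diff:
  assumes "f \<in> L2 S" "g \<in> L2 S"
  shows "(\<lambda>x. f x - g x) \<in> L2 S" "nrm S (\<lambda>x. f x - g x) \<le> nrm S f + nrm S g"
  using L2_add[OF assms(1) L2_scaleR(1)[OF assms(2), of "-1"]] L2_scaleR(2)[OF assms(2), of "-1"] by auto

lemma L2_bounded:
  fixes f :: "'a::euclidean_space \<Rightarrow> 'b::euclidean_space"
  assumes S: "open S" "bounded S" and f: "f \<in> borel_measurable (lebesgue_on S)"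
    and B: "AE x in lebesgue_on S. norm (f x) \<le> B"
  shows "f \<in> L2 S"
proof -
  have "finite_measure (lebesgue_on S)"
    using S by (intro finite_measure_lebesgue_on bounded_set_imp_lmeasurable) auto
  then have I: "integrable (lebesgue_on S) (\<lambda>x. B\<^sup>2)"
    by (rule finite_measure.integrable_const)
  have "AE x in lebesgue_on S. norm ((norm (f x))\<^sup>2) \<le> norm (B\<^sup>2)"
    using B by eventually_elim (auto intro: power_mono)
  then have "integrable (lebesgue_on S) (\<lambda>x. (norm (f x))\<^sup>2)"
    using f by (intro Bochner_Integration.integrable_bound[OF I]) auto
  then show ?thesis using f by (simp add: L2_def)
qed

lemma L2_imp_locally_integrable:
  fixes f :: "'a::euclidean_space \<Rightarrow> 'b::euclidean_space"
  assumes S: "open S" and f: "f \<in> L2 S" shows "locally_integrable S f"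
  unfolding locally_integrable_def
proof (intro conjI allI impI)
  show m: "f \<in> borel_measurable (lebesgue_on S)" using f by (simp add: L2_def)
  fix K assume K: "compact K \<and> K \<subseteq> S"
  have mK: "f \<in> borel_measurable (lebesgue_on K)"
    using m K by (metis borel_compact measurable_restrict_mono sets_completionI_sets sets_lborel)
  have "finite_measure (lebesgue_on K)" using K by (intro finite_measure_lebesgue_on lmeasurable_compact) auto
  then have 1: "integrable (lebesgue_on K) (\<lambda>x. 1 :: real)" by (rule finite_measure.integrable_const)
  have s: "S \<in> sets lebesgue" "K \<in> sets lebesgue" using S K by (auto simp: borel_compact)
  have "integrable lebesgue (\<lambda>x. if x \<in> S then (norm (f x))\<^sup>2 else 0)"
    using L2_norm_integrable[OF f] s by (subst Lebesgue_Measure.integrable_restrict_UNIV)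
  then have "integrable lebesgue (\<lambda>x. indicator K x *\<^sub>R (if x \<in> S then (norm (f x))\<^sup>2 else 0))"
    using s by (intro integrable_mult_indicator)
  also have "(\<lambda>x. indicator K x *\<^sub>R (if x \<in> S then (norm (f x))\<^sup>2 else 0)) = (\<lambda>x. if x \<in> K then (norm (f x))\<^sup>2 else 0)"
    using K by (intro ext) (auto simp: indicator_def)
  finally have 2: "integrable (lebesgue_on K) (\<lambda>x. (norm (f x))\<^sup>2)"
    using s by (subst (asm) Lebesgue_Measure.integrable_restrict_UNIV)
  have "norm (f x) \<le> 1 + (norm (f x))\<^sup>2" for x
    using sum_squares_bound[of "norm (f x)" 1] norm_ge_zero[of "f x"] by (simp del: norm_ge_zero)
  then show "integrable (lebesgue_on K) f"
    by (intro Bochner_Integration.integrable_bound[OF Bochner_Integration.integrable_add[OF 1 2]] mK) auto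
qed

lemma norm_square_component_sum: "(norm x)\<^sup>2 = (\<Sum>i\<in>Basis. (x \<bullet> i)\<^sup>2)"
  unfolding power2_norm_eq_inner euclidean_inner[of x x] by (simp add: power2_eq_square)

lemma L2_component_iff:
  "g \<in> L2 S \<longleftrightarrow> (\<forall>i\<in>Basis. (\<lambda>x. g x \<bullet> i) \<in> L2 S)"
proof
  assume "\<forall>i\<in>Basis. (\<lambda>x. g x \<bullet> i) \<in> L2 S"
  then have
    "integrable (lebesgue_on S) (\<lambda>x. \<Sum>i\<in>Basis. (g x \<bullet> i)\<^sup>2)" "g \<in> borel_measurable (lebesgue_on S)"
    by (auto simp: L2_def borel_measurable_euclidean_space[of g])
  then show "g \<in> L2 S"
    by (simp add: L2_def norm_square_component_sum)
next
  assume g: "g \<in> L2 S"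
  show "\<forall>i\<in>Basis. (\<lambda>x. g x \<bullet> i) \<in> L2 S"
  proof
    fix i assume i: "i \<in> (Basis :: 'b set)"
    show "(\<lambda>x. g x \<bullet> i) \<in> L2 S"
    proof (rule L2_mult_bounded(1)[OF g])
      show "(\<lambda>x. g x \<bullet> i) \<in> borel_measurable (lebesgue_on S)" using g by (auto simp: L2_def)
      show "AE x in lebesgue_on S. norm (g x \<bullet> i) \<le> 1 * norm (g x)" using i by (simp add: Basis_le_norm)
    qed simp
  qed
qed

lemma nrm_component_sum:
  assumes "g \<in> L2 S"
  shows "(nrm S g)\<^sup>2 = (\<Sum>i\<in>Basis. (nrm S (\<lambda>x. g x \<bullet> i))\<^sup>2)"
proof -
  have "integrable (lebesgue_on S) (\<lambda>x. (g x \<bullet> i)\<^sup>2)" if "i \<in> Basis" for i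
    using assms that by (subst (asm) L2_component_iff) (auto simp: L2_def)
  then show ?thesis
    by (simp add: nrm_square norm_square_component_sum[of "g _"])
qed

section \<open>Lipschitz functions\<close>

definition tgrad :: "('a::euclidean_space \<Rightarrow> real) \<Rightarrow> 'a \<Rightarrow> 'a" where
  "tgrad \<phi> x = (\<Sum>i\<in>Basis. pd i \<phi> x *\<^sub>R i)"

lemma tgrad_inner: "i \<in> Basis \<Longrightarrow> tgrad \<phi> x \<bullet> i = pd i \<phi> x"
  by (simp add: tgrad_def)

lemma inner_tgrad: "d \<bullet> tgrad \<phi> x = (\<Sum>i\<in>Basis. (d \<bullet> i) * pd i \<phi> x)"
  by (simp add: tgrad_def inner_sum_right mult.commute)

text \<open>The steps run through \<open>1 / (m + 1)\<close> so that the difference quotients form a sequence, as dominated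
  convergence requires.\<close>

definition diff_quot :: "'a::euclidean_space \<Rightarrow> ('a \<Rightarrow> real) \<Rightarrow> nat \<Rightarrow> 'a \<Rightarrow> real" where
  "diff_quot i q m x = (q (x + (1 / (real m + 1)) *\<^sub>R i) - q x) * (real m + 1)"

lemma diff_quot_test:
  assumes \<phi>: "\<phi> \<in> test_functions S" and i: "i \<in> Basis"
  shows "(\<lambda>m. diff_quot i \<phi> m x) \<longlonglongrightarrow> pd i \<phi> x"
    and "(\<lambda>m. - diff_quot (- i) \<phi> m x) \<longlonglongrightarrow> pd i \<phi> x"
proof -
  obtain M where M: "\<And>x d. \<bar>\<phi> (x + d) - \<phi> x - (\<Sum>i\<in>Basis. (d \<bullet> i) * pd i \<phi> x)\<bar> \<le> M * (norm d)\<^sup>2"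
    using test_functions_taylor[OF \<phi>] by blast
  have *: "\<bar>diff_quot (s *\<^sub>R i) \<phi> m x - s * pd i \<phi> x\<bar> \<le> M * (1 / (real m + 1))" if s: "\<bar>s\<bar> = 1" for m s
  proof -
    let ?h = "1 / (real m + 1)"
    have h: "?h > 0" by simp
    have "(\<Sum>j\<in>Basis. ((?h *\<^sub>R s *\<^sub>R i) \<bullet> j) * pd j \<phi> x) = ?h * s * pd i \<phi> x"
      using i by (simp add: inner_Basis if_distrib[of "\<lambda>z. _ * z"] if_distrib[of "\<lambda>z. z * _"] cong: if_cong)
    then have "\<bar>\<phi> (x + ?h *\<^sub>R s *\<^sub>R i) - \<phi> x - ?h * s * pd i \<phi> x\<bar> \<le> M * ?h\<^sup>2"
      using M[of x "?h *\<^sub>R s *\<^sub>R i"] i s by simp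
    then have "\<bar>\<phi> (x + ?h *\<^sub>R s *\<^sub>R i) - \<phi> x - ?h * s * pd i \<phi> x\<bar> * (real m + 1) \<le> M * ?h\<^sup>2 * (real m + 1)"
      by (rule mult_right_mono) simp
    moreover have "\<bar>\<phi> (x + ?h *\<^sub>R s *\<^sub>R i) - \<phi> x - ?h * s * pd i \<phi> x\<bar> * (real m + 1)
      = \<bar>(\<phi> (x + ?h *\<^sub>R s *\<^sub>R i) - \<phi> x - ?h * s * pd i \<phi> x) * (real m + 1)\<bar>"
      by (simp add: abs_mult)
    moreover have "(\<phi> (x + ?h *\<^sub>R s *\<^sub>R i) - \<phi> x - ?h * s * pd i \<phi> x) * (real m + 1) = diff_quot (s *\<^sub>R i) \<phi> m x - s * pd i \<phi> x"
      using h by (simp add: diff_quot_def left_diff_distrib)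
    moreover have "M * ?h\<^sup>2 * (real m + 1) = M * ?h" by (simp add: power2_eq_square)
    ultimately show ?thesis by simp
  qed
  have lim: "(\<lambda>m. M * (1 / (real m + 1))) \<longlonglongrightarrow> 0" by real_asymp
  have "(\<lambda>m. diff_quot (s *\<^sub>R i) \<phi> m x - s * pd i \<phi> x) \<longlonglongrightarrow> 0" if "\<bar>s\<bar> = 1" for s
    by (rule Lim_null_comparison[OF _ lim]) (use *[OF that] in auto)
  from this[of 1] tendsto_minus[OF this[of "-1"]]
  show "(\<lambda>m. diff_quot i \<phi> m x) \<longlonglongrightarrow> pd i \<phi> x" "(\<lambda>m. - diff_quot (- i) \<phi> m x) \<longlonglongrightarrow> pd i \<phi> x"
    by (auto simp: LIM_zero_iff dest: LIM_zero_cancel)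
qed

lemma diff_quot_bound:
  assumes "\<And>x d. \<bar>q (x + d) - q x\<bar> \<le> L * norm d" "norm i = 1"
  shows "\<bar>diff_quot i q m x\<bar> \<le> L"
proof -
  have "\<bar>q (x + (1 / (real m + 1)) *\<^sub>R i) - q x\<bar> * (real m + 1) \<le> (L * (1 / (real m + 1))) * (real m + 1)"
    using assms(1)[of x "(1 / (real m + 1)) *\<^sub>R i"] assms(2) by (intro mult_right_mono) auto
  then show ?thesis by (simp add: diff_quot_def abs_mult)
qed

text \<open>Difference quotients can be moved from one factor of an integral to the other by translation
  invariance; for Lipschitz functions dominated convergence then gives integration by parts.\<close>

lemma lipschitz_integration_by_parts:
  fixes q :: "'a::euclidean_space \<Rightarrow> real" and G :: "'a \<Rightarrow> real"
  assumes q: "cL2 q" and L: "\<And>x d. \<bar>q (x + d) - q x\<bar> \<le> L * norm d"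
    and [measurable]: "G \<in> borel_measurable borel"
    and i: "i \<in> Basis" and lim: "AE x in lborel. (\<lambda>m. diff_quot i q m x) \<longlonglongrightarrow> G x"
    and \<phi>: "\<phi> \<in> test_functions UNIV"
  shows "(\<integral>x. q x * pd i \<phi> x \<partial>lborel) = - (\<integral>x. G x * \<phi> x \<partial>lborel)"
proof -
  obtain L' where L': "\<And>x d. \<bar>\<phi> (x + d) - \<phi> x\<bar> \<le> L' * norm d" by (rule test_functions_lipschitz[OF \<phi>]) blast
  have [measurable]: "q \<in> borel_measurable borel" "\<phi> \<in> borel_measurable borel" "pd i \<phi> \<in> borel_measurable borel"
    using cL2_borel[OF q] test_functions_borel[OF \<phi>] test_functions_borel[OF test_functions_pd[OF \<phi> i]] by auto
  have [measurable]: "diff_quot j q m \<in> borel_measurable borel" "diff_quot j \<phi> m \<in> borel_measurable borel" for j m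
    unfolding diff_quot_def[abs_def] by measurable
  have swap: "(\<integral>x. q x * - diff_quot (- i) \<phi> m x \<partial>lborel) = - (\<integral>x. diff_quot i q m x * \<phi> x \<partial>lborel)" for m
  proof -
    let ?h = "1 / (real m + 1)"
    have I: "integrable lborel (\<lambda>x. q (x + a) * \<phi> (x + b))" for a b
    proof -
      have "cL2 (\<lambda>x. q (a + x))" "cL2 (\<lambda>x. \<phi> (b + x))"
        using cL2_shift[OF q] cL2_shift[OF test_functions_cL2[OF \<phi>]] by auto
      then show ?thesis by (intro square_integrable_mult) (auto simp: cL2_def add.commute)
    qed
    have "(\<integral>x. q x * \<phi> (x - ?h *\<^sub>R i) \<partial>lborel) = (\<integral>x. q (x + ?h *\<^sub>R i) * \<phi> x \<partial>lborel)"
      using integral_shift[of "\<lambda>x. q x * \<phi> (x - ?h *\<^sub>R i)" "?h *\<^sub>R i"] by simp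
    then have "(real m + 1) * ((\<integral>x. q x * \<phi> x \<partial>lborel) - (\<integral>x. q x * \<phi> (x - ?h *\<^sub>R i) \<partial>lborel))
       = - ((real m + 1) * ((\<integral>x. q (x + ?h *\<^sub>R i) * \<phi> x \<partial>lborel) - (\<integral>x. q x * \<phi> x \<partial>lborel)))"
      by (simp add: algebra_simps)
    also have "(\<integral>x. q x * \<phi> x \<partial>lborel) - (\<integral>x. q x * \<phi> (x - ?h *\<^sub>R i) \<partial>lborel) = (\<integral>x. q x * \<phi> x - q x * \<phi> (x - ?h *\<^sub>R i) \<partial>lborel)"
      using I[of 0 0] I[of 0 "- (?h *\<^sub>R i)"] by (subst Bochner_Integration.integral_diff) auto
    also have "(\<integral>x. q (x + ?h *\<^sub>R i) * \<phi> x \<partial>lborel) - (\<integral>x. q x * \<phi> x \<partial>lborel) = (\<integral>x. q (x + ?h *\<^sub>R i) * \<phi> x - q x * \<phi> x \<partial>lborel)"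
      using I[of 0 0] I[of "?h *\<^sub>R i" 0] by (subst Bochner_Integration.integral_diff) auto
    finally show ?thesis
      by (simp add: diff_quot_def left_diff_distrib right_diff_distrib mult_ac flip: integral_mult_right_zero)
  qed
  have A: "(\<lambda>m. \<integral>x. q x * - diff_quot (- i) \<phi> m x \<partial>lborel) \<longlonglongrightarrow> (\<integral>x. q x * pd i \<phi> x \<partial>lborel)"
  proof (rule integral_dominated_convergence[where w = "\<lambda>x. L' * \<bar>q x\<bar>"])
    show "AE x in lborel. (\<lambda>m. q x * - diff_quot (- i) \<phi> m x) \<longlonglongrightarrow> q x * pd i \<phi> x"
      using diff_quot_test(2)[OF \<phi> i] by (intro AE_I2 tendsto_mult_left)
    show "AE x in lborel. norm (q x * - diff_quot (- i) \<phi> m x) \<le> L' * \<bar>q x\<bar>" for m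
      using mult_right_mono[OF diff_quot_bound[OF L', of "- i" m], of "\<bar>q _\<bar>"] i by (intro AE_I2) (simp add: abs_mult mult.commute)
  qed (use cL2_integrable[OF q] in auto)
  have B: "(\<lambda>m. \<integral>x. diff_quot i q m x * \<phi> x \<partial>lborel) \<longlonglongrightarrow> (\<integral>x. G x * \<phi> x \<partial>lborel)"
  proof (rule integral_dominated_convergence[where w = "\<lambda>x. L * \<bar>\<phi> x\<bar>"])
    show "AE x in lborel. (\<lambda>m. diff_quot i q m x * \<phi> x) \<longlonglongrightarrow> G x * \<phi> x"
      using lim by eventually_elim (intro tendsto_mult_right)
    show "AE x in lborel. norm (diff_quot i q m x * \<phi> x) \<le> L * \<bar>\<phi> x\<bar>" for m
      using mult_right_mono[OF diff_quot_bound[OF L, of i m], of "\<bar>\<phi> _\<bar>"] i by (intro AE_I2) (simp add: abs_mult)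
  qed (use cL2_integrable[OF test_functions_cL2[OF \<phi>]] in auto)
  show ?thesis
    by (rule LIMSEQ_unique[OF A[unfolded swap] tendsto_minus[OF B]])
qed

text \<open>A Lipschitz function whose difference quotients converge almost everywhere has their limit as weak
  gradient. Both test functions and finite element functions fall under this; the limits
  are explicit in both cases, whereas for Lipschitz functions in general this is Rademacher's theorem.\<close>

lemma lipschitz_weak_gradient:
  fixes q :: "'a::euclidean_space \<Rightarrow> real"
  assumes S: "open S" "bounded S" and q: "cL2 q" and L: "\<And>x d. \<bar>q (x + d) - q x\<bar> \<le> L * norm d"
    and G: "\<And>i. i \<in> Basis \<Longrightarrow> (\<lambda>x. G x \<bullet> i) \<in> borel_measurable borel"
    and lim: "\<And>i. i \<in> Basis \<Longrightarrow> AE x in lborel. (\<lambda>m. diff_quot i q m x) \<longlonglongrightarrow> G x \<bullet> i"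
  shows "weak_gradient S q G" "q \<in> L2 S" "G \<in> L2 S"
proof -
  have mq: "q \<in> borel_measurable borel" using cL2_borel[OF q] .
  have "(\<lambda>x. G x \<bullet> i) \<in> L2 S" if i: "i \<in> Basis" for i
  proof (rule L2_bounded[OF S borel_imp_lebesgue_on[OF G[OF i]], of L])
    have "AE x in lborel. norm (G x \<bullet> i) \<le> L"
      using lim[OF i]
    proof eventually_elim
      case (elim x)
      show ?case
        by (rule Lim_bounded[OF tendsto_norm[OF elim], of 0]) (use diff_quot_bound[OF L] i in auto)
    qed
    then have "AE x in lebesgue. norm (G x \<bullet> i) \<le> L" by (rule AE_completion)
    then have "AE x in lebesgue. x \<in> S \<longrightarrow> norm (G x \<bullet> i) \<le> L" by eventually_elim simp
    then show "AE x in lebesgue_on S. norm (G x \<bullet> i) \<le> L"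
      using S by (subst AE_lebesgue_on_iff) auto
  qed
  then show GL2: "G \<in> L2 S" by (subst L2_component_iff) auto
  show qL2: "q \<in> L2 S"
  proof -
    have "integrable lebesgue (\<lambda>x. (q x)\<^sup>2)" using q by (auto simp: cL2_def integrable_completion)
    then have "integrable (lebesgue_on S) (\<lambda>x. (q x)\<^sup>2)"
      using S by (intro integrable_restrict_space[THEN iffD2] integrable_mult_indicator) auto
    then show ?thesis using borel_imp_lebesgue_on[OF mq] by (simp add: L2_def)
  qed
  show "weak_gradient S q G"
  proof (rule weak_gradientI)
    fix \<phi> and i :: 'a assume \<phi>: "\<phi> \<in> test_functions S" and i: "i \<in> Basis"
    have supp: "\<psi> x = 0" if "\<psi> \<in> test_functions S" "x \<notin> S" for \<psi> :: "'a \<Rightarrow> real" and x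
      by (rule test_functions_compact[OF that(1)]) (use that(2) in blast)
    have "(\<integral>x. q x * pd i \<phi> x \<partial>lborel) = - (\<integral>x. (G x \<bullet> i) * \<phi> x \<partial>lborel)"
      by (rule lipschitz_integration_by_parts[OF q L G[OF i] i lim[OF i] test_functions_mono[OF _ \<phi>]]) simp
    moreover have "(\<integral>x. q x * pd i \<phi> x \<partial>lebesgue_on S) = (\<integral>x. q x * pd i \<phi> x \<partial>lborel)"
      using mq test_functions_borel[OF test_functions_pd[OF \<phi> i]] supp[OF test_functions_pd[OF \<phi> i]]
      by (intro integral_lebesgue_on_eq_lborel[OF S(1)]) auto
    moreover have "(\<integral>x. (G x \<bullet> i) * \<phi> x \<partial>lebesgue_on S) = (\<integral>x. (G x \<bullet> i) * \<phi> x \<partial>lborel)"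
      using G[OF i] test_functions_borel[OF \<phi>] supp[OF \<phi>]
      by (intro integral_lebesgue_on_eq_lborel[OF S(1)]) auto
    ultimately show "(\<integral>x. q x * pd i \<phi> x \<partial>lebesgue_on S) = - (\<integral>x. (G x \<bullet> i) * \<phi> x \<partial>lebesgue_on S)" by simp
  qed (use L2_imp_locally_integrable[OF S(1)] qL2 GL2 in auto)
qed

lemma test_weak_gradient:
  assumes S: "open S" "bounded S" and \<phi>: "\<phi> \<in> test_functions UNIV"
  shows "weak_gradient S \<phi> (tgrad \<phi>)" "\<phi> \<in> L2 S" "tgrad \<phi> \<in> L2 S"
proof -
  obtain L where L: "\<And>x d. \<bar>\<phi> (x + d) - \<phi> x\<bar> \<le> L * norm d" by (rule test_functions_lipschitz[OF \<phi>]) blast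
  have G: "(\<lambda>x. tgrad \<phi> x \<bullet> i) \<in> borel_measurable borel" if "i \<in> Basis" for i
    using test_functions_borel[OF test_functions_pd[OF \<phi> that]] that by (simp add: tgrad_inner)
  have lim: "AE x in lborel. (\<lambda>m. diff_quot i \<phi> m x) \<longlonglongrightarrow> tgrad \<phi> x \<bullet> i" if "i \<in> Basis" for i
    using diff_quot_test(1)[OF \<phi> that] that by (simp add: tgrad_inner)
  show "weak_gradient S \<phi> (tgrad \<phi>)" "\<phi> \<in> L2 S" "tgrad \<phi> \<in> L2 S"
    using lipschitz_weak_gradient[OF S test_functions_cL2[OF \<phi>] L G lim] by auto
qed

section \<open>The Sobolev spaces\<close>

lemma H1D:
  assumes "open S" "u \<in> H1 S"
  shows "u \<in> L2 S" "weak_gradient S u (grad S u)" "grad S u \<in> L2 S"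
proof -
  obtain g where g: "g \<in> L2 S" "weak_gradient S u g" and u: "u \<in> L2 S"
    using assms(2) by (auto simp: H1_def)
  show "u \<in> L2 S" by (rule u)
  show w: "weak_gradient S u (grad S u)" by (rule grad_weak_gradient[OF g(2)])
  have "AE x in lebesgue_on S. g x = grad S u x"
    using grad_AE_eq[OF assms(1) g(2)] by eventually_elim simp
  then show "grad S u \<in> L2 S"
    using weak_gradientD(2)[OF w] by (intro L2_cong_AE[OF g(1)]) (simp_all add: locally_integrable_def)
qed

lemma H1I: "u \<in> L2 S \<Longrightarrow> g \<in> L2 S \<Longrightarrow> weak_gradient S u g \<Longrightarrow> u \<in> H1 S"
  by (auto simp: H1_def)

lemma nrm_grad:
  assumes "open S" "weak_gradient S u g"
  shows "nrm S (grad S u) = nrm S g"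
  using weak_gradientD(2)[OF assms(2)] weak_gradientD(2)[OF grad_weak_gradient[OF assms(2)]] grad_AE_eq[OF assms]
  by (intro nrm_cong_AE) (auto simp: locally_integrable_def)

lemma H1_norm_eq: "H1_norm S u = sqrt ((nrm S u)\<^sup>2 + (nrm S (grad S u))\<^sup>2)"
  by (simp add: H1_norm_def nrm_square)

lemma H1_norm_le: "H1_norm S u \<le> nrm S u + nrm S (grad S u)"
  unfolding H1_norm_eq by (rule sqrt_sum_squares_le_sum) auto

lemma nrm_le_H1_norm: "nrm S u \<le> H1_norm S u" "nrm S (grad S u) \<le> H1_norm S u"
  unfolding H1_norm_eq by (rule real_le_rsqrt, simp)+

lemma H1_add:
  assumes S: "open S" and u: "u \<in> H1 S" and v: "v \<in> H1 S"
  shows "(\<lambda>x. u x + v x) \<in> H1 S"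
    "weak_gradient S (\<lambda>x. u x + v x) (\<lambda>x. grad S u x + grad S v x)"
  using H1I[OF L2_add(1)[OF H1D(1)[OF S u] H1D(1)[OF S v]] L2_add(1)[OF H1D(3)[OF S u] H1D(3)[OF S v]]]
    weak_gradient_add[OF S H1D(2)[OF S u] H1D(2)[OF S v]] by auto

lemma H1_cmult:
  assumes S: "open S" and u: "u \<in> H1 S"
  shows "(\<lambda>x. c * u x) \<in> H1 S" "weak_gradient S (\<lambda>x. c * u x) (\<lambda>x. c *\<^sub>R grad S u x)"
  using H1I[OF _ L2_scaleR(1)[OF H1D(3)[OF S u], of c]] L2_scaleR(1)[OF H1D(1)[OF S u], of c]
    weak_gradient_cmult[OF H1D(2)[OF S u], of c] by auto

lemma H1_diff:
  assumes S: "open S" and u: "u \<in> H1 S" and v: "v \<in> H1 S"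
  shows "(\<lambda>x. u x - v x) \<in> H1 S"
    "weak_gradient S (\<lambda>x. u x - v x) (\<lambda>x. grad S u x - grad S v x)"
  using H1I[OF L2_diff(1)[OF H1D(1)[OF S u] H1D(1)[OF S v]] L2_diff(1)[OF H1D(3)[OF S u] H1D(3)[OF S v]]]
    weak_gradient_diff[OF S H1D(2)[OF S u] H1D(2)[OF S v]] by auto

lemma H1_norm_add_le:
  assumes S: "open S" and u: "u \<in> H1 S" and v: "v \<in> H1 S"
  shows "H1_norm S (\<lambda>x. u x + v x) \<le> 2 * H1_norm S u + 2 * H1_norm S v"
proof -
  have "H1_norm S (\<lambda>x. u x + v x) \<le> (nrm S u + nrm S v) + (nrm S (grad S u) + nrm S (grad S v))"
    using H1_norm_le[of S "\<lambda>x. u x + v x"] L2_add(2)[OF H1D(1)[OF S u] H1D(1)[OF S v]]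
      L2_add(2)[OF H1D(3)[OF S u] H1D(3)[OF S v]] nrm_grad[OF S H1_add(2)[OF assms]] by linarith
  then show ?thesis using nrm_le_H1_norm[of S u] nrm_le_H1_norm[of S v] by linarith
qed

lemma H10_iff:
  "u \<in> H10 S \<longleftrightarrow> u \<in> H1 S \<and> (\<forall>e>0. \<exists>\<phi>\<in>test_functions S. H1_norm S (\<lambda>x. u x - \<phi> x) < e)"
proof (intro iffI conjI allI impI)
  fix e :: real assume u: "u \<in> H10 S" and e: "e > 0"
  then obtain \<phi> :: "nat \<Rightarrow> 'a \<Rightarrow> real" where \<phi>: "\<And>k. \<phi> k \<in> test_functions S" "(\<lambda>k. H1_norm S (\<lambda>x. u x - \<phi> k x)) \<longlonglongrightarrow> 0"
    by (auto simp: H10_def)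
  from order_tendstoD(2)[OF \<phi>(2) e] obtain k where "H1_norm S (\<lambda>x. u x - \<phi> k x) < e"
    by (auto simp: eventually_sequentially)
  then show "\<exists>\<phi>\<in>test_functions S. H1_norm S (\<lambda>x. u x - \<phi> x) < e" using \<phi>(1) by blast
next
  assume u: "u \<in> H1 S \<and> (\<forall>e>0. \<exists>\<phi>\<in>test_functions S. H1_norm S (\<lambda>x. u x - \<phi> x) < e)"
  then have "\<exists>\<phi>\<in>test_functions S. H1_norm S (\<lambda>x. u x - \<phi> x) < 1 / (real k + 1)" for k :: nat by simp
  then obtain \<phi> where \<phi>: "\<And>k::nat. \<phi> k \<in> test_functions S" "\<And>k. H1_norm S (\<lambda>x. u x - \<phi> k x) < 1 / (real k + 1)" by metis
  have z: "(\<lambda>k. 1 / (real k + 1)) \<longlonglongrightarrow> 0" by real_asymp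
  have nn: "0 \<le> H1_norm S (\<lambda>x. u x - \<phi> k x)" for k
    using nrm_le_H1_norm(1)[of S "\<lambda>x. u x - \<phi> k x"] nrm_nonneg[of S "\<lambda>x. u x - \<phi> k x"] by linarith
  have "(\<lambda>k. H1_norm S (\<lambda>x. u x - \<phi> k x)) \<longlonglongrightarrow> 0"
    by (rule tendsto_sandwich[OF _ _ tendsto_const z]) (use \<phi>(2) nn in \<open>auto intro!: always_eventually less_imp_le\<close>)
  then show "u \<in> H10 S" using u \<phi>(1) by (auto simp: H10_def)
qed (auto simp: H10_def)

lemma H10_H1: "u \<in> H10 S \<Longrightarrow> u \<in> H1 S"
  by (simp add: H10_def)

lemma test_H1:
  assumes S: "open S" "bounded S" and \<phi>: "\<phi> \<in> test_functions S"
  shows "\<phi> \<in> H1 S" "weak_gradient S \<phi> (tgrad \<phi>)" "\<phi> \<in> L2 S" "tgrad \<phi> \<in> L2 S"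
  using test_weak_gradient[OF S test_functions_mono[OF _ \<phi>]] H1I by auto

lemma H10_limit:
  assumes S: "open S" "bounded S" and u: "u \<in> H1 S"
    and ap: "\<And>e. e > 0 \<Longrightarrow> \<exists>p\<in>H10 S. H1_norm S (\<lambda>x. u x - p x) < e"
  shows "u \<in> H10 S"
  unfolding H10_iff
proof (intro conjI allI impI u)
  fix e :: real assume e: "e > 0"
  obtain p where p: "p \<in> H10 S" "H1_norm S (\<lambda>x. u x - p x) < e / 4" using ap[of "e/4"] e by auto
  obtain \<phi> where \<phi>: "\<phi> \<in> test_functions S" "H1_norm S (\<lambda>x. p x - \<phi> x) < e / 4"
    using p(1) e unfolding H10_iff by (meson zero_less_divide_iff zero_less_numeral)
  have "H1_norm S (\<lambda>x. (u x - p x) + (p x - \<phi> x)) \<le> 2 * H1_norm S (\<lambda>x. u x - p x) + 2 * H1_norm S (\<lambda>x. p x - \<phi> x)"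
    by (rule H1_norm_add_le[OF S(1) H1_diff(1)[OF S(1) u H10_H1[OF p(1)]] H1_diff(1)[OF S(1) H10_H1[OF p(1)] test_H1(1)[OF S \<phi>(1)]]])
  then have "H1_norm S (\<lambda>x. u x - \<phi> x) < e" using p(2) \<phi>(2) by simp
  then show "\<exists>\<phi>\<in>test_functions S. H1_norm S (\<lambda>x. u x - \<phi> x) < e" using \<phi>(1) by blast
qed

lemma C_k_cmult: "C_k k f \<Longrightarrow> C_k k (\<lambda>x. c * f x)"
  by (intro C_k_mult C_k_const)

lemma test_functions_add:
  assumes "\<phi> \<in> test_functions S" "\<psi> \<in> test_functions S" shows "(\<lambda>x. \<phi> x + \<psi> x) \<in> test_functions S"
proof -
  obtain K where K: "compact K" "K \<subseteq> S" "\<And>x. x \<notin> K \<Longrightarrow> \<phi> x = 0" by (rule test_functions_compact[OF assms(1)]) blast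
  obtain K' where K': "compact K'" "K' \<subseteq> S" "\<And>x. x \<notin> K' \<Longrightarrow> \<psi> x = 0" by (rule test_functions_compact[OF assms(2)]) blast
  show ?thesis
  proof (rule test_functionsI[of _ "K \<union> K'"])
    show "C_k k (\<lambda>x. \<phi> x + \<psi> x)" for k by (rule C_k_add[OF test_functions_C_k test_functions_C_k]) (rule assms)+
  qed (use K K' in auto)
qed

lemma test_functions_mult:
  assumes "\<phi> \<in> test_functions S" "\<And>k. C_k k \<psi>" shows "(\<lambda>x. \<psi> x * \<phi> x) \<in> test_functions S"
proof -
  obtain K where K: "compact K" "K \<subseteq> S" "\<And>x. x \<notin> K \<Longrightarrow> \<phi> x = 0" by (rule test_functions_compact[OF assms(1)]) blast
  show ?thesis
  proof (rule test_functionsI[of _ K])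
    show "C_k k (\<lambda>x. \<psi> x * \<phi> x)" for k by (rule C_k_mult[OF assms(2) test_functions_C_k[OF assms(1)]])
  qed (use K in auto)
qed

lemma H10_add:
  assumes S: "open S" "bounded S" and u: "u \<in> H10 S" and v: "v \<in> H10 S"
  shows "(\<lambda>x. u x + v x) \<in> H10 S"
  unfolding H10_iff
proof (intro conjI allI impI H1_add(1)[OF S(1)] H10_H1 u v)
  fix e :: real assume e: "e > 0"
  obtain \<phi> where \<phi>: "\<phi> \<in> test_functions S" "H1_norm S (\<lambda>x. u x - \<phi> x) < e / 4"
    using u e unfolding H10_iff by (meson zero_less_divide_iff zero_less_numeral)
  obtain \<psi> where \<psi>: "\<psi> \<in> test_functions S" "H1_norm S (\<lambda>x. v x - \<psi> x) < e / 4"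
    using v e unfolding H10_iff by (meson zero_less_divide_iff zero_less_numeral)
  have "H1_norm S (\<lambda>x. (u x - \<phi> x) + (v x - \<psi> x)) \<le> 2 * H1_norm S (\<lambda>x. u x - \<phi> x) + 2 * H1_norm S (\<lambda>x. v x - \<psi> x)"
    by (rule H1_norm_add_le[OF S(1) H1_diff(1)[OF S(1) H10_H1[OF u] test_H1(1)[OF S \<phi>(1)]] H1_diff(1)[OF S(1) H10_H1[OF v] test_H1(1)[OF S \<psi>(1)]]])
  then have "H1_norm S (\<lambda>x. (u x + v x) - (\<phi> x + \<psi> x)) < e" using \<phi>(2) \<psi>(2) by (simp add: algebra_simps)
  then show "\<exists>\<phi>\<in>test_functions S. H1_norm S (\<lambda>x. (u x + v x) - \<phi> x) < e"
    using test_functions_add[OF \<phi>(1) \<psi>(1)] by (intro bexI[of _ "\<lambda>x. \<phi> x + \<psi> x"])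
qed

lemma H1_norm_cmult:
  assumes S: "open S" and u: "u \<in> H1 S"
  shows "H1_norm S (\<lambda>x. c * u x) = \<bar>c\<bar> * H1_norm S u"
proof -
  have "(nrm S (\<lambda>x. c * u x))\<^sup>2 + (nrm S (grad S (\<lambda>x. c * u x)))\<^sup>2 = c\<^sup>2 * ((nrm S u)\<^sup>2 + (nrm S (grad S u))\<^sup>2)"
    using L2_scaleR(2)[OF H1D(1)[OF S u], of c] L2_scaleR(2)[OF H1D(3)[OF S u], of c] nrm_grad[OF S H1_cmult(2)[OF S u, of c]]
    by (simp add: power_mult_distrib distrib_left)
  then show ?thesis by (simp add: H1_norm_eq real_sqrt_mult)
qed

lemma H10_cmult:
  assumes S: "open S" "bounded S" and u: "u \<in> H10 S"
  shows "(\<lambda>x. c * u x) \<in> H10 S"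
  unfolding H10_iff
proof (intro conjI allI impI H1_cmult(1)[OF S(1)] H10_H1 u)
  fix e :: real assume e: "e > 0"
  have "e / (\<bar>c\<bar> + 1) > 0" using e by simp
  then obtain \<phi> where \<phi>: "\<phi> \<in> test_functions S" "H1_norm S (\<lambda>x. u x - \<phi> x) < e / (\<bar>c\<bar> + 1)"
    using u unfolding H10_iff by meson
  have d: "(\<lambda>x. u x - \<phi> x) \<in> H1 S" by (rule H1_diff(1)[OF S(1) H10_H1[OF u] test_H1(1)[OF S \<phi>(1)]])
  have "\<bar>c\<bar> * H1_norm S (\<lambda>x. u x - \<phi> x) \<le> \<bar>c\<bar> * (e / (\<bar>c\<bar> + 1))" using \<phi>(2) by (intro mult_left_mono) auto
  also have "\<dots> < e" using e by (simp add: field_simps)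
  finally have "H1_norm S (\<lambda>x. c * u x - c * \<phi> x) < e"
    using H1_norm_cmult[OF S(1) d, of c] by (simp add: right_diff_distrib)
  moreover have "(\<lambda>x. c * \<phi> x) \<in> test_functions S" by (rule test_functions_mult[OF \<phi>(1) C_k_const])
  ultimately show "\<exists>\<phi>\<in>test_functions S. H1_norm S (\<lambda>x. c * u x - \<phi> x) < e"
    by (intro bexI[of _ "\<lambda>x. c * \<phi> x"])
qed

lemma H10_diff:
  assumes S: "open S" "bounded S" and u: "u \<in> H10 S" and v: "v \<in> H10 S"
  shows "(\<lambda>x. u x - v x) \<in> H10 S"
  using H10_add[OF S u H10_cmult[OF S v, of "-1"]] by simp

lemma test_H10:
  assumes S: "open S" "bounded S" and \<phi>: "\<phi> \<in> test_functions S"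
  shows "\<phi> \<in> H10 S"
proof (rule H10_iff[THEN iffD2], intro conjI allI impI test_H1(1)[OF S \<phi>])
  fix e :: real assume "e > 0"
  have "H1_norm S (\<lambda>x. \<phi> x - \<phi> x) = 0"
    using H1_norm_cmult[OF S(1) test_H1(1)[OF S \<phi>], of 0] by simp
  then show "\<exists>\<psi>\<in>test_functions S. H1_norm S (\<lambda>x. \<phi> x - \<psi> x) < e" using \<phi> \<open>e > 0\<close> by (intro bexI[of _ \<phi>]) auto
qed

lemma H10_approx:
  assumes S: "open S" "bounded S" and u: "u \<in> H10 S"
  obtains \<phi> where "\<And>k::nat. \<phi> k \<in> test_functions S"
    "(\<lambda>k. nrm S (\<lambda>x. u x - \<phi> k x)) \<longlonglongrightarrow> 0" "(\<lambda>k. nrm S (grad S (\<lambda>x. u x - \<phi> k x))) \<longlonglongrightarrow> 0"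
proof -
  obtain \<phi> :: "nat \<Rightarrow> 'a \<Rightarrow> real" where \<phi>: "\<And>k. \<phi> k \<in> test_functions S" "(\<lambda>k. H1_norm S (\<lambda>x. u x - \<phi> k x)) \<longlonglongrightarrow> 0"
    using u by (auto simp: H10_def)
  show ?thesis
    by (rule that[OF \<phi>(1)]; rule tendsto_sandwich[OF _ _ tendsto_const \<phi>(2)])
       (auto intro!: always_eventually nrm_le_H1_norm)
qed

section \<open>A strip estimate\<close>

text \<open>Integrating along segments of length \<open>s\<close> that leave \<open>S\<close> bounds \<open>u\<close> by its gradient. With \<open>s\<close> the
  diameter of \<open>S\<close> this is Poincare's inequality; for small \<open>s\<close> it says how fast \<open>u\<close> decays at the boundary.\<close>

lemma strip_estimate_test:
  fixes \<phi> :: "'a::euclidean_space \<Rightarrow> real"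
  assumes \<phi>: "\<phi> \<in> test_functions UNIV" and e: "norm e = 1" and s: "s > 0"
    and A[measurable]: "A \<in> sets borel" and z: "\<And>x. x \<in> A \<Longrightarrow> \<phi> (x - s *\<^sub>R e) = 0"
  shows "(\<integral>\<^sup>+x. ennreal ((\<phi> x)\<^sup>2) * indicator A x \<partial>lborel) \<le> ennreal (s\<^sup>2) * (\<integral>\<^sup>+x. ennreal ((norm (tgrad \<phi> x))\<^sup>2) \<partial>lborel)"
proof -
  define D where "D x = e \<bullet> tgrad \<phi> x" for x
  have tg[measurable]: "tgrad \<phi> \<in> borel_measurable borel"
    unfolding tgrad_def[abs_def] using test_functions_borel[OF test_functions_pd[OF \<phi>]]
    by (intro borel_measurable_sum borel_measurable_scaleR) auto
  have Dm[measurable]: "D \<in> borel_measurable borel" unfolding D_def by measurable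
  have Dc: "continuous_on T D" for T
    unfolding D_def inner_tgrad
    by (intro continuous_intros test_functions_continuous[OF test_functions_pd[OF \<phi>]])
  define w where "w t = indicator {0..s} t / s" for t
  have [measurable]: "w \<in> borel_measurable borel" unfolding w_def by measurable
  have w: "w t \<ge> 0" "(\<integral>\<^sup>+t. ennreal (w t) \<partial>lborel) = 1" for t
  proof -
    show "w t \<ge> 0" using s by (simp add: w_def indicator_def)
    have "(\<integral>\<^sup>+t. ennreal (w t) \<partial>lborel) = (\<integral>\<^sup>+t. ennreal (1/s) * indicator {0..s} t \<partial>lborel)"
      by (intro nn_integral_cong) (auto simp: w_def indicator_def)
    also have "\<dots> = 1" using s by (simp add: nn_integral_cmult ennreal_mult[symmetric])
    finally show "(\<integral>\<^sup>+t. ennreal (w t) \<partial>lborel) = 1" .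
  qed
  have "ennreal ((\<phi> x)\<^sup>2) * indicator A x \<le> (\<integral>\<^sup>+t. ennreal ((s * D (x - t *\<^sub>R e))\<^sup>2 * w t) \<partial>lborel)" for x
  proof (cases "x \<in> A")
    case True
    have der: "((\<lambda>t. - \<phi> (x - t *\<^sub>R e)) has_vector_derivative D (x - t *\<^sub>R e)) (at t within {0..s})" for t
    proof -
      have 1: "((\<lambda>t. x - t *\<^sub>R e) has_derivative (\<lambda>h. - (h *\<^sub>R e))) (at t)"
        by (auto intro!: derivative_eq_intros)
      have 2: "(\<phi> has_derivative (\<lambda>d. d \<bullet> tgrad \<phi> (x - t *\<^sub>R e))) (at ((\<lambda>t. x - t *\<^sub>R e) t))"
        using has_derivative_pd[OF test_functions_differentiable[OF \<phi>], of "x - t *\<^sub>R e"] by (simp add: inner_tgrad)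
      have "((\<lambda>t. \<phi> (x - t *\<^sub>R e)) has_derivative (\<lambda>h. - (h *\<^sub>R e) \<bullet> tgrad \<phi> (x - t *\<^sub>R e))) (at t)"
        using diff_chain_at[OF 1 2] by (simp add: o_def)
      note X = has_derivative_at_withinI[OF has_derivative_minus[OF this]]
      have "(\<lambda>h. - (- (h *\<^sub>R e) \<bullet> tgrad \<phi> (x - t *\<^sub>R e))) = (\<lambda>h. h *\<^sub>R D (x - t *\<^sub>R e))"
        by (simp add: D_def)
      with X[of "{0..s}"] show ?thesis unfolding has_vector_derivative_def by simp
    qed
    have "(\<integral>t. indicator {0..s} t *\<^sub>R D (x - t *\<^sub>R e) \<partial>lborel) = - \<phi> (x - s *\<^sub>R e) - (- \<phi> (x - 0 *\<^sub>R e))"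
      by (rule integral_FTC_Icc[OF less_imp_le[OF s]])
         (auto intro!: der continuous_on_compose2[OF Dc[of UNIV]] continuous_intros)
    then have "\<phi> x = (\<integral>t. s * D (x - t *\<^sub>R e) * w t \<partial>lborel)"
      using z[OF True] s by (simp add: w_def mult.commute)
    then have "ennreal ((\<phi> x)\<^sup>2) \<le> (\<integral>\<^sup>+t. ennreal ((s * D (x - t *\<^sub>R e))\<^sup>2 * w t) \<partial>lborel)"
      using jensen_square[of w lborel "\<lambda>t. s * D (x - t *\<^sub>R e)"] w by simp
    then show ?thesis using True by simp
  qed simp
  then have "(\<integral>\<^sup>+x. ennreal ((\<phi> x)\<^sup>2) * indicator A x \<partial>lborel)
     \<le> (\<integral>\<^sup>+x. \<integral>\<^sup>+t. ennreal ((s * D (x - t *\<^sub>R e))\<^sup>2 * w t) \<partial>lborel \<partial>lborel)"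
    by (rule nn_integral_mono)
  also have "\<dots> = (\<integral>\<^sup>+t. \<integral>\<^sup>+x. ennreal ((s * D (x - t *\<^sub>R e))\<^sup>2 * w t) \<partial>lborel \<partial>lborel)"
    by (rule lborel_pair.Fubini') measurable
  also have "\<dots> = (\<integral>\<^sup>+t. (ennreal (s\<^sup>2) * (\<integral>\<^sup>+x. ennreal ((D x)\<^sup>2) \<partial>lborel)) * ennreal (w t) \<partial>lborel)"
  proof (rule nn_integral_cong)
    fix t :: real
    have "(\<integral>\<^sup>+x. ennreal ((s * D (x - t *\<^sub>R e))\<^sup>2 * w t) \<partial>lborel)
      = (\<integral>\<^sup>+x. ennreal (s\<^sup>2) * ennreal ((D (x + - (t *\<^sub>R e)))\<^sup>2) * ennreal (w t) \<partial>lborel)"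
      using w by (simp add: power_mult_distrib ennreal_mult)
    also have "\<dots> = ennreal (s\<^sup>2) * (\<integral>\<^sup>+x. ennreal ((D (x + - (t *\<^sub>R e)))\<^sup>2) \<partial>lborel) * ennreal (w t)"
      by (subst nn_integral_multc, measurable, subst nn_integral_cmult, measurable)
    also have "(\<integral>\<^sup>+x. ennreal ((D (x + - (t *\<^sub>R e)))\<^sup>2) \<partial>lborel) = (\<integral>\<^sup>+x. ennreal ((D x)\<^sup>2) \<partial>lborel)"
      by (rule nn_integral_shift) measurable
    finally show "(\<integral>\<^sup>+x. ennreal ((s * D (x - t *\<^sub>R e))\<^sup>2 * w t) \<partial>lborel)
      = (ennreal (s\<^sup>2) * (\<integral>\<^sup>+x. ennreal ((D x)\<^sup>2) \<partial>lborel)) * ennreal (w t)" .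
  qed
  also have "\<dots> = ennreal (s\<^sup>2) * (\<integral>\<^sup>+x. ennreal ((D x)\<^sup>2) \<partial>lborel)"
    by (subst nn_integral_cmult) (simp_all add: w(2))
  also have "\<dots> \<le> ennreal (s\<^sup>2) * (\<integral>\<^sup>+x. ennreal ((norm (tgrad \<phi> x))\<^sup>2) \<partial>lborel)"
  proof (intro mult_left_mono nn_integral_mono ennreal_leI)
    fix x
    have "\<bar>D x\<bar> \<le> norm (tgrad \<phi> x)" using Cauchy_Schwarz_ineq2[of e "tgrad \<phi> x"] e by (simp add: D_def)
    then show "(D x)\<^sup>2 \<le> (norm (tgrad \<phi> x))\<^sup>2" by (metis abs_ge_zero power2_abs power_mono)
  qed simp
  finally show ?thesis .
qed

lemma nn_integral_nrm:
  assumes S: "open S" and f: "f \<in> L2 S" and b: "f \<in> borel_measurable borel" and z: "\<And>x. x \<notin> S \<Longrightarrow> f x = 0"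
  shows "(\<integral>\<^sup>+x. ennreal ((norm (f x))\<^sup>2) \<partial>lborel) = ennreal ((nrm S f)\<^sup>2)"
proof -
  have r: "rep S (\<lambda>x. (norm (f x))\<^sup>2) (\<lambda>x. (norm (f x))\<^sup>2)" using b z by (auto simp: rep_def)
  have m: "(\<lambda>x. (norm (f x))\<^sup>2) \<in> borel_measurable (lebesgue_on S)" using f by (auto simp: L2_def)
  show ?thesis
    using rep_integral[OF S m r] L2_norm_integrable[OF f] by (simp add: nrm_square nn_integral_eq_integral)
qed

text \<open>The estimate passes from test functions to \<open>H\<^sub>0\<^sup>1\<close> by density.\<close>

lemma strip_estimate:
  fixes S :: "'a::euclidean_space set"
  assumes S: "open S" "bounded S" and u: "u \<in> H10 S" and e: "norm e = 1" and s: "s > 0"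
    and A[measurable]: "A \<in> sets borel" and z: "\<And>x. x \<in> A \<Longrightarrow> x - s *\<^sub>R e \<notin> S"
  shows "(\<lambda>x. u x * indicator A x) \<in> L2 S" "nrm S (\<lambda>x. u x * indicator A x) \<le> s * nrm S (grad S u)"
proof -
  have Am: "indicator A \<in> borel_measurable (lebesgue_on S)" by (rule borel_imp_lebesgue_on) measurable
  have AL: "(\<lambda>x. f x * indicator A x) \<in> L2 S" "nrm S (\<lambda>x. f x * indicator A x) \<le> nrm S f" if "f \<in> L2 S" for f :: "'a \<Rightarrow> real"
  proof -
    have m: "(\<lambda>x. f x * indicator A x) \<in> borel_measurable (lebesgue_on S)"
      using L2_measurable[OF that] Am by (rule borel_measurable_times)
    have "AE x in lebesgue_on S. norm (f x * indicator A x) \<le> 1 * norm (f x)" by (rule AE_I2) (simp add: indicator_def)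
    from L2_mult_bounded[OF that m this]
    show "(\<lambda>x. f x * indicator A x) \<in> L2 S" "nrm S (\<lambda>x. f x * indicator A x) \<le> nrm S f" by simp_all
  qed
  note uL = H1D[OF S(1) H10_H1[OF u]]
  show "(\<lambda>x. u x * indicator A x) \<in> L2 S" by (rule AL(1)[OF uL(1)])
  have supp: "\<psi> x = 0" if "\<psi> \<in> test_functions S" "x \<notin> S" for \<psi> :: "'a \<Rightarrow> real" and x
    by (rule test_functions_compact[OF that(1)]) (use that(2) in blast)
  have test: "nrm S (\<lambda>x. \<phi> x * indicator A x) \<le> s * nrm S (tgrad \<phi>)" if \<phi>: "\<phi> \<in> test_functions S" for \<phi>
  proof -
    have \<phi>m: "\<phi> \<in> borel_measurable borel" by (rule test_functions_borel[OF \<phi>])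
    have "ennreal ((nrm S (\<lambda>x. \<phi> x * indicator A x))\<^sup>2) = (\<integral>\<^sup>+x. ennreal ((norm (\<phi> x * indicator A x))\<^sup>2) \<partial>lborel)"
      by (rule nn_integral_nrm[symmetric, OF S(1) AL(1)[OF test_H1(3)[OF S \<phi>]]]) (use \<phi>m supp[OF \<phi>] in auto)
    also have "\<dots> = (\<integral>\<^sup>+x. ennreal ((\<phi> x)\<^sup>2) * indicator A x \<partial>lborel)"
      by (intro nn_integral_cong) (auto simp: indicator_def)
    also have "\<dots> \<le> ennreal (s\<^sup>2) * (\<integral>\<^sup>+x. ennreal ((norm (tgrad \<phi> x))\<^sup>2) \<partial>lborel)"
      by (rule strip_estimate_test[OF test_functions_mono[OF _ \<phi>] e s A]) (use supp[OF \<phi> z] in auto)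
    also have "(\<integral>\<^sup>+x. ennreal ((norm (tgrad \<phi> x))\<^sup>2) \<partial>lborel) = ennreal ((nrm S (tgrad \<phi>))\<^sup>2)"
    proof (rule nn_integral_nrm[OF S(1) test_H1(4)[OF S \<phi>]])
      show "tgrad \<phi> \<in> borel_measurable borel"
        unfolding tgrad_def[abs_def] using test_functions_borel[OF test_functions_pd[OF \<phi>]]
        by (intro borel_measurable_sum borel_measurable_scaleR) auto
      show "tgrad \<phi> x = 0" if "x \<notin> S" for x
        unfolding tgrad_def using supp[OF test_functions_pd[OF \<phi>] that] by simp
    qed
    finally have "(nrm S (\<lambda>x. \<phi> x * indicator A x))\<^sup>2 \<le> (s * nrm S (tgrad \<phi>))\<^sup>2"
      by (simp add: ennreal_mult'[symmetric] power_mult_distrib ennreal_le_iff)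
    then show ?thesis by (rule power2_le_imp_le) (use s in simp)
  qed
  obtain \<phi> where \<phi>: "\<And>k::nat. \<phi> k \<in> test_functions S" "(\<lambda>k. nrm S (\<lambda>x. u x - \<phi> k x)) \<longlonglongrightarrow> 0"
    "(\<lambda>k. nrm S (grad S (\<lambda>x. u x - \<phi> k x))) \<longlonglongrightarrow> 0" by (rule H10_approx[OF S u]) blast
  have "nrm S (\<lambda>x. u x * indicator A x) \<le> nrm S (\<lambda>x. u x - \<phi> k x) + s * (nrm S (grad S u) + nrm S (grad S (\<lambda>x. u x - \<phi> k x)))" for k
  proof -
    note t = test_H1[OF S \<phi>(1)[of k]]
    note d = H1_diff[OF S(1) H10_H1[OF u] t(1)]
    have "nrm S (\<lambda>x. (u x - \<phi> k x) * indicator A x + \<phi> k x * indicator A x) \<le> nrm S (\<lambda>x. (u x - \<phi> k x) * indicator A x) + nrm S (\<lambda>x. \<phi> k x * indicator A x)"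
      by (rule L2_add(2)[OF AL(1)[OF H1D(1)[OF S(1) d(1)]] AL(1)[OF t(3)]])
    moreover have "(\<lambda>x. (u x - \<phi> k x) * indicator A x + \<phi> k x * indicator A x) = (\<lambda>x. u x * indicator A x)"
      by (auto simp: indicator_def)
    moreover have "nrm S (\<lambda>x. (u x - \<phi> k x) * indicator A x) \<le> nrm S (\<lambda>x. u x - \<phi> k x)"
      by (rule AL(2)[OF H1D(1)[OF S(1) d(1)]])
    moreover have "nrm S (\<lambda>x. \<phi> k x * indicator A x) \<le> s * nrm S (grad S (\<phi> k))"
      using test[OF \<phi>(1)] nrm_grad[OF S(1) t(2)] by simp
    moreover have "nrm S (grad S (\<phi> k)) \<le> nrm S (grad S u) + nrm S (grad S (\<lambda>x. u x - \<phi> k x))"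
    proof -
      note dd = weak_gradient_diff[OF S(1) uL(2) H1D(2)[OF S(1) d(1)]]
      have "nrm S (grad S (\<phi> k)) = nrm S (\<lambda>x. grad S u x - grad S (\<lambda>x. u x - \<phi> k x) x)"
        using nrm_grad[OF S(1) dd] by simp
      then show ?thesis using L2_diff(2)[OF uL(3) H1D(3)[OF S(1) d(1)]] by simp
    qed
    then have "s * nrm S (grad S (\<phi> k)) \<le> s * (nrm S (grad S u) + nrm S (grad S (\<lambda>x. u x - \<phi> k x)))"
      using s by (intro mult_left_mono) auto
    ultimately show ?thesis by simp
  qed
  moreover have "(\<lambda>k. nrm S (\<lambda>x. u x - \<phi> k x) + s * (nrm S (grad S u) + nrm S (grad S (\<lambda>x. u x - \<phi> k x)))) \<longlonglongrightarrow> 0 + s * (nrm S (grad S u) + 0)"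
    by (intro tendsto_intros \<phi>)
  ultimately show "nrm S (\<lambda>x. u x * indicator A x) \<le> s * nrm S (grad S u)"
    by (intro Lim_bounded2[where N = 0 and C = "nrm S (\<lambda>x. u x * indicator A x)"]) auto
qed

text \<open>If \<open>s\<close> exceeds the diameter, every translate of a point of \<open>S\<close> by \<open>s\<close> leaves \<open>S\<close>.\<close>

lemma poincare:
  fixes S :: "'a::euclidean_space set"
  assumes S: "open S" "bounded S"
  obtains C where "C > 0" "\<And>u. u \<in> H10 S \<Longrightarrow> nrm S u \<le> C * nrm S (grad S u)"
proof -
  obtain R where R: "\<And>x. x \<in> S \<Longrightarrow> norm x \<le> R" using S(2) by (auto simp: bounded_iff)
  define s where "s = 2 * \<bar>R\<bar> + 1"
  obtain e :: 'a where e: "e \<in> Basis" using nonempty_Basis by blast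
  have s: "s > 0" by (simp add: s_def)
  have "nrm S u \<le> s * nrm S (grad S u)" if u: "u \<in> H10 S" for u
  proof -
    have z: "x - s *\<^sub>R e \<notin> S" if "x \<in> S" for x
    proof
      assume "x - s *\<^sub>R e \<in> S"
      then have "norm (s *\<^sub>R e) \<le> R + R"
        using R[OF that] R norm_triangle_ineq4[of x "x - s *\<^sub>R e"] by fastforce
      then show False using e by (simp add: s_def)
    qed
    have "nrm S (\<lambda>x. u x * indicator S x) \<le> s * nrm S (grad S u)"
      by (rule strip_estimate(2)[OF S u _ s _ z]) (use e S in auto)
    moreover have "nrm S (\<lambda>x. u x * indicator S x) = nrm S u"
      unfolding nrm_def by (intro arg_cong[where f = sqrt] Bochner_Integration.integral_cong) auto
    ultimately show ?thesis by simp
  qed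
  with s show ?thesis by (rule that)
qed

section \<open>The bilinear form\<close>

lemma weighted_L2:
  fixes g :: "'a::euclidean_space \<Rightarrow> 'b::euclidean_space"
  assumes \<alpha>: "\<alpha> \<in> borel_measurable (lebesgue_on \<Omega>)" "\<And>x. x \<in> \<Omega> \<Longrightarrow> lo \<le> \<alpha> x \<and> \<alpha> x \<le> hi" and lo: "0 < lo"
    and g: "g \<in> L2 \<Omega>"
  shows "(\<lambda>x. sqrt (\<alpha> x) *\<^sub>R g x) \<in> L2 \<Omega>"
    "nrm \<Omega> (\<lambda>x. sqrt (\<alpha> x) *\<^sub>R g x) \<le> sqrt \<bar>hi\<bar> * nrm \<Omega> g"
    "nrm \<Omega> g \<le> 1 / sqrt lo * nrm \<Omega> (\<lambda>x. sqrt (\<alpha> x) *\<^sub>R g x)"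
    "(nrm \<Omega> (\<lambda>x. sqrt (\<alpha> x) *\<^sub>R g x))\<^sup>2 = (\<integral>x. \<alpha> x * (norm (g x))\<^sup>2 \<partial>lebesgue_on \<Omega>)"
proof -
  have gm: "g \<in> borel_measurable (lebesgue_on \<Omega>)" by (simp add: L2_measurable[OF g] g[unfolded L2_def, simplified])
  have m: "(\<lambda>x. sqrt (\<alpha> x) *\<^sub>R g x) \<in> borel_measurable (lebesgue_on \<Omega>)"
    using \<alpha>(1) gm by measurable
  have "AE x in lebesgue_on \<Omega>. norm (sqrt (\<alpha> x) *\<^sub>R g x) \<le> sqrt \<bar>hi\<bar> * norm (g x)"
  proof (rule AE_I2)
    fix x assume "x \<in> space (lebesgue_on \<Omega>)"
    then have "lo \<le> \<alpha> x \<and> \<alpha> x \<le> hi" using \<alpha>(2) by simp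
    then have "\<bar>sqrt (\<alpha> x)\<bar> \<le> sqrt \<bar>hi\<bar>" using lo by (simp add: real_sqrt_abs2)
    then show "norm (sqrt (\<alpha> x) *\<^sub>R g x) \<le> sqrt \<bar>hi\<bar> * norm (g x)"
      unfolding norm_scaleR by (rule mult_right_mono) simp
  qed
  from L2_mult_bounded[OF g m this]
  show L: "(\<lambda>x. sqrt (\<alpha> x) *\<^sub>R g x) \<in> L2 \<Omega>" and "nrm \<Omega> (\<lambda>x. sqrt (\<alpha> x) *\<^sub>R g x) \<le> sqrt \<bar>hi\<bar> * nrm \<Omega> g"
    by simp_all
  have "AE x in lebesgue_on \<Omega>. norm (g x) \<le> 1 / sqrt lo * norm (sqrt (\<alpha> x) *\<^sub>R g x)"
  proof (rule AE_I2)
    fix x assume "x \<in> space (lebesgue_on \<Omega>)"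
    then have "lo \<le> \<alpha> x \<and> \<alpha> x \<le> hi" using \<alpha>(2) by simp
    then have "sqrt lo \<le> \<bar>sqrt (\<alpha> x)\<bar>" using lo by simp
    then have "sqrt lo * norm (g x) \<le> \<bar>sqrt (\<alpha> x)\<bar> * norm (g x)" by (rule mult_right_mono) simp
    then show "norm (g x) \<le> 1 / sqrt lo * norm (sqrt (\<alpha> x) *\<^sub>R g x)" using lo by (simp add: field_simps)
  qed
  from L2_mult_bounded(2)[OF L gm this] lo
  show "nrm \<Omega> g \<le> 1 / sqrt lo * nrm \<Omega> (\<lambda>x. sqrt (\<alpha> x) *\<^sub>R g x)" by simp
  show "(nrm \<Omega> (\<lambda>x. sqrt (\<alpha> x) *\<^sub>R g x))\<^sup>2 = (\<integral>x. \<alpha> x * (norm (g x))\<^sup>2 \<partial>lebesgue_on \<Omega>)"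
    unfolding nrm_square
  proof (rule Bochner_Integration.integral_cong[OF refl])
    fix x assume "x \<in> space (lebesgue_on \<Omega>)"
    then have "lo \<le> \<alpha> x \<and> \<alpha> x \<le> hi" using \<alpha>(2) by simp
    then show "(norm (sqrt (\<alpha> x) *\<^sub>R g x))\<^sup>2 = \<alpha> x * (norm (g x))\<^sup>2" using lo by (simp add: power_mult_distrib)
  qed
qed

text \<open>Apart from its divergence, the advection velocity enters only through the bound on \<open>q v\<close> assumed here; it
  holds with the constant \<open>c_v\<close>, and for bounded \<open>v\<close> by Poincare's inequality.\<close>

locale advection_diffusion =
  fixes \<Omega> :: "'a::euclidean_space set" and \<alpha> :: "'a \<Rightarrow> real" and lo hi :: real and v :: "'a \<Rightarrow> 'a" and cv :: real
  assumes open_\<Omega>: "open \<Omega>" and bounded_\<Omega>: "bounded \<Omega>"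
    and \<alpha>_measurable: "\<alpha> \<in> borel_measurable (lebesgue_on \<Omega>)"
    and lo_pos: "0 < lo" and \<alpha>_bounds: "\<And>x. x \<in> \<Omega> \<Longrightarrow> lo \<le> \<alpha> x \<and> \<alpha> x \<le> hi"
    and v_measurable: "v \<in> borel_measurable (lebesgue_on \<Omega>)"
    and advection_L2: "\<And>q. q \<in> H10 \<Omega> \<Longrightarrow> (\<lambda>x. q x *\<^sub>R v x) \<in> L2 \<Omega>"
    and advection_bound: "\<And>q. q \<in> H10 \<Omega> \<Longrightarrow> nrm \<Omega> (\<lambda>x. q x *\<^sub>R v x) \<le> cv * nrm \<Omega> (grad \<Omega> q)"
    and cv_nonneg: "cv \<ge> 0"
begin

lemmas \<Omega> = open_\<Omega> bounded_\<Omega>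
lemmas weighted = weighted_L2[OF \<alpha>_measurable \<alpha>_bounds lo_pos]
lemmas H10D = H1D[OF open_\<Omega> H10_H1]

definition wgrad :: "('a \<Rightarrow> real) \<Rightarrow> 'a \<Rightarrow> 'a" where
  "wgrad q x = sqrt (\<alpha> x) *\<^sub>R grad \<Omega> q x"

definition transport :: "('a \<Rightarrow> real) \<Rightarrow> ('a \<Rightarrow> real) \<Rightarrow> real" where
  "transport p q = (\<integral>x. grad \<Omega> p x \<bullet> (q x *\<^sub>R v x) \<partial>lebesgue_on \<Omega>)"

definition diffusion :: "('a \<Rightarrow> real) \<Rightarrow> ('a \<Rightarrow> real) \<Rightarrow> real" where
  "diffusion p q = (\<integral>x. wgrad p x \<bullet> wgrad q x \<partial>lebesgue_on \<Omega>)"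

lemma wgrad_L2: "q \<in> H10 \<Omega> \<Longrightarrow> wgrad q \<in> L2 \<Omega>"
  unfolding wgrad_def[abs_def] by (rule weighted(1)) (auto intro: H10D(3))

lemma wgrad_nrm:
  assumes "q \<in> H10 \<Omega>"
  shows "nrm \<Omega> (wgrad q) \<le> sqrt \<bar>hi\<bar> * nrm \<Omega> (grad \<Omega> q)" "nrm \<Omega> (grad \<Omega> q) \<le> 1 / sqrt lo * nrm \<Omega> (wgrad q)"
    "(nrm \<Omega> (wgrad q))\<^sup>2 = (\<integral>x. \<alpha> x * (norm (grad \<Omega> q x))\<^sup>2 \<partial>lebesgue_on \<Omega>)"
  unfolding wgrad_def[abs_def] using weighted(2-4)[OF _ H10D(3)[OF assms]] by auto

lemma Y_norm_eq:
  assumes "q \<in> H10 \<Omega>" shows "Y_norm \<Omega> \<alpha> q = nrm \<Omega> (wgrad q)"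
  using real_sqrt_unique[OF wgrad_nrm(3)[OF assms] nrm_nonneg] by (simp add: Y_norm_def)

lemma grad_diff_AE:
  assumes p: "p \<in> H10 \<Omega>" and q: "q \<in> H10 \<Omega>"
  shows "AE x in lebesgue_on \<Omega>. grad \<Omega> (\<lambda>x. p x - q x) x = grad \<Omega> p x - grad \<Omega> q x"
  by (rule grad_AE_eq[OF open_\<Omega> H1_diff(2)[OF open_\<Omega> H10_H1[OF p] H10_H1[OF q]]])

lemma transport_bound:
  assumes "p \<in> H10 \<Omega>" "q \<in> H10 \<Omega>"
  shows "integrable (lebesgue_on \<Omega>) (\<lambda>x. grad \<Omega> p x \<bullet> (q x *\<^sub>R v x))"
    "\<bar>transport p q\<bar> \<le> nrm \<Omega> (grad \<Omega> p) * (cv * nrm \<Omega> (grad \<Omega> q))"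
proof -
  note i = L2_inner_integrable[OF H10D(3)[OF assms(1)] advection_L2[OF assms(2)]]
  show "integrable (lebesgue_on \<Omega>) (\<lambda>x. grad \<Omega> p x \<bullet> (q x *\<^sub>R v x))" by (rule i)
  show "\<bar>transport p q\<bar> \<le> nrm \<Omega> (grad \<Omega> p) * (cv * nrm \<Omega> (grad \<Omega> q))"
    using i(2) mult_left_mono[OF advection_bound[OF assms(2)] nrm_nonneg[of \<Omega> "grad \<Omega> p"]]
    unfolding transport_def by linarith
qed

lemma transport_diff:
  assumes p: "p \<in> H10 \<Omega>" "p' \<in> H10 \<Omega>" and q: "q \<in> H10 \<Omega>"
  shows "transport (\<lambda>x. p x - p' x) q = transport p q - transport p' q"
    "transport q (\<lambda>x. p x - p' x) = transport q p - transport q p'"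
proof -
  have d: "(\<lambda>x. p x - p' x) \<in> H10 \<Omega>" by (rule H10_diff[OF \<Omega> p])
  have "transport (\<lambda>x. p x - p' x) q = (\<integral>x. grad \<Omega> p x \<bullet> (q x *\<^sub>R v x) - grad \<Omega> p' x \<bullet> (q x *\<^sub>R v x) \<partial>lebesgue_on \<Omega>)"
    unfolding transport_def
  proof (rule integral_cong_AE)
    show "AE x in lebesgue_on \<Omega>. grad \<Omega> (\<lambda>x. p x - p' x) x \<bullet> (q x *\<^sub>R v x) = grad \<Omega> p x \<bullet> (q x *\<^sub>R v x) - grad \<Omega> p' x \<bullet> (q x *\<^sub>R v x)"
      using grad_diff_AE[OF p] by eventually_elim (simp add: inner_diff_left right_diff_distrib)
  qed (use transport_bound(1)[OF d q] transport_bound(1)[OF p(1) q] transport_bound(1)[OF p(2) q] in auto)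
  then show "transport (\<lambda>x. p x - p' x) q = transport p q - transport p' q"
    using transport_bound(1)[OF p(1) q] transport_bound(1)[OF p(2) q] by (simp add: transport_def)
  show "transport q (\<lambda>x. p x - p' x) = transport q p - transport q p'"
    using transport_bound(1)[OF q p(1)] transport_bound(1)[OF q p(2)]
    by (simp add: transport_def scaleR_diff_left inner_diff_right left_diff_distrib flip: Bochner_Integration.integral_diff)
qed

lemma diffusion_diff:
  assumes p: "p \<in> H10 \<Omega>" "p' \<in> H10 \<Omega>" and q: "q \<in> H10 \<Omega>"
  shows "diffusion (\<lambda>x. p x - p' x) q = diffusion p q - diffusion p' q"
proof -
  have d: "(\<lambda>x. p x - p' x) \<in> H10 \<Omega>" by (rule H10_diff[OF \<Omega> p])
  note I = L2_inner_integrable(1)[OF wgrad_L2 wgrad_L2[OF q]]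
  have "diffusion (\<lambda>x. p x - p' x) q = (\<integral>x. wgrad p x \<bullet> wgrad q x - wgrad p' x \<bullet> wgrad q x \<partial>lebesgue_on \<Omega>)"
    unfolding diffusion_def
  proof (rule integral_cong_AE)
    show "AE x in lebesgue_on \<Omega>. wgrad (\<lambda>x. p x - p' x) x \<bullet> wgrad q x = wgrad p x \<bullet> wgrad q x - wgrad p' x \<bullet> wgrad q x"
      using grad_diff_AE[OF p] by eventually_elim (simp add: wgrad_def scaleR_diff_right inner_diff_left right_diff_distrib)
  qed (use I[OF d] I[OF p(1)] I[OF p(2)] in auto)
  then show ?thesis using I[OF p(1)] I[OF p(2)] by (simp add: diffusion_def)
qed

text \<open>Test functions are dense and functionals in the dual are bounded by the energy norm. Hence the functional
  selected in the definition of the duality pairing does not matter.\<close>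

lemma Y_dual_unique:
  assumes F: "F \<in> Y_dual \<Omega> \<alpha>" and G: "G \<in> Y_dual \<Omega> \<alpha>"
    and eq: "\<And>\<phi>. \<phi> \<in> test_functions \<Omega> \<Longrightarrow> F \<phi> = G \<phi>" and q: "q \<in> H10 \<Omega>"
  shows "F q = G q"
proof -
  obtain \<phi> where \<phi>: "\<And>k::nat. \<phi> k \<in> test_functions \<Omega>" "(\<lambda>k. nrm \<Omega> (grad \<Omega> (\<lambda>x. q x - \<phi> k x))) \<longlonglongrightarrow> 0"
    by (rule H10_approx[OF \<Omega> q]) blast
  have lim: "(\<lambda>k. F (\<phi> k)) \<longlonglongrightarrow> F q" if F: "F \<in> Y_dual \<Omega> \<alpha>" for F
  proof -
    obtain C where add: "\<And>p q. p \<in> H10 \<Omega> \<Longrightarrow> q \<in> H10 \<Omega> \<Longrightarrow> F (\<lambda>x. p x + q x) = F p + F q"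
      and mult: "\<And>a q. q \<in> H10 \<Omega> \<Longrightarrow> F (\<lambda>x. a * q x) = a * F q"
      and C: "\<And>q. q \<in> H10 \<Omega> \<Longrightarrow> \<bar>F q\<bar> \<le> C * Y_norm \<Omega> \<alpha> q"
      using F unfolding Y_dual_def by blast
    have le: "norm (F (\<phi> k) - F q) \<le> \<bar>C\<bar> * (sqrt \<bar>hi\<bar> * nrm \<Omega> (grad \<Omega> (\<lambda>x. q x - \<phi> k x)))" for k
    proof -
      note t = test_H10[OF \<Omega> \<phi>(1)[of k]]
      have d: "(\<lambda>x. q x - \<phi> k x) \<in> H10 \<Omega>" by (rule H10_diff[OF \<Omega> q t])
      have "F (\<lambda>x. q x - \<phi> k x) = F q - F (\<phi> k)"
        using add[OF q H10_cmult[OF \<Omega> t, of "-1"]] mult[OF t, of "-1"] by simp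
      then have "norm (F (\<phi> k) - F q) \<le> C * nrm \<Omega> (wgrad (\<lambda>x. q x - \<phi> k x))"
        using C[OF d] Y_norm_eq[OF d] by simp
      also have "\<dots> \<le> \<bar>C\<bar> * nrm \<Omega> (wgrad (\<lambda>x. q x - \<phi> k x))" by (rule mult_right_mono) auto
      also have "\<dots> \<le> \<bar>C\<bar> * (sqrt \<bar>hi\<bar> * nrm \<Omega> (grad \<Omega> (\<lambda>x. q x - \<phi> k x)))"
        by (rule mult_left_mono[OF wgrad_nrm(1)[OF d]]) simp
      finally show ?thesis .
    qed
    have "(\<lambda>k. \<bar>C\<bar> * (sqrt \<bar>hi\<bar> * nrm \<Omega> (grad \<Omega> (\<lambda>x. q x - \<phi> k x)))) \<longlonglongrightarrow> \<bar>C\<bar> * (sqrt \<bar>hi\<bar> * 0)"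
      by (intro tendsto_intros \<phi>)
    then have "(\<lambda>k. \<bar>C\<bar> * (sqrt \<bar>hi\<bar> * nrm \<Omega> (grad \<Omega> (\<lambda>x. q x - \<phi> k x)))) \<longlonglongrightarrow> 0" by simp
    then have "(\<lambda>k. F (\<phi> k) - F q) \<longlonglongrightarrow> 0"
      by (rule Lim_null_comparison[rotated]) (use le in auto)
    then show ?thesis by (rule LIM_zero_cancel)
  qed
  have "(\<lambda>k. F (\<phi> k)) \<longlonglongrightarrow> G q" using lim[OF G] eq[OF \<phi>(1)] by simp
  with lim[OF F] show ?thesis by (rule LIMSEQ_unique)
qed

text \<open>For \<open>p \<in> H\<^sub>0\<^sup>1\<close> the bound on \<open>q v\<close> makes \<open>q \<mapsto> \<integral> v \<bullet> \<nabla>p q\<close> a bounded functional on all of \<open>H\<^sub>0\<^sup>1\<close>. By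
  uniqueness it is the duality pairing, so the bilinear form is given by integrals.\<close>

lemma b_form_eq:
  assumes p: "p \<in> H10 \<Omega>" and q: "q \<in> H10 \<Omega>"
  shows "b_form \<Omega> \<alpha> v p q = diffusion p q + transport p q"
proof -
  have "(\<integral>x. \<alpha> x * (grad \<Omega> p x \<bullet> grad \<Omega> q x) \<partial>lebesgue_on \<Omega>) = diffusion p q"
    unfolding diffusion_def wgrad_def
  proof (rule Bochner_Integration.integral_cong[OF refl])
    fix x assume "x \<in> space (lebesgue_on \<Omega>)"
    then have "\<alpha> x \<ge> 0" using \<alpha>_bounds[of x] lo_pos by simp
    then show "\<alpha> x * (grad \<Omega> p x \<bullet> grad \<Omega> q x) = (sqrt (\<alpha> x) *\<^sub>R grad \<Omega> p x) \<bullet> (sqrt (\<alpha> x) *\<^sub>R grad \<Omega> q x)"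
      by (simp add: mult.assoc[symmetric])
  qed
  moreover have "duality_pairing \<Omega> \<alpha> (\<lambda>x. v x \<bullet> grad \<Omega> p x) q = transport p q"
  proof -
    have eq: "(\<integral>x. (v x \<bullet> grad \<Omega> p x) * \<phi> x \<partial>lebesgue_on \<Omega>) = transport p \<phi>" for \<phi>
      unfolding transport_def by (intro Bochner_Integration.integral_cong) (simp_all add: inner_commute mult.commute)
    have D: "transport p \<in> Y_dual \<Omega> \<alpha>"
      unfolding Y_dual_def mem_Collect_eq
    proof (intro conjI ballI allI exI)
      fix r s assume rs: "r \<in> H10 \<Omega>" "s \<in> H10 \<Omega>"
      have "transport p (\<lambda>x. (r x + s x) - s x) = transport p (\<lambda>x. r x + s x) - transport p s"
        by (rule transport_diff(2)[OF H10_add[OF \<Omega> rs] rs(2) p])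
      then show "transport p (\<lambda>x. r x + s x) = transport p r + transport p s" by simp
    next
      fix a s
      show "transport p (\<lambda>x. a * s x) = a * transport p s" by (simp add: transport_def mult.assoc)
    next
      fix s assume s: "s \<in> H10 \<Omega>"
      have "\<bar>transport p s\<bar> \<le> nrm \<Omega> (grad \<Omega> p) * cv * nrm \<Omega> (grad \<Omega> s)" using transport_bound(2)[OF p s] by (simp add: mult.assoc)
      also have "\<dots> \<le> nrm \<Omega> (grad \<Omega> p) * cv * (1 / sqrt lo * nrm \<Omega> (wgrad s))"
        by (rule mult_left_mono[OF wgrad_nrm(2)[OF s]]) (simp add: cv_nonneg)
      finally show "\<bar>transport p s\<bar> \<le> (nrm \<Omega> (grad \<Omega> p) * cv * (1 / sqrt lo)) * Y_norm \<Omega> \<alpha> s"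
        by (simp add: Y_norm_eq[OF s] mult.assoc)
    qed
    then have E: "extends_pairing \<Omega> \<alpha> (\<lambda>x. v x \<bullet> grad \<Omega> p x) (transport p)"
      by (simp add: extends_pairing_def eq)
    then have "extends_pairing \<Omega> \<alpha> (\<lambda>x. v x \<bullet> grad \<Omega> p x) (SOME F. extends_pairing \<Omega> \<alpha> (\<lambda>x. v x \<bullet> grad \<Omega> p x) F)"
      by (rule someI[of "extends_pairing \<Omega> \<alpha> (\<lambda>x. v x \<bullet> grad \<Omega> p x)"])
    then show ?thesis
      unfolding duality_pairing_def using E by (intro Y_dual_unique[OF _ D _ q]) (auto simp: extends_pairing_def)
  qed
  ultimately show ?thesis by (simp add: b_form_def)
qed

text \<open>For test functions \<open>2 \<phi> v \<bullet> \<nabla>\<phi> = v \<bullet> \<nabla>(\<phi>\<^sup>2)\<close>, and \<open>\<phi>\<^sup>2\<close> is again a test function; density extends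
  the sign of the divergence to a sign of the transport term.\<close>

lemma transport_self_test:
  assumes d: "weak_divergence \<Omega> v d" and \<phi>: "\<phi> \<in> test_functions \<Omega>"
  shows "2 * transport \<phi> \<phi> = - (\<integral>x. d x * (\<phi> x)\<^sup>2 \<partial>lebesgue_on \<Omega>)"
proof -
  have sq: "(\<lambda>x. \<phi> x * \<phi> x) \<in> test_functions \<Omega>" by (rule test_functions_mult[OF \<phi> test_functions_C_k[OF \<phi>]])
  have df: "\<phi> differentiable at x" for x by (rule test_functions_differentiable[OF \<phi>])
  have fd: "frechet_derivative (\<lambda>x. \<phi> x * \<phi> x) (at x) (v x) = 2 * (tgrad \<phi> x \<bullet> (\<phi> x *\<^sub>R v x))" for x
  proof -
    have "((\<lambda>x. \<phi> x * \<phi> x) has_derivative (\<lambda>h. \<phi> x * (\<Sum>i\<in>Basis. (h \<bullet> i) * pd i \<phi> x) + (\<Sum>i\<in>Basis. (h \<bullet> i) * pd i \<phi> x) * \<phi> x)) (at x)"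
      by (rule has_derivative_mult[OF has_derivative_pd[OF df] has_derivative_pd[OF df]])
    from frechet_derivative_at[OF this, symmetric] show ?thesis
      by (simp add: inner_tgrad[symmetric] inner_commute)
  qed
  have "transport \<phi> \<phi> = (\<integral>x. tgrad \<phi> x \<bullet> (\<phi> x *\<^sub>R v x) \<partial>lebesgue_on \<Omega>)"
    unfolding transport_def
  proof (rule integral_cong_AE)
    show "AE x in lebesgue_on \<Omega>. grad \<Omega> \<phi> x \<bullet> (\<phi> x *\<^sub>R v x) = tgrad \<phi> x \<bullet> (\<phi> x *\<^sub>R v x)"
      using grad_AE_eq[OF open_\<Omega> test_H1(2)[OF \<Omega> \<phi>]] by eventually_elim simp
    show "(\<lambda>x. grad \<Omega> \<phi> x \<bullet> (\<phi> x *\<^sub>R v x)) \<in> borel_measurable (lebesgue_on \<Omega>)"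
      using transport_bound(1)[OF test_H10[OF \<Omega> \<phi>] test_H10[OF \<Omega> \<phi>]] by auto
    show "(\<lambda>x. tgrad \<phi> x \<bullet> (\<phi> x *\<^sub>R v x)) \<in> borel_measurable (lebesgue_on \<Omega>)"
      using L2_inner_integrable(1)[OF test_H1(4)[OF \<Omega> \<phi>] advection_L2[OF test_H10[OF \<Omega> \<phi>]]] by auto
  qed
  then have "2 * transport \<phi> \<phi> = (\<integral>x. frechet_derivative (\<lambda>x. \<phi> x * \<phi> x) (at x) (v x) \<partial>lebesgue_on \<Omega>)"
    unfolding fd by (simp del: inner_scaleR_right)
  also have "\<dots> = - (\<integral>x. d x * (\<phi> x)\<^sup>2 \<partial>lebesgue_on \<Omega>)"
    using d sq by (simp add: weak_divergence_def power2_eq_square)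
  finally show ?thesis .
qed

lemma transport_self_limit:
  assumes p: "p \<in> H10 \<Omega>"
  obtains \<phi> where "\<And>k::nat. \<phi> k \<in> test_functions \<Omega>" "(\<lambda>k. transport (\<phi> k) (\<phi> k)) \<longlonglongrightarrow> transport p p"
proof -
  obtain \<phi> where \<phi>: "\<And>k::nat. \<phi> k \<in> test_functions \<Omega>" "(\<lambda>k. nrm \<Omega> (grad \<Omega> (\<lambda>x. p x - \<phi> k x))) \<longlonglongrightarrow> 0"
    by (rule H10_approx[OF \<Omega> p]) blast
  let ?P = "nrm \<Omega> (grad \<Omega> p)" let ?d = "\<lambda>k. nrm \<Omega> (grad \<Omega> (\<lambda>x. p x - \<phi> k x))"
  have le: "norm (transport (\<phi> k) (\<phi> k) - transport p p) \<le> ?d k * (cv * ?P) + ?P * (cv * ?d k) + ?d k * (cv * ?d k)" for k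
  proof -
    note t = test_H10[OF \<Omega> \<phi>(1)[of k]]
    have d: "(\<lambda>x. p x - \<phi> k x) \<in> H10 \<Omega>" (is "?e \<in> _") by (rule H10_diff[OF \<Omega> p t])
    have "transport p p - transport (\<phi> k) (\<phi> k) = transport ?e p + transport p ?e - transport ?e ?e"
      using transport_diff[OF p t p] transport_diff[OF p t t] transport_diff(2)[OF p t d] by simp
    then show ?thesis
      using transport_bound(2)[OF d p] transport_bound(2)[OF p d] transport_bound(2)[OF d d]
      unfolding real_norm_def by linarith
  qed
  have "(\<lambda>k. ?d k * (cv * ?P) + ?P * (cv * ?d k) + ?d k * (cv * ?d k)) \<longlonglongrightarrow> 0 * (cv * ?P) + ?P * (cv * 0) + 0 * (cv * 0)"
    by (intro tendsto_intros \<phi>)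
  then have "(\<lambda>k. ?d k * (cv * ?P) + ?P * (cv * ?d k) + ?d k * (cv * ?d k)) \<longlonglongrightarrow> 0" by simp
  then have "(\<lambda>k. transport (\<phi> k) (\<phi> k) - transport p p) \<longlonglongrightarrow> 0"
    by (rule Lim_null_comparison[rotated]) (use le in auto)
  then have "(\<lambda>k. transport (\<phi> k) (\<phi> k)) \<longlonglongrightarrow> transport p p" by (rule LIM_zero_cancel)
  with \<phi>(1) show ?thesis by (rule that)
qed

lemma transport_self_nonneg:
  assumes d: "weak_divergence \<Omega> v d" "AE x in lebesgue_on \<Omega>. d x \<le> 0" and p: "p \<in> H10 \<Omega>"
  shows "transport p p \<ge> 0"
proof -
  obtain \<phi> where \<phi>: "\<And>k::nat. \<phi> k \<in> test_functions \<Omega>" "(\<lambda>k. transport (\<phi> k) (\<phi> k)) \<longlonglongrightarrow> transport p p"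
    by (rule transport_self_limit[OF p]) blast
  have "transport (\<phi> k) (\<phi> k) \<ge> 0" for k
  proof -
    have "AE x in lebesgue_on \<Omega>. 0 \<le> - (d x * (\<phi> k x)\<^sup>2)"
      using d(2) by eventually_elim (simp add: mult_nonpos_nonneg)
    then have "0 \<le> (\<integral>x. - (d x * (\<phi> k x)\<^sup>2) \<partial>lebesgue_on \<Omega>)" by (rule integral_nonneg_AE)
    then show ?thesis using transport_self_test[OF d(1) \<phi>(1)[of k]] by simp
  qed
  then show ?thesis by (intro LIMSEQ_le_const[OF \<phi>(2)]) auto
qed

text \<open>Polarization of the vanishing quadratic form.\<close>

lemma transport_antisym:
  assumes d: "weak_divergence \<Omega> v d" "AE x in lebesgue_on \<Omega>. d x = 0" and p: "p \<in> H10 \<Omega>" and q: "q \<in> H10 \<Omega>"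
  shows "transport p q = - transport q p"
proof -
  have self: "transport p p = 0" if p: "p \<in> H10 \<Omega>" for p
  proof -
    obtain \<phi> where \<phi>: "\<And>k::nat. \<phi> k \<in> test_functions \<Omega>" "(\<lambda>k. transport (\<phi> k) (\<phi> k)) \<longlonglongrightarrow> transport p p"
      by (rule transport_self_limit[OF p]) blast
    have "transport (\<phi> k) (\<phi> k) = 0" for k
    proof -
      have "(\<integral>x. d x * (\<phi> k x)\<^sup>2 \<partial>lebesgue_on \<Omega>) = 0"
        by (rule integral_eq_zero_AE) (use d(2) in eventually_elim, simp)
      then show ?thesis using transport_self_test[OF d(1) \<phi>(1)[of k]] by simp
    qed
    then show ?thesis using \<phi>(2) by (simp add: LIMSEQ_const_iff)
  qed
  have e: "(\<lambda>x. p x - q x) \<in> H10 \<Omega>" by (rule H10_diff[OF \<Omega> p q])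
  show ?thesis
    using self[OF e] self[OF p] self[OF q] transport_diff(1)[OF p q e] transport_diff(2)[OF p q p]
      transport_diff(2)[OF p q q] by simp
qed

text \<open>Galerkin orthogonality tested with the discrete part \<open>w = I - u\<^sub>H\<close> of the error, for an arbitrary discrete
  function \<open>I\<close>, which will be the interpolant.\<close>

lemma galerkin_orthogonality:
  assumes u: "u \<in> H10 \<Omega>" "uH \<in> H10 \<Omega>" "I \<in> H10 \<Omega>"
    and G: "b_form \<Omega> \<alpha> v u (\<lambda>x. I x - uH x) = b_form \<Omega> \<alpha> v uH (\<lambda>x. I x - uH x)"
    and pos: "transport (\<lambda>x. I x - uH x) (\<lambda>x. I x - uH x) \<ge> 0"
    and b: "\<bar>transport (\<lambda>x. u x - I x) (\<lambda>x. I x - uH x)\<bar> \<le> B * nrm \<Omega> (wgrad (\<lambda>x. I x - uH x))" and B: "B \<ge> 0"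
  shows "(Y_norm \<Omega> \<alpha> (\<lambda>x. u x - uH x))\<^sup>2 \<le> 8 * (nrm \<Omega> (wgrad (\<lambda>x. u x - I x)))\<^sup>2 + 2 * B\<^sup>2"
proof -
  let ?w = "\<lambda>x. I x - uH x" let ?\<eta> = "\<lambda>x. u x - I x"
  have w: "?w \<in> H10 \<Omega>" and \<eta>: "?\<eta> \<in> H10 \<Omega>" and e: "(\<lambda>x. u x - uH x) \<in> H10 \<Omega>"
    using H10_diff[OF \<Omega>] u by auto
  let ?W = "nrm \<Omega> (wgrad ?w)" let ?E = "nrm \<Omega> (wgrad ?\<eta>)"
  have WW: "diffusion ?w ?w = ?W\<^sup>2" by (simp add: diffusion_def nrm_square power2_norm_eq_inner)
  have "diffusion ?\<eta> ?w + diffusion ?w ?w + transport ?\<eta> ?w + transport ?w ?w = 0"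
    using G b_form_eq[OF u(1) w] b_form_eq[OF u(2) w] diffusion_diff[OF u(1,3) w] diffusion_diff[OF u(3,2) w]
      transport_diff(1)[OF u(1,3) w] transport_diff(1)[OF u(3,2) w] by simp
  moreover have "\<bar>diffusion ?\<eta> ?w\<bar> \<le> ?E * ?W"
    unfolding diffusion_def by (rule L2_inner_integrable(2)[OF wgrad_L2[OF \<eta>] wgrad_L2[OF w]])
  \<comment> \<open>the form is coercive on \<open>w\<close>, so the discrete error is controlled by the interpolation error\<close>
  ultimately have "?W * ?W \<le> (?E + B) * ?W" using pos b WW by (simp add: power2_eq_square distrib_right)
  then have W: "?W \<le> ?E + B"
    using B nrm_nonneg[of \<Omega> "wgrad ?\<eta>"] nrm_nonneg[of \<Omega> "wgrad ?w"]
    by (cases "?W = 0") (auto simp: mult_le_cancel_right)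
  have "nrm \<Omega> (wgrad (\<lambda>x. u x - uH x)) \<le> ?E + ?W"
  proof -
    have "nrm \<Omega> (wgrad (\<lambda>x. u x - uH x)) = nrm \<Omega> (\<lambda>x. wgrad ?\<eta> x + wgrad ?w x)"
    proof (rule nrm_cong_AE)
      show "AE x in lebesgue_on \<Omega>. wgrad (\<lambda>x. u x - uH x) x = wgrad ?\<eta> x + wgrad ?w x"
        using grad_diff_AE[OF u(1,2)] grad_diff_AE[OF u(1,3)] grad_diff_AE[OF u(3,2)]
        by eventually_elim (simp add: wgrad_def scaleR_diff_right)
    qed (use wgrad_L2[OF e] L2_add(1)[OF wgrad_L2[OF \<eta>] wgrad_L2[OF w]] in \<open>auto simp: L2_def\<close>)
    then show ?thesis using L2_add(2)[OF wgrad_L2[OF \<eta>] wgrad_L2[OF w]] by simp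
  qed
  then have "Y_norm \<Omega> \<alpha> (\<lambda>x. u x - uH x) \<le> 2 * ?E + B" using W Y_norm_eq[OF e] by simp
  then have "(Y_norm \<Omega> \<alpha> (\<lambda>x. u x - uH x))\<^sup>2 \<le> (2 * ?E + B)\<^sup>2" by (rule power_mono) (simp add: Y_norm_eq[OF e])
  also have "\<dots> \<le> 8 * ?E\<^sup>2 + 2 * B\<^sup>2"
    using zero_le_power2[of "2 * ?E - B"] by (simp add: power2_eq_square algebra_simps)
  finally show ?thesis .
qed

text \<open>Here the advection term keeps the gradient on the interpolation error, and the discrete error is handled
  by the bound on \<open>q v\<close>.\<close>

lemma error_estimate_bounded_multiplier:
  assumes u: "u \<in> H10 \<Omega>" "uH \<in> H10 \<Omega>" "I \<in> H10 \<Omega>"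
    and G: "b_form \<Omega> \<alpha> v u (\<lambda>x. I x - uH x) = b_form \<Omega> \<alpha> v uH (\<lambda>x. I x - uH x)"
    and d: "weak_divergence \<Omega> v d" "AE x in lebesgue_on \<Omega>. d x \<le> 0"
  shows "(Y_norm \<Omega> \<alpha> (\<lambda>x. u x - uH x))\<^sup>2
    \<le> 8 * (nrm \<Omega> (wgrad (\<lambda>x. u x - I x)))\<^sup>2 + 2 * (cv\<^sup>2 / lo * (nrm \<Omega> (grad \<Omega> (\<lambda>x. u x - I x)))\<^sup>2)"
proof -
  have w: "(\<lambda>x. I x - uH x) \<in> H10 \<Omega>" (is "?w \<in> _") and \<eta>: "(\<lambda>x. u x - I x) \<in> H10 \<Omega>" (is "?\<eta> \<in> _")
    using H10_diff[OF \<Omega>] u by auto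
  define B where "B = nrm \<Omega> (grad \<Omega> ?\<eta>) * cv * (1 / sqrt lo)"
  have "\<bar>transport ?\<eta> ?w\<bar> \<le> nrm \<Omega> (grad \<Omega> ?\<eta>) * cv * nrm \<Omega> (grad \<Omega> ?w)"
    using transport_bound(2)[OF \<eta> w] by (simp add: mult.assoc)
  also have "\<dots> \<le> nrm \<Omega> (grad \<Omega> ?\<eta>) * cv * (1 / sqrt lo * nrm \<Omega> (wgrad ?w))"
    by (rule mult_left_mono[OF wgrad_nrm(2)[OF w]]) (simp add: cv_nonneg)
  finally have b: "\<bar>transport ?\<eta> ?w\<bar> \<le> B * nrm \<Omega> (wgrad ?w)" by (simp add: B_def)
  have "B\<^sup>2 = cv\<^sup>2 / lo * (nrm \<Omega> (grad \<Omega> ?\<eta>))\<^sup>2"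
    using lo_pos by (simp add: B_def power_mult_distrib power_divide)
  moreover have "B \<ge> 0" using lo_pos cv_nonneg by (simp add: B_def)
  ultimately show ?thesis
    using galerkin_orthogonality[OF u G transport_self_nonneg[OF d w] b] by (simp only:)
qed

text \<open>Antisymmetry moves the derivative from the interpolation error \<open>\<eta>\<close> to the discrete error \<open>w\<close>. The
  advection term is then bounded by \<open>\<eta>\<close> itself, which is of one order higher than its gradient.\<close>

lemma error_estimate_solenoidal:
  assumes u: "u \<in> H10 \<Omega>" "uH \<in> H10 \<Omega>" "I \<in> H10 \<Omega>"
    and G: "b_form \<Omega> \<alpha> v u (\<lambda>x. I x - uH x) = b_form \<Omega> \<alpha> v uH (\<lambda>x. I x - uH x)"
    and d: "weak_divergence \<Omega> v d" "AE x in lebesgue_on \<Omega>. d x = 0"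
  shows "(Y_norm \<Omega> \<alpha> (\<lambda>x. u x - uH x))\<^sup>2
    \<le> 8 * (nrm \<Omega> (wgrad (\<lambda>x. u x - I x)))\<^sup>2 + 2 * (nrm \<Omega> (\<lambda>x. ((u x - I x) / sqrt (\<alpha> x)) *\<^sub>R v x))\<^sup>2"
proof -
  have w: "(\<lambda>x. I x - uH x) \<in> H10 \<Omega>" (is "?w \<in> _") and \<eta>: "(\<lambda>x. u x - I x) \<in> H10 \<Omega>" (is "?\<eta> \<in> _")
    using H10_diff[OF \<Omega>] u by auto
  let ?z = "\<lambda>x. (?\<eta> x / sqrt (\<alpha> x)) *\<^sub>R v x"
  have L: "?z \<in> L2 \<Omega>"
  proof (rule L2_mult_bounded(1)[OF advection_L2[OF \<eta>]])
    show "?z \<in> borel_measurable (lebesgue_on \<Omega>)"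
      using L2_measurable[OF H10D(1)[OF \<eta>]] \<alpha>_measurable v_measurable by measurable
    show "AE x in lebesgue_on \<Omega>. norm (?z x) \<le> (1 / sqrt lo) * norm (?\<eta> x *\<^sub>R v x)"
    proof (rule AE_I2)
      fix x assume "x \<in> space (lebesgue_on \<Omega>)"
      then have "sqrt lo \<le> sqrt (\<alpha> x)" using \<alpha>_bounds[of x] by simp
      then have "1 / sqrt (\<alpha> x) \<le> 1 / sqrt lo" using lo_pos by (intro divide_left_mono) (auto intro: mult_pos_pos simp: less_le_trans[of _ "sqrt lo"])
      then have "1 / sqrt (\<alpha> x) * norm (?\<eta> x *\<^sub>R v x) \<le> 1 / sqrt lo * norm (?\<eta> x *\<^sub>R v x)" by (rule mult_right_mono) simp
      moreover have "0 < sqrt (\<alpha> x)" using \<open>sqrt lo \<le> sqrt (\<alpha> x)\<close> lo_pos by (metis less_le_trans real_sqrt_gt_0_iff)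
      ultimately show "norm (?z x) \<le> (1 / sqrt lo) * norm (?\<eta> x *\<^sub>R v x)" by (simp add: abs_divide)
    qed
  qed (use lo_pos in simp)
  have "transport ?w ?\<eta> = (\<integral>x. wgrad ?w x \<bullet> ?z x \<partial>lebesgue_on \<Omega>)"
    unfolding transport_def wgrad_def
  proof (rule Bochner_Integration.integral_cong[OF refl])
    fix x assume "x \<in> space (lebesgue_on \<Omega>)"
    then have "\<alpha> x > 0" using \<alpha>_bounds[of x] lo_pos by simp
    then show "grad \<Omega> ?w x \<bullet> (?\<eta> x *\<^sub>R v x) = (sqrt (\<alpha> x) *\<^sub>R grad \<Omega> ?w x) \<bullet> ?z x" by simp
  qed
  then have "\<bar>transport ?\<eta> ?w\<bar> \<le> nrm \<Omega> ?z * nrm \<Omega> (wgrad ?w)"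
    using transport_antisym[OF d \<eta> w] L2_inner_integrable(2)[OF wgrad_L2[OF w] L] by (simp add: mult.commute)
  moreover have "transport ?w ?w \<ge> 0"
    using transport_antisym[OF d w w] by simp
  ultimately show ?thesis
    using galerkin_orthogonality[OF u G] by simp
qed

end

section \<open>Taylor's formula on convex sets\<close>

lemma quadratic_form_bound:
  fixes d :: "'a::euclidean_space" and H :: "'a \<Rightarrow> 'a \<Rightarrow> real"
  shows "(\<Sum>i\<in>Basis. \<Sum>j\<in>Basis. (d \<bullet> i) * (d \<bullet> j) * H i j)\<^sup>2 \<le> (norm d)^4 * (\<Sum>i\<in>Basis. \<Sum>j\<in>Basis. (H i j)\<^sup>2)"
proof -
  have "(\<Sum>i\<in>Basis. \<Sum>j\<in>Basis. (d \<bullet> i) * (d \<bullet> j) * H i j)\<^sup>2 = (\<Sum>i\<in>Basis. (d \<bullet> i) * (\<Sum>j\<in>Basis. (d \<bullet> j) * H i j))\<^sup>2"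
    by (simp add: sum_distrib_left mult.assoc)
  also have "\<dots> \<le> (\<Sum>i\<in>Basis. (d \<bullet> i)\<^sup>2) * (\<Sum>i\<in>Basis. (\<Sum>j\<in>Basis. (d \<bullet> j) * H i j)\<^sup>2)"
    by (rule Cauchy_Schwarz_ineq_sum)
  also have "\<dots> \<le> (norm d)\<^sup>2 * (\<Sum>i\<in>Basis. (norm d)\<^sup>2 * (\<Sum>j\<in>Basis. (H i j)\<^sup>2))"
    unfolding norm_square_component_sum[of d, symmetric]
    by (intro mult_left_mono sum_mono) (auto simp: norm_square_component_sum[of d] intro: Cauchy_Schwarz_ineq_sum sum_nonneg)
  also have "\<dots> = (norm d)^4 * (\<Sum>i\<in>Basis. \<Sum>j\<in>Basis. (H i j)\<^sup>2)"
    by (simp add: sum_distrib_left[symmetric] power4_eq_xxxx power2_eq_square mult.assoc)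
  finally show ?thesis .
qed

text \<open>The weight \<open>(1 - t) powr (- 1/2) / 2\<close> is a probability density on the unit interval. It absorbs the
  blow-up of the change of variables below, and does so exactly up to dimension three.\<close>

definition hweight :: "real \<Rightarrow> real" where
  "hweight t = (if 0 \<le> t \<and> t < 1 then 1 / (2 * sqrt (1 - t)) else 0)"

lemma hweight_nonneg: "hweight t \<ge> 0" by (simp add: hweight_def)

lemma hweight_measurable [measurable]: "hweight \<in> borel_measurable borel"
  unfolding hweight_def[abs_def] by measurable

lemma hweight_integral: "(\<integral>\<^sup>+t. ennreal (hweight t) \<partial>lborel) = 1"
proof -
  have "((\<lambda>x::real. x powr (-1/2)) has_integral (1 powr (-1/2 + 1) / (-1/2 + 1))) {0..1}"
    by (rule has_integral_powr_from_0) auto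
  then have "((\<lambda>x::real. x powr (-1/2)) has_integral 2) {0..1}" by simp
  then have "((\<lambda>x::real. (1/2) * x powr (-1/2)) has_integral (1/2) * 2) {0..1}" by (rule has_integral_mult_right)
  then have "((\<lambda>x::real. if x \<in> {0..1} then (1/2) * x powr (-1/2) else 0) has_integral (1/2) * 2) UNIV"
    by (simp only: has_integral_restrict_UNIV)
  then have "(\<integral>\<^sup>+x. ennreal (if x \<in> {0..1} then (1/2) * x powr (-1/2) else 0) \<partial>lborel) = ennreal ((1/2) * 2)"
    by (intro nn_integral_has_integral_lborel) auto
  moreover have "(\<integral>\<^sup>+t. ennreal (hweight t) \<partial>lborel) = (\<integral>\<^sup>+x. ennreal (hweight (1 - x)) \<partial>lborel)"
    by (rule nn_integral_reflect[symmetric]) measurable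
  moreover have "ennreal (hweight (1 - x)) = ennreal (if x \<in> {0..1} then (1/2) * x powr (-1/2) else 0)" for x :: real
    by (cases "x = 0") (auto simp: hweight_def indicator_def powr_minus powr_half_sqrt inverse_eq_divide)
  ultimately show ?thesis by simp
qed

definition hess_sq :: "('a::euclidean_space \<Rightarrow> real) \<Rightarrow> 'a \<Rightarrow> real" where
  "hess_sq f x = (\<Sum>i\<in>Basis. \<Sum>j\<in>Basis. (pd j (pd i f) x)\<^sup>2)"

text \<open>Taylor's formula with integral remainder, squared by Jensen's inequality with respect to the weight.\<close>

lemma taylor_remainder_pointwise:
  fixes f :: "'a::euclidean_space \<Rightarrow> real"
  assumes f: "\<And>k. C_k k f" and D: "norm (a - x) \<le> D"
  shows "ennreal ((f a - f x - (a - x) \<bullet> tgrad f x)\<^sup>2)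
    \<le> (\<integral>\<^sup>+t. ennreal ((2 * (1 - t) * sqrt (1 - t))\<^sup>2 * (D^4 * hess_sq f (t *\<^sub>R a + (1 - t) *\<^sub>R x)) * hweight t) \<partial>lborel)"
proof -
  define d where "d = a - x"
  define y where "y t = x + t *\<^sub>R d" for t
  have y: "y t = t *\<^sub>R a + (1 - t) *\<^sub>R x" for t by (simp add: y_def d_def algebra_simps)
  have df: "f differentiable at z" and dp: "i \<in> Basis \<Longrightarrow> pd i f differentiable at z" for z i
    using f[of "Suc (Suc 0)"] by (auto simp: C_k_Suc_pd)
  define p where "p t = (\<Sum>i\<in>Basis. (d \<bullet> i) * pd i f (y t))" for t
  define s where "s t = (\<Sum>i\<in>Basis. \<Sum>j\<in>Basis. (d \<bullet> i) * (d \<bullet> j) * pd j (pd i f) (y t))" for t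
  have yd: "(y has_derivative (\<lambda>h. h *\<^sub>R d)) (at t)" for t
    unfolding y_def by (auto intro!: derivative_eq_intros)
  have chain: "((\<lambda>t. g (y t)) has_real_derivative (\<Sum>i\<in>Basis. (d \<bullet> i) * pd i g (y t))) (at t)"
    if "\<And>z. g differentiable at z" for g :: "'a \<Rightarrow> real" and t
  proof -
    have "((\<lambda>t. g (y t)) has_derivative (\<lambda>h. \<Sum>i\<in>Basis. ((h *\<^sub>R d) \<bullet> i) * pd i g (y t))) (at t)"
      using diff_chain_at[OF yd has_derivative_pd[OF that]] by (simp add: o_def)
    moreover have "(\<lambda>h. \<Sum>i\<in>Basis. ((h *\<^sub>R d) \<bullet> i) * pd i g (y t)) = (*) (\<Sum>i\<in>Basis. (d \<bullet> i) * pd i g (y t))"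
      by (rule ext) (simp add: sum_distrib_left sum_distrib_right mult_ac)
    ultimately show ?thesis by (simp add: has_field_derivative_def)
  qed
  have pder: "(p has_real_derivative s t) (at t)" for t
  proof -
    have "((\<lambda>t. \<Sum>i\<in>Basis. (d \<bullet> i) * pd i f (y t)) has_real_derivative (\<Sum>i\<in>Basis. (d \<bullet> i) * (\<Sum>j\<in>Basis. (d \<bullet> j) * pd j (pd i f) (y t)))) (at t)"
      by (intro DERIV_sum DERIV_cmult chain dp)
    then show ?thesis by (simp add: p_def[abs_def] s_def sum_distrib_left mult.assoc)
  qed
  have fder: "((\<lambda>t. f (y t)) has_real_derivative p t) (at t)" for t
    unfolding p_def by (rule chain[OF df])
  have der: "((\<lambda>t. f (y t) + (1 - t) * p t) has_vector_derivative (1 - t) * s t) (at t within {0..1})" for t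
  proof -
    have "((\<lambda>t. f (y t) + (1 - t) * p t) has_real_derivative p t + ((0 - 1) * p t + s t * (1 - t))) (at t)"
      by (intro DERIV_add fder DERIV_mult pder DERIV_diff DERIV_const DERIV_ident)
    then show ?thesis
      by (rule has_vector_derivative_at_within[OF has_real_derivative_iff_has_vector_derivative[THEN iffD1, OF DERIV_cong]])
         (simp add: mult.commute)
  qed
  have cy: "continuous_on {0..1} y" unfolding y_def by (intro continuous_intros)
  have ch: "C_k 0 (pd j (pd i f))" if "i \<in> Basis" "j \<in> Basis" for i j
    using f[of "Suc (Suc 0)"] that unfolding C_k_Suc_pd by blast
  have cs: "continuous_on {0..1} (\<lambda>t. (1 - t) * s t)"
    unfolding s_def using ch
    by (intro continuous_intros continuous_on_compose2[OF _ cy, of UNIV]) auto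
  have "(\<integral>t. indicator {0..1} t *\<^sub>R ((1 - t) * s t) \<partial>lborel) = (f (y 1) + (1 - 1) * p 1) - (f (y 0) + (1 - 0) * p 0)"
    by (rule integral_FTC_Icc[OF _ der cs]) auto
  also have "\<dots> = f a - f x - (a - x) \<bullet> tgrad f x"
    by (simp add: y_def d_def p_def inner_tgrad)
  finally have eq: "f a - f x - (a - x) \<bullet> tgrad f x = (\<integral>t. indicator {0..1} t *\<^sub>R ((1 - t) * s t) \<partial>lborel)" by simp
  have ind: "indicator {0..1} t *\<^sub>R ((1 - t) * s t) = (2 * (1 - t) * sqrt (1 - t) * (indicator {0..1} t * s t)) * hweight t" for t
    by (cases "t = 1") (auto simp: indicator_def hweight_def)
  have sm: "(\<lambda>t. indicator {0..1} t * s t) \<in> borel_measurable borel"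
  proof -
    have "continuous_on {0..1} s"
      unfolding s_def using ch by (intro continuous_intros continuous_on_compose2[OF _ cy, of UNIV]) auto
    then have "(\<lambda>t. indicator {0..1} t *\<^sub>R s t) \<in> borel_measurable borel"
      by (intro borel_measurable_continuous_on_indicator) auto
    then show ?thesis by simp
  qed
  have "ennreal ((f a - f x - (a - x) \<bullet> tgrad f x)\<^sup>2)
    \<le> (\<integral>\<^sup>+t. ennreal ((2 * (1 - t) * sqrt (1 - t) * (indicator {0..1} t * s t))\<^sup>2 * hweight t) \<partial>lborel)"
    unfolding eq ind
    by (rule jensen_square) (use sm in \<open>auto simp: hweight_nonneg hweight_integral\<close>)
  also have "\<dots> \<le> (\<integral>\<^sup>+t. ennreal ((2 * (1 - t) * sqrt (1 - t))\<^sup>2 * (D^4 * hess_sq f (y t)) * hweight t) \<partial>lborel)"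
  proof (intro nn_integral_mono ennreal_leI mult_right_mono hweight_nonneg)
    fix t
    have h0: "0 \<le> hess_sq f (y t)" unfolding hess_sq_def by (intro sum_nonneg) auto
    have "(indicator {0..1} t * s t)\<^sup>2 \<le> (s t)\<^sup>2" by (simp add: indicator_def)
    also have "\<dots> \<le> (norm d)^4 * hess_sq f (y t)" unfolding s_def hess_sq_def by (rule quadratic_form_bound)
    also have "\<dots> \<le> D^4 * hess_sq f (y t)" using D h0 by (intro mult_right_mono power_mono) (auto simp: d_def)
    finally show "(2 * (1 - t) * sqrt (1 - t) * (indicator {0..1} t * s t))\<^sup>2 \<le> (2 * (1 - t) * sqrt (1 - t))\<^sup>2 * (D^4 * hess_sq f (y t))"
      unfolding power_mult_distrib[of "2 * (1 - t) * sqrt (1 - t)"] by (rule mult_left_mono) simp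
  qed
  finally show ?thesis unfolding y .
qed

text \<open>The points \<open>t a + (1 - t) x\<close> lie in \<open>K\<close>, and the map \<open>x \<mapsto> t a + (1 - t) x\<close> scales volumes by
  \<open>(1 - t) ^ n\<close>. Integrating the remainder over \<open>x\<close> first leaves the integral of \<open>(1 - t) ^ (2 - n)\<close> times a
  square root, which is finite for \<open>n \<le> 3\<close>; no reference element is needed.\<close>

lemma taylor_remainder_L2:
  fixes f :: "'a::euclidean_space \<Rightarrow> real"
  assumes dim: "DIM('a) \<le> 3" and f: "\<And>k. C_k k f" and K: "convex K" "compact K" and a: "a \<in> K"
    and D: "\<And>x. x \<in> K \<Longrightarrow> norm (a - x) \<le> D"
  shows "(\<integral>\<^sup>+x. ennreal ((f a - f x - (a - x) \<bullet> tgrad f x)\<^sup>2) * indicator K x \<partial>lborel)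
    \<le> ennreal (4 * D^4) * (\<integral>\<^sup>+x. ennreal (hess_sq f x) * indicator K x \<partial>lborel)"
proof -
  have [measurable]: "K \<in> sets borel" using K by (simp add: borel_compact)
  have "C_k 0 (pd j (pd i f))" if "i \<in> Basis" "j \<in> Basis" for i j
    using f[of "Suc (Suc 0)"] that unfolding C_k_Suc_pd by blast
  then have ch: "continuous_on UNIV (hess_sq f)"
    unfolding hess_sq_def[abs_def] by (intro continuous_intros) auto
  have [measurable]: "hess_sq f \<in> borel_measurable borel" using ch by (rule borel_measurable_continuous_onI)
  have h0: "0 \<le> hess_sq f x" for x unfolding hess_sq_def by (intro sum_nonneg) auto
  define N where "N = (\<integral>\<^sup>+x. ennreal (hess_sq f x) * indicator K x \<partial>lborel)"
  define c where "c t = (2 * (1 - t) * sqrt (1 - t))\<^sup>2 * D^4" for t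
  have c0: "c t \<ge> 0" for t by (simp add: c_def)
  have [measurable]: "c \<in> borel_measurable borel" unfolding c_def by measurable
  have "(\<integral>\<^sup>+x. ennreal ((f a - f x - (a - x) \<bullet> tgrad f x)\<^sup>2) * indicator K x \<partial>lborel)
     \<le> (\<integral>\<^sup>+x. \<integral>\<^sup>+t. ennreal (c t * hweight t) * (ennreal (hess_sq f (t *\<^sub>R a + (1 - t) *\<^sub>R x)) * indicator K x) \<partial>lborel \<partial>lborel)"
  proof (rule nn_integral_mono)
    fix x
    have "ennreal (c t * hweight t) * ennreal (hess_sq f (t *\<^sub>R a + (1 - t) *\<^sub>R x))
       = ennreal ((2 * (1 - t) * sqrt (1 - t))\<^sup>2 * (D^4 * hess_sq f (t *\<^sub>R a + (1 - t) *\<^sub>R x)) * hweight t)" for t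
      using c0 hweight_nonneg h0 by (simp add: ennreal_mult'[symmetric] c_def mult_ac)
    then show "ennreal ((f a - f x - (a - x) \<bullet> tgrad f x)\<^sup>2) * indicator K x
      \<le> (\<integral>\<^sup>+t. ennreal (c t * hweight t) * (ennreal (hess_sq f (t *\<^sub>R a + (1 - t) *\<^sub>R x)) * indicator K x) \<partial>lborel)"
      using taylor_remainder_pointwise[OF f D] by (cases "x \<in> K") auto
  qed
  also have "\<dots> = (\<integral>\<^sup>+t. \<integral>\<^sup>+x. ennreal (c t * hweight t) * (ennreal (hess_sq f (t *\<^sub>R a + (1 - t) *\<^sub>R x)) * indicator K x) \<partial>lborel \<partial>lborel)"
    by (rule lborel_pair.Fubini') measurable
  also have "\<dots> = (\<integral>\<^sup>+t. ennreal (c t * hweight t) * (\<integral>\<^sup>+x. ennreal (hess_sq f (t *\<^sub>R a + (1 - t) *\<^sub>R x)) * indicator K x \<partial>lborel) \<partial>lborel)"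
    by (intro nn_integral_cong nn_integral_cmult) measurable
  also have "\<dots> \<le> (\<integral>\<^sup>+t. ennreal (4 * D^4) * N * ennreal (hweight t) \<partial>lborel)"
  proof (rule nn_integral_mono)
    fix t :: real
    show "ennreal (c t * hweight t) * (\<integral>\<^sup>+x. ennreal (hess_sq f (t *\<^sub>R a + (1 - t) *\<^sub>R x)) * indicator K x \<partial>lborel)
      \<le> ennreal (4 * D^4) * N * ennreal (hweight t)" (is "_ * ?J \<le> _")
    proof (cases "0 \<le> t \<and> t < 1")
      case True
      define r where "r = 1 - t"
      have r: "0 < r" "r \<le> 1" using True by (auto simp: r_def)
      have "?J \<le> (\<integral>\<^sup>+x. ennreal (hess_sq f (t *\<^sub>R a + r *\<^sub>R x)) * indicator K (t *\<^sub>R a + r *\<^sub>R x) \<partial>lborel)"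
      proof (rule nn_integral_mono)
        fix x
        have "x \<in> K \<Longrightarrow> t *\<^sub>R a + r *\<^sub>R x \<in> K" using convexD[OF K(1) a, of x t r] True by (auto simp: r_def)
        then show "ennreal (hess_sq f (t *\<^sub>R a + (1 - t) *\<^sub>R x)) * indicator K x
          \<le> ennreal (hess_sq f (t *\<^sub>R a + r *\<^sub>R x)) * indicator K (t *\<^sub>R a + r *\<^sub>R x)"
          by (auto simp: r_def indicator_def)
      qed
      then have J: "ennreal (r ^ DIM('a)) * ?J \<le> N"
        unfolding N_def using r by (subst nn_integral_affine[of _ r "t *\<^sub>R a"]) (auto intro: mult_left_mono)
      have "r ^ 3 \<le> r ^ DIM('a)" using r dim by (intro power_decreasing) auto
      moreover have "c t = (4 * D^4) * r ^ 3"
        using r by (simp add: c_def r_def[symmetric] power_mult_distrib power2_eq_square[of r] power3_eq_cube)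
      ultimately have "c t \<le> 4 * D^4 * r ^ DIM('a)"
        by (simp add: mult_left_mono)
      from mult_right_mono[OF this hweight_nonneg[of t]]
      have "c t * hweight t \<le> (4 * D^4 * hweight t) * r ^ DIM('a)" by (simp only: mult_ac)
      then have "ennreal (c t * hweight t) * ?J \<le> ennreal ((4 * D^4 * hweight t) * r ^ DIM('a)) * ?J"
        by (intro mult_right_mono ennreal_leI) auto
      also have "\<dots> = ennreal (4 * D^4 * hweight t) * (ennreal (r ^ DIM('a)) * ?J)"
        using r hweight_nonneg by (simp add: ennreal_mult mult.assoc)
      also have "\<dots> \<le> ennreal (4 * D^4 * hweight t) * N" by (rule mult_left_mono[OF J]) simp
      also have "\<dots> = ennreal (4 * D^4) * N * ennreal (hweight t)"
        using hweight_nonneg by (simp add: ennreal_mult mult_ac)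
      finally show ?thesis .
    qed (auto simp: hweight_def)
  qed
  also have "\<dots> = ennreal (4 * D^4) * N"
    by (subst nn_integral_cmult) (auto simp: hweight_integral)
  finally show ?thesis unfolding N_def .
qed

lemma hess_sq_nn_integral:
  fixes f :: "'a::euclidean_space \<Rightarrow> real"
  assumes f: "\<And>k. C_k k f" and [measurable]: "K \<in> sets borel"
  shows "(\<integral>\<^sup>+x. ennreal (hess_sq f x) * indicator K x \<partial>lborel)
    = (\<Sum>i\<in>Basis. \<Sum>j\<in>Basis. \<integral>\<^sup>+x. ennreal ((pd j (pd i f) x)\<^sup>2) * indicator K x \<partial>lborel)"
proof -
  have "C_k 0 (pd j (pd i f))" if "i \<in> Basis" "j \<in> Basis" for i j
    using f[of "Suc (Suc 0)"] that unfolding C_k_Suc_pd by blast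
  then have m: "pd j (pd i f) \<in> borel_measurable borel" if "i \<in> Basis" "j \<in> Basis" for i j
    using that by (auto intro!: borel_measurable_continuous_onI)
  have "ennreal (hess_sq f x) * indicator K x = (\<Sum>i\<in>Basis. \<Sum>j\<in>Basis. ennreal ((pd j (pd i f) x)\<^sup>2) * indicator K x)" for x
    unfolding hess_sq_def by (cases "x \<in> K") (simp_all add: sum_nonneg)
  then have "(\<integral>\<^sup>+x. ennreal (hess_sq f x) * indicator K x \<partial>lborel)
    = (\<integral>\<^sup>+x. (\<Sum>i\<in>Basis. \<Sum>j\<in>Basis. ennreal ((pd j (pd i f) x)\<^sup>2) * indicator K x) \<partial>lborel)"
    by (simp only:)
  also have "\<dots> = (\<Sum>i\<in>Basis. \<integral>\<^sup>+x. (\<Sum>j\<in>Basis. ennreal ((pd j (pd i f) x)\<^sup>2) * indicator K x) \<partial>lborel)"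
    by (rule nn_integral_sum, rule borel_measurable_sum) (use m in measurable)
  also have "\<dots> = (\<Sum>i\<in>Basis. \<Sum>j\<in>Basis. \<integral>\<^sup>+x. ennreal ((pd j (pd i f) x)\<^sup>2) * indicator K x \<partial>lborel)"
    by (rule sum.cong[OF refl], rule nn_integral_sum) (use m in measurable)
  finally show ?thesis .
qed

text \<open>The Sobolev embedding into continuous functions, in quantitative form: \<open>f a\<close> is the value at \<open>x\<close>, plus a first
  order term, plus the Taylor remainder, and this identity is squared and integrated over \<open>x\<close>.\<close>

lemma sup_bound_smooth:
  fixes f :: "'a::euclidean_space \<Rightarrow> real"
  assumes dim: "DIM('a) \<le> 3" and f: "\<And>k. C_k k f" and K: "convex K" "compact K" and a: "a \<in> K"
    and D: "\<And>x. x \<in> K \<Longrightarrow> norm (a - x) \<le> D"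
  shows "ennreal ((f a)\<^sup>2) * emeasure lborel K \<le> 3 * ((\<integral>\<^sup>+x. ennreal ((f x)\<^sup>2) * indicator K x \<partial>lborel)
    + ennreal (D\<^sup>2) * (\<Sum>i\<in>Basis. \<integral>\<^sup>+x. ennreal ((pd i f x)\<^sup>2) * indicator K x \<partial>lborel)
    + ennreal (4 * D^4) * (\<Sum>i\<in>Basis. \<Sum>j\<in>Basis. \<integral>\<^sup>+x. ennreal ((pd j (pd i f) x)\<^sup>2) * indicator K x \<partial>lborel))"
proof -
  have [measurable]: "K \<in> sets borel" using K by (simp add: borel_compact)
  have C: "C_k 0 f" "i \<in> Basis \<Longrightarrow> C_k 0 (pd i f)" "i \<in> Basis \<Longrightarrow> j \<in> Basis \<Longrightarrow> C_k 0 (pd j (pd i f))" for i j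
    using f[of "Suc (Suc 0)"] f[of "Suc 0"] f[of 0] unfolding C_k_Suc_pd by blast+
  then have m: "f \<in> borel_measurable borel" "i \<in> Basis \<Longrightarrow> pd i f \<in> borel_measurable borel"
     "i \<in> Basis \<Longrightarrow> j \<in> Basis \<Longrightarrow> pd j (pd i f) \<in> borel_measurable borel" for i j
    by (auto intro!: borel_measurable_continuous_onI)
  have [measurable]: "f \<in> borel_measurable borel" by (rule m(1))
  have [measurable]: "tgrad f \<in> borel_measurable borel"
    unfolding tgrad_def[abs_def] using m(2) by (intro borel_measurable_sum borel_measurable_scaleR) auto
  let ?R = "\<lambda>x. f a - f x - (a - x) \<bullet> tgrad f x"
  have pw: "(f a)\<^sup>2 \<le> 3 * ((f x)\<^sup>2 + D\<^sup>2 * (norm (tgrad f x))\<^sup>2 + (?R x)\<^sup>2)" if x: "x \<in> K" for x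
  proof -
    have "\<bar>(a - x) \<bullet> tgrad f x\<bar> \<le> D * norm (tgrad f x)"
      using Cauchy_Schwarz_ineq2[of "a - x" "tgrad f x"] mult_right_mono[OF D[OF x], of "norm (tgrad f x)"] by simp
    then have "((a - x) \<bullet> tgrad f x)\<^sup>2 \<le> (D * norm (tgrad f x))\<^sup>2"
      by (metis abs_ge_zero power2_abs power_mono)
    moreover have "(p + q + r)\<^sup>2 \<le> 3 * (p\<^sup>2 + q\<^sup>2 + r\<^sup>2)" for p q r :: real
      using zero_le_power2[of "p - q"] zero_le_power2[of "q - r"] zero_le_power2[of "p - r"]
      by (simp add: power2_eq_square algebra_simps)
    from this[of "f x" "(a - x) \<bullet> tgrad f x" "?R x"]
    have "(f a)\<^sup>2 \<le> 3 * ((f x)\<^sup>2 + ((a - x) \<bullet> tgrad f x)\<^sup>2 + (?R x)\<^sup>2)" by simp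
    ultimately show ?thesis by (simp add: power_mult_distrib)
  qed
  have "ennreal ((f a)\<^sup>2) * emeasure lborel K = (\<integral>\<^sup>+x. ennreal ((f a)\<^sup>2) * indicator K x \<partial>lborel)"
    by (subst nn_integral_cmult_indicator) auto
  also have "\<dots> \<le> (\<integral>\<^sup>+x. 3 * (ennreal ((f x)\<^sup>2) * indicator K x + ennreal (D\<^sup>2) * (ennreal ((norm (tgrad f x))\<^sup>2) * indicator K x)
     + ennreal ((?R x)\<^sup>2) * indicator K x) \<partial>lborel)"
  proof (rule nn_integral_mono)
    fix x
    show "ennreal ((f a)\<^sup>2) * indicator K x \<le> 3 * (ennreal ((f x)\<^sup>2) * indicator K x + ennreal (D\<^sup>2) * (ennreal ((norm (tgrad f x))\<^sup>2) * indicator K x)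
     + ennreal ((?R x)\<^sup>2) * indicator K x)"
    proof (cases "x \<in> K")
      case True
      have "ennreal ((f a)\<^sup>2) \<le> ennreal (3 * ((f x)\<^sup>2 + D\<^sup>2 * (norm (tgrad f x))\<^sup>2 + (?R x)\<^sup>2))"
        by (rule ennreal_leI[OF pw[OF True]])
      also have "\<dots> = 3 * (ennreal ((f x)\<^sup>2) + ennreal (D\<^sup>2) * ennreal ((norm (tgrad f x))\<^sup>2) + ennreal ((?R x)\<^sup>2))"
        by (simp add: ennreal_mult ennreal_plus)
      finally show ?thesis using True by simp
    qed simp
  qed
  also have "\<dots> = 3 * ((\<integral>\<^sup>+x. ennreal ((f x)\<^sup>2) * indicator K x \<partial>lborel)
     + ennreal (D\<^sup>2) * (\<integral>\<^sup>+x. ennreal ((norm (tgrad f x))\<^sup>2) * indicator K x \<partial>lborel)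
     + (\<integral>\<^sup>+x. ennreal ((?R x)\<^sup>2) * indicator K x \<partial>lborel))"
    by (simp add: nn_integral_cmult nn_integral_add)
  also have "(\<integral>\<^sup>+x. ennreal ((norm (tgrad f x))\<^sup>2) * indicator K x \<partial>lborel) = (\<Sum>i\<in>Basis. \<integral>\<^sup>+x. ennreal ((pd i f x)\<^sup>2) * indicator K x \<partial>lborel)"
  proof -
    have "ennreal ((norm (tgrad f x))\<^sup>2) * indicator K x = (\<Sum>i\<in>Basis. ennreal ((pd i f x)\<^sup>2) * indicator K x)" for x
      by (cases "x \<in> K") (simp_all add: norm_square_component_sum[of "tgrad f x"] tgrad_inner)
    then have "(\<integral>\<^sup>+x. ennreal ((norm (tgrad f x))\<^sup>2) * indicator K x \<partial>lborel)
      = (\<integral>\<^sup>+x. (\<Sum>i\<in>Basis. ennreal ((pd i f x)\<^sup>2) * indicator K x) \<partial>lborel)"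
      by (simp only:)
    also have "\<dots> = (\<Sum>i\<in>Basis. \<integral>\<^sup>+x. ennreal ((pd i f x)\<^sup>2) * indicator K x \<partial>lborel)"
      by (rule nn_integral_sum) (use m(2) in measurable)
    finally show ?thesis .
  qed
  also have "3 * ((\<integral>\<^sup>+x. ennreal ((f x)\<^sup>2) * indicator K x \<partial>lborel)
     + ennreal (D\<^sup>2) * (\<Sum>i\<in>Basis. \<integral>\<^sup>+x. ennreal ((pd i f x)\<^sup>2) * indicator K x \<partial>lborel)
     + (\<integral>\<^sup>+x. ennreal ((?R x)\<^sup>2) * indicator K x \<partial>lborel))
    \<le> 3 * ((\<integral>\<^sup>+x. ennreal ((f x)\<^sup>2) * indicator K x \<partial>lborel)
     + ennreal (D\<^sup>2) * (\<Sum>i\<in>Basis. \<integral>\<^sup>+x. ennreal ((pd i f x)\<^sup>2) * indicator K x \<partial>lborel)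
     + ennreal (4 * D^4) * (\<integral>\<^sup>+x. ennreal (hess_sq f x) * indicator K x \<partial>lborel))"
    by (intro mult_left_mono add_left_mono taylor_remainder_L2[OF dim f K a D]) auto
  also have "(\<integral>\<^sup>+x. ennreal (hess_sq f x) * indicator K x \<partial>lborel)
      = (\<Sum>i\<in>Basis. \<Sum>j\<in>Basis. \<integral>\<^sup>+x. ennreal ((pd j (pd i f) x)\<^sup>2) * indicator K x \<partial>lborel)"
    by (rule hess_sq_nn_integral[OF f]) simp
  finally show ?thesis .
qed

section \<open>Mollification of functions in \<open>H\<^sup>2\<close>\<close>

lemma pd_local_cong:
  assumes "f differentiable at x" "open X" "x \<in> X" "\<And>y. y \<in> X \<Longrightarrow> f y = g y"
  shows "pd i f x = pd i g x"
  unfolding pd_def using frechet_derivative_transform_within_open[OF assms] by simp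

text \<open>Testing the weak gradient with the translated and reflected mollifier. This is legitimate only where the
  support of the mollifier stays in the domain, so derivatives of mollified functions are known only at points
  that have some distance to the boundary.\<close>

lemma conv_weak_gradient:
  assumes \<Omega>: "open \<Omega>" and w: "weak_gradient \<Omega> u g" and U: "rep \<Omega> u U" and G: "rep \<Omega> (\<lambda>x. g x \<bullet> i) G"
    and e: "e > 0" and sub: "cball y e \<subseteq> \<Omega>" and i: "i \<in> Basis"
  shows "conv U (pd i (rho e)) y = conv G (rho e) y"
proof -
  define \<phi> where "\<phi> z = rho e (y + (-1) *\<^sub>R z)" for z
  have \<phi>: "\<phi> \<in> test_functions \<Omega>"
  proof (rule test_functionsI[where K = "cball y e"])
    show "C_k k \<phi>" for k unfolding \<phi>_def by (rule C_k_affine[OF test_functions_C_k[OF rho_test[OF e]]])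
    show "\<phi> z = 0" if "z \<notin> cball y e" for z
      unfolding \<phi>_def by (rule rho_zero[OF e]) (use that in \<open>simp add: dist_norm\<close>)
  qed (use sub in auto)
  have p: "pd i \<phi> z = - pd i (rho e) (y - z)" for z
    unfolding \<phi>_def using pd_affine(1)[OF test_functions_differentiable[OF rho_test[OF e]], where a = y and c = "-1" and x = z and i = i] by simp
  have u: "u \<in> borel_measurable (lebesgue_on \<Omega>)" "(\<lambda>x. g x \<bullet> i) \<in> borel_measurable (lebesgue_on \<Omega>)"
    using weak_gradientD(1)[OF w] locally_integrable_component[OF weak_gradientD(2)[OF w]]
    by (auto simp: locally_integrable_def)
  have "(\<integral>x. U x * pd i \<phi> x \<partial>lborel) = - (\<integral>x. G x * \<phi> x \<partial>lborel)"
    using weak_gradientD(3)[OF w \<phi> i] rep_integral_mult[OF \<Omega> u(1) U test_functions_borel[OF test_functions_pd[OF \<phi> i]]]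
      rep_integral_mult[OF \<Omega> u(2) G test_functions_borel[OF \<phi>]] by simp
  then show ?thesis unfolding p by (simp add: conv_def \<phi>_def)
qed

text \<open>A function in \<open>H\<^sup>2\<close> together with Borel representatives of its values and of its first and second
  derivatives.\<close>

locale H2_function =
  fixes \<Omega> :: "'a::euclidean_space set" and u :: "'a \<Rightarrow> real" and U :: "'a \<Rightarrow> real"
    and G :: "'a \<Rightarrow> 'a \<Rightarrow> real" and H :: "'a \<Rightarrow> 'a \<Rightarrow> 'a \<Rightarrow> real"
  assumes open_\<Omega>: "open \<Omega>" and bounded_\<Omega>: "bounded \<Omega>" and dim_le_3: "DIM('a) \<le> 3" and u_H2: "u \<in> H2 \<Omega>"
    and rep_U: "rep \<Omega> u U" and rep_G: "\<And>i. i \<in> Basis \<Longrightarrow> rep \<Omega> (\<lambda>x. grad \<Omega> u x \<bullet> i) (G i)"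
    and rep_H: "\<And>i j. i \<in> Basis \<Longrightarrow> j \<in> Basis \<Longrightarrow> rep \<Omega> (\<lambda>x. grad \<Omega> (\<lambda>y. grad \<Omega> u y \<bullet> i) x \<bullet> j) (H i j)"

lemma H2_function_ex:
  fixes \<Omega> :: "'a::euclidean_space set"
  assumes \<Omega>: "open \<Omega>" "bounded \<Omega>" and dim: "DIM('a) \<le> 3" and u: "u \<in> H2 \<Omega>"
  obtains U G H where "H2_function \<Omega> u U G H"
proof -
  have m: "u \<in> borel_measurable (lebesgue_on \<Omega>)" "\<And>i. i \<in> Basis \<Longrightarrow> (\<lambda>x. grad \<Omega> u x \<bullet> i) \<in> borel_measurable (lebesgue_on \<Omega>)"
    using u H1D(1)[OF \<Omega>(1)] by (auto simp: H2_def L2_def)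
  have m3: "(\<lambda>x. grad \<Omega> (\<lambda>y. grad \<Omega> u y \<bullet> i) x \<bullet> j) \<in> borel_measurable (lebesgue_on \<Omega>)" if "i \<in> Basis" for i j
  proof -
    have "grad \<Omega> (\<lambda>y. grad \<Omega> u y \<bullet> i) \<in> borel_measurable (lebesgue_on \<Omega>)"
      using H1D(3)[OF \<Omega>(1), of "\<lambda>y. grad \<Omega> u y \<bullet> i"] u that by (simp add: H2_def L2_def)
    then show ?thesis by measurable
  qed
  obtain U where U: "rep \<Omega> u U" by (rule rep_ex[OF \<Omega>(1) m(1)])
  have "\<exists>V. i \<in> Basis \<longrightarrow> rep \<Omega> (\<lambda>x. grad \<Omega> u x \<bullet> i) V" for i
    using rep_ex[OF \<Omega>(1) m(2)] by metis
  then obtain G where G: "\<And>i. i \<in> Basis \<Longrightarrow> rep \<Omega> (\<lambda>x. grad \<Omega> u x \<bullet> i) (G i)" by metis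
  have "\<exists>V. i \<in> Basis \<longrightarrow> rep \<Omega> (\<lambda>x. grad \<Omega> (\<lambda>y. grad \<Omega> u y \<bullet> i) x \<bullet> j) V" for i j
    using rep_ex[OF \<Omega>(1) m3] by metis
  then obtain H where H: "\<And>i j. i \<in> Basis \<Longrightarrow> rep \<Omega> (\<lambda>x. grad \<Omega> (\<lambda>y. grad \<Omega> u y \<bullet> i) x \<bullet> j) (H i j)" by metis
  show ?thesis by (rule that[of U G H]) (use \<Omega> dim u U G H in unfold_locales)
qed

context H2_function
begin

lemmas \<Omega> = open_\<Omega> bounded_\<Omega>

lemma u_H1: "u \<in> H1 \<Omega>" using u_H2 by (simp add: H2_def)

lemma grad_H1: "i \<in> Basis \<Longrightarrow> (\<lambda>x. grad \<Omega> u x \<bullet> i) \<in> H1 \<Omega>" using u_H2 by (simp add: H2_def)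

lemma L2_parts:
  shows "u \<in> L2 \<Omega>" and "i \<in> Basis \<Longrightarrow> (\<lambda>x. grad \<Omega> u x \<bullet> i) \<in> L2 \<Omega>"
    and "i \<in> Basis \<Longrightarrow> j \<in> Basis \<Longrightarrow> (\<lambda>x. grad \<Omega> (\<lambda>y. grad \<Omega> u y \<bullet> i) x \<bullet> j) \<in> L2 \<Omega>"
  using H1D(1)[OF open_\<Omega> u_H1] H1D(1)[OF open_\<Omega> grad_H1] H1D(3)[OF open_\<Omega> grad_H1] L2_component_iff by blast+

lemma cL2_parts:
  shows cL2_U: "cL2 U" and cL2_G: "i \<in> Basis \<Longrightarrow> cL2 (G i)" and cL2_H: "i \<in> Basis \<Longrightarrow> j \<in> Basis \<Longrightarrow> cL2 (H i j)"
  using rep_L2[OF \<Omega> L2_measurable[OF L2_parts(1)] rep_U] rep_L2[OF \<Omega> L2_measurable[OF L2_parts(2)] rep_G]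
    rep_L2[OF \<Omega> L2_measurable[OF L2_parts(3)] rep_H] L2_parts by blast+

lemma smooth_mollified: "e > 0 \<Longrightarrow> C_k k (conv U (rho e))"
  by (rule C_k_conv[OF cL2_integrable[OF cL2_U] rho_test])

lemma pd_mollified:
  assumes e: "e > 0" and y: "cball y e \<subseteq> \<Omega>" and i: "i \<in> Basis"
  shows "pd i (conv U (rho e)) y = conv (G i) (rho e) y"
  using pd_conv[OF cL2_integrable[OF cL2_U] rho_test[OF e] i]
    conv_weak_gradient[OF open_\<Omega> H1D(2)[OF open_\<Omega> u_H1] rep_U rep_G[OF i] e y i] by simp

lemma pd_pd_mollified:
  assumes e: "e > 0" and y: "cball y (2 * e) \<subseteq> \<Omega>" and i: "i \<in> Basis" and j: "j \<in> Basis"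
  shows "pd j (pd i (conv U (rho e))) y = conv (H i j) (rho e) y"
proof -
  have "pd j (pd i (conv U (rho e))) y = pd j (conv (G i) (rho e)) y"
  proof (rule pd_local_cong[of _ _ "ball y e"])
    show "pd i (conv U (rho e)) differentiable at y"
      using smooth_mollified[OF e, of "Suc (Suc 0)"] i by (auto simp: C_k_Suc_pd)
    fix z assume "z \<in> ball y e"
    then have "cball z e \<subseteq> cball y (2 * e)"
      using dist_triangle_le[of y z _ "2 * e"] by (auto simp: dist_commute)
    then show "pd i (conv U (rho e)) z = conv (G i) (rho e) z" using pd_mollified[OF e _ i] y by blast
  qed (use e in auto)
  also have "\<dots> = conv (G i) (pd j (rho e)) y"
    by (rule pd_conv[OF cL2_integrable[OF cL2_G[OF i]] rho_test[OF e] j])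
  also have "\<dots> = conv (H i j) (rho e) y"
    by (rule conv_weak_gradient[OF open_\<Omega> H1D(2)[OF open_\<Omega> grad_H1[OF i]] rep_G[OF i] rep_H[OF i j] e _ j])
       (rule order_trans[OF subset_cball y], use e in simp)
  finally show ?thesis .
qed

section \<open>Continuity up to the boundary\<close>

definition modulus :: "real \<Rightarrow> 'a \<Rightarrow> ennreal" where
  "modulus D h = 3 * (N2 (\<lambda>x. U (x + h) - U x) + ennreal (D\<^sup>2) * (\<Sum>i\<in>Basis. N2 (\<lambda>x. G i (x + h) - G i x))
     + ennreal (4 * D^4) * (\<Sum>i\<in>Basis. \<Sum>j\<in>Basis. N2 (\<lambda>x. H i j (x + h) - H i j x)))"

lemma modulus_tendsto: "(modulus D \<longlongrightarrow> 0) (at 0)"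
proof -
  have "(modulus D \<longlongrightarrow> 3 * (0 + ennreal (D\<^sup>2) * (\<Sum>i\<in>(Basis::'a set). 0) + ennreal (4 * D^4) * (\<Sum>i\<in>(Basis::'a set). \<Sum>j\<in>(Basis::'a set). 0))) (at 0)"
    unfolding modulus_def[abs_def]
    by (intro ennreal_tendsto_cmult tendsto_add tendsto_sum N2_translation_tendsto cL2_parts) auto
  then show ?thesis by simp
qed

lemma shifted_mollification_le:
  assumes V: "cL2 V" and e: "e > 0" and F: "\<And>z. z \<in> Q \<Longrightarrow> F z = conv V (rho e) (x + z) - conv V (rho e) (y + z)"
  shows "(\<integral>\<^sup>+z. ennreal ((F z)\<^sup>2) * indicator Q z \<partial>lborel) \<le> N2 (\<lambda>w. V (w + (x - y)) - V w)"
proof -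
  have [measurable]: "V \<in> borel_measurable borel" using V by (rule cL2_borel)
  have "(\<integral>\<^sup>+z. ennreal ((F z)\<^sup>2) * indicator Q z \<partial>lborel) \<le> N2 (conv (\<lambda>w. V (x + w) - V (y + w)) (rho e))"
    unfolding N2_def
    by (intro nn_integral_mono) (auto simp: F conv_diff_shift[OF V rho_test[OF e]] indicator_def)
  also have "\<dots> \<le> N2 (\<lambda>w. V (x + w) - V (y + w))" by (rule N2_conv_le[OF e]) measurable
  also have "\<dots> = N2 (\<lambda>w. V (w + (x - y)) - V w)"
    using N2_shift[of "\<lambda>w. V (w + (x - y)) - V w" y] by (simp add: algebra_simps)
  finally show ?thesis .
qed

text \<open>The difference of two translates of \<open>u\<close> on a fixed convex set \<open>Q\<close> is small in \<open>H\<^sup>2\<close>, so the embedding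
  makes it small at the point 0. This gives a modulus of continuity that depends neither on the position
  of the two points nor on the mollifier.\<close>

lemma mollified_modulus:
  assumes Q: "convex Q" "compact Q" "0 \<in> Q" "\<And>q. q \<in> Q \<Longrightarrow> norm q \<le> D" and e: "e > 0"
    and x: "\<And>q. q \<in> Q \<Longrightarrow> cball (x + q) (2 * e) \<subseteq> \<Omega>" and y: "\<And>q. q \<in> Q \<Longrightarrow> cball (y + q) (2 * e) \<subseteq> \<Omega>"
  shows "ennreal ((conv U (rho e) x - conv U (rho e) y)\<^sup>2) * emeasure lborel Q \<le> modulus D (x - y)"
proof -
  let ?u = "conv U (rho e)"
  define f where "f z = ?u (x + 1 *\<^sub>R z) + (-1) * ?u (y + 1 *\<^sub>R z)" for z
  have f: "C_k k f" for k unfolding f_def by (intro C_k_add C_k_cmult C_k_affine smooth_mollified e)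
  have sub: "cball z e \<subseteq> cball z (2 * e)" for z :: 'a using e by (intro subset_cball) simp
  have pdf: "pd i (\<lambda>z. g (x + 1 *\<^sub>R z) + (-1) * g (y + 1 *\<^sub>R z)) = (\<lambda>z. pd i g (x + 1 *\<^sub>R z) + (-1) * pd i g (y + 1 *\<^sub>R z))"
    if "\<And>z. g differentiable at z" for g :: "'a \<Rightarrow> real" and i
  proof
    fix z
    have d: "(\<lambda>z. g (a + 1 *\<^sub>R z)) differentiable at z" for a by (rule pd_affine(2)[OF that])
    have d': "(\<lambda>z. (-1) * g (y + 1 *\<^sub>R z)) differentiable at z" by (intro differentiable_mult d) auto
    have "pd i (\<lambda>z. (-1) * g (y + 1 *\<^sub>R z)) z = (-1) * pd i g (y + 1 *\<^sub>R z)"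
      using pd_mult[of "\<lambda>_. -1" z "\<lambda>z. g (y + 1 *\<^sub>R z)" i] d[of y] pd_affine(1)[OF that, where a = y and c = 1 and x = z and i = i] pd_eqI[OF has_derivative_const, of i "-1" z]
      by simp
    then show "pd i (\<lambda>z. g (x + 1 *\<^sub>R z) + (-1) * g (y + 1 *\<^sub>R z)) z = pd i g (x + 1 *\<^sub>R z) + (-1) * pd i g (y + 1 *\<^sub>R z)"
      using pd_add[OF d[of x] d', of i] pd_affine(1)[OF that, where a = x and c = 1 and x = z and i = i] by simp
  qed
  have df: "?u differentiable at z" and dp: "i \<in> Basis \<Longrightarrow> pd i ?u differentiable at z" for z i
    using smooth_mollified[OF e, of "Suc (Suc 0)"] by (auto simp: C_k_Suc_pd)
  have f1: "pd i f = (\<lambda>z. pd i ?u (x + 1 *\<^sub>R z) + (-1) * pd i ?u (y + 1 *\<^sub>R z))" for i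
    unfolding f_def[abs_def] by (rule pdf[OF df])
  have f2: "pd j (pd i f) = (\<lambda>z. pd j (pd i ?u) (x + 1 *\<^sub>R z) + (-1) * pd j (pd i ?u) (y + 1 *\<^sub>R z))" if "i \<in> Basis" for i j
    unfolding f1 by (rule pdf[OF dp[OF that]])
  have D: "norm (0 - z) \<le> D" if "z \<in> Q" for z using Q(4)[OF that] by simp
  have "ennreal ((f 0)\<^sup>2) * emeasure lborel Q \<le> 3 * ((\<integral>\<^sup>+z. ennreal ((f z)\<^sup>2) * indicator Q z \<partial>lborel)
    + ennreal (D\<^sup>2) * (\<Sum>i\<in>Basis. \<integral>\<^sup>+z. ennreal ((pd i f z)\<^sup>2) * indicator Q z \<partial>lborel)
    + ennreal (4 * D^4) * (\<Sum>i\<in>Basis. \<Sum>j\<in>Basis. \<integral>\<^sup>+z. ennreal ((pd j (pd i f) z)\<^sup>2) * indicator Q z \<partial>lborel))"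
    by (rule sup_bound_smooth[OF dim_le_3 f Q(1,2,3) D])
  also have "\<dots> \<le> modulus D (x - y)"
    unfolding modulus_def
  proof (intro mult_left_mono add_mono sum_mono)
    show "(\<integral>\<^sup>+z. ennreal ((f z)\<^sup>2) * indicator Q z \<partial>lborel) \<le> N2 (\<lambda>w. U (w + (x - y)) - U w)"
      by (rule shifted_mollification_le[OF cL2_U e]) (simp add: f_def)
    fix i :: 'a assume i: "i \<in> Basis"
    show "(\<integral>\<^sup>+z. ennreal ((pd i f z)\<^sup>2) * indicator Q z \<partial>lborel) \<le> N2 (\<lambda>w. G i (w + (x - y)) - G i w)"
    proof (rule shifted_mollification_le[OF cL2_G[OF i] e])
      fix z assume z: "z \<in> Q"
      show "pd i f z = conv (G i) (rho e) (x + z) - conv (G i) (rho e) (y + z)"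
        unfolding f1 using pd_mollified[OF e order_trans[OF sub x[OF z]] i] pd_mollified[OF e order_trans[OF sub y[OF z]] i] by simp
    qed
    fix j :: 'a assume j: "j \<in> Basis"
    show "(\<integral>\<^sup>+z. ennreal ((pd j (pd i f) z)\<^sup>2) * indicator Q z \<partial>lborel) \<le> N2 (\<lambda>w. H i j (w + (x - y)) - H i j w)"
      by (rule shifted_mollification_le[OF cL2_H[OF i j] e])
         (simp add: f2[OF i] pd_pd_mollified[OF e x i j] pd_pd_mollified[OF e y i j])
  qed auto
  finally show ?thesis by (simp add: f_def)
qed

definition epsk :: "nat \<Rightarrow> real" where "epsk k = 1 / (real k + 1)"

lemma epsk: "epsk k > 0" "epsk \<longlonglongrightarrow> 0"
  unfolding epsk_def by (simp, real_asymp)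

text \<open>A subsequence of the mollified functions converges almost everywhere, and at the points of convergence the
  modulus of continuity carries over to \<open>U\<close>.\<close>

lemma good_points:
  obtains S where "S \<subseteq> \<Omega>" "AE x in lebesgue. x \<in> \<Omega> \<longrightarrow> x \<in> S"
    "\<And>Q D x y. convex Q \<Longrightarrow> compact Q \<Longrightarrow> 0 \<in> Q \<Longrightarrow> (\<And>q. q \<in> Q \<Longrightarrow> norm q \<le> D) \<Longrightarrow> x \<in> S \<Longrightarrow> y \<in> S
      \<Longrightarrow> (\<And>q. q \<in> Q \<Longrightarrow> x + q \<in> \<Omega>) \<Longrightarrow> (\<And>q. q \<in> Q \<Longrightarrow> y + q \<in> \<Omega>)
      \<Longrightarrow> ennreal ((U x - U y)\<^sup>2) * emeasure lborel Q \<le> modulus D (x - y)"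
proof -
  have "(\<lambda>k. N2 (\<lambda>x. conv U (rho (epsk k)) x - U x)) \<longlonglongrightarrow> 0"
    by (rule N2_conv_tendsto[OF cL2_U epsk])
  then obtain r where r: "strict_mono r" "AE x in lborel. (\<lambda>k. conv U (rho (epsk (r k))) x - U x) \<longlonglongrightarrow> 0"
    by (rule N2_AE_subseq[rotated]) (auto intro: cL2_diff cL2_conv cL2_U epsk)
  define S where "S = {x \<in> \<Omega>. (\<lambda>k. conv U (rho (epsk (r k))) x) \<longlonglongrightarrow> U x}"
  show ?thesis
  proof (rule that[of S])
    show "S \<subseteq> \<Omega>" by (auto simp: S_def)
    show "AE x in lebesgue. x \<in> \<Omega> \<longrightarrow> x \<in> S"
      using AE_completion[OF r(2)] by eventually_elim (auto simp: S_def dest: LIM_zero_cancel)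
    fix Q D x y
    assume Q: "convex Q" "compact Q" "0 \<in> Q" "\<And>q. q \<in> Q \<Longrightarrow> norm q \<le> D" and xy: "x \<in> S" "y \<in> S"
      and sub: "\<And>q. q \<in> Q \<Longrightarrow> x + q \<in> \<Omega>" "\<And>q. q \<in> Q \<Longrightarrow> y + q \<in> \<Omega>"
    have "compact ((+) x ` Q \<union> (+) y ` Q)" using Q by (intro compact_Un compact_translation)
    moreover have "(+) x ` Q \<union> (+) y ` Q \<subseteq> \<Omega>" using sub by auto
    ultimately obtain d where d: "d > 0" "(\<Union>z\<in>(+) x ` Q \<union> (+) y ` Q. cball z d) \<subseteq> \<Omega>"
      using compact_subset_open_imp_cball_epsilon_subset[OF _ open_\<Omega>] by metis
    have fin: "emeasure lborel Q < \<infinity>" using Q(2) by (intro emeasure_bounded_finite compact_imp_bounded)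
    have "(\<lambda>k. (conv U (rho (epsk (r k))) x - conv U (rho (epsk (r k))) y)\<^sup>2) \<longlonglongrightarrow> (U x - U y)\<^sup>2"
      using xy by (intro tendsto_intros) (auto simp: S_def)
    then have lim: "(\<lambda>k. emeasure lborel Q * ennreal ((conv U (rho (epsk (r k))) x - conv U (rho (epsk (r k))) y)\<^sup>2)) \<longlonglongrightarrow> emeasure lborel Q * ennreal ((U x - U y)\<^sup>2)"
      using fin by (intro ennreal_tendsto_cmult tendsto_ennrealI) auto
    have "(\<lambda>k. epsk (r k)) \<longlonglongrightarrow> 0" using LIMSEQ_subseq_LIMSEQ[OF epsk(2) r(1)] by (simp add: o_def)
    then have "eventually (\<lambda>k. epsk (r k) < d / 2) sequentially" using d(1) by (intro order_tendstoD) auto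
    then have "eventually (\<lambda>k. emeasure lborel Q * ennreal ((conv U (rho (epsk (r k))) x - conv U (rho (epsk (r k))) y)\<^sup>2) \<le> modulus D (x - y)) sequentially"
    proof eventually_elim
      case (elim k)
      have c: "cball z (2 * epsk (r k)) \<subseteq> cball z d" for z :: 'a using elim by (intro subset_cball) simp
      have "cball (x + q) (2 * epsk (r k)) \<subseteq> \<Omega>" "cball (y + q) (2 * epsk (r k)) \<subseteq> \<Omega>" if "q \<in> Q" for q
        using c[of "x + q"] c[of "y + q"] d(2) that by blast+
      then show ?case using mollified_modulus[OF Q epsk(1)] by (simp add: mult.commute)
    qed
    then have "emeasure lborel Q * ennreal ((U x - U y)\<^sup>2) \<le> modulus D (x - y)"
      by (rule tendsto_upperbound[OF lim]) simp
    then show "ennreal ((U x - U y)\<^sup>2) * emeasure lborel Q \<le> modulus D (x - y)" by (simp add: mult.commute)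
  qed
qed

text \<open>The cone property supplies, near each point of the closure, one set \<open>Q\<close> that fits into \<open>\<Omega>\<close> when attached to any
  nearby point of \<open>\<Omega>\<close>. So \<open>U\<close> is uniformly continuous on a set of full measure and extends continuously.\<close>

lemma continuous_extension:
  assumes cone: "\<And>a. a \<in> closure \<Omega> \<Longrightarrow> \<exists>d>0. \<exists>Q. convex Q \<and> compact Q \<and> 0 \<in> Q \<and> interior Q \<noteq> {} \<and>
      (\<forall>x\<in>\<Omega> \<inter> ball a d. \<forall>q\<in>Q. x + q \<in> \<Omega>)"
  obtains g where "continuous_on (closure \<Omega>) g" "AE x in lebesgue. x \<in> \<Omega> \<longrightarrow> U x = g x" "AE x in lebesgue_on \<Omega>. u x = g x"
proof -
  obtain S where S: "S \<subseteq> \<Omega>" "AE x in lebesgue. x \<in> \<Omega> \<longrightarrow> x \<in> S"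
    "\<And>Q D x y. convex Q \<Longrightarrow> compact Q \<Longrightarrow> 0 \<in> Q \<Longrightarrow> (\<And>q. q \<in> Q \<Longrightarrow> norm q \<le> D) \<Longrightarrow> x \<in> S \<Longrightarrow> y \<in> S
      \<Longrightarrow> (\<And>q. q \<in> Q \<Longrightarrow> x + q \<in> \<Omega>) \<Longrightarrow> (\<And>q. q \<in> Q \<Longrightarrow> y + q \<in> \<Omega>)
      \<Longrightarrow> ennreal ((U x - U y)\<^sup>2) * emeasure lborel Q \<le> modulus D (x - y)"
    by (rule good_points) blast
  have loc: "\<exists>d>0. \<forall>x\<in>S \<inter> ball a d. \<forall>y\<in>S \<inter> ball a d. \<bar>U x - U y\<bar> < e" if a: "a \<in> closure \<Omega>" and e: "e > 0" for a e
  proof -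
    obtain d Q where d: "d > 0" and Q: "convex Q" "compact Q" "0 \<in> Q" "interior Q \<noteq> {}"
      and sub: "\<And>x q. x \<in> \<Omega> \<inter> ball a d \<Longrightarrow> q \<in> Q \<Longrightarrow> x + q \<in> \<Omega>"
      using cone[OF a] by blast
    obtain D where D: "\<And>q. q \<in> Q \<Longrightarrow> norm q \<le> D" using compact_imp_bounded[OF Q(2)] bounded_iff by blast
    have "emeasure lborel Q < \<infinity>" using Q(2) by (intro emeasure_bounded_finite compact_imp_bounded)
    then obtain m where m: "emeasure lborel Q = ennreal m" "m \<ge> 0" by (cases "emeasure lborel Q") auto
    have "emeasure lborel Q \<noteq> 0"
    proof
      assume "emeasure lborel Q = 0"
      then have "AE x in lborel. x \<notin> Q" using Q(2) by (subst AE_iff_null_sets[symmetric]) (auto simp: borel_compact null_sets_def)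
      then obtain x where "x \<in> interior Q" "x \<notin> Q" by (rule AE_lborel_open_ex[OF _ open_interior Q(4)])
      then show False using interior_subset by blast
    qed
    then have m0: "m > 0" using m by (cases "m = 0") auto
    have "eventually (\<lambda>h. modulus D h < ennreal (e\<^sup>2 * m)) (at 0)"
      using e m0 by (intro order_tendstoD[OF modulus_tendsto]) auto
    then obtain \<delta> where \<delta>: "\<delta> > 0" "\<And>h. h \<noteq> 0 \<Longrightarrow> norm h < \<delta> \<Longrightarrow> modulus D h < ennreal (e\<^sup>2 * m)"
      unfolding eventually_at by auto
    show ?thesis
    proof (intro exI[of _ "min d (\<delta> / 2)"] conjI ballI)
      fix x y assume xy: "x \<in> S \<inter> ball a (min d (\<delta> / 2))" "y \<in> S \<inter> ball a (min d (\<delta> / 2))"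
      show "\<bar>U x - U y\<bar> < e"
      proof (cases "x = y")
        case False
        have "norm (x - y) < \<delta>" using xy dist_triangle3[of x y a] by (auto simp: dist_norm[symmetric])
        then have "ennreal ((U x - U y)\<^sup>2) * ennreal m < ennreal (e\<^sup>2 * m)"
          using S(3)[OF Q(1-3) D, of x y] sub[of x] sub[of y] xy S(1) \<delta>(2)[of "x - y"] False m(1)
          by (auto intro: le_less_trans)
        then have "(U x - U y)\<^sup>2 * m < e\<^sup>2 * m" using m(2) by (simp add: ennreal_mult'[symmetric] ennreal_less_iff)
        then have "\<bar>U x - U y\<bar>\<^sup>2 < e\<^sup>2" using m0 by simp
        then show ?thesis by (rule power_less_imp_less_base) (use e in simp)
      qed (use e in simp)
    qed (use d \<delta> in auto)
  qed
  \<comment> \<open>a Lebesgue number of the cover by the neighbourhoods found above makes the continuity uniform\<close>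
  have uc: "uniformly_continuous_on S U"
    unfolding uniformly_continuous_on_def
  proof (intro allI impI)
    fix e :: real assume e: "e > 0"
    obtain d where d: "\<And>a. a \<in> closure \<Omega> \<Longrightarrow> d a > 0"
      "\<And>a x y. a \<in> closure \<Omega> \<Longrightarrow> x \<in> S \<inter> ball a (d a) \<Longrightarrow> y \<in> S \<inter> ball a (d a) \<Longrightarrow> \<bar>U x - U y\<bar> < e"
      using loc[OF _ e] by metis
    obtain \<epsilon> where \<epsilon>: "0 < \<epsilon>" "\<And>x. x \<in> closure \<Omega> \<Longrightarrow> \<exists>B \<in> (\<lambda>a. ball a (d a)) ` closure \<Omega>. ball x \<epsilon> \<subseteq> B"
      by (rule Heine_Borel_lemma[of "closure \<Omega>" "(\<lambda>a. ball a (d a)) ` closure \<Omega>"]) (use d(1) bounded_\<Omega> in auto)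
    have "dist (U y) (U x) < e" if xy: "x \<in> S" "y \<in> S" "dist y x < \<epsilon>" for x y
    proof -
      have "x \<in> closure \<Omega>" using xy(1) S(1) closure_subset by blast
      then obtain a where a: "a \<in> closure \<Omega>" "ball x \<epsilon> \<subseteq> ball a (d a)" using \<epsilon>(2) by blast
      have "x \<in> ball x \<epsilon>" "y \<in> ball x \<epsilon>" using xy(3) \<epsilon>(1) by (auto simp: dist_commute)
      then have "x \<in> ball a (d a)" "y \<in> ball a (d a)" using a(2) by blast+
      then show ?thesis using d(2)[OF a(1), of y x] xy by (simp add: dist_real_def)
    qed
    then show "\<exists>d>0. \<forall>x\<in>S. \<forall>x'\<in>S. dist x' x < d \<longrightarrow> dist (U x') (U x) < e" using \<epsilon>(1) by blast
  qed
  obtain g where g: "uniformly_continuous_on (closure S) g" "\<And>x. x \<in> S \<Longrightarrow> U x = g x"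
    by (rule uniformly_continuous_on_extension_on_closure[OF uc]) blast
  have "\<Omega> \<subseteq> closure S"
  proof
    fix x assume x: "x \<in> \<Omega>"
    show "x \<in> closure S"
      unfolding closure_approachable
    proof (intro allI impI)
      fix e :: real assume e: "e > 0"
      obtain y where "y \<in> \<Omega> \<inter> ball x e" "y \<in> \<Omega> \<longrightarrow> y \<in> S"
        by (rule AE_lebesgue_open_ex[OF S(2), of "\<Omega> \<inter> ball x e"]) (use x e open_\<Omega> in auto)
      then show "\<exists>y\<in>S. dist y x < e" by (auto simp: dist_commute)
    qed
  qed
  then have cl: "closure \<Omega> \<subseteq> closure S" by (intro closure_minimal) auto
  have A1: "AE x in lebesgue. x \<in> \<Omega> \<longrightarrow> U x = g x" using S(2) by eventually_elim (use g(2) in auto)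
  have "AE x in lebesgue. x \<in> \<Omega> \<longrightarrow> u x = U x"
    using rep_U open_\<Omega> by (simp add: rep_def AE_lebesgue_on_iff)
  with A1 have "AE x in lebesgue. x \<in> \<Omega> \<longrightarrow> u x = g x" by eventually_elim auto
  then have A2: "AE x in lebesgue_on \<Omega>. u x = g x" using open_\<Omega> by (subst AE_lebesgue_on_iff) auto
  show ?thesis
    by (rule that[OF continuous_on_subset[OF uniformly_continuous_imp_continuous[OF g(1)] cl] A1 A2])
qed

end

context H2_function
begin

section \<open>Taylor remainders of functions in \<open>H\<^sup>2\<close>\<close>

definition remainder :: "('a \<Rightarrow> real) \<Rightarrow> 'a \<Rightarrow> 'a \<Rightarrow> real" where
  "remainder g b x = g b - U x - (\<Sum>i\<in>Basis. ((b - x) \<bullet> i) * G i x)"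

definition hess_norm :: ennreal where
  "hess_norm = (\<Sum>i\<in>Basis. \<Sum>j\<in>Basis. N2 (H i j))"

lemma remainder_measurable [measurable]: "remainder g b \<in> borel_measurable borel"
proof -
  have [measurable]: "U \<in> borel_measurable borel" by (rule cL2_borel[OF cL2_U])
  have "(\<lambda>x. \<Sum>i\<in>Basis. ((b - x) \<bullet> i) * G i x) \<in> borel_measurable borel"
    by (rule borel_measurable_sum) (use cL2_borel[OF cL2_G] in measurable)
  then show ?thesis unfolding remainder_def[abs_def] by measurable
qed

lemma mollified_tendsto:
  assumes g: "continuous_on \<Omega> g" and eq: "AE x in lebesgue. x \<in> \<Omega> \<longrightarrow> U x = g x" and b: "b \<in> \<Omega>"
  shows "(\<lambda>k. conv U (rho (epsk k)) b) \<longlonglongrightarrow> g b"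
proof (rule LIMSEQ_I)
  fix r :: real assume r: "r > 0"
  have "isCont g b" using g b open_\<Omega> continuous_on_eq_continuous_at by blast
  then obtain d where d: "d > 0" "\<And>y. dist y b < d \<Longrightarrow> dist (g y) (g b) < r / 2"
    using r unfolding continuous_at_eps_delta by (meson half_gt_zero)
  obtain d' where d': "d' > 0" "ball b d' \<subseteq> \<Omega>" using b open_\<Omega> open_contains_ball by blast
  have "eventually (\<lambda>k. epsk k < min d d') sequentially" using d d' by (intro order_tendstoD[OF epsk(2)]) simp
  then obtain k0 where k0: "\<And>k. k \<ge> k0 \<Longrightarrow> epsk k < min d d'" by (auto simp: eventually_sequentially)
  have "\<bar>conv U (rho (epsk k)) b - g b\<bar> \<le> r / 2" if "k \<ge> k0" for k
  proof (rule conv_rho_near[OF epsk(1) cL2_integrable[OF cL2_U]])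
    have "AE y in lebesgue. dist b y < epsk k \<longrightarrow> \<bar>U y - g b\<bar> \<le> r / 2"
      using eq
    proof eventually_elim
      case (elim y)
      show ?case
      proof
        assume "dist b y < epsk k"
        then have y: "dist b y < d" "y \<in> ball b d'" using k0[OF that] by auto
        then have "U y = g y" using elim d'(2) by blast
        then show "\<bar>U y - g b\<bar> \<le> r / 2" using d(2)[of y] y(1) by (simp add: dist_real_def dist_commute)
      qed
    qed
    then show "AE y in lborel. dist b y < epsk k \<longrightarrow> \<bar>U y - g b\<bar> \<le> r / 2"
      using cL2_borel[OF cL2_U] by (subst (asm) AE_completion_iff) auto
  qed
  then show "\<exists>k0. \<forall>k\<ge>k0. norm (conv U (rho (epsk k)) b - g b) < r"
    using r by (intro exI[of _ k0]) (force intro: le_less_trans)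
qed

text \<open>On a compact convex subset mollified functions are smooth and satisfy the estimate. In the limit their
  Taylor remainders converge in \<open>L\<^sup>2\<close>; the square of a sum costs a factor two, which turns the constant 4 into 8.\<close>

lemma remainder_compact:
  assumes g: "continuous_on \<Omega> g" and eq: "AE x in lebesgue. x \<in> \<Omega> \<longrightarrow> U x = g x"
    and K: "convex K" "compact K" "K \<subseteq> \<Omega>" and b: "b \<in> K" and D: "\<And>x. x \<in> K \<Longrightarrow> norm (b - x) \<le> D"
  shows "(\<integral>\<^sup>+x. ennreal ((remainder g b x)\<^sup>2) * indicator K x \<partial>lborel) \<le> ennreal (8 * D^4) * hess_norm"
proof -
  have [measurable]: "K \<in> sets borel" using K by (simp add: borel_compact)
  have Um[measurable]: "U \<in> borel_measurable borel" by (rule cL2_borel[OF cL2_U])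
  obtain d where d: "d > 0" "(\<Union>x\<in>K. cball x d) \<subseteq> \<Omega>"
    by (rule compact_subset_open_imp_cball_epsilon_subset[OF K(2) open_\<Omega> K(3)])
  define uk where "uk k = conv U (rho (epsk k))" for k
  define err where "err k = 6 * (ennreal ((g b - uk k b)\<^sup>2) * emeasure lborel K + N2 (\<lambda>x. uk k x - U x)
     + ennreal (D\<^sup>2) * (\<Sum>i\<in>Basis. N2 (\<lambda>x. conv (G i) (rho (epsk k)) x - G i x)))" for k
  have fin: "emeasure lborel K < \<infinity>" using K(2) by (intro emeasure_bounded_finite compact_imp_bounded)
  have err0: "err \<longlonglongrightarrow> 0"
  proof -
    have "(\<lambda>k. (g b - uk k b)\<^sup>2) \<longlonglongrightarrow> (g b - g b)\<^sup>2"
      unfolding uk_def using b K(3) by (intro tendsto_intros mollified_tendsto[OF g eq]) auto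
    then have "(\<lambda>k. emeasure lborel K * ennreal ((g b - uk k b)\<^sup>2)) \<longlonglongrightarrow> emeasure lborel K * ennreal ((g b - g b)\<^sup>2)"
      using fin by (intro ennreal_tendsto_cmult tendsto_ennrealI) auto
    then have 1: "(\<lambda>k. ennreal ((g b - uk k b)\<^sup>2) * emeasure lborel K) \<longlonglongrightarrow> 0" by (simp add: mult.commute)
    have 2: "(\<lambda>k. N2 (\<lambda>x. uk k x - U x)) \<longlonglongrightarrow> 0"
      unfolding uk_def by (rule N2_conv_tendsto[OF cL2_U epsk])
    have "(\<lambda>k. \<Sum>i\<in>(Basis::'a set). N2 (\<lambda>x. conv (G i) (rho (epsk k)) x - G i x)) \<longlonglongrightarrow> (\<Sum>i\<in>(Basis::'a set). 0)"
      by (rule tendsto_sum, rule N2_conv_tendsto[OF cL2_G epsk])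
    then have 3: "(\<lambda>k. ennreal (D\<^sup>2) * (\<Sum>i\<in>(Basis::'a set). N2 (\<lambda>x. conv (G i) (rho (epsk k)) x - G i x))) \<longlonglongrightarrow> ennreal (D\<^sup>2) * 0"
      by (intro ennreal_tendsto_cmult) auto
    have "err \<longlonglongrightarrow> 6 * (0 + 0 + ennreal (D\<^sup>2) * 0)"
      unfolding err_def[abs_def] by (rule ennreal_tendsto_cmult[OF _ tendsto_add[OF tendsto_add[OF 1 2] 3]]) simp
    then show ?thesis by simp
  qed
  have le: "(\<integral>\<^sup>+x. ennreal ((remainder g b x)\<^sup>2) * indicator K x \<partial>lborel) \<le> ennreal (8 * D^4) * hess_norm + err k"
    if k: "epsk k < d / 2" for k
  proof -
    have sub: "cball x (2 * epsk k) \<subseteq> \<Omega>" "cball x (epsk k) \<subseteq> \<Omega>" if "x \<in> K" for x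
    proof -
      have "cball x d \<subseteq> \<Omega>" using d(2) that by blast
      then show "cball x (2 * epsk k) \<subseteq> \<Omega>" "cball x (epsk k) \<subseteq> \<Omega>"
        using k epsk(1)[of k] by (auto intro!: order_trans[OF subset_cball])
    qed
    have f: "C_k m (uk k)" for m unfolding uk_def by (rule smooth_mollified[OF epsk(1)])
    have ukm[measurable]: "uk k \<in> borel_measurable borel"
      unfolding uk_def by (intro conv_borel cL2_integrable cL2_U rho_test epsk)
    have Gm: "G i \<in> borel_measurable borel" "conv (G i) (rho (epsk k)) \<in> borel_measurable borel" if "i \<in> Basis" for i
      using cL2_borel[OF cL2_G[OF that]] conv_borel[OF cL2_integrable[OF cL2_G[OF that]] rho_test[OF epsk(1)[of k]]] by auto
    let ?R = "\<lambda>x. uk k b - uk k x - (b - x) \<bullet> tgrad (uk k) x"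
    define S where "S x = (\<Sum>i\<in>Basis. (conv (G i) (rho (epsk k)) x - G i x)\<^sup>2)" for x
    have tgm[measurable]: "tgrad (uk k) \<in> borel_measurable borel"
    proof -
      have "C_k 0 (pd i (uk k))" if "i \<in> Basis" for i using f[of "Suc 0"] that unfolding C_k_Suc_pd by blast
      then show ?thesis
        unfolding tgrad_def[abs_def] by (intro borel_measurable_sum borel_measurable_scaleR borel_measurable_continuous_onI) auto
    qed
    have Sm[measurable]: "S \<in> borel_measurable borel"
      unfolding S_def by (rule borel_measurable_sum) (use Gm in measurable)
    have S0: "S x \<ge> 0" for x unfolding S_def by (intro sum_nonneg) auto
    have pw: "(remainder g b x)\<^sup>2 \<le> 2 * (?R x)\<^sup>2 + 6 * ((g b - uk k b)\<^sup>2 + (uk k x - U x)\<^sup>2 + D\<^sup>2 * S x)" if x: "x \<in> K" for x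
    proof -
      define T where "T = (\<Sum>i\<in>Basis. ((b - x) \<bullet> i) * (conv (G i) (rho (epsk k)) x - G i x))"
      have "(b - x) \<bullet> tgrad (uk k) x = (\<Sum>i\<in>Basis. ((b - x) \<bullet> i) * conv (G i) (rho (epsk k)) x)"
        unfolding inner_tgrad uk_def by (intro sum.cong refl) (simp add: pd_mollified[OF epsk(1) sub(2)[OF x]])
      then have eqR: "remainder g b x = ?R x + ((g b - uk k b) + (uk k x - U x) + T)"
        by (simp add: remainder_def T_def right_diff_distrib sum_subtractf)
      have "T\<^sup>2 \<le> (\<Sum>i\<in>Basis. ((b - x) \<bullet> i)\<^sup>2) * S x"
        unfolding T_def S_def by (rule Cauchy_Schwarz_ineq_sum)
      also have "\<dots> = (norm (b - x))\<^sup>2 * S x" by (simp add: norm_square_component_sum)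
      also have "\<dots> \<le> D\<^sup>2 * S x" using D[OF x] by (intro mult_right_mono power_mono S0) auto
      finally have T: "T\<^sup>2 \<le> D\<^sup>2 * S x" .
      have a1: "(p + q)\<^sup>2 \<le> 2 * p\<^sup>2 + 2 * q\<^sup>2" for p q :: real
        using zero_le_power2[of "p - q"] by (simp add: power2_eq_square algebra_simps)
      have a2: "(p + q + r)\<^sup>2 \<le> 3 * (p\<^sup>2 + q\<^sup>2 + r\<^sup>2)" for p q r :: real
        using zero_le_power2[of "p - q"] zero_le_power2[of "q - r"] zero_le_power2[of "p - r"]
        by (simp add: power2_eq_square algebra_simps)
      have a3: "X \<le> 2 * p + 6 * (q + r + w)" if "X \<le> 2 * p + 2 * y" "y \<le> 3 * (q + r + z)" "z \<le> w" for X p q r w y z :: real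
        using that by argo
      show ?thesis
        unfolding eqR
        by (rule a3[OF a1[of "?R x" "(g b - uk k b) + (uk k x - U x) + T"] a2[of "g b - uk k b" "uk k x - U x" T] T])
    qed
    have "(\<integral>\<^sup>+x. ennreal ((remainder g b x)\<^sup>2) * indicator K x \<partial>lborel)
      \<le> (\<integral>\<^sup>+x. 2 * (ennreal ((?R x)\<^sup>2) * indicator K x) + 6 * (ennreal ((g b - uk k b)\<^sup>2) * indicator K x + ennreal ((uk k x - U x)\<^sup>2) + ennreal (D\<^sup>2) * ennreal (S x)) \<partial>lborel)"
    proof (rule nn_integral_mono)
      fix x
      show "ennreal ((remainder g b x)\<^sup>2) * indicator K x \<le> 2 * (ennreal ((?R x)\<^sup>2) * indicator K x) + 6 * (ennreal ((g b - uk k b)\<^sup>2) * indicator K x + ennreal ((uk k x - U x)\<^sup>2) + ennreal (D\<^sup>2) * ennreal (S x))"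
      proof (cases "x \<in> K")
        case True
        have "ennreal ((remainder g b x)\<^sup>2) \<le> ennreal (2 * (?R x)\<^sup>2 + 6 * ((g b - uk k b)\<^sup>2 + (uk k x - U x)\<^sup>2 + D\<^sup>2 * S x))"
          by (rule ennreal_leI[OF pw[OF True]])
        also have "\<dots> = 2 * ennreal ((?R x)\<^sup>2) + 6 * (ennreal ((g b - uk k b)\<^sup>2) + ennreal ((uk k x - U x)\<^sup>2) + ennreal (D\<^sup>2) * ennreal (S x))"
          using S0[of x] by (simp add: ennreal_plus ennreal_mult)
        finally show ?thesis using True by simp
      qed simp
    qed
    also have "\<dots> = 2 * (\<integral>\<^sup>+x. ennreal ((?R x)\<^sup>2) * indicator K x \<partial>lborel) + 6 * (ennreal ((g b - uk k b)\<^sup>2) * emeasure lborel K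
        + N2 (\<lambda>x. uk k x - U x) + ennreal (D\<^sup>2) * (\<integral>\<^sup>+x. ennreal (S x) \<partial>lborel))"
      by (simp add: nn_integral_add nn_integral_cmult nn_integral_cmult_indicator N2_def)
    also have "(\<integral>\<^sup>+x. ennreal (S x) \<partial>lborel) = (\<Sum>i\<in>Basis. N2 (\<lambda>x. conv (G i) (rho (epsk k)) x - G i x))"
    proof -
      have "(\<integral>\<^sup>+x. ennreal (S x) \<partial>lborel) = (\<integral>\<^sup>+x. (\<Sum>i\<in>Basis. ennreal ((conv (G i) (rho (epsk k)) x - G i x)\<^sup>2)) \<partial>lborel)"
        by (simp add: S_def)
      also have "\<dots> = (\<Sum>i\<in>Basis. N2 (\<lambda>x. conv (G i) (rho (epsk k)) x - G i x))"
        unfolding N2_def by (rule nn_integral_sum) (use Gm in measurable)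
      finally show ?thesis .
    qed
    finally have A: "(\<integral>\<^sup>+x. ennreal ((remainder g b x)\<^sup>2) * indicator K x \<partial>lborel)
      \<le> 2 * (\<integral>\<^sup>+x. ennreal ((?R x)\<^sup>2) * indicator K x \<partial>lborel) + err k" by (simp add: err_def)
    have T1: "(\<integral>\<^sup>+x. ennreal ((?R x)\<^sup>2) * indicator K x \<partial>lborel) \<le> ennreal (4 * D^4) * (\<integral>\<^sup>+x. ennreal (hess_sq (uk k) x) * indicator K x \<partial>lborel)"
      by (rule taylor_remainder_L2[OF dim_le_3 f K(1,2) b D])
    have "(\<integral>\<^sup>+x. ennreal (hess_sq (uk k) x) * indicator K x \<partial>lborel)
      = (\<Sum>i\<in>Basis. \<Sum>j\<in>Basis. \<integral>\<^sup>+x. ennreal ((pd j (pd i (uk k)) x)\<^sup>2) * indicator K x \<partial>lborel)"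
      by (rule hess_sq_nn_integral[OF f]) simp
    also have "\<dots> \<le> hess_norm"
      unfolding hess_norm_def
    proof (intro sum_mono)
      fix i j :: 'a assume i: "i \<in> Basis" and j: "j \<in> Basis"
      have "(\<integral>\<^sup>+x. ennreal ((pd j (pd i (uk k)) x)\<^sup>2) * indicator K x \<partial>lborel) \<le> N2 (conv (H i j) (rho (epsk k)))"
        unfolding N2_def
        by (intro nn_integral_mono) (auto simp: indicator_def uk_def pd_pd_mollified[OF epsk(1) sub(1) i j])
      also have "\<dots> \<le> N2 (H i j)" by (rule N2_conv_le[OF epsk(1) cL2_borel[OF cL2_H[OF i j]]])
      finally show "(\<integral>\<^sup>+x. ennreal ((pd j (pd i (uk k)) x)\<^sup>2) * indicator K x \<partial>lborel) \<le> N2 (H i j)" .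
    qed
    finally have T2: "(\<integral>\<^sup>+x. ennreal (hess_sq (uk k) x) * indicator K x \<partial>lborel) \<le> hess_norm" .
    have "(\<integral>\<^sup>+x. ennreal ((?R x)\<^sup>2) * indicator K x \<partial>lborel) \<le> ennreal (4 * D^4) * hess_norm"
      by (rule order_trans[OF T1 mult_left_mono[OF T2]]) simp
    then have "2 * (\<integral>\<^sup>+x. ennreal ((?R x)\<^sup>2) * indicator K x \<partial>lborel) \<le> 2 * (ennreal (4 * D^4) * hess_norm)"
      by (rule mult_left_mono) simp
    also have "2 * (ennreal (4 * D^4) * hess_norm) = ennreal (8 * D^4) * hess_norm"
    proof -
      have "ennreal (8 * D^4) = ennreal (2 * (4 * D^4))" by simp
      also have "\<dots> = 2 * ennreal (4 * D^4)" by (subst ennreal_mult) auto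
      finally show ?thesis by (simp only: mult.assoc)
    qed
    finally have "2 * (\<integral>\<^sup>+x. ennreal ((?R x)\<^sup>2) * indicator K x \<partial>lborel) \<le> ennreal (8 * D^4) * hess_norm" .
    then show ?thesis using A by (meson add_right_mono order_trans)
  qed
  have "eventually (\<lambda>k. epsk k < d / 2) sequentially" using d(1) by (intro order_tendstoD[OF epsk(2)]) simp
  then have ev: "eventually (\<lambda>k. (\<integral>\<^sup>+x. ennreal ((remainder g b x)\<^sup>2) * indicator K x \<partial>lborel) \<le> ennreal (8 * D^4) * hess_norm + err k) sequentially"
    by eventually_elim (rule le)
  have "(\<lambda>k. ennreal (8 * D^4) * hess_norm + err k) \<longlonglongrightarrow> ennreal (8 * D^4) * hess_norm + 0"
    by (intro tendsto_add tendsto_const err0)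
  from tendsto_lowerbound[OF this ev] show ?thesis by simp
qed

text \<open>Shrinking a convex \<open>\<Omega>\<close> towards an interior point reduces the estimate up to the closure to compact
  subsets; Fatou's lemma passes to the limit.\<close>

lemma remainder_convex:
  assumes conv: "convex \<Omega>" and ne: "\<Omega> \<noteq> {}"
    and g: "continuous_on (closure \<Omega>) g" and eq: "AE x in lebesgue. x \<in> \<Omega> \<longrightarrow> U x = g x"
    and a: "a \<in> closure \<Omega>" and D: "\<And>x y. x \<in> closure \<Omega> \<Longrightarrow> y \<in> closure \<Omega> \<Longrightarrow> norm (x - y) \<le> D"
  shows "(\<integral>\<^sup>+x. ennreal ((remainder g a x)\<^sup>2) * indicator \<Omega> x \<partial>lborel) \<le> ennreal (8 * D^4) * hess_norm"
proof -
  have [measurable]: "\<Omega> \<in> sets borel" using open_\<Omega> by auto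
  obtain x0 where x0: "x0 \<in> \<Omega>" using ne by blast
  have g': "continuous_on \<Omega> g" using continuous_on_subset[OF g closure_subset] .
  define T where "T m y = y - epsk (Suc m) *\<^sub>R (y - x0)" for m and y :: 'a
  have e01: "0 < epsk (Suc m)" "epsk (Suc m) < 1" for m by (auto simp: epsk_def)
  have e0: "(\<lambda>m. epsk (Suc m)) \<longlonglongrightarrow> 0" using LIMSEQ_Suc[OF epsk(2)] .
  define K where "K m = T m ` closure \<Omega>" for m
  have Tin: "T m y \<in> \<Omega>" if "y \<in> closure \<Omega>" for m y
    using mem_interior_closure_convex_shrink[OF conv _ that, of x0 "epsk (Suc m)"] x0 e01[of m] interior_open[OF open_\<Omega>]
    by (simp add: T_def)
  have Teq: "T m y = epsk (Suc m) *\<^sub>R x0 + (1 - epsk (Suc m)) *\<^sub>R y" for m y by (simp add: T_def algebra_simps)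
  have Kc: "compact (K m)" for m
    unfolding K_def T_def using bounded_\<Omega> by (intro compact_continuous_image continuous_intros) auto
  have Kconv: "convex (K m)" for m
  proof -
    have "K m = (+) (epsk (Suc m) *\<^sub>R x0) ` ((*\<^sub>R) (1 - epsk (Suc m)) ` closure \<Omega>)"
      unfolding K_def Teq[abs_def] image_image ..
    then show ?thesis using conv by (simp add: convex_translation convex_scaling convex_closure)
  qed
  have KO: "K m \<subseteq> \<Omega>" for m using Tin by (auto simp: K_def)
  have [measurable]: "K m \<in> sets borel" for m using Kc by (simp add: borel_compact)
  have le: "(\<integral>\<^sup>+x. ennreal ((remainder g (T m a) x)\<^sup>2) * indicator (K m) x \<partial>lborel) \<le> ennreal (8 * D^4) * hess_norm" for m
  proof (rule remainder_compact[OF g' eq Kconv Kc KO])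
    show b: "T m a \<in> K m" using a by (auto simp: K_def)
    show "norm (T m a - x) \<le> D" if "x \<in> K m" for x
      using D[of "T m a" x] KO[of m] b that closure_subset[of \<Omega>] by blast
  qed
  have lim: "(\<lambda>m. ennreal ((remainder g (T m a) x)\<^sup>2) * indicator (K m) x) \<longlonglongrightarrow> ennreal ((remainder g a x)\<^sup>2)" if x: "x \<in> \<Omega>" for x
  proof -
    have Ta: "(\<lambda>m. T m a) \<longlonglongrightarrow> a"
    proof -
      have "(\<lambda>m. T m a) \<longlonglongrightarrow> a - 0 *\<^sub>R (a - x0)" unfolding T_def by (intro tendsto_intros e0)
      then show ?thesis by simp
    qed
    have gT: "(\<lambda>m. g (T m a)) \<longlonglongrightarrow> g a"
      by (rule continuous_on_tendsto_compose[OF g Ta a]) (use Tin[OF a] closure_subset in \<open>auto intro!: always_eventually\<close>)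
    have "(\<lambda>m. remainder g (T m a) x) \<longlonglongrightarrow> remainder g a x"
      unfolding remainder_def by (intro tendsto_intros gT Ta)
    then have A: "(\<lambda>m. ennreal ((remainder g (T m a) x)\<^sup>2)) \<longlonglongrightarrow> ennreal ((remainder g a x)\<^sup>2)"
      by (intro tendsto_ennrealI tendsto_power)
    \<comment> \<open>the preimage of \<open>x\<close> under the homothety converges to \<open>x\<close>, hence stays in \<open>\<Omega>\<close> eventually\<close>
    define y where "y m = x + (epsk (Suc m) / (1 - epsk (Suc m))) *\<^sub>R (x - x0)" for m
    have "y \<longlonglongrightarrow> x + (0 / (1 - 0)) *\<^sub>R (x - x0)" unfolding y_def by (intro tendsto_intros e0) auto
    then have "y \<longlonglongrightarrow> x" by simp
    then have "eventually (\<lambda>m. y m \<in> \<Omega>) sequentially" using x open_\<Omega> topological_tendstoD by blast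
    then have "eventually (\<lambda>m. x \<in> K m) sequentially"
    proof eventually_elim
      case (elim m)
      have "(1 - epsk (Suc m)) *\<^sub>R y m = (1 - epsk (Suc m)) *\<^sub>R x + epsk (Suc m) *\<^sub>R (x - x0)"
        using e01[of m] by (simp add: y_def scaleR_add_right)
      then have "T m (y m) = x" unfolding Teq by (simp add: algebra_simps)
      then show ?case using elim closure_subset[of \<Omega>] unfolding K_def by (metis imageI subsetD)
    qed
    then have "eventually (\<lambda>m. ennreal ((remainder g (T m a) x)\<^sup>2) = ennreal ((remainder g (T m a) x)\<^sup>2) * indicator (K m) x) sequentially"
      by eventually_elim simp
    then show ?thesis by (rule Lim_transform_eventually[OF A])
  qed
  have "(\<integral>\<^sup>+x. ennreal ((remainder g a x)\<^sup>2) * indicator \<Omega> x \<partial>lborel)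
    \<le> (\<integral>\<^sup>+x. liminf (\<lambda>m. ennreal ((remainder g (T m a) x)\<^sup>2) * indicator (K m) x) \<partial>lborel)"
  proof (rule nn_integral_mono)
    fix x
    show "ennreal ((remainder g a x)\<^sup>2) * indicator \<Omega> x \<le> liminf (\<lambda>m. ennreal ((remainder g (T m a) x)\<^sup>2) * indicator (K m) x)"
      using lim_imp_Liminf[OF sequentially_bot lim, of x] by (cases "x \<in> \<Omega>") auto
  qed
  also have "\<dots> \<le> liminf (\<lambda>m. \<integral>\<^sup>+x. ennreal ((remainder g (T m a) x)\<^sup>2) * indicator (K m) x \<partial>lborel)"
    by (rule nn_integral_liminf) measurable
  also have "\<dots> \<le> ennreal (8 * D^4) * hess_norm"
    by (rule Liminf_le) (use le in auto)
  finally show ?thesis .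
qed

lemma taylor_H2:
  assumes conv: "convex \<Omega>" and ne: "\<Omega> \<noteq> {}"
    and g: "continuous_on (closure \<Omega>) g" and eq: "AE x in lebesgue_on \<Omega>. u x = g x"
    and a: "a \<in> closure \<Omega>" and D: "\<And>x y. x \<in> closure \<Omega> \<Longrightarrow> y \<in> closure \<Omega> \<Longrightarrow> norm (x - y) \<le> D"
  shows "(\<lambda>x. g a - u x - (a - x) \<bullet> grad \<Omega> u x) \<in> L2 \<Omega>"
    "(nrm \<Omega> (\<lambda>x. g a - u x - (a - x) \<bullet> grad \<Omega> u x))\<^sup>2 \<le> 8 * D^4 * (H2_seminorm \<Omega> u)\<^sup>2"
proof -
  let ?f = "\<lambda>x. g a - u x - (a - x) \<bullet> grad \<Omega> u x"
  have [measurable]: "\<Omega> \<in> sets borel" using open_\<Omega> by auto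
  have eqU: "AE x in lebesgue_on \<Omega>. u x = U x" using rep_U by (simp add: rep_def)
  have "AE x in lebesgue_on \<Omega>. \<forall>i\<in>Basis. grad \<Omega> u x \<bullet> i = G i x"
    by (rule AE_ball_countable') (use rep_G in \<open>auto simp: rep_def countable_finite\<close>)
  with eqU have AEr: "AE x in lebesgue_on \<Omega>. ?f x = remainder g a x * indicator \<Omega> x"
    using AE_space
  proof eventually_elim
    case (elim x)
    have "(a - x) \<bullet> grad \<Omega> u x = (\<Sum>i\<in>Basis. ((a - x) \<bullet> i) * G i x)"
      unfolding euclidean_inner[of "a - x" "grad \<Omega> u x"] using elim(2) by (intro sum.cong) auto
    then show ?case using elim by (simp add: remainder_def)
  qed
  have "AE x in lebesgue_on \<Omega>. U x = g x" using eq eqU by eventually_elim simp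
  then have eqU': "AE x in lebesgue. x \<in> \<Omega> \<longrightarrow> U x = g x" using open_\<Omega> by (subst (asm) AE_lebesgue_on_iff) auto
  have r: "rep \<Omega> ?f (\<lambda>x. remainder g a x * indicator \<Omega> x)"
    using AEr by (auto simp: rep_def)
  have um: "u \<in> borel_measurable (lebesgue_on \<Omega>)" "grad \<Omega> u \<in> borel_measurable (lebesgue_on \<Omega>)"
    using L2_parts(1) H1D(3)[OF open_\<Omega> u_H1] by (auto simp: L2_def)
  have idm: "(\<lambda>x. a - x) \<in> borel_measurable (lebesgue_on \<Omega>)"
    by (rule measurable_restrict_space1, rule measurable_completion) simp
  have fm: "?f \<in> borel_measurable (lebesgue_on \<Omega>)"
    by (intro borel_measurable_diff borel_measurable_const um borel_measurable_inner idm)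
  have H2: "hess_norm = ennreal ((H2_seminorm \<Omega> u)\<^sup>2)"
  proof -
    have "N2 (H i j) = ennreal (\<integral>x. (grad \<Omega> (\<lambda>y. grad \<Omega> u y \<bullet> i) x \<bullet> j)\<^sup>2 \<partial>lebesgue_on \<Omega>)" if "i \<in> Basis" "j \<in> Basis" for i j
      using N2_eq_integral[OF cL2_H[OF that]] rep_integral_square[OF open_\<Omega> L2_measurable[OF L2_parts(3)[OF that]] rep_H[OF that]] by simp
    then have "hess_norm = (\<Sum>i\<in>Basis. \<Sum>j\<in>Basis. ennreal (\<integral>x. (grad \<Omega> (\<lambda>y. grad \<Omega> u y \<bullet> i) x \<bullet> j)\<^sup>2 \<partial>lebesgue_on \<Omega>))"
      unfolding hess_norm_def by simp
    also have "\<dots> = ennreal (\<Sum>i\<in>Basis. \<Sum>j\<in>Basis. \<integral>x. (grad \<Omega> (\<lambda>y. grad \<Omega> u y \<bullet> i) x \<bullet> j)\<^sup>2 \<partial>lebesgue_on \<Omega>)"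
      by (simp add: sum_nonneg)
    also have "\<dots> = ennreal ((H2_seminorm \<Omega> u)\<^sup>2)"
      unfolding H2_seminorm_def by (subst real_sqrt_pow2) (auto intro!: sum_nonneg)
    finally show ?thesis .
  qed
  have "N2 (\<lambda>x. remainder g a x * indicator \<Omega> x) = (\<integral>\<^sup>+x. ennreal ((remainder g a x)\<^sup>2) * indicator \<Omega> x \<partial>lborel)"
    unfolding N2_def by (intro nn_integral_cong) (auto simp: indicator_def)
  also have "\<dots> \<le> ennreal (8 * D^4) * hess_norm" by (rule remainder_convex[OF conv ne g eqU' a D])
  finally have le: "N2 (\<lambda>x. remainder g a x * indicator \<Omega> x) \<le> ennreal (8 * D^4 * (H2_seminorm \<Omega> u)\<^sup>2)"
    unfolding H2 by (simp add: ennreal_mult'[symmetric])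
  obtain R where R: "\<And>x. x \<in> \<Omega> \<Longrightarrow> norm x \<le> R" using bounded_\<Omega> by (auto simp: bounded_iff)
  have "cL2 (\<lambda>x. remainder g a x * indicator \<Omega> x)"
    unfolding cL2_def
  proof (intro conjI exI[of _ R] allI impI)
    show "integrable lborel (\<lambda>x. (remainder g a x * indicator \<Omega> x)\<^sup>2)"
      using le by (auto simp: integrable_iff_bounded N2_def intro: le_less_trans)
    show "remainder g a x * indicator \<Omega> x = 0" if "R < norm x" for x using R[of x] that by (auto simp: indicator_def)
  qed measurable
  with rep_L2[OF \<Omega> fm r] show L: "?f \<in> L2 \<Omega>" by simp
  have "ennreal ((nrm \<Omega> ?f)\<^sup>2) = N2 (\<lambda>x. remainder g a x * indicator \<Omega> x)"
    using rep_integral_square[OF open_\<Omega> fm r] N2_eq_integral[OF \<open>cL2 _\<close>] by (simp add: nrm_square)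
  then have "ennreal ((nrm \<Omega> ?f)\<^sup>2) \<le> ennreal (8 * D^4 * (H2_seminorm \<Omega> u)\<^sup>2)" using le by simp
  then show "(nrm \<Omega> ?f)\<^sup>2 \<le> 8 * D^4 * (H2_seminorm \<Omega> u)\<^sup>2"
    by (subst (asm) ennreal_le_iff) auto
qed

end

section \<open>Lipschitz domains\<close>

lemma lipschitz_chart:
  assumes "bounded_lipschitz_domain \<Omega>" "a \<in> frontier \<Omega>"
  obtains r e \<gamma> L where "r > 0" "norm e = 1" "L \<ge> 0"
    "\<And>x y. \<bar>\<gamma> (x - (x \<bullet> e) *\<^sub>R e) - \<gamma> (y - (y \<bullet> e) *\<^sub>R e)\<bar> \<le> L * norm ((x - y) - ((x - y) \<bullet> e) *\<^sub>R e)"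
    "\<And>y. y \<in> ball a r \<Longrightarrow> y \<in> \<Omega> \<longleftrightarrow> \<gamma> (y - (y \<bullet> e) *\<^sub>R e) < y \<bullet> e"
proof -
  obtain r e \<gamma> L where c: "r > 0" "norm e = 1" "L-lipschitz_on {z. z \<bullet> e = 0} \<gamma>"
    "\<forall>y\<in>ball a r. y \<in> \<Omega> \<longleftrightarrow> \<gamma> (y - (y \<bullet> e) *\<^sub>R e) < y \<bullet> e"
    using assms unfolding bounded_lipschitz_domain_def by blast
  show ?thesis
  proof (rule that[OF c(1,2)])
    show "L \<ge> 0" using c(3) by (rule lipschitz_on_nonneg)
    show "y \<in> \<Omega> \<longleftrightarrow> \<gamma> (y - (y \<bullet> e) *\<^sub>R e) < y \<bullet> e" if "y \<in> ball a r" for y using c(4) that by blast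
    fix x y
    have "e \<bullet> e = 1" using c(2) by (simp add: dot_square_norm)
    then have "dist (\<gamma> (x - (x \<bullet> e) *\<^sub>R e)) (\<gamma> (y - (y \<bullet> e) *\<^sub>R e)) \<le> L * dist (x - (x \<bullet> e) *\<^sub>R e) (y - (y \<bullet> e) *\<^sub>R e)"
      by (intro lipschitz_onD[OF c(3)]) (auto simp: inner_diff_left)
    then show "\<bar>\<gamma> (x - (x \<bullet> e) *\<^sub>R e) - \<gamma> (y - (y \<bullet> e) *\<^sub>R e)\<bar> \<le> L * norm ((x - y) - ((x - y) \<bullet> e) *\<^sub>R e)"
      by (simp add: dist_norm algebra_simps inner_diff_left)
  qed
qed

text \<open>Above a graph with Lipschitz constant \<open>L\<close> one may move by a short vector in the cone around the axis \<open>e\<close> of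
  slope \<open>L\<close> without leaving the domain.\<close>

lemma lipschitz_cone_property:
  assumes \<Omega>: "bounded_lipschitz_domain \<Omega>" and a: "a \<in> closure \<Omega>"
  shows "\<exists>d>0. \<exists>Q. convex Q \<and> compact Q \<and> 0 \<in> Q \<and> interior Q \<noteq> {} \<and> (\<forall>x\<in>\<Omega> \<inter> ball a d. \<forall>q\<in>Q. x + q \<in> \<Omega>)"
proof (cases "a \<in> \<Omega>")
  case True
  have "open \<Omega>" using \<Omega> by (simp add: bounded_lipschitz_domain_def)
  then obtain r where r: "r > 0" "ball a r \<subseteq> \<Omega>" using True open_contains_ball by blast
  have "x + q \<in> \<Omega>" if "x \<in> ball a (r/2)" "q \<in> cball 0 (r/3)" for x q
  proof -
    have "dist a (x + q) \<le> dist a x + norm q" using norm_triangle_ineq4[of "a - x" q] by (simp add: dist_norm algebra_simps)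
    then show ?thesis using that r by (intro subsetD[OF r(2)]) auto
  qed
  then show ?thesis using r(1) by (intro exI[of _ "r/2"] conjI exI[of _ "cball 0 (r/3)"]) auto
next
  case False
  have "open \<Omega>" using \<Omega> by (simp add: bounded_lipschitz_domain_def)
  then have fr: "a \<in> frontier \<Omega>" using a False by (simp add: frontier_def interior_open)
  obtain r e \<gamma> L where c: "r > 0" "norm e = 1" "L \<ge> 0"
    "\<And>x y. \<bar>\<gamma> (x - (x \<bullet> e) *\<^sub>R e) - \<gamma> (y - (y \<bullet> e) *\<^sub>R e)\<bar> \<le> L * norm ((x - y) - ((x - y) \<bullet> e) *\<^sub>R e)"
    "\<And>y. y \<in> ball a r \<Longrightarrow> y \<in> \<Omega> \<longleftrightarrow> \<gamma> (y - (y \<bullet> e) *\<^sub>R e) < y \<bullet> e"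
    by (rule lipschitz_chart[OF \<Omega> fr]) blast
  define P where "P q = q - (q \<bullet> e) *\<^sub>R e" for q
  define Q where "Q = cball 0 (r/3) \<inter> {q. L * norm (P q) \<le> q \<bullet> e}"
  have contP: "continuous_on S P" for S unfolding P_def by (intro continuous_intros)
  have P0: "P (s *\<^sub>R e) = 0" for s using c(2) by (simp add: P_def dot_square_norm)
  have "convex Q"
    unfolding Q_def
  proof (intro convex_Int convex_cball convexI)
    fix x y :: 'a and s t :: real
    assume xy: "x \<in> {q. L * norm (P q) \<le> q \<bullet> e}" "y \<in> {q. L * norm (P q) \<le> q \<bullet> e}" and st: "0 \<le> s" "0 \<le> t" "s + t = 1"
    have "P (s *\<^sub>R x + t *\<^sub>R y) = s *\<^sub>R P x + t *\<^sub>R P y" by (simp add: P_def inner_add_left algebra_simps)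
    then have "L * norm (P (s *\<^sub>R x + t *\<^sub>R y)) \<le> L * (s * norm (P x) + t * norm (P y))"
      using norm_triangle_ineq[of "s *\<^sub>R P x" "t *\<^sub>R P y"] st c(3) by (intro mult_left_mono) auto
    also have "\<dots> = s * (L * norm (P x)) + t * (L * norm (P y))" by (simp add: algebra_simps)
    also have "\<dots> \<le> s * (x \<bullet> e) + t * (y \<bullet> e)" using xy st by (intro add_mono mult_left_mono) auto
    finally show "s *\<^sub>R x + t *\<^sub>R y \<in> {q. L * norm (P q) \<le> q \<bullet> e}" by (simp add: inner_add_left)
  qed
  moreover have "compact Q"
    unfolding Q_def by (intro compact_Int_closed compact_cball closed_Collect_le continuous_intros contP)
  moreover have "0 \<in> Q" using c(1) P0[of 0] by (simp add: Q_def)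
  moreover have "interior Q \<noteq> {}"
  proof -
    have "open (ball 0 (r/3) \<inter> {q. L * norm (P q) < q \<bullet> e})"
      by (intro open_Int open_ball open_Collect_less continuous_intros contP)
    moreover have "ball 0 (r/3) \<inter> {q. L * norm (P q) < q \<bullet> e} \<subseteq> Q" by (auto simp: Q_def)
    moreover have "(r/4) *\<^sub>R e \<in> ball 0 (r/3) \<inter> {q. L * norm (P q) < q \<bullet> e}"
      using c(1,2) P0 by (simp add: dot_square_norm)
    ultimately show ?thesis using interior_maximal by blast
  qed
  moreover have "x + q \<in> \<Omega>" if x: "x \<in> \<Omega> \<inter> ball a (r/3)" and q: "q \<in> Q" for x q
  proof -
    have "dist a (x + q) \<le> dist a x + norm q" using norm_triangle_ineq4[of "a - x" q] by (simp add: dist_norm algebra_simps)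
    then have 1: "x + q \<in> ball a r" using x q c(1) by (auto simp: Q_def)
    have 2: "\<gamma> (x - (x \<bullet> e) *\<^sub>R e) < x \<bullet> e" using c(5)[of x] x c(1) by auto
    have "\<gamma> ((x + q) - ((x + q) \<bullet> e) *\<^sub>R e) \<le> \<gamma> (x - (x \<bullet> e) *\<^sub>R e) + L * norm (P q)"
      using c(4)[of "x + q" x] by (simp add: P_def)
    also have "\<dots> < x \<bullet> e + q \<bullet> e" using 2 q by (auto simp: Q_def)
    finally show ?thesis using c(5)[OF 1] by (simp add: inner_add_left)
  qed
  ultimately show ?thesis using c(1) by (intro exI[of _ "r/3"] conjI exI[of _ Q]) auto
qed

lemma lipschitz_graph_point:
  assumes a: "a \<in> frontier \<Omega>" and op: "open \<Omega>" and c: "r > 0" "norm e = 1" "L \<ge> 0"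
    "\<And>x y. \<bar>\<gamma> (x - (x \<bullet> e) *\<^sub>R e) - \<gamma> (y - (y \<bullet> e) *\<^sub>R e)\<bar> \<le> L * norm ((x - y) - ((x - y) \<bullet> e) *\<^sub>R e)"
    "\<And>y. y \<in> ball a r \<Longrightarrow> y \<in> \<Omega> \<longleftrightarrow> \<gamma> (y - (y \<bullet> e) *\<^sub>R e) < y \<bullet> e"
  shows "a \<bullet> e \<le> \<gamma> (a - (a \<bullet> e) *\<^sub>R e)"
proof -
  have "a \<notin> \<Omega>" using a op by (simp add: frontier_def interior_open)
  then show ?thesis using c(5)[of a] c(1) by simp
qed

lemma norm_projection_le:
  assumes "norm e = 1" shows "norm (x - (x \<bullet> e) *\<^sub>R e) \<le> norm x"
proof -
  have "(norm (x - (x \<bullet> e) *\<^sub>R e))\<^sup>2 = (norm x)\<^sup>2 - (x \<bullet> e)\<^sup>2"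
  proof -
    have "e \<bullet> e = 1" using assms by (simp add: dot_square_norm)
    then show ?thesis
      unfolding power2_norm_eq_inner by (simp add: inner_diff_left inner_diff_right inner_commute power2_eq_square)
  qed
  then have "(norm (x - (x \<bullet> e) *\<^sub>R e))\<^sup>2 \<le> (norm x)\<^sup>2" by simp
  then show ?thesis by (rule power2_le_imp_le) simp
qed

text \<open>A Lipschitz domain lies locally on one side of its boundary. This excludes slits, and it is what ties the
  mesh, which is given as a decomposition of the closure, to the domain itself.\<close>

lemma lipschitz_interior_closure:
  assumes \<Omega>: "bounded_lipschitz_domain \<Omega>" and a: "a \<in> frontier \<Omega>"
  shows "a \<notin> interior (closure \<Omega>)"
proof
  assume "a \<in> interior (closure \<Omega>)"
  then obtain d where d: "d > 0" "ball a d \<subseteq> closure \<Omega>" by (auto simp: mem_interior)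
  have op: "open \<Omega>" using \<Omega> by (simp add: bounded_lipschitz_domain_def)
  obtain r e \<gamma> L where c: "r > 0" "norm e = 1" "L \<ge> 0"
    "\<And>x y. \<bar>\<gamma> (x - (x \<bullet> e) *\<^sub>R e) - \<gamma> (y - (y \<bullet> e) *\<^sub>R e)\<bar> \<le> L * norm ((x - y) - ((x - y) \<bullet> e) *\<^sub>R e)"
    "\<And>y. y \<in> ball a r \<Longrightarrow> y \<in> \<Omega> \<longleftrightarrow> \<gamma> (y - (y \<bullet> e) *\<^sub>R e) < y \<bullet> e"
    by (rule lipschitz_chart[OF \<Omega> a]) blast
  define t where "t = min d r / 4"
  have t: "t > 0" "4 * t \<le> d" "4 * t \<le> r" using d(1) c(1) by (auto simp: t_def)
  let ?b = "a - (2 * t) *\<^sub>R e"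
  have ee: "e \<bullet> e = 1" using c(2) by (simp add: dot_square_norm)
  have "dist a ?b = 2 * t" using c(2) t(1) by (simp add: dist_norm)
  then have "?b \<in> closure \<Omega>" using d(2) t by (intro subsetD[OF d(2)]) simp
  moreover have "t / (L + 1) > 0" using t(1) c(3) by simp
  ultimately obtain y where y: "y \<in> \<Omega>" "dist y ?b < t / (L + 1)" unfolding closure_approachable by blast
  have "t / (L + 1) \<le> t" using t(1) c(3) by (simp add: divide_le_eq)
  then have yt: "dist y ?b < t" using y(2) by simp
  have "dist a y < r" using dist_triangle[of a y ?b] \<open>dist a ?b = 2 * t\<close> yt t by (simp add: dist_commute)
  then have "\<gamma> (y - (y \<bullet> e) *\<^sub>R e) < y \<bullet> e" using c(5)[of y] y(1) by simp
  moreover have "\<gamma> (a - (a \<bullet> e) *\<^sub>R e) - \<gamma> (y - (y \<bullet> e) *\<^sub>R e) \<le> L * norm (y - ?b)"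
  proof -
    have "(a - y) - ((a - y) \<bullet> e) *\<^sub>R e = (?b - y) - ((?b - y) \<bullet> e) *\<^sub>R e" using ee by (simp add: inner_diff_left algebra_simps)
    then have "norm ((a - y) - ((a - y) \<bullet> e) *\<^sub>R e) \<le> norm (?b - y)"
      using norm_projection_le[OF c(2), of "?b - y"] by (simp only:)
    then have "norm ((a - y) - ((a - y) \<bullet> e) *\<^sub>R e) \<le> norm (y - ?b)"
      by (simp only: norm_minus_commute[of ?b y])
    then have "L * norm ((a - y) - ((a - y) \<bullet> e) *\<^sub>R e) \<le> L * norm (y - ?b)" using c(3) by (rule mult_left_mono)
    then show ?thesis using c(4)[of a y] by linarith
  qed
  moreover have "y \<bullet> e \<le> a \<bullet> e - 2 * t + norm (y - ?b)"
    using Cauchy_Schwarz_ineq2[of "y - ?b" e] c(2) ee by (simp add: inner_diff_left)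
  moreover have "a \<bullet> e \<le> \<gamma> (a - (a \<bullet> e) *\<^sub>R e)" by (rule lipschitz_graph_point[OF a op c])
  moreover have "(L + 1) * norm (y - ?b) < t" using y(2) c(3) by (simp add: dist_norm field_simps)
  ultimately show False using t(1) by (simp add: distrib_right)
qed

text \<open>A function in \<open>H\<^sub>0\<^sup>1\<close> that is continuous up to the boundary vanishes there. Near a boundary point where
  it does not, the strip of width \<open>s\<close> along the boundary has measure of order \<open>s\<close>, because the translates
  of the strip by multiples of \<open>s\<close> cover a fixed neighbourhood, whereas the strip estimate forces \<open>s\<^sup>2\<close>.\<close>

lemma H10_continuous_frontier_zero:
  fixes \<Omega> :: "'a::euclidean_space set"
  assumes \<Omega>: "bounded_lipschitz_domain \<Omega>" and u: "u \<in> H10 \<Omega>" and g: "continuous_on (closure \<Omega>) g"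
    and eq: "AE x in lebesgue_on \<Omega>. u x = g x" and a: "a \<in> frontier \<Omega>"
  shows "g a = 0"
proof (rule ccontr)
  assume ga: "g a \<noteq> 0"
  have op: "open \<Omega>" and bd: "bounded \<Omega>" using \<Omega> by (auto simp: bounded_lipschitz_domain_def)
  have m\<Omega>[measurable]: "\<Omega> \<in> sets borel" using op by auto
  obtain r0 e \<gamma> L where c: "r0 > 0" "norm e = 1" "L \<ge> 0"
    "\<And>x y. \<bar>\<gamma> (x - (x \<bullet> e) *\<^sub>R e) - \<gamma> (y - (y \<bullet> e) *\<^sub>R e)\<bar> \<le> L * norm ((x - y) - ((x - y) \<bullet> e) *\<^sub>R e)"
    "\<And>y. y \<in> ball a r0 \<Longrightarrow> y \<in> \<Omega> \<longleftrightarrow> \<gamma> (y - (y \<bullet> e) *\<^sub>R e) < y \<bullet> e"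
    by (rule lipschitz_chart[OF \<Omega> a]) blast
  have ee: "e \<bullet> e = 1" using c(2) by (simp add: dot_square_norm)
  define m where "m = \<bar>g a\<bar> / 2"
  have m: "m > 0" using ga by (simp add: m_def)
  have acl: "a \<in> closure \<Omega>" using a by (simp add: frontier_def)
  obtain r1 where r1: "r1 > 0" "\<And>x. x \<in> closure \<Omega> \<Longrightarrow> dist x a < r1 \<Longrightarrow> dist (g x) (g a) < m"
    using g acl m unfolding continuous_on_iff by metis
  define r where "r = min r0 r1"
  have r: "r > 0" "r \<le> r0" "r \<le> r1" using c(1) r1(1) by (auto simp: r_def)
  have gm: "m \<le> \<bar>g x\<bar>" if "x \<in> \<Omega>" "x \<in> ball a r" for x
    using r1(2)[of x] that r closure_subset[of \<Omega>] by (auto simp: dist_commute dist_real_def m_def abs_if split: if_splits)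
  define r' where "r' = r / (2 * (L + 3))"
  define h where "h = (1 + L) * r'"
  have r': "r' > 0" "h > 0" "r' + h < r / 2"
    using r(1) c(3) by (auto simp: r'_def h_def field_simps add_pos_nonneg)
  define B where "B = \<Omega> \<inter> ball a r'"
  have Bm[measurable]: "B \<in> sets borel" by (simp add: B_def)
  have "B \<noteq> {}" using acl r'(1) unfolding B_def closure_approachable by (force simp: dist_commute)
  have Bfin: "emeasure lborel B < \<infinity>" unfolding B_def by (intro emeasure_bounded_finite) (auto intro: bounded_Int)
  define \<beta> where "\<beta> = measure lborel B"
  have "emeasure lborel B \<noteq> 0"
  proof
    assume "emeasure lborel B = 0"
    then have "AE x in lborel. x \<notin> B" by (subst AE_iff_null_sets[symmetric]) (auto simp: null_sets_def)
    then obtain x where "x \<in> B" "x \<notin> B" by (rule AE_lborel_open_ex) (use op \<open>B \<noteq> {}\<close> in \<open>auto simp: B_def\<close>)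
    then show False by blast
  qed
  then have \<beta>: "\<beta> > 0" using Bfin by (simp add: \<beta>_def measure_def enn2real_positive_iff zero_less_iff_neq_zero)
  define A where "A s = {x. x \<in> \<Omega> \<and> x \<in> ball a r \<and> x - s *\<^sub>R e \<notin> \<Omega>}" for s
  have Am[measurable]: "A s \<in> sets borel" for s
  proof -
    have "(\<lambda>x. x - s *\<^sub>R e) -` \<Omega> \<in> sets borel"
      using measurable_sets_borel[of "\<lambda>x. x - s *\<^sub>R e" borel \<Omega>] by simp
    moreover have "A s = (\<Omega> \<inter> ball a r) - (\<lambda>x. x - s *\<^sub>R e) -` \<Omega>" by (auto simp: A_def)
    ultimately show ?thesis by auto
  qed
  have Afin: "emeasure lborel (A s) < \<infinity>" for s
    by (rule emeasure_bounded_finite, rule bounded_subset[of "ball a r"]) (auto simp: A_def)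
  have meas: "\<beta> * s \<le> r * measure lborel (A s)" if s: "s > 0" "s < r / 2" for s
  proof -
    define J where "J = nat \<lfloor>h / s\<rfloor> + 1"
    have J: "real J * s > h" "real J * s \<le> h + s"
    proof -
      have J': "real J = of_int \<lfloor>h / s\<rfloor> + 1" using r'(2) s by (simp add: J_def)
      have "h / s < real J" unfolding J' by linarith
      then show "real J * s > h" using s by (simp add: field_simps)
      have "real J \<le> h / s + 1" unfolding J' by linarith
      then have "real J * s \<le> (h / s + 1) * s" using s by (intro mult_right_mono) auto
      then show "real J * s \<le> h + s" using s by (simp add: distrib_right)
    qed
    have cover: "\<exists>j<J. x - (real j * s) *\<^sub>R e \<in> A s" if x: "x \<in> B" for x
    proof -
      have near: "x - t *\<^sub>R e \<in> ball a r" if "0 \<le> t" "t \<le> h + s" for t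
      proof -
        have "dist a (x - t *\<^sub>R e) \<le> dist a x + norm (t *\<^sub>R e)"
          using norm_triangle_ineq[of "a - x" "t *\<^sub>R e"] by (simp add: dist_norm algebra_simps)
        also have "\<dots> < r" using x that c(2) r'(3) s by (simp add: B_def)
        finally show ?thesis by simp
      qed
      have low: "x \<bullet> e - \<gamma> (x - (x \<bullet> e) *\<^sub>R e) \<le> h"
      proof -
        have xa: "norm (x - a) < r'" using x by (simp add: B_def dist_norm norm_minus_commute)
        have "L * norm ((a - x) - ((a - x) \<bullet> e) *\<^sub>R e) \<le> L * r'"
          using norm_projection_le[OF c(2), of "a - x"] xa c(3) by (intro mult_left_mono) (auto simp: norm_minus_commute)
        moreover have "x \<bullet> e - a \<bullet> e \<le> r'" using Cauchy_Schwarz_ineq2[of "x - a" e] c(2) xa by (simp add: inner_diff_left)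
        moreover have "a \<bullet> e \<le> \<gamma> (a - (a \<bullet> e) *\<^sub>R e)" by (rule lipschitz_graph_point[OF a op c])
        ultimately show ?thesis using c(4)[of a x] by (simp add: h_def distrib_right)
      qed
      have out: "x - (real J * s) *\<^sub>R e \<notin> \<Omega>"
      proof -
        have bl: "x - (real J * s) *\<^sub>R e \<in> ball a r0" using near[of "real J * s"] J s r(2) by auto
        have pr: "(x - (real J * s) *\<^sub>R e) - ((x - (real J * s) *\<^sub>R e) \<bullet> e) *\<^sub>R e = x - (x \<bullet> e) *\<^sub>R e"
          using ee by (simp add: inner_diff_left algebra_simps)
        have "(x - (real J * s) *\<^sub>R e) \<bullet> e = x \<bullet> e - real J * s" using ee by (simp add: inner_diff_left)
        then show ?thesis using c(5)[OF bl, unfolded pr] low J(1) by simp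
      qed
      define j0 where "j0 = (LEAST j. x - (real j * s) *\<^sub>R e \<notin> \<Omega>)"
      have j0: "x - (real j0 * s) *\<^sub>R e \<notin> \<Omega>" "j0 \<le> J"
        unfolding j0_def
        using LeastI[of "\<lambda>j. x - (real j * s) *\<^sub>R e \<notin> \<Omega>" J, OF out]
          Least_le[of "\<lambda>j. x - (real j * s) *\<^sub>R e \<notin> \<Omega>" J, OF out] by auto
      have "j0 \<noteq> 0"
      proof
        assume "j0 = 0"
        with j0(1) x show False by (simp add: B_def)
      qed
      then obtain j where j: "j0 = Suc j" by (cases j0) auto
      have jin: "x - (real j * s) *\<^sub>R e \<in> \<Omega>" using not_less_Least[of j "\<lambda>j. x - (real j * s) *\<^sub>R e \<notin> \<Omega>"] j by (auto simp: j0_def)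
      have "real j * s \<le> real J * s" using j j0(2) s by (intro mult_right_mono) auto
      then have "x - (real j * s) *\<^sub>R e \<in> ball a r" by (intro near order_trans[OF _ J(2)]) (use s in simp_all)
      moreover have "x - (real j * s) *\<^sub>R e - s *\<^sub>R e \<notin> \<Omega>" using j0(1) j by (simp add: algebra_simps)
      ultimately show ?thesis using jin j j0(2) by (intro exI[of _ j]) (auto simp: A_def)
    qed
    have tr: "emeasure lborel {x. x - (real j * s) *\<^sub>R e \<in> A s} = emeasure lborel (A s)" for j
    proof -
      have M: "{x. x - (real j * s) *\<^sub>R e \<in> A s} \<in> sets lborel" by measurable
      have "emeasure lborel {x. x - (real j * s) *\<^sub>R e \<in> A s} = (\<integral>\<^sup>+x. indicator {x. x - (real j * s) *\<^sub>R e \<in> A s} x \<partial>lborel)"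
        using M by (rule nn_integral_indicator[symmetric])
      also have "\<dots> = (\<integral>\<^sup>+x. indicator (A s) (x + - ((real j * s) *\<^sub>R e)) \<partial>lborel)"
        by (intro nn_integral_cong) (simp add: indicator_def)
      also have "\<dots> = (\<integral>\<^sup>+x. indicator (A s) x \<partial>lborel)" by (rule nn_integral_shift) measurable
      finally show ?thesis by simp
    qed
    have "emeasure lborel B \<le> emeasure lborel (\<Union>j\<in>{..<J}. {x. x - (real j * s) *\<^sub>R e \<in> A s})"
      by (rule emeasure_mono) (use cover in auto)
    also have "\<dots> \<le> (\<Sum>j\<in>{..<J}. emeasure lborel {x. x - (real j * s) *\<^sub>R e \<in> A s})"
      by (rule emeasure_subadditive_finite) auto
    also have "\<dots> = of_nat J * emeasure lborel (A s)" unfolding tr by simp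
    finally have "ennreal \<beta> \<le> ennreal (real J * measure lborel (A s))"
      using Bfin Afin[of s] by (simp add: \<beta>_def emeasure_eq_ennreal_measure ennreal_mult ennreal_of_nat_eq_real_of_nat top_unique less_top)
    then have "\<beta> \<le> real J * measure lborel (A s)" by (subst (asm) ennreal_le_iff) auto
    then have "\<beta> * s \<le> (real J * measure lborel (A s)) * s" using s by (intro mult_right_mono) auto
    also have "\<dots> = (real J * s) * measure lborel (A s)" by simp
    also have "\<dots> \<le> r * measure lborel (A s)"
      using J(2) r' s by (intro mult_right_mono) auto
    finally show ?thesis .
  qed
  have strip: "m\<^sup>2 * measure lborel (A s) \<le> s\<^sup>2 * (nrm \<Omega> (grad \<Omega> u))\<^sup>2" if s: "s > 0" for s
  proof -
    note S = strip_estimate[OF op bd u c(2) s Am[of s]]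
    have z: "x \<in> A s \<Longrightarrow> x - s *\<^sub>R e \<notin> \<Omega>" for x by (simp add: A_def)
    have I1: "integrable (lebesgue_on \<Omega>) (\<lambda>x. (norm (u x * indicator (A s) x))\<^sup>2)" by (rule L2_norm_integrable[OF S(1)[OF z]])
    have Ai: "(\<integral>x. m\<^sup>2 * indicator (A s) x \<partial>lebesgue_on \<Omega>) = (\<integral>x. m\<^sup>2 * indicator (A s) x \<partial>lborel)"
      by (rule integral_lebesgue_on_eq_lborel[OF op]) (auto simp: A_def indicator_def)
    have ind: "integrable lborel (\<lambda>x. m\<^sup>2 * indicator (A s) x)"
      using Afin[of s] by (intro integrable_mult_right integrable_real_indicator) auto
    have I2: "integrable (lebesgue_on \<Omega>) (\<lambda>x. m\<^sup>2 * indicator (A s) x)"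
      by (subst rep_integral(2)[OF op borel_imp_lebesgue_on, of _ "\<lambda>x. m\<^sup>2 * indicator (A s) x"])
         (use ind in \<open>auto simp: rep_def A_def indicator_def\<close>)
    have "m\<^sup>2 * measure lborel (A s) = (\<integral>x. m\<^sup>2 * indicator (A s) x \<partial>lebesgue_on \<Omega>)"
      unfolding Ai using Afin[of s] by simp
    also have "\<dots> \<le> (\<integral>x. (norm (u x * indicator (A s) x))\<^sup>2 \<partial>lebesgue_on \<Omega>)"
    proof (rule integral_mono_AE[OF I2 I1])
      show "AE x in lebesgue_on \<Omega>. m\<^sup>2 * indicator (A s) x \<le> (norm (u x * indicator (A s) x))\<^sup>2"
        using eq
      proof eventually_elim
        case (elim x)
        show ?case
        proof (cases "x \<in> A s")
          case True
          then have "m \<le> \<bar>g x\<bar>" by (intro gm) (auto simp: A_def)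
          then have "m\<^sup>2 \<le> \<bar>g x\<bar>\<^sup>2" using m by (intro power_mono) auto
          then show ?thesis using True elim by simp
        qed simp
      qed
    qed
    also have "\<dots> = (nrm \<Omega> (\<lambda>x. u x * indicator (A s) x))\<^sup>2" by (simp only: nrm_square)
    also have "\<dots> \<le> (s * nrm \<Omega> (grad \<Omega> u))\<^sup>2" by (rule power_mono[OF S(2)[OF z]]) auto
    finally show ?thesis by (simp add: power_mult_distrib)
  qed
  define C where "C = r * (nrm \<Omega> (grad \<Omega> u))\<^sup>2 / m\<^sup>2"
  have bnd: "\<beta> \<le> s * C" if s: "s > 0" "s < r / 2" for s
  proof -
    have "measure lborel (A s) \<le> s\<^sup>2 * (nrm \<Omega> (grad \<Omega> u))\<^sup>2 / m\<^sup>2" using strip[OF s(1)] m by (simp add: field_simps)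
    then have "r * measure lborel (A s) \<le> r * (s\<^sup>2 * (nrm \<Omega> (grad \<Omega> u))\<^sup>2 / m\<^sup>2)" using r(1) by (intro mult_left_mono) auto
    with meas[OF s] have "\<beta> * s \<le> (s * C) * s" by (simp add: C_def power2_eq_square mult_ac)
    then show ?thesis using s by (simp add: mult.commute)
  qed
  have C0: "C \<ge> 0" using r(1) by (simp add: C_def)
  define s where "s = min (r / 4) (\<beta> / (2 * (C + 1)))"
  have s: "s > 0" "s < r / 2" using r(1) \<beta> C0 by (auto simp: s_def)
  have "s * C \<le> \<beta> / (2 * (C + 1)) * (C + 1)" using C0 s(1) \<beta> by (intro mult_mono) (auto simp: s_def)
  also have "\<dots> = \<beta> / 2" using C0 by (simp add: field_simps)
  finally show False using bnd[OF s] \<beta> by simp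
qed

section \<open>Piecewise affine functions in \<open>H\<^sub>0\<^sup>1\<close>\<close>

text \<open>The class of piecewise affine functions introduced here contains the finite element functions that vanish
  outside the domain and, unlike a finite element space, is stable under truncation.\<close>

definition affine_near :: "('a::euclidean_space \<Rightarrow> real) \<Rightarrow> 'a \<Rightarrow> 'a \<Rightarrow> bool" where
  "affine_near q z b \<longleftrightarrow> (\<exists>d>0. \<forall>y\<in>ball z d. q y = q z + b \<bullet> (y - z))"

text \<open>The last clause is the form in which it is used that level sets of an affine function are null sets
  unless the function is constant; truncation at a level then preserves the class.\<close>

definition pw_affine :: "'a::euclidean_space set \<Rightarrow> real \<Rightarrow> ('a \<Rightarrow> real) \<Rightarrow> bool" where
  "pw_affine S L q \<longleftrightarrow> (\<forall>x d. \<bar>q (x + d) - q x\<bar> \<le> L * norm d) \<and> (\<forall>x. x \<notin> S \<longrightarrow> q x = 0) \<and>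
     (AE z in lebesgue. z \<in> S \<longrightarrow> (\<exists>b. affine_near q z b)) \<and>
     (\<forall>c. AE z in lebesgue. z \<in> S \<and> q z = c \<longrightarrow> affine_near q z 0)"

text \<open>The limit of difference quotients where it exists. The case distinctions only keep the function bounded and
  measurable on the exceptional null set.\<close>

definition dgrad :: "'a::euclidean_space set \<Rightarrow> real \<Rightarrow> ('a \<Rightarrow> real) \<Rightarrow> 'a \<Rightarrow> 'a" where
  "dgrad S L q z = (\<Sum>i\<in>Basis. (if z \<in> S \<and> \<bar>lim (\<lambda>m. diff_quot i q m z)\<bar> \<le> L then lim (\<lambda>m. diff_quot i q m z) else 0) *\<^sub>R i)"

lemma dgrad_inner:
  "i \<in> Basis \<Longrightarrow> dgrad S L q z \<bullet> i = (if z \<in> S \<and> \<bar>lim (\<lambda>m. diff_quot i q m z)\<bar> \<le> L then lim (\<lambda>m. diff_quot i q m z) else 0)"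
  by (simp add: dgrad_def)

lemma diff_quot_affine_near:
  assumes "affine_near q z b" and i: "i \<in> Basis"
  shows "(\<lambda>m. diff_quot i q m z) \<longlonglongrightarrow> b \<bullet> i"
proof (rule tendsto_eventually)
  obtain d where d: "d > 0" "\<And>y. y \<in> ball z d \<Longrightarrow> q y = q z + b \<bullet> (y - z)" using assms(1) unfolding affine_near_def by blast
  have "eventually (\<lambda>m. 1 / (real m + 1) < d) sequentially"
  proof (rule order_tendstoD(2)[OF _ d(1)])
    show "(\<lambda>m. 1 / (real m + 1)) \<longlonglongrightarrow> 0" by real_asymp
  qed
  then show "eventually (\<lambda>m. diff_quot i q m z = b \<bullet> i) sequentially"
  proof eventually_elim
    case (elim m)
    have "z + (1 / (real m + 1)) *\<^sub>R i \<in> ball z d" using elim i by (simp add: dist_norm)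
    from d(2)[OF this] show ?case by (simp add: diff_quot_def)
  qed
qed

lemma affine_near_lipschitz:
  assumes L: "\<And>x d. \<bar>q (x + d) - q x\<bar> \<le> L * norm d" and "affine_near q z b" "i \<in> Basis"
  shows "\<bar>b \<bullet> i\<bar> \<le> L"
proof (rule Lim_bounded[OF tendsto_rabs[OF diff_quot_affine_near[OF assms(2,3)]]])
  show "\<forall>m\<ge>0. \<bar>diff_quot i q m z\<bar> \<le> L" using diff_quot_bound[OF L] assms(3) by simp
qed

lemma dgrad_affine_near:
  assumes L: "\<And>x d. \<bar>q (x + d) - q x\<bar> \<le> L * norm d" and b: "affine_near q z b" and z: "z \<in> S"
  shows "dgrad S L q z = b"
proof (rule euclidean_eqI)
  fix i :: 'a assume i: "i \<in> Basis"
  show "dgrad S L q z \<bullet> i = b \<bullet> i"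
    using limI[OF diff_quot_affine_near[OF b i]] affine_near_lipschitz[OF L b i] z by (simp add: dgrad_inner[OF i])
qed

lemma pw_affine_props:
  fixes S :: "'a::euclidean_space set"
  assumes S: "open S" "bounded S" "negligible (frontier S)" and q: "pw_affine S L q"
  shows "cL2 q" "\<And>i. i \<in> Basis \<Longrightarrow> cL2 (\<lambda>z. dgrad S L q z \<bullet> i)"
    "\<And>i. i \<in> Basis \<Longrightarrow> AE z in lborel. (\<lambda>m. diff_quot i q m z) \<longlonglongrightarrow> dgrad S L q z \<bullet> i"
proof -
  have L: "\<bar>q (x + d) - q x\<bar> \<le> L * norm d" and z0: "x \<notin> S \<Longrightarrow> q x = 0"
    and aff: "AE z in lebesgue. z \<in> S \<longrightarrow> (\<exists>b. affine_near q z b)" for x d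
    using q by (auto simp: pw_affine_def)
  have [measurable]: "S \<in> sets borel" using S by auto
  obtain R where R: "\<And>x. x \<in> S \<Longrightarrow> norm x \<le> R" using S(2) by (auto simp: bounded_iff)
  obtain i0 :: 'a where "i0 \<in> Basis" using nonempty_Basis by blast
  then have L0: "L \<ge> 0" using order_trans[OF abs_ge_zero L[of 0 i0]] by simp
  have "continuous_on UNIV q"
    unfolding continuous_on_iff
  proof (intro ballI allI impI)
    fix x and e :: real assume e: "e > 0"
    show "\<exists>d>0. \<forall>x'\<in>UNIV. dist x' x < d \<longrightarrow> dist (q x') (q x) < e"
    proof (intro exI[of _ "e / (L + 1)"] conjI ballI impI)
      fix x' assume "dist x' x < e / (L + 1)"
      then have "(L + 1) * norm (x' - x) < e" using L0 by (simp add: dist_norm field_simps)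
      moreover have "L * norm (x' - x) \<le> (L + 1) * norm (x' - x)" by (rule mult_right_mono) auto
      moreover have "\<bar>q x' - q x\<bar> \<le> L * norm (x' - x)" using L[of x "x' - x"] by simp
      ultimately show "dist (q x') (q x) < e" by (simp add: dist_real_def)
    qed (use e L0 in simp)
  qed
  then have qm[measurable]: "q \<in> borel_measurable borel" by (rule borel_measurable_continuous_onI)
  show "cL2 q"
  proof (rule cL2_bounded[OF qm, of "L * (2 * \<bar>R\<bar> + 1)" R])
    fix x
    show "\<bar>q x\<bar> \<le> L * (2 * \<bar>R\<bar> + 1)"
    proof (cases "x \<in> S")
      case True
      \<comment> \<open>a point outside \<open>S\<close>, where \<open>q\<close> vanishes\<close>
      have "(\<bar>R\<bar> + 1) *\<^sub>R i0 \<notin> S" using R[of "(\<bar>R\<bar> + 1) *\<^sub>R i0"] \<open>i0 \<in> Basis\<close> by auto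
      then have "\<bar>q x\<bar> \<le> L * norm (x - (\<bar>R\<bar> + 1) *\<^sub>R i0)" using z0 L[of "(\<bar>R\<bar> + 1) *\<^sub>R i0" "x - (\<bar>R\<bar> + 1) *\<^sub>R i0"] by simp
      also have "\<dots> \<le> L * (2 * \<bar>R\<bar> + 1)"
        using R[OF True] norm_triangle_ineq4[of x "(\<bar>R\<bar> + 1) *\<^sub>R i0"] \<open>i0 \<in> Basis\<close> L0 by (intro mult_left_mono) auto
      finally show ?thesis .
    qed (use z0 L0 in simp)
    show "R < norm x \<Longrightarrow> q x = 0" using R[of x] z0[of x] by auto
  qed
  fix i :: 'a assume i: "i \<in> Basis"
  have dm: "diff_quot i q m \<in> borel_measurable borel" for m unfolding diff_quot_def[abs_def] by measurable
  have gm: "(\<lambda>z. dgrad S L q z \<bullet> i) \<in> borel_measurable borel"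
    unfolding dgrad_inner[OF i] using dm by measurable
  show "cL2 (\<lambda>z. dgrad S L q z \<bullet> i)"
    by (rule cL2_bounded[OF gm, of L R]) (use L0 R in \<open>force simp: dgrad_inner[OF i]\<close>)+
  have fr: "AE z in lebesgue. z \<notin> frontier S" using S(3) negligible_iff_AE[of "\<lambda>z. z \<notin> frontier S"] by simp
  from aff fr have "AE z in lebesgue. (\<lambda>m. diff_quot i q m z) \<longlonglongrightarrow> dgrad S L q z \<bullet> i"
  proof eventually_elim
    case (elim z)
    show ?case
    proof (cases "z \<in> S")
      case True
      then obtain b where b: "affine_near q z b" using elim by blast
      show ?thesis using diff_quot_affine_near[OF b i] dgrad_affine_near[OF L b True] by simp
    next
      case False
      then have "z \<in> - closure S" using elim(2) closure_Un_frontier[of S] by auto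
      then obtain d where d: "d > 0" "ball z d \<subseteq> - closure S" using open_contains_ball[of "- closure S"] by blast
      have "affine_near q z 0"
        unfolding affine_near_def
      proof (intro exI[of _ d] conjI ballI d(1))
        fix y assume "y \<in> ball z d"
        then have "y \<notin> S" using d(2) closure_subset by blast
        then show "q y = q z + 0 \<bullet> (y - z)" using z0 False by simp
      qed
      from diff_quot_affine_near[OF this i] show ?thesis using False by (simp add: dgrad_inner[OF i])
    qed
  qed
  then show "AE z in lborel. (\<lambda>m. diff_quot i q m z) \<longlonglongrightarrow> dgrad S L q z \<bullet> i"
    using dm gm by (subst (asm) AE_completion_iff) auto
qed

lemma pw_affine_H1:
  fixes S :: "'a::euclidean_space set"
  assumes S: "open S" "bounded S" "negligible (frontier S)" and q: "pw_affine S L q"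
  shows "weak_gradient S q (dgrad S L q)" "q \<in> L2 S" "dgrad S L q \<in> L2 S" "q \<in> H1 S"
proof -
  note P = pw_affine_props[OF S q]
  have L: "\<bar>q (x + d) - q x\<bar> \<le> L * norm d" for x d using q by (auto simp: pw_affine_def)
  show "weak_gradient S q (dgrad S L q)" "q \<in> L2 S" "dgrad S L q \<in> L2 S"
    using lipschitz_weak_gradient[OF S(1,2) P(1) L cL2_borel[OF P(2)] P(3)] by auto
  then show "q \<in> H1 S" by (auto intro: H1I)
qed

lemma nrm_eq_N2:
  assumes S: "open S" "bounded S" and V: "cL2 V" "\<And>x. x \<notin> S \<Longrightarrow> V x = 0"
  shows "ennreal ((nrm S V)\<^sup>2) = N2 V"
proof -
  have r: "rep S V V" using V cL2_borel[OF V(1)] by (auto simp: rep_def)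
  show ?thesis
    using rep_integral_square[OF S(1) borel_imp_lebesgue_on[OF cL2_borel[OF V(1)]] r] N2_eq_integral[OF V(1)]
    by (simp add: nrm_square)
qed

text \<open>As the support is a compact subset of \<open>S\<close>, the mollified functions are test functions. Their gradient is the
  mollified gradient and converges in \<open>L\<^sup>2\<close>.\<close>

lemma pw_affine_compact_support_H10:
  fixes S :: "'a::euclidean_space set"
  assumes S: "open S" "bounded S" "negligible (frontier S)" and q: "pw_affine S L q"
    and K: "compact K" "K \<subseteq> S" "\<And>x. x \<notin> K \<Longrightarrow> q x = 0"
  shows "q \<in> H10 S"
  unfolding H10_iff
proof (intro conjI allI impI pw_affine_H1(4)[OF S q])
  fix \<epsilon> :: real assume \<epsilon>: "\<epsilon> > 0"
  note P = pw_affine_props[OF S q] note W = pw_affine_H1[OF S q]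
  have L: "\<bar>q (x + d) - q x\<bar> \<le> L * norm d" for x d using q by (auto simp: pw_affine_def)
  let ?G = "\<lambda>i z. dgrad S L q z \<bullet> i"
  obtain r where r: "r > 0" "(\<Union>x\<in>K. cball x r) \<subseteq> S"
    by (rule compact_subset_open_imp_cball_epsilon_subset[OF K(1) S(1) K(2)])
  define e where "e k = r / (real k + 1)" for k :: nat
  have e: "e k > 0" "e k \<le> r" "e \<longlonglongrightarrow> 0" for k
    using r(1) unfolding e_def by (simp, simp add: divide_le_eq, real_asymp)
  define \<phi> where "\<phi> k = conv q (rho (e k))" for k
  have \<phi>: "\<phi> k \<in> test_functions S" for k
    unfolding \<phi>_def
  proof (rule conv_test_function[OF cL2_integrable[OF P(1)] K(1,3) e(1)])
    fix x y assume "x \<in> K" "dist x y \<le> e k"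
    then show "y \<in> S" using e(2)[of k] by (intro subsetD[OF r(2)] UN_I[of x]) auto
  qed
  have pdphi: "pd i (\<phi> k) x = conv (?G i) (rho (e k)) x" if i: "i \<in> Basis" for i k x
  proof -
    define \<psi> where "\<psi> z = rho (e k) (x + (-1) *\<^sub>R z)" for z
    have \<psi>: "\<psi> \<in> test_functions UNIV"
    proof (rule test_functionsI[where K = "cball x (e k)"])
      show "C_k m \<psi>" for m unfolding \<psi>_def by (rule C_k_affine[OF test_functions_C_k[OF rho_test[OF e(1)]]])
      show "\<psi> z = 0" if "z \<notin> cball x (e k)" for z
        unfolding \<psi>_def by (rule rho_zero[OF e(1)]) (use that in \<open>simp add: dist_norm\<close>)
    qed auto
    have p: "pd i \<psi> z = - pd i (rho (e k)) (x - z)" for z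
      unfolding \<psi>_def using pd_affine(1)[OF test_functions_differentiable[OF rho_test[OF e(1)]], where a = x and c = "-1" and x = z and i = i] by simp
    have "(\<integral>z. q z * pd i \<psi> z \<partial>lborel) = - (\<integral>z. ?G i z * \<psi> z \<partial>lborel)"
      by (rule lipschitz_integration_by_parts[OF P(1) L cL2_borel[OF P(2)[OF i]] i P(3)[OF i] \<psi>])
    then have "conv q (pd i (rho (e k))) x = conv (?G i) (rho (e k)) x" unfolding p by (simp add: conv_def \<psi>_def)
    then show ?thesis unfolding \<phi>_def using pd_conv[OF cL2_integrable[OF P(1)] rho_test[OF e(1)] i] by simp
  qed
  have supp: "\<psi> x = 0" if "\<psi> \<in> test_functions S" "x \<notin> S" for \<psi> :: "'a \<Rightarrow> real" and x
    by (rule test_functions_compact[OF that(1)]) (use that(2) in blast)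
  have sq: "ennreal ((H1_norm S (\<lambda>x. q x - \<phi> k x))\<^sup>2)
     = N2 (\<lambda>x. conv q (rho (e k)) x - q x) + (\<Sum>i\<in>Basis. N2 (\<lambda>x. conv (?G i) (rho (e k)) x - ?G i x))" for k
  proof -
    note t = test_H1[OF S(1,2) \<phi>[of k]]
    have w: "weak_gradient S (\<lambda>x. q x - \<phi> k x) (\<lambda>x. dgrad S L q x - tgrad (\<phi> k) x)"
      by (rule weak_gradient_diff[OF S(1) W(1) t(2)])
    have dL: "(\<lambda>x. dgrad S L q x - tgrad (\<phi> k) x) \<in> L2 S" by (rule L2_diff(1)[OF W(3) t(4)])
    have "(H1_norm S (\<lambda>x. q x - \<phi> k x))\<^sup>2 = (nrm S (\<lambda>x. q x - \<phi> k x))\<^sup>2 + (\<Sum>i\<in>Basis. (nrm S (\<lambda>x. ?G i x - pd i (\<phi> k) x))\<^sup>2)"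
      unfolding H1_norm_eq nrm_grad[OF S(1) w] nrm_component_sum[OF dL] by (simp add: inner_diff_left tgrad_inner sum_nonneg)
    then have "ennreal ((H1_norm S (\<lambda>x. q x - \<phi> k x))\<^sup>2) = ennreal ((nrm S (\<lambda>x. q x - \<phi> k x))\<^sup>2) + (\<Sum>i\<in>Basis. ennreal ((nrm S (\<lambda>x. ?G i x - pd i (\<phi> k) x))\<^sup>2))"
      by (simp add: sum_nonneg)
    also have "ennreal ((nrm S (\<lambda>x. q x - \<phi> k x))\<^sup>2) = N2 (\<lambda>x. q x - \<phi> k x)"
    proof (rule nrm_eq_N2[OF S(1,2)])
      show "cL2 (\<lambda>x. q x - \<phi> k x)" by (rule cL2_diff[OF P(1) test_functions_cL2[OF \<phi>]])
      show "q x - \<phi> k x = 0" if "x \<notin> S" for x using supp[OF \<phi> that] K(2,3) that by auto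
    qed
    also have "(\<Sum>i\<in>Basis. ennreal ((nrm S (\<lambda>x. ?G i x - pd i (\<phi> k) x))\<^sup>2)) = (\<Sum>i\<in>Basis. N2 (\<lambda>x. ?G i x - pd i (\<phi> k) x))"
    proof (rule sum.cong[OF refl], rule nrm_eq_N2[OF S(1,2)])
      fix i :: 'a assume i: "i \<in> Basis"
      show "cL2 (\<lambda>x. ?G i x - pd i (\<phi> k) x)" by (rule cL2_diff[OF P(2)[OF i] test_functions_cL2[OF test_functions_pd[OF \<phi> i]]])
      show "?G i x - pd i (\<phi> k) x = 0" if "x \<notin> S" for x
        using supp[OF test_functions_pd[OF \<phi> i] that] that by (simp add: dgrad_inner[OF i])
    qed
    also have "N2 (\<lambda>x. q x - \<phi> k x) = N2 (\<lambda>x. conv q (rho (e k)) x - q x)"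
      by (simp add: N2_def \<phi>_def power2_commute)
    also have "(\<Sum>i\<in>Basis. N2 (\<lambda>x. ?G i x - pd i (\<phi> k) x)) = (\<Sum>i\<in>Basis. N2 (\<lambda>x. conv (?G i) (rho (e k)) x - ?G i x))"
      by (rule sum.cong[OF refl]) (simp add: N2_def pdphi power2_commute)
    finally show ?thesis .
  qed
  have "(\<lambda>k. N2 (\<lambda>x. conv q (rho (e k)) x - q x) + (\<Sum>i\<in>(Basis::'a set). N2 (\<lambda>x. conv (?G i) (rho (e k)) x - ?G i x))) \<longlonglongrightarrow> 0 + (\<Sum>i\<in>(Basis::'a set). 0)"
    by (intro tendsto_add tendsto_sum N2_conv_tendsto P e)
  then have "(\<lambda>k. ennreal ((H1_norm S (\<lambda>x. q x - \<phi> k x))\<^sup>2)) \<longlonglongrightarrow> 0" unfolding sq by simp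
  then have "eventually (\<lambda>k. ennreal ((H1_norm S (\<lambda>x. q x - \<phi> k x))\<^sup>2) < ennreal (\<epsilon>\<^sup>2)) sequentially"
    using \<epsilon> by (intro order_tendstoD) auto
  then obtain k where "ennreal ((H1_norm S (\<lambda>x. q x - \<phi> k x))\<^sup>2) < ennreal (\<epsilon>\<^sup>2)" by (auto simp: eventually_sequentially)
  then have "(H1_norm S (\<lambda>x. q x - \<phi> k x))\<^sup>2 < \<epsilon>\<^sup>2" by (simp add: ennreal_less_iff)
  then have "H1_norm S (\<lambda>x. q x - \<phi> k x) < \<epsilon>" by (rule power_less_imp_less_base) (use \<epsilon> in simp)
  then show "\<exists>\<phi>\<in>test_functions S. H1_norm S (\<lambda>x. q x - \<phi> x) < \<epsilon>" using \<phi> by blast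
qed

definition clamp1 :: "real \<Rightarrow> real \<Rightarrow> real" where
  "clamp1 \<delta> t = max (- \<delta>) (min \<delta> t)"

lemma clamp1_affine_near:
  fixes q :: "'a::euclidean_space \<Rightarrow> real"
  assumes \<delta>: "\<delta> > 0" and b: "affine_near q z b" and reg: "\<bar>q z\<bar> = \<delta> \<Longrightarrow> b = 0"
  shows "affine_near (\<lambda>x. clamp1 \<delta> (q x)) z (if \<bar>q z\<bar> < \<delta> then b else 0)"
proof -
  obtain d where d: "d > 0" "\<And>y. y \<in> ball z d \<Longrightarrow> q y = q z + b \<bullet> (y - z)" using b unfolding affine_near_def by blast
  \<comment> \<open>on a small ball \<open>q\<close> stays on the same side of the levels\<close>
  define e where "e = (if b = 0 then d else min d (\<bar>\<delta> - \<bar>q z\<bar>\<bar> / norm b))"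
  have e: "e > 0" "e \<le> d" using d(1) reg by (cases "b = 0"; cases "\<bar>q z\<bar> = \<delta>"; simp add: e_def)+
  have "clamp1 \<delta> (q y) = clamp1 \<delta> (q z) + (if \<bar>q z\<bar> < \<delta> then b else 0) \<bullet> (y - z)" if y: "y \<in> ball z e" for y
  proof -
    have qy: "q y = q z + b \<bullet> (y - z)" using d(2)[of y] y e(2) by auto
    have "\<bar>b \<bullet> (y - z)\<bar> < \<bar>\<delta> - \<bar>q z\<bar>\<bar>" if bn: "b \<noteq> 0"
    proof -
      have C: "\<bar>b \<bullet> (y - z)\<bar> \<le> norm b * norm (y - z)" by (rule Cauchy_Schwarz_ineq2)
      have "norm (y - z) < \<bar>\<delta> - \<bar>q z\<bar>\<bar> / norm b" using y bn by (auto simp: e_def dist_norm norm_minus_commute)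
      then have "norm b * norm (y - z) < norm b * (\<bar>\<delta> - \<bar>q z\<bar>\<bar> / norm b)" using bn by (intro mult_strict_left_mono) auto
      then show ?thesis using C bn by simp
    qed
    then show ?thesis using qy reg \<delta> by (cases "b = 0") (auto simp: clamp1_def)
  qed
  then show ?thesis using e(1) unfolding affine_near_def by blast
qed

lemma clamp1_lipschitz: "\<bar>clamp1 \<delta> s - clamp1 \<delta> t\<bar> \<le> \<bar>s - t\<bar>"
  "\<bar>(s - clamp1 \<delta> s) - (t - clamp1 \<delta> t)\<bar> \<le> \<bar>s - t\<bar>"
  by (auto simp: clamp1_def min_def max_def)

lemma affine_near_diff:
  assumes "affine_near p z b" "affine_near q z c" shows "affine_near (\<lambda>x. p x - q x) z (b - c)"
proof -
  obtain d d' where d: "d > 0" "\<And>y. y \<in> ball z d \<Longrightarrow> p y = p z + b \<bullet> (y - z)"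
    "d' > 0" "\<And>y. y \<in> ball z d' \<Longrightarrow> q y = q z + c \<bullet> (y - z)" using assms unfolding affine_near_def by blast
  have "p y - q y = p z - q z + (b - c) \<bullet> (y - z)" if "y \<in> ball z (min d d')" for y
    using d(2)[of y] d(4)[of y] that by (simp add: inner_diff_left)
  moreover have "min d d' > 0" using d(1,3) by simp
  ultimately show ?thesis unfolding affine_near_def by blast
qed

text \<open>At almost every point \<open>\<bar>q\<bar>\<close> is either off the level \<open>\<delta>\<close>, or \<open>q\<close> is locally constant. In both cases
  truncation acts locally as the identity or as a constant.\<close>

lemma pw_affine_clamp:
  assumes q: "pw_affine S L q" and \<delta>: "\<delta> > 0"
  shows "pw_affine S L (\<lambda>x. clamp1 \<delta> (q x))" "pw_affine S L (\<lambda>x. q x - clamp1 \<delta> (q x))"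
    "AE z in lebesgue. z \<in> S \<longrightarrow> dgrad S L (\<lambda>x. clamp1 \<delta> (q x)) z = (if \<bar>q z\<bar> < \<delta> then dgrad S L q z else 0)"
proof -
  have L: "\<bar>q (x + d) - q x\<bar> \<le> L * norm d" and z0: "x \<notin> S \<Longrightarrow> q x = 0"
    and aff: "AE z in lebesgue. z \<in> S \<longrightarrow> (\<exists>b. affine_near q z b)" and lev: "AE z in lebesgue. z \<in> S \<and> q z = c \<longrightarrow> affine_near q z 0" for x d c
    using q by (auto simp: pw_affine_def)
  have Lc: "\<bar>clamp1 \<delta> (q (x + d)) - clamp1 \<delta> (q x)\<bar> \<le> L * norm d"
    "\<bar>(q (x + d) - clamp1 \<delta> (q (x + d))) - (q x - clamp1 \<delta> (q x))\<bar> \<le> L * norm d" for x d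
    by (rule order_trans[OF clamp1_lipschitz(1) L], rule order_trans[OF clamp1_lipschitz(2) L])
  have c0: "clamp1 \<delta> 0 = 0" using \<delta> by (simp add: clamp1_def)
  have A: "AE z in lebesgue. z \<in> S \<longrightarrow> (\<exists>b. affine_near q z b \<and> (\<bar>q z\<bar> = \<delta> \<longrightarrow> b = 0))"
    using aff lev[of \<delta>] lev[of "- \<delta>"] by eventually_elim (use \<delta> in \<open>auto simp: abs_if split: if_splits\<close>)
  have near: "affine_near (\<lambda>x. clamp1 \<delta> (q x)) z (if \<bar>q z\<bar> < \<delta> then b else 0)"
     "affine_near (\<lambda>x. q x - clamp1 \<delta> (q x)) z (b - (if \<bar>q z\<bar> < \<delta> then b else 0))"
    if "affine_near q z b" "\<bar>q z\<bar> = \<delta> \<longrightarrow> b = 0" for z b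
    using clamp1_affine_near[OF \<delta> that(1)] affine_near_diff[OF that(1)] that(2) by auto
  have lev0: "AE z in lebesgue. z \<in> S \<and> q z - clamp1 \<delta> (q z) = c \<longrightarrow> affine_near (\<lambda>x. q x - clamp1 \<delta> (q x)) z 0" for c
  proof -
    \<comment> \<open>a nonzero value determines the value of \<open>q\<close>; where the value is 0, \<open>q\<close> does not exceed the level\<close>
    have "AE z in lebesgue. z \<in> S \<and> q z = (if c > 0 then c + \<delta> else c - \<delta>) \<longrightarrow> affine_near q z 0" by (rule lev)
    then show ?thesis using A
    proof eventually_elim
      case (elim z)
      show ?case
      proof
        assume z: "z \<in> S \<and> q z - clamp1 \<delta> (q z) = c"
        show "affine_near (\<lambda>x. q x - clamp1 \<delta> (q x)) z 0"
        proof (cases "\<bar>q z\<bar> \<le> \<delta>")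
          case True
          obtain b where b: "affine_near q z b" "\<bar>q z\<bar> = \<delta> \<longrightarrow> b = 0" using elim(2) z by blast
          then have "b - (if \<bar>q z\<bar> < \<delta> then b else 0) = 0" using True by auto
          then show ?thesis using near(2)[OF b] by simp
        next
          case False
          then have "q z = (if c > 0 then c + \<delta> else c - \<delta>)" using z \<delta> by (auto simp: clamp1_def min_def max_def split: if_splits)
          then have "affine_near q z 0" using elim(1) z by blast
          from near(2)[OF this] show ?thesis by simp
        qed
      qed
    qed
  qed
  have lev1: "AE z in lebesgue. z \<in> S \<and> clamp1 \<delta> (q z) = c \<longrightarrow> affine_near (\<lambda>x. clamp1 \<delta> (q x)) z 0" for c
    using A lev[of c]
  proof eventually_elim
    case (elim z)
    show ?case
    proof
      assume z: "z \<in> S \<and> clamp1 \<delta> (q z) = c"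
      show "affine_near (\<lambda>x. clamp1 \<delta> (q x)) z 0"
      proof (cases "\<bar>q z\<bar> < \<delta>")
        case True
        then have "q z = c" using z by (auto simp: clamp1_def)
        then have "affine_near q z 0" using elim(2) z by blast
        from near(1)[OF this] show ?thesis by simp
      next
        case False
        obtain b where b: "affine_near q z b" "\<bar>q z\<bar> = \<delta> \<longrightarrow> b = 0" using elim(1) z by blast
        from near(1)[OF b] show ?thesis using False by simp
      qed
    qed
  qed
  have aff1: "AE z in lebesgue. z \<in> S \<longrightarrow> (\<exists>b. affine_near (\<lambda>x. clamp1 \<delta> (q x)) z b)"
    using A by eventually_elim (use near(1) in blast)
  have aff0: "AE z in lebesgue. z \<in> S \<longrightarrow> (\<exists>b. affine_near (\<lambda>x. q x - clamp1 \<delta> (q x)) z b)"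
    using A by eventually_elim (use near(2) in blast)
  show "pw_affine S L (\<lambda>x. clamp1 \<delta> (q x))" unfolding pw_affine_def using Lc(1) z0 c0 aff1 lev1 by simp
  show "pw_affine S L (\<lambda>x. q x - clamp1 \<delta> (q x))" unfolding pw_affine_def using Lc(2) z0 c0 aff0 lev0 by simp
  show "AE z in lebesgue. z \<in> S \<longrightarrow> dgrad S L (\<lambda>x. clamp1 \<delta> (q x)) z = (if \<bar>q z\<bar> < \<delta> then dgrad S L q z else 0)"
    using A
  proof eventually_elim
    case (elim z)
    show ?case
    proof
      assume z: "z \<in> S"
      obtain b where b: "affine_near q z b" "\<bar>q z\<bar> = \<delta> \<longrightarrow> b = 0" using elim z by blast
      show "dgrad S L (\<lambda>x. clamp1 \<delta> (q x)) z = (if \<bar>q z\<bar> < \<delta> then dgrad S L q z else 0)"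
        using dgrad_affine_near[OF Lc(1) near(1)[OF b] z] dgrad_affine_near[OF L b(1) z] by simp
    qed
  qed
qed

text \<open>Cutting off the values in \<open>[- \<delta>, \<delta>]\<close> makes the support compact. The part cut off is small in \<open>H\<^sup>1\<close>
  because the gradient of \<open>q\<close> vanishes almost everywhere on the zero set of \<open>q\<close>.\<close>

lemma pw_affine_H10:
  fixes S :: "'a::euclidean_space set"
  assumes S: "open S" "bounded S" "negligible (frontier S)" and q: "pw_affine S L q"
  shows "q \<in> H10 S"
proof (rule H10_limit[OF S(1,2) pw_affine_H1(4)[OF S q]])
  fix \<epsilon> :: real assume \<epsilon>: "\<epsilon> > 0"
  have L: "\<bar>q (x + d) - q x\<bar> \<le> L * norm d" and z0: "x \<notin> S \<Longrightarrow> q x = 0"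
    and lev: "AE z in lebesgue. z \<in> S \<and> q z = 0 \<longrightarrow> affine_near q z 0" for x d
    using q by (auto simp: pw_affine_def)
  note P = pw_affine_props[OF S q] note W = pw_affine_H1[OF S q]
  have qm: "q \<in> borel_measurable (lebesgue_on S)" by (rule L2_measurable[OF W(2)])
  have Gm: "dgrad S L q \<in> borel_measurable (lebesgue_on S)" using W(3) by (simp add: L2_def)
  define \<delta> where "\<delta> m = 1 / (real m + 1)" for m :: nat
  have \<delta>: "\<delta> m > 0" "\<delta> \<longlonglongrightarrow> 0" for m unfolding \<delta>_def by (simp, real_asymp)
  define w where "w m x = clamp1 (\<delta> m) (q x)" for m x
  note Pc = pw_affine_clamp[OF q \<delta>(1), folded w_def]
  have p: "(\<lambda>x. q x - w m x) \<in> H10 S" for m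
  proof (rule pw_affine_compact_support_H10[OF S Pc(2)])
    have "continuous_on UNIV q"
    proof -
      have "L-lipschitz_on UNIV q"
      proof (rule lipschitz_onI)
        show "dist (q x) (q y) \<le> L * dist x y" for x y using L[of y "x - y"] by (simp add: dist_real_def dist_norm)
        obtain i :: 'a where "i \<in> Basis" using nonempty_Basis by blast
        then show "0 \<le> L" using order_trans[OF abs_ge_zero L[of 0 i]] by simp
      qed
      then show ?thesis by (rule lipschitz_on_continuous_on)
    qed
    then have cl: "closed {x. \<delta> m \<le> \<bar>q x\<bar>}" by (intro closed_Collect_le continuous_intros)
    have sub: "{x. \<delta> m \<le> \<bar>q x\<bar>} \<subseteq> S" using z0 \<delta>(1)[of m] by (force simp: not_le)
    then show "{x. \<delta> m \<le> \<bar>q x\<bar>} \<subseteq> S" .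
    show "compact {x. \<delta> m \<le> \<bar>q x\<bar>}" using cl bounded_subset[OF S(2) sub] by (simp add: compact_eq_bounded_closed)
    show "q x - w m x = 0" if "x \<notin> {x. \<delta> m \<le> \<bar>q x\<bar>}" for x using that by (auto simp: w_def clamp1_def)
  qed
  note Wc = pw_affine_H1[OF S Pc(1)]
  have fin: "finite_measure (lebesgue_on S)"
    using S by (intro finite_measure_lebesgue_on bounded_set_imp_lmeasurable) auto
  have lim1: "(\<lambda>m. \<integral>x. (norm (w m x))\<^sup>2 \<partial>lebesgue_on S) \<longlonglongrightarrow> (\<integral>x. 0 \<partial>lebesgue_on S)"
  proof (rule integral_dominated_convergence[where w = "\<lambda>_. 1"])
    have b: "\<bar>w m x\<bar> \<le> \<delta> m" for m x using \<delta>(1)[of m] by (auto simp: w_def clamp1_def)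
    show "AE x in lebesgue_on S. (\<lambda>m. (norm (w m x))\<^sup>2) \<longlonglongrightarrow> 0"
    proof (rule AE_I2)
      fix x
      have "(\<lambda>m. norm (w m x)) \<longlonglongrightarrow> 0"
        by (rule tendsto_sandwich[OF _ _ tendsto_const \<delta>(2)]) (use b in \<open>auto intro!: always_eventually\<close>)
      from tendsto_power[OF this, of 2] show "(\<lambda>m. (norm (w m x))\<^sup>2) \<longlonglongrightarrow> 0" by simp
    qed
    show "AE x in lebesgue_on S. norm ((norm (w m x))\<^sup>2) \<le> 1" for m
    proof (rule AE_I2)
      fix x
      have "\<delta> m \<le> 1" by (simp add: \<delta>_def)
      then have "\<bar>w m x\<bar> \<le> 1" using b[of m x] by linarith
      then show "norm ((norm (w m x))\<^sup>2) \<le> 1" by (simp add: abs_square_le_1)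
    qed
    show "(\<lambda>x. (norm (w m x))\<^sup>2) \<in> borel_measurable (lebesgue_on S)" for m
      using L2_measurable[OF Wc(2)[of m]] by measurable
  qed (use finite_measure.integrable_const[OF fin] in auto)
  have lim2: "(\<lambda>m. \<integral>x. (norm (dgrad S L (w m) x))\<^sup>2 \<partial>lebesgue_on S) \<longlonglongrightarrow> (\<integral>x. 0 \<partial>lebesgue_on S)"
  proof (rule integral_dominated_convergence[where w = "\<lambda>x. (norm (dgrad S L q x))\<^sup>2"])
    have all: "AE x in lebesgue_on S. \<forall>m. dgrad S L (w m) x = (if \<bar>q x\<bar> < \<delta> m then dgrad S L q x else 0)"
      unfolding AE_all_countable using Pc(3) S(1) by (subst AE_lebesgue_on_iff) auto
    have zero: "AE x in lebesgue_on S. q x = 0 \<longrightarrow> dgrad S L q x = 0"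
    proof -
      have "AE x in lebesgue. x \<in> S \<longrightarrow> q x = 0 \<longrightarrow> dgrad S L q x = 0"
        using lev by eventually_elim (use dgrad_affine_near[OF L] in blast)
      then show ?thesis using S(1) by (subst AE_lebesgue_on_iff) auto
    qed
    from all zero show "AE x in lebesgue_on S. (\<lambda>m. (norm (dgrad S L (w m) x))\<^sup>2) \<longlonglongrightarrow> 0"
    proof eventually_elim
      case (elim x)
      show ?case
      proof (cases "q x = 0")
        case False
        then have "eventually (\<lambda>m. \<delta> m < \<bar>q x\<bar>) sequentially" by (intro order_tendstoD(2)[OF \<delta>(2)]) simp
        then have "eventually (\<lambda>m. (norm (dgrad S L (w m) x))\<^sup>2 = 0) sequentially"
          by (rule eventually_mono) (use elim(1) in auto)
        then show ?thesis by (rule tendsto_eventually)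
      next
        case True
        then have "dgrad S L (w m) x = 0" for m using elim by simp
        then show ?thesis by simp
      qed
    qed
    show "AE x in lebesgue_on S. norm ((norm (dgrad S L (w m) x))\<^sup>2) \<le> (norm (dgrad S L q x))\<^sup>2" for m
      using all by eventually_elim simp
    show "(\<lambda>x. (norm (dgrad S L (w m) x))\<^sup>2) \<in> borel_measurable (lebesgue_on S)" for m
      using L2_norm_integrable[OF Wc(3)[of m]] by auto
  qed (use L2_norm_integrable[OF W(3)] in auto)
  have "(\<lambda>m. (nrm S (w m))\<^sup>2 + (nrm S (grad S (w m)))\<^sup>2) \<longlonglongrightarrow> 0 + 0"
    unfolding nrm_grad[OF S(1) Wc(1)] nrm_square using lim1 lim2 by (intro tendsto_add) auto
  then have "eventually (\<lambda>m. (nrm S (w m))\<^sup>2 + (nrm S (grad S (w m)))\<^sup>2 < \<epsilon>\<^sup>2) sequentially"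
    using \<epsilon> by (intro order_tendstoD) auto
  then obtain m where m: "(nrm S (w m))\<^sup>2 + (nrm S (grad S (w m)))\<^sup>2 < \<epsilon>\<^sup>2" by (auto simp: eventually_sequentially)
  have "sqrt ((nrm S (w m))\<^sup>2 + (nrm S (grad S (w m)))\<^sup>2) < sqrt (\<epsilon>\<^sup>2)" using m by (rule real_sqrt_less_mono)
  then have "H1_norm S (w m) < \<epsilon>" using \<epsilon> by (simp add: H1_norm_eq)
  then show "\<exists>p\<in>H10 S. H1_norm S (\<lambda>x. q x - p x) < \<epsilon>"
    using p[of m] by (intro bexI[of _ "\<lambda>x. q x - w m x"]) auto
qed

section \<open>Restriction to subdomains\<close>

lemma integrable_lebesgue_on_subset:
  fixes F :: "'a::euclidean_space \<Rightarrow> real"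
  assumes "open S" "open C" "C \<subseteq> S" and F: "integrable (lebesgue_on S) F"
  shows "integrable (lebesgue_on C) F"
proof -
  have s: "C \<in> sets lebesgue" "S \<in> sets lebesgue" using assms(1,2) by auto
  have "integrable lebesgue (\<lambda>x. if x \<in> S then F x else 0)"
    using F s by (subst Lebesgue_Measure.integrable_restrict_UNIV)
  then have "integrable lebesgue (\<lambda>x. indicator C x *\<^sub>R (if x \<in> S then F x else 0))"
    using s by (intro integrable_mult_indicator)
  also have "(\<lambda>x. indicator C x *\<^sub>R (if x \<in> S then F x else 0)) = (\<lambda>x. if x \<in> C then F x else 0)"
    using assms(3) by (intro ext) (auto simp: indicator_def)
  finally show ?thesis using s by (subst (asm) Lebesgue_Measure.integrable_restrict_UNIV)
qed

lemma L2_restrict: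
  assumes "open S" "open C" "C \<subseteq> S" and f: "f \<in> L2 S"
  shows "f \<in> L2 C"
proof -
  have "f \<in> borel_measurable (lebesgue_on C)" using f assms(3) by (auto simp: L2_def intro: measurable_restrict_mono)
  then show ?thesis using integrable_lebesgue_on_subset[OF assms(1-3) L2_norm_integrable[OF f]] by (simp add: L2_def)
qed

lemma AE_lebesgue_on_subset:
  assumes "open S" "open C" "C \<subseteq> S" "AE x in lebesgue_on S. P x"
  shows "AE x in lebesgue_on C. P x"
proof -
  have "AE x in lebesgue. x \<in> S \<longrightarrow> P x" using assms(1,4) by (subst (asm) AE_lebesgue_on_iff) auto
  then have "AE x in lebesgue. x \<in> C \<longrightarrow> P x" by eventually_elim (use assms(3) in auto)
  then show ?thesis using assms(2) by (subst AE_lebesgue_on_iff) auto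
qed

text \<open>Restricting a function to a subdomain changes the chosen gradient on a null set only.\<close>

lemma H1_restrict:
  assumes S: "open S" and C: "open C" "C \<subseteq> S" and u: "u \<in> H1 S"
  shows "u \<in> H1 C" "AE x in lebesgue_on C. grad C u x = grad S u x"
proof -
  have w: "weak_gradient C u (grad S u)" by (rule weak_gradient_restrict[OF S H1D(2)[OF S u] C(2,1)])
  show "u \<in> H1 C" by (rule H1I[OF L2_restrict[OF S C H1D(1)[OF S u]] L2_restrict[OF S C H1D(3)[OF S u]] w])
  show "AE x in lebesgue_on C. grad C u x = grad S u x" by (rule grad_AE_eq[OF C(1) w])
qed

lemma H1_cong_AE:
  assumes S: "open S" and u: "u \<in> H1 S" and m: "u' \<in> borel_measurable (lebesgue_on S)"
    and eq: "AE x in lebesgue_on S. u x = u' x"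
  shows "u' \<in> H1 S"
proof -
  have L: "u' \<in> L2 S" by (rule L2_cong_AE[OF H1D(1)[OF S u] m eq])
  note w = H1D(2)[OF S u]
  have "weak_gradient S u' (grad S u)"
  proof (rule weak_gradientI[OF L2_imp_locally_integrable[OF S L] weak_gradientD(2)[OF w]])
    fix \<phi> i assume \<phi>: "\<phi> \<in> test_functions S" and i: "i \<in> (Basis :: 'a set)"
    have "(\<integral>x. u' x * pd i \<phi> x \<partial>lebesgue_on S) = (\<integral>x. u x * pd i \<phi> x \<partial>lebesgue_on S)"
    proof (rule integral_cong_AE)
      show "AE x in lebesgue_on S. u' x * pd i \<phi> x = u x * pd i \<phi> x" using eq by eventually_elim simp
    qed (use m L2_measurable[OF H1D(1)[OF S u]] borel_imp_lebesgue_on[OF test_functions_borel[OF test_functions_pd[OF \<phi> i]], of S] in auto)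
    then show "(\<integral>x. u' x * pd i \<phi> x \<partial>lebesgue_on S) = - (\<integral>x. (grad S u x \<bullet> i) * \<phi> x \<partial>lebesgue_on S)"
      using weak_gradientD(3)[OF w \<phi> i] by simp
  qed
  then show ?thesis by (rule H1I[OF L H1D(3)[OF S u]])
qed

lemma H2_restrict:
  assumes S: "open S" and C: "open C" "C \<subseteq> S" and u: "u \<in> H2 S"
  shows "u \<in> H2 C"
proof -
  have u1: "u \<in> H1 S" "\<And>i. i \<in> Basis \<Longrightarrow> (\<lambda>x. grad S u x \<bullet> i) \<in> H1 S" using u by (auto simp: H2_def)
  note r = H1_restrict[OF S C u1(1)]
  have "(\<lambda>x. grad C u x \<bullet> i) \<in> H1 C" if i: "i \<in> Basis" for i
  proof (rule H1_cong_AE[OF C(1) H1_restrict(1)[OF S C u1(2)[OF i]]])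
    show "(\<lambda>x. grad C u x \<bullet> i) \<in> borel_measurable (lebesgue_on C)"
      using H1D(3)[OF C(1) r(1)] by (auto simp: L2_def)
    show "AE x in lebesgue_on C. grad S u x \<bullet> i = grad C u x \<bullet> i" using r(2) by eventually_elim simp
  qed
  then show ?thesis using r(1) by (simp add: H2_def)
qed

text \<open>For an essentially bounded nonnegative function on a nonempty open set the essential supremum is finite, so
  its real value is an upper bound almost everywhere.\<close>

lemma ess_sup_on_bounds:
  assumes C: "open C" "C \<noteq> {}" and f: "f \<in> borel_measurable (lebesgue_on C)"
    and b: "AE x in lebesgue_on C. f x \<le> B" and nn: "\<And>x. x \<in> C \<Longrightarrow> 0 \<le> f x"
  shows "AE x in lebesgue_on C. f x \<le> ess_sup_on C f" "0 \<le> ess_sup_on C f"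
proof -
  let ?S = "esssup (lebesgue_on C) (\<lambda>x. ereal (f x))"
  have AE: "AE x in lebesgue_on C. ereal (f x) \<le> ?S" by (rule esssup_AE)
  have "?S \<le> ereal B" using f b by (intro esssup_I) auto
  moreover have "AE x in lebesgue. x \<in> C \<longrightarrow> ereal (f x) \<le> ?S" using AE C(1) by (subst (asm) AE_lebesgue_on_iff) auto
  then obtain x where x: "x \<in> C" "ereal (f x) \<le> ?S" by (rule AE_lebesgue_open_ex[OF _ C]) auto
  then have "0 \<le> ?S" using nn[OF x(1)] by (metis ereal_less_eq(5) order_trans)
  ultimately obtain s where s: "?S = ereal s" "s \<ge> 0" by (cases ?S) auto
  then show "AE x in lebesgue_on C. f x \<le> ess_sup_on C f" "0 \<le> ess_sup_on C f"
    using AE by (simp_all add: ess_sup_on_def)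
qed

section \<open>Interpolation on a simplicial mesh\<close>

text \<open>After subtracting one of the points the others are linearly independent, so a linear functional with
  prescribed values exists; the adjoint represents it by a vector.\<close>

lemma affine_interpolation:
  fixes p :: "'a::euclidean_space \<Rightarrow> real"
  assumes "\<not> affine_dependent C"
  shows "\<exists>a b. \<forall>x\<in>C. a + b \<bullet> x = p x"
proof (cases "C = {}")
  case False
  then obtain a0 where a0: "a0 \<in> C" by blast
  have "independent ((\<lambda>x. - a0 + x) ` (C - {a0}))" using assms affine_dependent_iff_dependent2[OF a0] by blast
  then obtain l where l: "linear l" "\<forall>z\<in>(\<lambda>x. - a0 + x) ` (C - {a0}). l z = p (a0 + z) - p a0"
    using linear_independent_extend[of "(\<lambda>x. - a0 + x) ` (C - {a0})" "\<lambda>z. p (a0 + z) - p a0"] by blast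
  let ?b = "adjoint l 1"
  have b: "?b \<bullet> z = l z" for z using adjoint_works[OF l(1), of z 1] by (simp add: inner_commute)
  have "p a0 - ?b \<bullet> a0 + ?b \<bullet> x = p x" if x: "x \<in> C" for x
  proof (cases "x = a0")
    case False
    then have "l (- a0 + x) = p x - p a0" using l(2) x by auto
    then show ?thesis using b[of "- a0 + x"] by (simp add: inner_add_right inner_diff_right)
  qed simp
  then show ?thesis by blast
qed simp

lemma negligible_AE_notin: "negligible N \<Longrightarrow> AE x in lebesgue. x \<notin> N"
  unfolding negligible_iff_AE[symmetric] by simp

definition vertices :: "'a::euclidean_space set \<Rightarrow> 'a set" where
  "vertices K = {x. x extreme_point_of K}"

locale lipschitz_mesh =
  fixes \<Omega> :: "'a::euclidean_space set" and \<T> :: "'a set set"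
  assumes lipschitz_domain: "bounded_lipschitz_domain \<Omega>" and mesh: "simplicial_mesh \<Omega> \<T>"
begin

lemma open_\<Omega>: "open \<Omega>" and bounded_\<Omega>: "bounded \<Omega>"
  using lipschitz_domain by (auto simp: bounded_lipschitz_domain_def)

lemma finite_\<T>: "finite \<T>" and Union_\<T>: "\<Union>\<T> = closure \<Omega>"
  using mesh by (auto simp: simplicial_mesh_def triangulation_def)

lemma simplex_\<T>: "K \<in> \<T> \<Longrightarrow> int DIM('a) simplex K"
  using mesh by (simp add: simplicial_mesh_def)

lemma element_vertices:
  assumes "K \<in> \<T>"
  shows "\<not> affine_dependent (vertices K)" "finite (vertices K)" "card (vertices K) = DIM('a) + 1"
    "convex hull (vertices K) = K"
proof -
  obtain C where C: "\<not> affine_dependent C" "int (card C) = int DIM('a) + 1" "K = convex hull C"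
    using simplex_\<T>[OF assms] by (auto simp: simplex_def)
  have "vertices K = C" using extreme_point_of_convex_hull_affine_independent[OF C(1)] by (auto simp: vertices_def C(3))
  then show "\<not> affine_dependent (vertices K)" "finite (vertices K)" "card (vertices K) = DIM('a) + 1"
    "convex hull (vertices K) = K"
    using C aff_independent_finite[OF C(1)] by auto
qed

lemma element_subset: "K \<in> \<T> \<Longrightarrow> K \<subseteq> closure \<Omega>"
  using Union_\<T> by blast

lemma element:
  assumes K: "K \<in> \<T>"
  shows "compact K" "convex K" "closed K" "interior K \<noteq> {}" "closure (interior K) = K" "interior K \<subseteq> \<Omega>"
proof -
  show cK: "compact K" "convex K" "closed K"
    using compact_simplex convex_simplex closed_simplex simplex_\<T>[OF K] by blast+
  have "affine hull K = UNIV" using aff_dim_simplex[OF simplex_\<T>[OF K]] aff_dim_eq_full by blast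
  then have "rel_interior K = interior K" by (rule rel_interior_interior)
  moreover have "K \<noteq> {}" using element_vertices(3)[OF K] by (auto simp: vertices_def extreme_point_of_def)
  ultimately show ne: "interior K \<noteq> {}" using rel_interior_eq_empty[OF cK(2)] by simp
  show "closure (interior K) = K" using convex_closure_interior[OF cK(2) ne] cK(3) by simp
  show "interior K \<subseteq> \<Omega>"
  proof
    fix x assume x: "x \<in> interior K"
    then have "x \<in> interior (closure \<Omega>)" using interior_mono[OF element_subset[OF K]] by blast
    then have "x \<notin> frontier \<Omega>" "x \<in> closure \<Omega>" using lipschitz_interior_closure[OF lipschitz_domain] interior_subset by auto
    then show "x \<in> \<Omega>" using open_\<Omega> by (simp add: frontier_def interior_open)
  qed
qed

lemma negligible_skeleton: "negligible (\<Union>K\<in>\<T>. frontier K)"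
  using finite_\<T> element(2) negligible_convex_frontier by (intro negligible_Union) auto

lemma negligible_frontier: "negligible (frontier \<Omega>)"
proof (rule negligible_subset[OF negligible_skeleton])
  show "frontier \<Omega> \<subseteq> (\<Union>K\<in>\<T>. frontier K)"
  proof
    fix x assume x: "x \<in> frontier \<Omega>"
    then have "x \<in> closure \<Omega>" "x \<notin> \<Omega>" using open_\<Omega> by (auto simp: frontier_def interior_open)
    then obtain K where K: "K \<in> \<T>" "x \<in> K" using Union_\<T> by blast
    then have "x \<in> frontier K" using element(3,6)[OF K(1)] \<open>x \<notin> \<Omega>\<close> by (auto simp: frontier_def)
    then show "x \<in> (\<Union>K\<in>\<T>. frontier K)" using K by blast
  qed
qed

lemma AE_element: "AE x in lebesgue. x \<in> \<Omega> \<longrightarrow> (\<exists>K\<in>\<T>. x \<in> interior K)"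
proof -
  have "AE x in lebesgue. x \<notin> (\<Union>K\<in>\<T>. frontier K)"
    by (rule negligible_AE_notin[OF negligible_skeleton])
  then show ?thesis
  proof eventually_elim
    case (elim x)
    show ?case
    proof
      assume "x \<in> \<Omega>"
      then obtain K where K: "K \<in> \<T>" "x \<in> K" using Union_\<T> closure_subset by blast
      then show "\<exists>K\<in>\<T>. x \<in> interior K" using elim element(3)[OF K(1)] by (auto simp: frontier_def)
    qed
  qed
qed

text \<open>Near a point only the elements containing it matter.\<close>

lemma elements_at:
  obtains d where "d > 0" "\<And>w. w \<in> closure \<Omega> \<Longrightarrow> dist y w < d \<Longrightarrow> \<exists>K\<in>\<T>. y \<in> K \<and> w \<in> K"
proof -
  have "closed (\<Union>{K\<in>\<T>. y \<notin> K})" using finite_\<T> element(3) by (intro closed_Union) auto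
  then have "open (- \<Union>{K\<in>\<T>. y \<notin> K})" by (simp add: open_Compl)
  moreover have "y \<in> - \<Union>{K\<in>\<T>. y \<notin> K}" by blast
  ultimately obtain d where d: "d > 0" "ball y d \<subseteq> - \<Union>{K\<in>\<T>. y \<notin> K}" using open_contains_ball by blast
  show thesis
  proof (rule that[OF d(1)])
    fix w assume w: "w \<in> closure \<Omega>" "dist y w < d"
    then obtain K where K: "K \<in> \<T>" "w \<in> K" using Union_\<T> by blast
    moreover have "w \<notin> \<Union>{K\<in>\<T>. y \<notin> K}" using d(2) w(2) by auto
    ultimately show "\<exists>K\<in>\<T>. y \<in> K \<and> w \<in> K" by blast
  qed
qed

text \<open>If a vertex of the smallest face containing a point \<open>x\<close> were in \<open>\<Omega>\<close>, the elements around a point \<open>y\<close> of the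
  face close to this vertex would cover a neighbourhood of \<open>y\<close>. All of them contain the whole face, so their
  homothetic images with a centre on the face beyond \<open>x\<close>, which lie in the elements, cover a neighbourhood of \<open>x\<close>.
  This is impossible at a boundary point of a Lipschitz domain.
  Hence all vertices of the face of a point on \<open>\<partial>\<Omega>\<close> lie on \<open>\<partial>\<Omega>\<close>, and interpolation preserves zero
  boundary values.\<close>

lemma frontier_face_vertices:
  assumes x: "x \<in> frontier \<Omega>" and K: "K \<in> \<T>"
    and \<mu>: "\<And>a. a \<in> vertices K \<Longrightarrow> \<mu> a \<ge> 0" "sum \<mu> (vertices K) = 1" "(\<Sum>a\<in>vertices K. \<mu> a *\<^sub>R a) = x"
    and b: "b \<in> vertices K" "\<mu> b > 0"
  shows "b \<in> frontier \<Omega>"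
proof (rule ccontr)
  assume nb: "b \<notin> frontier \<Omega>"
  note V = element_vertices[OF K]
  have "b \<in> K" using hull_inc[OF b(1), of convex] V(4) by simp
  then have b\<Omega>: "b \<in> \<Omega>" using nb element_subset[OF K] open_\<Omega> by (auto simp: frontier_def interior_open)
  define c where "c = {a \<in> vertices K. \<mu> a > 0}"
  define F where "F = convex hull c"
  have c: "c \<subseteq> vertices K" "finite c" "b \<in> c" using V(2) b by (auto simp: c_def)
  have ci: "\<not> affine_dependent c" using V(1) c(1) affine_dependent_subset by blast
  have zero: "a \<in> vertices K - c \<Longrightarrow> \<mu> a = 0" for a using \<mu>(1)[of a] by (auto simp: c_def)
  have s1: "sum \<mu> c = 1" using sum.mono_neutral_left[OF V(2) c(1), of \<mu>] zero \<mu>(2) by simp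
  have s2: "(\<Sum>a\<in>c. \<mu> a *\<^sub>R a) = x" using sum.mono_neutral_left[OF V(2) c(1), of "\<lambda>a. \<mu> a *\<^sub>R a"] zero \<mu>(3) by simp
  have FK: "F face_of K"
    using face_of_convex_hull_affine_independent[OF V(1), unfolded V(4)] c(1) by (auto simp: F_def)
  have xF: "x \<in> F" unfolding F_def convex_hull_finite[OF c(2)]
    using s1 s2 by (intro CollectI exI[of _ \<mu>]) (auto simp: c_def)
  have ex: "(\<Sum>a\<in>c. (r * \<mu> a + (if a = b then t else 0)) *\<^sub>R a) = r *\<^sub>R x + t *\<^sub>R b"
     "(\<Sum>a\<in>c. r * \<mu> a + (if a = b then t else 0)) = r + t" for r t
  proof -
    have "(\<Sum>a\<in>c. (r * \<mu> a + (if a = b then t else 0)) *\<^sub>R a) = (\<Sum>a\<in>c. r *\<^sub>R (\<mu> a *\<^sub>R a) + (if a = b then t *\<^sub>R b else 0))"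
      by (intro sum.cong) (auto simp: scaleR_add_left)
    then show "(\<Sum>a\<in>c. (r * \<mu> a + (if a = b then t else 0)) *\<^sub>R a) = r *\<^sub>R x + t *\<^sub>R b"
      using c s2 by (simp add: sum.distrib scaleR_sum_right[symmetric] del: scaleR_scaleR)
    show "(\<Sum>a\<in>c. r * \<mu> a + (if a = b then t else 0)) = r + t"
      using c s1 by (simp add: sum.distrib sum_distrib_left[symmetric])
  qed
  obtain e where e: "e > 0" "ball b e \<subseteq> \<Omega>" using b\<Omega> open_\<Omega> open_contains_ball by blast
  \<comment> \<open>the weight \<open>t\<close> of the vertex \<open>b\<close> is so close to 1 that \<open>y\<close> below lies in the ball around \<open>b\<close>\<close>
  define t where "t = max (1/2) (1 - e / (2 * (norm (x - b) + 1)))"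
  have nb0: "norm (x - b) + 1 > 0" using norm_ge_zero[of "x - b"] by linarith
  have t: "0 < t" "t < 1" "(1 - t) * norm (x - b) < e"
  proof -
    show "0 < t" by (simp add: t_def)
    show "t < 1" using e(1) nb0 by (simp add: t_def)
    have "1 - t \<le> e / (2 * (norm (x - b) + 1))" by (simp add: t_def)
    then have "(1 - t) * norm (x - b) \<le> e / (2 * (norm (x - b) + 1)) * (norm (x - b) + 1)"
      using e(1) nb0 by (intro mult_mono) auto
    also have "\<dots> = e / 2" using nb0 by (simp add: field_simps)
    also have "\<dots> < e" using e(1) by simp
    finally show "(1 - t) * norm (x - b) < e" .
  qed
  define y where "y = (1 - t) *\<^sub>R x + t *\<^sub>R b"
  have "y - b = (1 - t) *\<^sub>R (x - b)" by (simp add: y_def algebra_simps)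
  then have "dist b y < e" using t by (simp add: dist_norm norm_minus_commute[of b])
  then have y\<Omega>: "y \<in> \<Omega>" using e(2) by auto
  have yF: "y \<in> rel_interior F"
    unfolding F_def rel_interior_convex_hull_explicit[OF ci]
  proof (intro CollectI exI[of _ "\<lambda>a. (1 - t) * \<mu> a + (if a = b then t else 0)"] conjI ballI)
    show "0 < (1 - t) * \<mu> a + (if a = b then t else 0)" if "a \<in> c" for a
      using that t by (auto simp: c_def intro: add_pos_pos)
  qed (simp_all add: ex y_def)
  \<comment> \<open>moving from \<open>x\<close> away from \<open>b\<close> by this amount keeps all barycentric coordinates nonnegative\<close>
  let ?p = "x + \<mu> b *\<^sub>R (x - b)"
  have pF: "?p \<in> F"
    unfolding F_def convex_hull_finite[OF c(2)]
  proof (intro CollectI exI[of _ "\<lambda>a. (1 + \<mu> b) * \<mu> a + (if a = b then - \<mu> b else 0)"] conjI ballI)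
    show "0 \<le> (1 + \<mu> b) * \<mu> a + (if a = b then - \<mu> b else 0)" if "a \<in> c" for a
      using that b(2) by (auto simp: c_def algebra_simps)
  qed (simp_all only: ex, simp_all add: algebra_simps)
  obtain d where d: "d > 0" "\<And>w. w \<in> closure \<Omega> \<Longrightarrow> dist y w < d \<Longrightarrow> \<exists>K'\<in>\<T>. y \<in> K' \<and> w \<in> K'"
    by (rule elements_at[of y]) blast
  obtain d' where d': "d' > 0" "ball y d' \<subseteq> \<Omega>" using y\<Omega> open_\<Omega> open_contains_ball by blast
  \<comment> \<open>\<open>s\<close> is chosen such that \<open>x\<close> divides the segment from \<open>y\<close> to the centre in the ratio \<open>s : 1 - s\<close>\<close>
  define s where "s = t / (t + \<mu> b)"
  have s: "0 < s" "s < 1" "(1 - s) * t = s * \<mu> b" using t b(2) by (auto simp: s_def field_simps)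
  have xs: "(1 - s) *\<^sub>R y + s *\<^sub>R ?p = x"
  proof -
    have "(1 - s) *\<^sub>R y + s *\<^sub>R ?p = x + ((1 - s) * t - s * \<mu> b) *\<^sub>R (b - x)" by (simp add: y_def algebra_simps)
    then show ?thesis using s(3) by simp
  qed
  have "ball x ((1 - s) * min d d') \<subseteq> closure \<Omega>"
  proof
    fix z assume z: "z \<in> ball x ((1 - s) * min d d')"
    \<comment> \<open>\<open>z\<close> is the image of this point under the homothety\<close>
    let ?w = "y + (1 / (1 - s)) *\<^sub>R (z - x)"
    have "dist y ?w = norm (z - x) / (1 - s)" using s(2) by (simp add: dist_norm)
    also have "norm (z - x) / (1 - s) < min d d'"
    proof -
      have "norm (z - x) < min d d' * (1 - s)" using z by (simp add: dist_norm norm_minus_commute mult.commute)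
      then show ?thesis using s(2) pos_divide_less_eq[of "1 - s" "norm (z - x)" "min d d'"] by simp
    qed
    finally have w: "dist y ?w < min d d'" .
    then have "?w \<in> \<Omega>" using d'(2) by auto
    then obtain K' where K': "K' \<in> \<T>" "y \<in> K'" "?w \<in> K'" using d(2)[of ?w] w closure_subset by auto
    have "K \<inter> K' face_of K" using mesh K K'(1) by (simp add: simplicial_mesh_def triangulation_def)
    moreover have "y \<in> K" using yF rel_interior_subset face_of_imp_subset[OF FK] by blast
    ultimately have "F \<subseteq> K \<inter> K'" using yF K'(2) by (intro subset_of_face_of[OF _ face_of_imp_subset[OF FK]]) auto
    then have "?p \<in> K'" using pF by blast
    then have "(1 - s) *\<^sub>R ?w + s *\<^sub>R ?p \<in> K'" using s by (intro convexD[OF element(2)[OF K'(1)] K'(3)]) auto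
    also have "(1 - s) *\<^sub>R ?w + s *\<^sub>R ?p = ((1 - s) *\<^sub>R y + s *\<^sub>R ?p) + (z - x)"
      using s(2) by (simp add: scaleR_add_right)
    finally show "z \<in> closure \<Omega>" using xs element_subset[OF K'(1)] by auto
  qed
  moreover have "(1 - s) * min d d' > 0" using d(1) d'(1) s(2) by simp
  ultimately have "x \<in> interior (closure \<Omega>)" unfolding mem_interior by blast
  then show False using lipschitz_interior_closure[OF lipschitz_domain x] by blast
qed

definition local_interpolant :: "('a \<Rightarrow> real) \<Rightarrow> 'a set \<Rightarrow> real \<times> 'a" where
  "local_interpolant g K = (SOME l. \<forall>x\<in>vertices K. fst l + snd l \<bullet> x = g x)"

definition interpolant :: "('a \<Rightarrow> real) \<Rightarrow> 'a \<Rightarrow> real" where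
  "interpolant g x = (if x \<in> closure \<Omega> then let l = local_interpolant g (SOME K. K \<in> \<T> \<and> x \<in> K) in fst l + snd l \<bullet> x else 0)"

lemma local_interpolant_vertex:
  assumes "K \<in> \<T>" "x \<in> vertices K"
  shows "fst (local_interpolant g K) + snd (local_interpolant g K) \<bullet> x = g x"
proof -
  obtain a b where "\<forall>x\<in>vertices K. a + b \<bullet> x = g x" using affine_interpolation[OF element_vertices(1)[OF assms(1)]] by blast
  then have "\<forall>x\<in>vertices K. fst (a, b) + snd (a, b) \<bullet> x = g x" by simp
  then have "\<forall>x\<in>vertices K. fst (local_interpolant g K) + snd (local_interpolant g K) \<bullet> x = g x"
    unfolding local_interpolant_def by (rule someI[of "\<lambda>l. \<forall>x\<in>vertices K. fst l + snd l \<bullet> x = g x"])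
  then show ?thesis using assms(2) by blast
qed

text \<open>By conformity two elements meet in the convex hull of their common vertices.\<close>

lemma local_interpolant_agree:
  assumes K: "K \<in> \<T>" "K' \<in> \<T>" and x: "x \<in> K" "x \<in> K'"
  shows "fst (local_interpolant g K) + snd (local_interpolant g K) \<bullet> x
    = fst (local_interpolant g K') + snd (local_interpolant g K') \<bullet> x"
proof -
  let ?l = "local_interpolant g K" and ?l' = "local_interpolant g K'"
  have "T \<inter> T' face_of T" if "T \<in> \<T>" "T' \<in> \<T>" for T T'
    using mesh that by (simp add: simplicial_mesh_def triangulation_def)
  from this[OF K] this[OF K(2,1)] have F: "K \<inter> K' face_of K" "K \<inter> K' face_of K'" by (simp_all add: Int_commute)
  note V = element_vertices[OF K(1)]
  obtain c where c: "c \<subseteq> vertices K" "K \<inter> K' = convex hull c"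
    using F(1) face_of_convex_hull_affine_independent[OF V(1), of "K \<inter> K'"] V(4) by auto
  have "c \<subseteq> {z. (snd ?l - snd ?l') \<bullet> z = fst ?l' - fst ?l}"
  proof
    fix a assume a: "a \<in> c"
    then have "a \<in> K \<inter> K'" "a extreme_point_of K" using c hull_subset[of c convex] by (auto simp: vertices_def)
    then have "a extreme_point_of (K \<inter> K')" using extreme_point_of_face[OF F(1)] by blast
    then have "a \<in> vertices K'" using extreme_point_of_face[OF F(2)] by (simp add: vertices_def)
    then have "fst ?l + snd ?l \<bullet> a = fst ?l' + snd ?l' \<bullet> a"
      using local_interpolant_vertex[OF K(1), of a g] local_interpolant_vertex[OF K(2), of a g] a c(1) by auto
    then show "a \<in> {z. (snd ?l - snd ?l') \<bullet> z = fst ?l' - fst ?l}" by (simp add: inner_diff_left)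
  qed
  then have "convex hull c \<subseteq> {z. (snd ?l - snd ?l') \<bullet> z = fst ?l' - fst ?l}" by (rule hull_minimal) (rule convex_hyperplane)
  then have "x \<in> {z. (snd ?l - snd ?l') \<bullet> z = fst ?l' - fst ?l}" using x c(2) by blast
  then show ?thesis by (simp add: inner_diff_left)
qed

lemma interpolant_eq:
  assumes "K \<in> \<T>" "x \<in> K"
  shows "interpolant g x = fst (local_interpolant g K) + snd (local_interpolant g K) \<bullet> x"
proof -
  let ?K = "SOME K. K \<in> \<T> \<and> x \<in> K"
  have "?K \<in> \<T> \<and> x \<in> ?K" by (rule someI[of "\<lambda>K. K \<in> \<T> \<and> x \<in> K" K]) (use assms in blast)
  then show ?thesis
    using local_interpolant_agree[OF _ assms(1) _ assms(2), of ?K g] element_subset[OF assms(1)] assms(2)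
    by (auto simp: interpolant_def Let_def)
qed

lemma interpolant_outside:
  assumes g: "\<And>a. a \<in> frontier \<Omega> \<Longrightarrow> g a = 0" and x: "x \<notin> \<Omega>"
  shows "interpolant g x = 0"
proof (cases "x \<in> closure \<Omega>")
  case True
  then have xf: "x \<in> frontier \<Omega>" using x open_\<Omega> by (simp add: frontier_def interior_open)
  obtain K where K: "K \<in> \<T>" "x \<in> K" using True Union_\<T> by blast
  note V = element_vertices[OF K(1)]
  have "x \<in> convex hull (vertices K)" using K(2) V(4) by simp
  then obtain \<mu> where \<mu>: "\<And>a. a \<in> vertices K \<Longrightarrow> \<mu> a \<ge> 0" "sum \<mu> (vertices K) = 1" "(\<Sum>a\<in>vertices K. \<mu> a *\<^sub>R a) = x"
    unfolding convex_hull_finite[OF V(2)] by blast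
  let ?l = "local_interpolant g K"
  have z: "\<mu> a * g a = 0" if "a \<in> vertices K" for a
  proof (cases "\<mu> a = 0")
    case False
    then have "\<mu> a > 0" using \<mu>(1)[OF that] by simp
    then show ?thesis using g[OF frontier_face_vertices[OF xf K(1) \<mu> that]] by simp
  qed simp
  have "interpolant g x = fst ?l + snd ?l \<bullet> x" by (rule interpolant_eq[OF K])
  also have "\<dots> = (\<Sum>a\<in>vertices K. \<mu> a * fst ?l) + (\<Sum>a\<in>vertices K. \<mu> a * (snd ?l \<bullet> a))"
    using \<mu>(2) unfolding \<mu>(3)[symmetric] by (simp add: inner_sum_right sum_distrib_right[symmetric])
  also have "\<dots> = (\<Sum>a\<in>vertices K. \<mu> a * g a)"
    unfolding sum.distrib[symmetric] using local_interpolant_vertex[OF K(1), of _ g] by (intro sum.cong) (auto simp: distrib_left[symmetric])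
  finally show ?thesis using z by simp
qed (simp add: interpolant_def)

text \<open>A crude common Lipschitz constant.\<close>

definition slope :: "('a \<Rightarrow> real) \<Rightarrow> real" where
  "slope g = (\<Sum>K\<in>\<T>. norm (snd (local_interpolant g K)))"

text \<open>A segment is cut by finitely many closed sets, the elements and the complement of the domain, and the
  function is Lipschitz on each piece.\<close>

lemma interpolant_lipschitz:
  assumes g: "\<And>a. a \<in> frontier \<Omega> \<Longrightarrow> g a = 0"
  shows "\<bar>interpolant g (x + d) - interpolant g x\<bar> \<le> slope g * norm d"
proof -
  have s0: "slope g \<ge> 0" by (simp add: slope_def sum_nonneg)
  have "(slope g * norm d)-lipschitz_on {0..1} (\<lambda>t. interpolant g (x + t *\<^sub>R d))"
  proof (rule lipschitz_on_closed_Union[where I = "insert (- \<Omega>) \<T>" and U = "\<lambda>S. {t. x + t *\<^sub>R d \<in> S}"])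
    fix S assume S: "S \<in> insert (- \<Omega>) \<T>"
    show "(slope g * norm d)-lipschitz_on {t. x + t *\<^sub>R d \<in> S} (\<lambda>t. interpolant g (x + t *\<^sub>R d))"
    proof (cases "S \<in> \<T>")
      case True
      let ?b = "snd (local_interpolant g S)"
      have nb: "norm ?b \<le> slope g"
        unfolding slope_def using True finite_\<T> by (intro member_le_sum[of S \<T> "\<lambda>K. norm (snd (local_interpolant g K))"]) auto
      show ?thesis
      proof (rule lipschitz_onI)
        fix t t' assume t: "t \<in> {t. x + t *\<^sub>R d \<in> S}" "t' \<in> {t. x + t *\<^sub>R d \<in> S}"
        have "interpolant g (x + t *\<^sub>R d) - interpolant g (x + t' *\<^sub>R d) = (t - t') * (?b \<bullet> d)"
          using interpolant_eq[OF True, of "x + t *\<^sub>R d" g] interpolant_eq[OF True, of "x + t' *\<^sub>R d" g] t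
          by (simp add: inner_add_right algebra_simps)
        then have "dist (interpolant g (x + t *\<^sub>R d)) (interpolant g (x + t' *\<^sub>R d)) = \<bar>?b \<bullet> d\<bar> * dist t t'"
          by (simp add: dist_real_def abs_mult)
        also have "\<dots> \<le> (slope g * norm d) * dist t t'"
        proof (rule mult_right_mono)
          have "\<bar>?b \<bullet> d\<bar> \<le> norm ?b * norm d" by (rule Cauchy_Schwarz_ineq2)
          also have "\<dots> \<le> slope g * norm d" using nb by (rule mult_right_mono) simp
          finally show "\<bar>?b \<bullet> d\<bar> \<le> slope g * norm d" .
        qed simp
        finally show "dist (interpolant g (x + t *\<^sub>R d)) (interpolant g (x + t' *\<^sub>R d)) \<le> slope g * norm d * dist t t'" .
      qed (use s0 in simp)
    next
      case False
      then have "S = - \<Omega>" using S by simp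
      then show ?thesis using interpolant_outside[of g, OF g] s0 by (intro lipschitz_onI) auto
    qed
    have "closed S" using S element(3) open_\<Omega> by auto
    then have "closed ((\<lambda>t. x + t *\<^sub>R d) -` S)" by (intro closed_vimage continuous_intros)
    then show "closed {t. x + t *\<^sub>R d \<in> S}" by (simp add: vimage_def)
  next
    show "{0..1} \<subseteq> (\<Union>S\<in>insert (- \<Omega>) \<T>. {t. x + t *\<^sub>R d \<in> S})"
    proof
      fix t :: real
      show "t \<in> (\<Union>S\<in>insert (- \<Omega>) \<T>. {t. x + t *\<^sub>R d \<in> S})"
        using Union_\<T> closure_subset[of \<Omega>] by (cases "x + t *\<^sub>R d \<in> \<Omega>") auto
    qed
  qed (use finite_\<T> s0 in auto)
  from lipschitz_onD[OF this, of 1 0] show ?thesis by (simp add: dist_real_def)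
qed

lemma interpolant_affine_near:
  assumes "K \<in> \<T>" "x \<in> interior K"
  shows "affine_near (interpolant g) x (snd (local_interpolant g K))"
proof -
  obtain d where d: "d > 0" "ball x d \<subseteq> K" using assms(2) by (auto simp: mem_interior)
  have "interpolant g y = interpolant g x + snd (local_interpolant g K) \<bullet> (y - x)" if y: "y \<in> ball x d" for y
  proof -
    have "y \<in> K" "x \<in> K" using y d(2) assms(2) interior_subset by auto
    then show ?thesis using interpolant_eq[OF assms(1), of y g] interpolant_eq[OF assms(1), of x g] by (simp add: inner_diff_right)
  qed
  then show ?thesis using d(1) unfolding affine_near_def by blast
qed

lemma interpolant_pw_affine:
  assumes g: "\<And>a. a \<in> frontier \<Omega> \<Longrightarrow> g a = 0"
  shows "pw_affine \<Omega> (slope g) (interpolant g)"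
  unfolding pw_affine_def
proof (intro conjI allI impI)
  show "\<bar>interpolant g (x + d) - interpolant g x\<bar> \<le> slope g * norm d" for x d by (rule interpolant_lipschitz[of g, OF g])
  show "interpolant g x = 0" if "x \<notin> \<Omega>" for x by (rule interpolant_outside[of g, OF g that])
  show "AE z in lebesgue. z \<in> \<Omega> \<longrightarrow> (\<exists>b. affine_near (interpolant g) z b)"
    using AE_element by eventually_elim (use interpolant_affine_near in blast)
  fix c
  let ?b = "\<lambda>K. snd (local_interpolant g K)" and ?a = "\<lambda>K. fst (local_interpolant g K)"
  have "negligible (\<Union>K\<in>{K\<in>\<T>. ?b K \<noteq> 0}. {z. ?b K \<bullet> z = c - ?a K})"
    using finite_\<T> negligible_hyperplane by (intro negligible_Union) auto
  then have "AE z in lebesgue. z \<notin> (\<Union>K\<in>{K\<in>\<T>. ?b K \<noteq> 0}. {z. ?b K \<bullet> z = c - ?a K})"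
    by (rule negligible_AE_notin)
  then show "AE z in lebesgue. z \<in> \<Omega> \<and> interpolant g z = c \<longrightarrow> affine_near (interpolant g) z 0"
    using AE_element
  proof eventually_elim
    case (elim z)
    show ?case
    proof
      assume z: "z \<in> \<Omega> \<and> interpolant g z = c"
      then obtain K where K: "K \<in> \<T>" "z \<in> interior K" using elim(2) by blast
      then have "interpolant g z = ?a K + ?b K \<bullet> z" using interior_subset by (intro interpolant_eq) auto
      then have "?b K = 0" using elim(1) K(1) z by force
      then show "affine_near (interpolant g) z 0" using interpolant_affine_near[OF K, of g] by simp
    qed
  qed
qed

lemma interpolant_X_H:
  assumes g: "\<And>a. a \<in> frontier \<Omega> \<Longrightarrow> g a = 0"
  shows "interpolant g \<in> X_H \<Omega> \<T>"
proof -
  have "(slope g)-lipschitz_on UNIV (interpolant g)"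
  proof (rule lipschitz_onI)
    show "dist (interpolant g x) (interpolant g y) \<le> slope g * dist x y" for x y
      using interpolant_lipschitz[of g y "x - y", OF g] by (simp add: dist_real_def dist_norm)
  qed (simp add: slope_def sum_nonneg)
  then have "continuous_on UNIV (interpolant g)" by (rule lipschitz_on_continuous_on)
  then have "continuous_on (closure \<Omega>) (interpolant g)" by (rule continuous_on_subset) simp
  moreover have "\<exists>a b. \<forall>x\<in>K. interpolant g x = a + b \<bullet> x" if "K \<in> \<T>" for K
    using interpolant_eq[OF that] by blast
  ultimately have "interpolant g \<in> S_H \<Omega> \<T>" by (simp add: S_H_def)
  moreover have "interpolant g \<in> H10 \<Omega>"
    by (rule pw_affine_H10[OF open_\<Omega> bounded_\<Omega> negligible_frontier interpolant_pw_affine[of g, OF g]])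
  ultimately show ?thesis by (simp add: X_H_def)
qed

end

section \<open>The interpolation error\<close>

text \<open>The affine function \<open>m y = a + b \<bullet> y - u x - \<nabla>u x \<bullet> (y - x)\<close> equals at each vertex \<open>v\<close> the Taylor
  remainder of \<open>u\<close> from \<open>x\<close> to \<open>v\<close>. It is therefore bounded on the whole element by the root of the sum of the
  squared remainders; its value at \<open>x\<close> is the interpolation error at \<open>x\<close>, and its slope is the error of the
  gradient.\<close>

lemma affine_interpolation_pointwise:
  fixes b gx :: "'a::euclidean_space" and g :: "'a \<Rightarrow> real"
  assumes V: "finite V" and l: "\<And>v. v \<in> V \<Longrightarrow> a + b \<bullet> v = g v"
    and ball: "cball x0 r \<subseteq> convex hull V" "r > 0" and x: "x \<in> convex hull V"
  shows "(ux - (a + b \<bullet> x))\<^sup>2 \<le> (\<Sum>v\<in>V. (g v - ux - (v - x) \<bullet> gx)\<^sup>2)"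
    "(norm (gx - b))\<^sup>2 \<le> (\<Sum>v\<in>V. (g v - ux - (v - x) \<bullet> gx)\<^sup>2) / r\<^sup>2"
proof -
  define S where "S = (\<Sum>v\<in>V. (g v - ux - (v - x) \<bullet> gx)\<^sup>2)"
  define m where "m y = a + b \<bullet> y - ux - (y - x) \<bullet> gx" for y
  have S0: "S \<ge> 0" by (simp add: S_def sum_nonneg)
  have m_eq: "m y = (b - gx) \<bullet> y + (a - ux + x \<bullet> gx)" for y
    by (simp add: m_def inner_diff_left inner_diff_right inner_commute algebra_simps)
  have "V \<subseteq> {y. \<bar>m y\<bar> \<le> sqrt S}"
  proof
    fix v assume v: "v \<in> V"
    have "m v = g v - ux - (v - x) \<bullet> gx" using l[OF v] by (simp add: m_def)
    then have "(m v)\<^sup>2 \<le> S"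
      unfolding S_def using v V by (simp add: member_le_sum[of v V "\<lambda>v. (g v - ux - (v - x) \<bullet> gx)\<^sup>2"])
    then show "v \<in> {y. \<bar>m y\<bar> \<le> sqrt S}" using real_le_rsqrt[of "\<bar>m v\<bar>" S] by simp
  qed
  moreover have "convex {y. \<bar>m y\<bar> \<le> sqrt S}"
  proof -
    have "{y. \<bar>m y\<bar> \<le> sqrt S} = {y. (b - gx) \<bullet> y \<le> sqrt S - (a - ux + x \<bullet> gx)} \<inter> {y. (b - gx) \<bullet> y \<ge> - sqrt S - (a - ux + x \<bullet> gx)}"
      unfolding m_eq by (auto simp: abs_le_iff)
    then show ?thesis by (simp add: convex_Int convex_halfspace_le convex_halfspace_ge)
  qed
  ultimately have M: "\<bar>m y\<bar> \<le> sqrt S" if "y \<in> convex hull V" for y using hull_minimal[of V "{y. \<bar>m y\<bar> \<le> sqrt S}" convex] that by blast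
  have "\<bar>m x\<bar>\<^sup>2 \<le> (sqrt S)\<^sup>2" by (rule power_mono[OF M[OF x]]) simp
  then show "(ux - (a + b \<bullet> x))\<^sup>2 \<le> (\<Sum>v\<in>V. (g v - ux - (v - x) \<bullet> gx)\<^sup>2)"
    using S0 unfolding S_def[symmetric] by (simp add: m_def power2_commute)
  have "norm (gx - b) \<le> sqrt S / r"
  proof (cases "b = gx")
    case False
    define z where "z = (r / norm (b - gx)) *\<^sub>R (b - gx)"
    have nz: "norm z = r" using False ball(2) by (simp add: z_def)
    have "x0 + z \<in> cball x0 r" "x0 - z \<in> cball x0 r" using nz by (auto simp: dist_norm)
    then have "\<bar>m (x0 + z)\<bar> \<le> sqrt S" "\<bar>m (x0 - z)\<bar> \<le> sqrt S" using M subsetD[OF ball(1)] by blast+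
    moreover have "m (x0 + z) - m (x0 - z) = 2 * ((b - gx) \<bullet> z)" by (simp add: m_eq inner_add_right inner_diff_right)
    moreover have "(b - gx) \<bullet> z = r * norm (b - gx)"
      using False by (simp add: z_def dot_square_norm power2_eq_square)
    ultimately have "r * norm (b - gx) \<le> sqrt S" by linarith
    then show ?thesis using ball(2) by (simp add: pos_le_divide_eq mult.commute norm_minus_commute)
  qed (use S0 ball(2) in simp)
  then have "(norm (gx - b))\<^sup>2 \<le> (sqrt S / r)\<^sup>2" by (rule power_mono) simp
  then show "(norm (gx - b))\<^sup>2 \<le> (\<Sum>v\<in>V. (g v - ux - (v - x) \<bullet> gx)\<^sup>2) / r\<^sup>2"
    using S0 unfolding S_def[symmetric] by (simp add: power_divide)
qed

text \<open>The \<open>L\<^sup>2\<close> norms of the remainders at the vertices are bounded by Taylor's formula on the convex element,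
  so the constants depend only on the number of vertices, the diameter, and the radius of an inscribed ball.\<close>

lemma affine_interpolation_error:
  fixes C :: "'a::euclidean_space set"
  assumes dim: "DIM('a) \<le> 3" and C: "open C" "bounded C" "convex C" "C \<noteq> {}" and u: "u \<in> H2 C"
    and g: "continuous_on (closure C) g" "AE x in lebesgue_on C. u x = g x"
    and V: "finite V" "convex hull V = closure C" and l: "\<And>v. v \<in> V \<Longrightarrow> a + b \<bullet> v = g v"
    and D: "\<And>x y. x \<in> closure C \<Longrightarrow> y \<in> closure C \<Longrightarrow> norm (x - y) \<le> D" and ball: "cball x0 r \<subseteq> closure C" "r > 0"
  shows "(nrm C (\<lambda>x. u x - (a + b \<bullet> x)))\<^sup>2 \<le> real (card V) * (8 * D^4 * (H2_seminorm C u)\<^sup>2)"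
    "(nrm C (\<lambda>x. grad C u x - b))\<^sup>2 \<le> real (card V) * (8 * D^4 * (H2_seminorm C u)\<^sup>2) / r\<^sup>2"
proof -
  obtain U G H where "H2_function C u U G H" by (rule H2_function_ex[OF C(1,2) dim u])
  then interpret H2_function C u U G H .
  let ?R = "\<lambda>v x. g v - u x - (v - x) \<bullet> grad C u x"
  have VC: "v \<in> closure C" if "v \<in> V" for v using hull_inc[OF that, of convex] V(2) by simp
  note T = taylor_H2[OF C(3,4) g VC D]
  have Ri: "integrable (lebesgue_on C) (\<lambda>x. (?R v x)\<^sup>2)" if "v \<in> V" for v
    using L2_norm_integrable[OF T(1)[OF that]] by simp
  have Si: "integrable (lebesgue_on C) (\<lambda>x. \<Sum>v\<in>V. (?R v x)\<^sup>2)" by (intro Bochner_Integration.integrable_sum Ri)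
  have "(\<integral>x. (\<Sum>v\<in>V. (?R v x)\<^sup>2) \<partial>lebesgue_on C) = (\<Sum>v\<in>V. (nrm C (?R v))\<^sup>2)"
    using Ri by (subst Bochner_Integration.integral_sum) (simp_all add: nrm_square)
  also have "\<dots> \<le> (\<Sum>v\<in>V. 8 * D^4 * (H2_seminorm C u)\<^sup>2)" by (intro sum_mono T(2))
  finally have S: "(\<integral>x. (\<Sum>v\<in>V. (?R v x)\<^sup>2) \<partial>lebesgue_on C) \<le> real (card V) * (8 * D^4 * (H2_seminorm C u)\<^sup>2)" by simp
  have S0: "0 \<le> (\<Sum>v\<in>V. (?R v x)\<^sup>2)" for x by (simp add: sum_nonneg)
  have hull: "x \<in> convex hull V" if "x \<in> space (lebesgue_on C)" for x using that V(2) closure_subset[of C] by auto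
  note P = affine_interpolation_pointwise[OF V(1) l ball(1)[folded V(2)] ball(2) hull]
  have "(nrm C (\<lambda>x. u x - (a + b \<bullet> x)))\<^sup>2 \<le> (\<integral>x. (\<Sum>v\<in>V. (?R v x)\<^sup>2) \<partial>lebesgue_on C)"
    unfolding nrm_square by (rule integral_mono'[OF Si _ S0]) (use P(1) in simp)
  then show "(nrm C (\<lambda>x. u x - (a + b \<bullet> x)))\<^sup>2 \<le> real (card V) * (8 * D^4 * (H2_seminorm C u)\<^sup>2)" using S by linarith
  have "(nrm C (\<lambda>x. grad C u x - b))\<^sup>2 \<le> (\<integral>x. (\<Sum>v\<in>V. (?R v x)\<^sup>2) / r\<^sup>2 \<partial>lebesgue_on C)"
    unfolding nrm_square by (rule integral_mono') (use Si S0 P(2) in simp_all)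
  also have "\<dots> = (\<integral>x. (\<Sum>v\<in>V. (?R v x)\<^sup>2) \<partial>lebesgue_on C) / r\<^sup>2" by simp
  also have "\<dots> \<le> real (card V) * (8 * D^4 * (H2_seminorm C u)\<^sup>2) / r\<^sup>2" using S by (rule divide_right_mono) simp
  finally show "(nrm C (\<lambda>x. grad C u x - b))\<^sup>2 \<le> real (card V) * (8 * D^4 * (H2_seminorm C u)\<^sup>2) / r\<^sup>2" .
qed

text \<open>The inradius is a supremum that need not be attained; the factor 2 replaces it by the radius of an
  actual ball.\<close>

lemma shape_regular_ball:
  fixes K :: "'a::euclidean_space set"
  assumes K: "bounded K" "interior K \<noteq> {}" and s: "diameter K \<le> \<sigma> * inradius K"
  obtains x r where "r > 0" "cball x r \<subseteq> K" "diameter K \<le> 2 * \<sigma> * r"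
proof -
  let ?A = "{r. 0 \<le> r \<and> (\<exists>x. cball x r \<subseteq> K)}"
  obtain i :: 'a where i: "i \<in> Basis" using nonempty_Basis by blast
  have bd: "r \<le> diameter K" if r: "r \<in> ?A" for r
  proof -
    obtain x where x: "cball x r \<subseteq> K" "0 \<le> r" using r by blast
    then have "x \<in> K" "x + r *\<^sub>R i \<in> K" using i by (auto simp: subset_iff dist_norm)
    from diameter_bounded_bound[OF K(1) this] show ?thesis using x(2) i by (simp add: dist_norm)
  qed
  obtain x e where e: "e > 0" "cball x e \<subseteq> K" using K(2) by (auto simp: mem_interior_cball)
  have bA: "bdd_above ?A" using bd by (intro bdd_aboveI) auto
  have "e \<in> ?A" using e by auto
  then have "e \<le> inradius K" unfolding inradius_def using bA by (rule cSup_upper)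
  then have pos: "inradius K > 0" using e(1) by linarith
  have "diameter K > 0" using bd[OF \<open>e \<in> ?A\<close>] e(1) by linarith
  then have \<sigma>: "\<sigma> > 0" using s pos zero_less_mult_pos2[of \<sigma> "inradius K"] by linarith
  have "inradius K / 2 < Sup ?A" using pos unfolding inradius_def[symmetric] by simp
  then obtain r where r: "r \<in> ?A" "inradius K / 2 < r" using less_cSupD[of ?A] \<open>e \<in> ?A\<close> by blast
  then obtain y where y: "cball y r \<subseteq> K" by blast
  have "\<sigma> * inradius K \<le> \<sigma> * (2 * r)" using r(2) \<sigma> by (intro mult_left_mono) auto
  then show thesis using r(2) pos y s by (intro that[of r y]) auto
qed

context lipschitz_mesh
begin

text \<open>The open elements cover the domain up to a null set.\<close>

lemma integral_le_elements:
  fixes F :: "'a \<Rightarrow> real"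
  assumes F: "integrable (lebesgue_on \<Omega>) F" and nn: "\<And>x. x \<in> \<Omega> \<Longrightarrow> 0 \<le> F x"
  shows "(\<integral>x. F x \<partial>lebesgue_on \<Omega>) \<le> (\<Sum>K\<in>\<T>. \<integral>x. F x \<partial>lebesgue_on (interior K))"
proof -
  have s: "\<Omega> \<in> sets lebesgue" "interior K \<in> sets lebesgue" for K :: "'a set" using open_\<Omega> by auto
  have iK: "integrable lebesgue (\<lambda>x. if x \<in> interior K then F x else 0)" if "K \<in> \<T>" for K
    using integrable_lebesgue_on_subset[OF open_\<Omega> open_interior element(6)[OF that] F] s
    by (subst Lebesgue_Measure.integrable_restrict_UNIV)
  have "(\<integral>x. F x \<partial>lebesgue_on \<Omega>) = (\<integral>x. (if x \<in> \<Omega> then F x else 0) \<partial>lebesgue)"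
    using s by (subst Lebesgue_Measure.integral_restrict_UNIV) auto
  also have "\<dots> \<le> (\<integral>x. (\<Sum>K\<in>\<T>. if x \<in> interior K then F x else 0) \<partial>lebesgue)"
  proof (rule integral_mono_AE)
    show "integrable lebesgue (\<lambda>x. if x \<in> \<Omega> then F x else 0)"
      using F s by (subst Lebesgue_Measure.integrable_restrict_UNIV)
    show "integrable lebesgue (\<lambda>x. \<Sum>K\<in>\<T>. if x \<in> interior K then F x else 0)"
      using iK by (rule Bochner_Integration.integrable_sum)
    show "AE x in lebesgue. (if x \<in> \<Omega> then F x else 0) \<le> (\<Sum>K\<in>\<T>. if x \<in> interior K then F x else 0)"
      using AE_element
    proof eventually_elim
      case (elim x)
      have nnK: "0 \<le> (if x \<in> interior K then F x else 0)" if "K \<in> \<T>" for K using element(6)[OF that] nn by auto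
      show ?case
      proof (cases "x \<in> \<Omega>")
        case True
        then obtain K where K: "K \<in> \<T>" "x \<in> interior K" using elim by blast
        have "(if x \<in> interior K then F x else 0) \<le> (\<Sum>K\<in>\<T>. if x \<in> interior K then F x else 0)"
          using K(1) nnK finite_\<T> by (intro member_le_sum) auto
        then show ?thesis using K(2) True by simp
      next
        case False
        then show ?thesis using nnK by (simp add: sum_nonneg)
      qed
    qed
  qed
  also have "\<dots> = (\<Sum>K\<in>\<T>. \<integral>x. F x \<partial>lebesgue_on (interior K))"
    using iK s by (subst Bochner_Integration.integral_sum) (auto simp: Lebesgue_Measure.integral_restrict_UNIV)
  finally show ?thesis .
qed

lemma weighted_integral_le_elements:
  fixes f :: "'a \<Rightarrow> 'b::euclidean_space"
  assumes f: "f \<in> L2 \<Omega>" and w: "w \<in> borel_measurable (lebesgue_on \<Omega>)" "AE x in lebesgue_on \<Omega>. w x \<le> B" "\<And>x. x \<in> \<Omega> \<Longrightarrow> 0 \<le> w x"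
    and e: "\<And>K. K \<in> \<T> \<Longrightarrow> (nrm (interior K) f)\<^sup>2 \<le> E K"
  shows "(\<integral>x. w x * (norm (f x))\<^sup>2 \<partial>lebesgue_on \<Omega>) \<le> (\<Sum>K\<in>\<T>. ess_sup_on (interior K) w * E K)"
proof -
  have fi: "integrable (lebesgue_on \<Omega>) (\<lambda>x. (norm (f x))\<^sup>2)" by (rule L2_norm_integrable[OF f])
  have wi: "integrable (lebesgue_on \<Omega>) (\<lambda>x. w x * (norm (f x))\<^sup>2)"
  proof (rule Bochner_Integration.integrable_bound[where f = "\<lambda>x. B * (norm (f x))\<^sup>2"])
    show "AE x in lebesgue_on \<Omega>. norm (w x * (norm (f x))\<^sup>2) \<le> norm (B * (norm (f x))\<^sup>2)"
      using w(2) AE_space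
    proof eventually_elim
      case (elim x)
      then have "0 \<le> w x" "w x \<le> \<bar>B\<bar>" using w(3)[of x] by auto
      then show ?case by (simp add: abs_mult mult_right_mono)
    qed
  qed (use fi w(1) L2_measurable[OF L2_norm_fun[OF f]] in auto)
  have "(\<integral>x. w x * (norm (f x))\<^sup>2 \<partial>lebesgue_on \<Omega>) \<le> (\<Sum>K\<in>\<T>. \<integral>x. w x * (norm (f x))\<^sup>2 \<partial>lebesgue_on (interior K))"
    using w(3) by (intro integral_le_elements[OF wi]) simp
  also have "\<dots> \<le> (\<Sum>K\<in>\<T>. ess_sup_on (interior K) w * E K)"
  proof (rule sum_mono)
    fix K assume K: "K \<in> \<T>"
    note sub = open_\<Omega> open_interior element(6)[OF K]
    have wm: "w \<in> borel_measurable (lebesgue_on (interior K))" using w(1) sub(3) by (auto intro: measurable_restrict_mono)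
    have w0: "0 \<le> w x" if "x \<in> interior K" for x using w(3) sub(3) that by blast
    have ess: "AE x in lebesgue_on (interior K). w x \<le> ess_sup_on (interior K) w" "0 \<le> ess_sup_on (interior K) w"
      using ess_sup_on_bounds[OF open_interior element(4)[OF K] wm AE_lebesgue_on_subset[OF sub w(2)]] w0 by blast+
    have fK: "integrable (lebesgue_on (interior K)) (\<lambda>x. (norm (f x))\<^sup>2)" by (rule integrable_lebesgue_on_subset[OF sub fi])
    have "(\<integral>x. w x * (norm (f x))\<^sup>2 \<partial>lebesgue_on (interior K)) \<le> (\<integral>x. ess_sup_on (interior K) w * (norm (f x))\<^sup>2 \<partial>lebesgue_on (interior K))"
    proof (rule integral_mono_AE)
      show "AE x in lebesgue_on (interior K). w x * (norm (f x))\<^sup>2 \<le> ess_sup_on (interior K) w * (norm (f x))\<^sup>2"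
        using ess(1) by eventually_elim (simp add: mult_right_mono)
    qed (use integrable_lebesgue_on_subset[OF sub wi] fK in simp_all)
    also have "\<dots> = ess_sup_on (interior K) w * (nrm (interior K) f)\<^sup>2" by (simp add: nrm_square)
    also have "\<dots> \<le> ess_sup_on (interior K) w * E K" using e[OF K] ess(2) by (rule mult_left_mono)
    finally show "(\<integral>x. w x * (norm (f x))\<^sup>2 \<partial>lebesgue_on (interior K)) \<le> ess_sup_on (interior K) w * E K" .
  qed
  finally show ?thesis .
qed

lemma interpolation_error:
  assumes dim: "DIM('a) \<le> 3" and reg: "shape_regular \<sigma> \<T>" and u: "u \<in> H2 \<Omega>"
    and g: "continuous_on (closure \<Omega>) g" "AE x in lebesgue_on \<Omega>. u x = g x" "\<And>a. a \<in> frontier \<Omega> \<Longrightarrow> g a = 0"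
    and K: "K \<in> \<T>"
  shows "(nrm (interior K) (\<lambda>x. u x - interpolant g x))\<^sup>2
      \<le> 8 * real (DIM('a) + 1) * (mesh_size K)^4 * (H2_seminorm (interior K) u)\<^sup>2"
    "(nrm (interior K) (grad \<Omega> (\<lambda>x. u x - interpolant g x)))\<^sup>2
      \<le> 32 * real (DIM('a) + 1) * \<sigma>\<^sup>2 * (mesh_size K)\<^sup>2 * (H2_seminorm (interior K) u)\<^sup>2"
proof -
  note E = element[OF K] and V = element_vertices[OF K]
  note sub = open_\<Omega> open_interior E(6)
  let ?C = "interior K" and ?D = "mesh_size K" and ?\<eta> = "\<lambda>x. u x - interpolant g x"
  let ?a = "fst (local_interpolant g K)" and ?b = "snd (local_interpolant g K)"
  have bK: "bounded K" using E(1) by (rule compact_imp_bounded)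
  have "diameter K \<le> \<sigma> * inradius K" using reg K by (simp add: shape_regular_def)
  then obtain x0 r where r: "r > 0" "cball x0 r \<subseteq> K" "diameter K \<le> 2 * \<sigma> * r" by (rule shape_regular_ball[OF bK E(4)])
  have D: "norm (x - y) \<le> ?D" if "x \<in> closure ?C" "y \<in> closure ?C" for x y
    using diameter_bounded_bound[OF bK, of x y] that E(5) by (simp add: mesh_size_def dist_norm)
  have gC: "continuous_on (closure ?C) g" using g(1) element_subset[OF K] E(5) by (metis continuous_on_subset)
  have bC: "bounded ?C" using bK interior_subset by (rule bounded_subset)
  have hull: "convex hull (vertices K) = closure ?C" using V(4) E(5) by simp
  have ball: "cball x0 r \<subseteq> closure ?C" using r(2) E(5) by simp
  note B = affine_interpolation_error[OF dim open_interior bC convex_interior[OF E(2)] E(4) H2_restrict[OF sub u] gC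
      AE_lebesgue_on_subset[OF sub g(2)] V(2) hull local_interpolant_vertex[OF K] D ball r(1), unfolded V(3)]
  have eq: "interpolant g x = ?a + ?b \<bullet> x" if "x \<in> ?C" for x
    by (rule interpolant_eq[OF K]) (use that interior_subset in blast)
  have "nrm ?C ?\<eta> = nrm ?C (\<lambda>x. u x - (?a + ?b \<bullet> x))"
    unfolding nrm_def by (intro arg_cong[where f = sqrt] Bochner_Integration.integral_cong refl) (simp add: eq)
  then show "(nrm ?C ?\<eta>)\<^sup>2 \<le> 8 * real (DIM('a) + 1) * ?D^4 * (H2_seminorm ?C u)\<^sup>2"
    using B(1) by (simp only: mult_ac)
  have u1: "u \<in> H1 \<Omega>" using u by (simp add: H2_def)
  note pw = interpolant_pw_affine[of g, OF g(3)]
  note I = pw_affine_H1[OF open_\<Omega> bounded_\<Omega> negligible_frontier pw]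
  have w: "weak_gradient \<Omega> ?\<eta> (\<lambda>x. grad \<Omega> u x - dgrad \<Omega> (slope g) (interpolant g) x)"
    by (rule weak_gradient_diff[OF open_\<Omega> H1D(2)[OF open_\<Omega> u1] I(1)])
  have m: "grad \<Omega> ?\<eta> \<in> borel_measurable (lebesgue_on \<Omega>)"
    using weak_gradientD(2)[OF grad_weak_gradient[OF w]] by (simp add: locally_integrable_def)
  have "nrm ?C (grad \<Omega> ?\<eta>) = nrm ?C (\<lambda>x. grad ?C u x - ?b)"
  proof (rule nrm_cong_AE)
    show "grad \<Omega> ?\<eta> \<in> borel_measurable (lebesgue_on ?C)" using m sub(3) by (auto intro: measurable_restrict_mono)
    show "(\<lambda>x. grad ?C u x - ?b) \<in> borel_measurable (lebesgue_on ?C)"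
      using H1D(3)[OF open_interior H1_restrict(1)[OF sub u1]] by (auto simp: L2_def)
    show "AE x in lebesgue_on ?C. grad \<Omega> ?\<eta> x = grad ?C u x - ?b"
      using AE_lebesgue_on_subset[OF sub grad_AE_eq[OF open_\<Omega> w]] H1_restrict(2)[OF sub u1] AE_space
    proof eventually_elim
      case (elim x)
      then have x: "x \<in> ?C" by simp
      have "dgrad \<Omega> (slope g) (interpolant g) x = ?b"
        using x sub(3) by (intro dgrad_affine_near interpolant_affine_near[OF K x] interpolant_lipschitz g(3)) auto
      then show ?case using elim by simp
    qed
  qed
  then have "(nrm ?C (grad \<Omega> ?\<eta>))\<^sup>2 \<le> real (DIM('a) + 1) * (8 * ?D^4 * (H2_seminorm ?C u)\<^sup>2) / r\<^sup>2" using B(2) by simp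
  also have "\<dots> \<le> 32 * real (DIM('a) + 1) * \<sigma>\<^sup>2 * ?D\<^sup>2 * (H2_seminorm ?C u)\<^sup>2"
  proof -
    have "?D\<^sup>2 \<le> (2 * \<sigma> * r)\<^sup>2" using r(3) diameter_ge_0[OF bK] unfolding mesh_size_def by (rule power_mono)
    then have "?D\<^sup>2 / r\<^sup>2 \<le> 4 * \<sigma>\<^sup>2" using r(1) by (simp add: power_mult_distrib pos_divide_le_eq)
    then have "(8 * real (DIM('a) + 1) * ?D\<^sup>2 * (H2_seminorm ?C u)\<^sup>2) * (?D\<^sup>2 / r\<^sup>2)
      \<le> (8 * real (DIM('a) + 1) * ?D\<^sup>2 * (H2_seminorm ?C u)\<^sup>2) * (4 * \<sigma>\<^sup>2)" by (intro mult_left_mono) auto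
    moreover have "?D^4 = ?D\<^sup>2 * ?D\<^sup>2" by (simp add: power_add[symmetric])
    moreover have "n * (8 * (a * a) * h) / q = (8 * n * a * h) * (a / q)" "(8 * n * a * h) * (4 * s) = 32 * n * s * a * h"
      for n a h q s :: real by simp_all
    ultimately show ?thesis by (simp only:)
  qed
  finally show "(nrm ?C (grad \<Omega> ?\<eta>))\<^sup>2 \<le> 32 * real (DIM('a) + 1) * \<sigma>\<^sup>2 * ?D\<^sup>2 * (H2_seminorm ?C u)\<^sup>2" .
qed

lemma X_H_diff:
  assumes "p \<in> X_H \<Omega> \<T>" "q \<in> X_H \<Omega> \<T>" shows "(\<lambda>x. p x - q x) \<in> X_H \<Omega> \<T>"
proof -
  have "\<exists>a b. \<forall>x\<in>K. p x - q x = a + b \<bullet> x" if "K \<in> \<T>" for K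
  proof -
    obtain a b a' b' where "\<forall>x\<in>K. p x = a + b \<bullet> x" "\<forall>x\<in>K. q x = a' + b' \<bullet> x"
      using assms \<open>K \<in> \<T>\<close> unfolding X_H_def S_H_def by blast
    then have "\<forall>x\<in>K. p x - q x = (a - a') + (b - b') \<bullet> x" by (simp add: inner_diff_left)
    then show ?thesis by blast
  qed
  moreover have "continuous_on (closure \<Omega>) (\<lambda>x. p x - q x)"
    using assms by (intro continuous_on_diff) (auto simp: X_H_def S_H_def)
  moreover have "(\<lambda>x. p x - q x) \<in> H10 \<Omega>" using assms by (intro H10_diff[OF open_\<Omega> bounded_\<Omega>]) (auto simp: X_H_def)
  ultimately show ?thesis by (simp add: X_H_def S_H_def)
qed

end

section \<open>Bounds for the advection term\<close>

lemma nrm_zero_AE: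
  assumes f: "f \<in> L2 \<Omega>" and z: "nrm \<Omega> f = 0"
  shows "AE x in lebesgue_on \<Omega>. f x = 0"
proof -
  have "(\<integral>x. (norm (f x))\<^sup>2 \<partial>lebesgue_on \<Omega>) = 0" using z nrm_square[of \<Omega> f] by simp
  then have "AE x in lebesgue_on \<Omega>. (norm (f x))\<^sup>2 = 0"
    using L2_norm_integrable[OF f] by (subst (asm) integral_nonneg_eq_0_iff_AE) auto
  then show ?thesis by eventually_elim simp
qed

text \<open>The supremum runs over functions that are not almost everywhere zero; for these the denominator is positive
  by Poincare's inequality. If there are none, the supremum is \<open>- \<infinity>\<close> and its real value is 0.\<close>

lemma finite_c_v_bound:
  fixes \<Omega> :: "'a::euclidean_space set"
  assumes \<Omega>: "open \<Omega>" "bounded \<Omega>" and v: "v \<in> borel_measurable (lebesgue_on \<Omega>)" and fin: "c_v \<Omega> v < \<infinity>"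
    and q: "q \<in> H10 \<Omega>"
  shows "(\<lambda>x. q x *\<^sub>R v x) \<in> L2 \<Omega>"
    "nrm \<Omega> (\<lambda>x. q x *\<^sub>R v x) \<le> real_of_ereal (c_v \<Omega> v) * nrm \<Omega> (grad \<Omega> q)"
    "0 \<le> real_of_ereal (c_v \<Omega> v)"
proof -
  let ?Q = "{q \<in> H10 \<Omega>. \<not> (AE x in lebesgue_on \<Omega>. q x = 0)}"
  let ?f = "\<lambda>q. L2_norm \<Omega> (\<lambda>x. q x *\<^sub>R v x) / L2_norm \<Omega> (grad \<Omega> q)"
  note D = H1D[OF \<Omega>(1) H10_H1]
  obtain P where P: "P > 0" "\<And>u. u \<in> H10 \<Omega> \<Longrightarrow> nrm \<Omega> u \<le> P * nrm \<Omega> (grad \<Omega> u)" by (rule poincare[OF \<Omega>]) blast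
  have L2n: "L2_norm \<Omega> f = ereal (nrm \<Omega> f)" if "f \<in> L2 \<Omega>" for f :: "'a \<Rightarrow> 'b::euclidean_space"
    using that by (simp add: L2_norm_def nrm_def)
  have pos: "nrm \<Omega> (grad \<Omega> p) > 0" if "p \<in> ?Q" for p
  proof (rule ccontr)
    assume "\<not> nrm \<Omega> (grad \<Omega> p) > 0"
    then have z: "nrm \<Omega> (grad \<Omega> p) = 0" using nrm_nonneg[of \<Omega> "grad \<Omega> p"] by linarith
    have "nrm \<Omega> p = 0" using P(2)[of p] that z nrm_nonneg[of \<Omega> p] by simp
    then show False using nrm_zero_AE[OF D(1)] that by blast
  qed
  have le: "?f p \<le> c_v \<Omega> v" if "p \<in> ?Q" for p unfolding c_v_def by (rule SUP_upper[OF that])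
  have B: "(\<lambda>x. p x *\<^sub>R v x) \<in> L2 \<Omega> \<and> ereal (nrm \<Omega> (\<lambda>x. p x *\<^sub>R v x) / nrm \<Omega> (grad \<Omega> p)) \<le> c_v \<Omega> v" if p: "p \<in> ?Q" for p
  proof -
    have g: "L2_norm \<Omega> (grad \<Omega> p) = ereal (nrm \<Omega> (grad \<Omega> p))" using p by (intro L2n D(3)) auto
    have i: "(\<lambda>x. p x *\<^sub>R v x) \<in> L2 \<Omega>"
    proof (rule ccontr)
      assume "(\<lambda>x. p x *\<^sub>R v x) \<notin> L2 \<Omega>"
      then have "?f p = \<infinity>" using pos[OF p] unfolding g by (simp add: L2_norm_def)
      then show False using le[OF p] fin by simp
    qed
    then show ?thesis using le[OF p] pos[OF p] unfolding g L2n[OF i] by simp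
  qed
  show c0: "0 \<le> real_of_ereal (c_v \<Omega> v)"
  proof (cases "?Q = {}")
    case False
    then obtain p where p: "p \<in> ?Q" by blast
    have "0 \<le> nrm \<Omega> (\<lambda>x. p x *\<^sub>R v x) / nrm \<Omega> (grad \<Omega> p)" by simp
    then have "ereal 0 \<le> ereal (nrm \<Omega> (\<lambda>x. p x *\<^sub>R v x) / nrm \<Omega> (grad \<Omega> p))" by (simp only: ereal_less_eq)
    also have "\<dots> \<le> c_v \<Omega> v" using B[OF p] by blast
    finally show ?thesis by (simp add: real_of_ereal_pos zero_ereal_def)
  next
    case True
    then show ?thesis unfolding c_v_def by (simp only: True image_empty Sup_empty) (simp add: bot_ereal_def)
  qed
  show "(\<lambda>x. q x *\<^sub>R v x) \<in> L2 \<Omega>" "nrm \<Omega> (\<lambda>x. q x *\<^sub>R v x) \<le> real_of_ereal (c_v \<Omega> v) * nrm \<Omega> (grad \<Omega> q)"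
  proof -
    have "(\<lambda>x. q x *\<^sub>R v x) \<in> L2 \<Omega> \<and> nrm \<Omega> (\<lambda>x. q x *\<^sub>R v x) \<le> real_of_ereal (c_v \<Omega> v) * nrm \<Omega> (grad \<Omega> q)"
    proof (cases "AE x in lebesgue_on \<Omega>. q x = 0")
      case True
      have m: "(\<lambda>x. q x *\<^sub>R v x) \<in> borel_measurable (lebesgue_on \<Omega>)" using L2_measurable[OF D(1)[OF q]] v by measurable
      have le: "AE x in lebesgue_on \<Omega>. norm (q x *\<^sub>R v x) \<le> 0 * norm (q x)" using True by eventually_elim simp
      show ?thesis using L2_mult_bounded[OF D(1)[OF q] m le] mult_nonneg_nonneg[OF c0 nrm_nonneg[of \<Omega> "grad \<Omega> q"]] by simp
    next
      case False
      then have p: "q \<in> ?Q" using q by simp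
      have "ereal (nrm \<Omega> (\<lambda>x. q x *\<^sub>R v x) / nrm \<Omega> (grad \<Omega> q)) \<le> ereal (real_of_ereal (c_v \<Omega> v))"
        using B[OF p] fin by (cases "c_v \<Omega> v") auto
      then show ?thesis using B[OF p] pos[OF p] by (simp add: pos_divide_le_eq)
    qed
    then show "(\<lambda>x. q x *\<^sub>R v x) \<in> L2 \<Omega>" "nrm \<Omega> (\<lambda>x. q x *\<^sub>R v x) \<le> real_of_ereal (c_v \<Omega> v) * nrm \<Omega> (grad \<Omega> q)" by auto
  qed
qed

lemma Linf_advection_bound:
  fixes \<Omega> :: "'a::euclidean_space set"
  assumes \<Omega>: "open \<Omega>" "bounded \<Omega>" and v: "v \<in> Linf \<Omega>"
  obtains c where "c \<ge> 0" "\<And>q. q \<in> H10 \<Omega> \<Longrightarrow> (\<lambda>x. q x *\<^sub>R v x) \<in> L2 \<Omega>"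
    "\<And>q. q \<in> H10 \<Omega> \<Longrightarrow> nrm \<Omega> (\<lambda>x. q x *\<^sub>R v x) \<le> c * nrm \<Omega> (grad \<Omega> q)"
proof -
  obtain M where vm: "v \<in> borel_measurable (lebesgue_on \<Omega>)" and M: "AE x in lebesgue_on \<Omega>. norm (v x) \<le> M"
    using v by (auto simp: Linf_def)
  obtain P where P: "P > 0" "\<And>u. u \<in> H10 \<Omega> \<Longrightarrow> nrm \<Omega> u \<le> P * nrm \<Omega> (grad \<Omega> u)" by (rule poincare[OF \<Omega>]) blast
  have B: "(\<lambda>x. q x *\<^sub>R v x) \<in> L2 \<Omega>" "nrm \<Omega> (\<lambda>x. q x *\<^sub>R v x) \<le> \<bar>M\<bar> * nrm \<Omega> q" if q: "q \<in> H10 \<Omega>" for q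
  proof -
    note q2 = H1D(1)[OF \<Omega>(1) H10_H1[OF q]]
    have m: "(\<lambda>x. q x *\<^sub>R v x) \<in> borel_measurable (lebesgue_on \<Omega>)" using L2_measurable[OF q2] vm by measurable
    have le: "AE x in lebesgue_on \<Omega>. norm (q x *\<^sub>R v x) \<le> \<bar>M\<bar> * norm (q x)"
      using M
    proof eventually_elim
      case (elim x)
      then have "norm (v x) \<le> \<bar>M\<bar>" by simp
      then show ?case by (simp add: mult.commute[of "\<bar>M\<bar>"] mult_left_mono)
    qed
    show "(\<lambda>x. q x *\<^sub>R v x) \<in> L2 \<Omega>" "nrm \<Omega> (\<lambda>x. q x *\<^sub>R v x) \<le> \<bar>M\<bar> * nrm \<Omega> q" using L2_mult_bounded[OF q2 m le] by auto
  qed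
  show thesis
  proof (rule that[of "\<bar>M\<bar> * P"])
    show "nrm \<Omega> (\<lambda>x. q x *\<^sub>R v x) \<le> \<bar>M\<bar> * P * nrm \<Omega> (grad \<Omega> q)" if q: "q \<in> H10 \<Omega>" for q
      using order_trans[OF B(2)[OF q] mult_left_mono[OF P(2)[OF q], of "\<bar>M\<bar>"]] by (simp add: mult.assoc)
  qed (use P(1) B(1) in auto)
qed

section \<open>The error estimates\<close>

locale galerkin_approximation = lipschitz_mesh \<Omega> \<T> for \<Omega> :: "'a::euclidean_space set" and \<T> +
  fixes \<alpha> :: "'a \<Rightarrow> real" and lo hi :: real and v :: "'a \<Rightarrow> 'a" and d :: "'a \<Rightarrow> real"
    and f :: "('a \<Rightarrow> real) \<Rightarrow> real" and \<sigma> :: real and u uH :: "'a \<Rightarrow> real"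
  assumes dim: "DIM('a) \<le> 3"
    and \<alpha>_measurable: "\<alpha> \<in> borel_measurable (lebesgue_on \<Omega>)"
    and lo_pos: "0 < lo" and \<alpha>_bounds: "\<And>x. x \<in> \<Omega> \<Longrightarrow> lo \<le> \<alpha> x \<and> \<alpha> x \<le> hi"
    and div_v: "weak_divergence \<Omega> v d" and regular: "shape_regular \<sigma> \<T>"
    and u_H10: "u \<in> H10 \<Omega>" and u_solves: "\<And>q. q \<in> H10 \<Omega> \<Longrightarrow> b_form \<Omega> \<alpha> v u q = f q"
    and uH: "uH \<in> X_H \<Omega> \<T>" and uH_solves: "\<And>q. q \<in> X_H \<Omega> \<T> \<Longrightarrow> b_form \<Omega> \<alpha> v uH q = f q"
    and u_H2: "u \<in> H2 \<Omega>"
begin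

lemma v_measurable: "v \<in> borel_measurable (lebesgue_on \<Omega>)"
  using div_v by (simp add: weak_divergence_def locally_integrable_def)

lemma ess_sup_alpha_nonneg:
  assumes K: "K \<in> \<T>" shows "0 \<le> ess_sup_on (interior K) \<alpha>"
proof (rule ess_sup_on_bounds(2)[OF open_interior element(4)[OF K]])
  show "\<alpha> \<in> borel_measurable (lebesgue_on (interior K))" using \<alpha>_measurable element(6)[OF K] by (rule measurable_restrict_mono)
  show "AE x in lebesgue_on (interior K). \<alpha> x \<le> hi" using \<alpha>_bounds element(6)[OF K] by (intro AE_I2) auto
  show "0 \<le> \<alpha> x" if "x \<in> interior K" for x
  proof -
    have "x \<in> \<Omega>" using element(6)[OF K] that by blast
    then show ?thesis using \<alpha>_bounds[of x] lo_pos by simp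
  qed
qed

definition value_bound :: "'a set \<Rightarrow> real" where
  "value_bound K = 8 * real (DIM('a) + 1) * (mesh_size K)^4 * (H2_seminorm (interior K) u)\<^sup>2"

definition gradient_bound :: "'a set \<Rightarrow> real" where
  "gradient_bound K = 32 * real (DIM('a) + 1) * \<sigma>\<^sup>2 * (mesh_size K)\<^sup>2 * (H2_seminorm (interior K) u)\<^sup>2"

text \<open>The approximation is the interpolant of the continuous version of \<open>u\<close>. It belongs to the discrete space, so
  its difference to \<open>u\<^sub>H\<close> is an admissible test function in both variational problems.\<close>

lemma good_approximation:
  obtains I where "I \<in> H10 \<Omega>" "b_form \<Omega> \<alpha> v u (\<lambda>x. I x - uH x) = b_form \<Omega> \<alpha> v uH (\<lambda>x. I x - uH x)"
    "\<And>K. K \<in> \<T> \<Longrightarrow> (nrm (interior K) (\<lambda>x. u x - I x))\<^sup>2 \<le> value_bound K"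
    "\<And>K. K \<in> \<T> \<Longrightarrow> (nrm (interior K) (grad \<Omega> (\<lambda>x. u x - I x)))\<^sup>2 \<le> gradient_bound K"
proof -
  obtain U G H where "H2_function \<Omega> u U G H" by (rule H2_function_ex[OF open_\<Omega> bounded_\<Omega> dim u_H2])
  then interpret H2_function \<Omega> u U G H .
  obtain g where g: "continuous_on (closure \<Omega>) g" "AE x in lebesgue_on \<Omega>. u x = g x"
    by (rule continuous_extension[OF lipschitz_cone_property[OF lipschitz_domain]]) blast
  have g0: "g a = 0" if "a \<in> frontier \<Omega>" for a
    by (rule H10_continuous_frontier_zero[OF lipschitz_domain u_H10 g that])
  have I: "interpolant g \<in> X_H \<Omega> \<T>" by (rule interpolant_X_H[of g, OF g0])
  have w: "(\<lambda>x. interpolant g x - uH x) \<in> X_H \<Omega> \<T>" by (rule X_H_diff[OF I uH])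
  show thesis
  proof (rule that[of "interpolant g"])
    show "interpolant g \<in> H10 \<Omega>" using I by (simp add: X_H_def)
    show "b_form \<Omega> \<alpha> v u (\<lambda>x. interpolant g x - uH x) = b_form \<Omega> \<alpha> v uH (\<lambda>x. interpolant g x - uH x)"
      using u_solves uH_solves w by (simp add: X_H_def)
  qed (unfold value_bound_def gradient_bound_def, rule interpolation_error[OF dim regular u_H2 g g0]; assumption)+
qed

lemma estimate_bounded_multiplier:
  assumes fin: "c_v \<Omega> v < \<infinity>" and d: "AE x in lebesgue_on \<Omega>. d x \<le> 0"
  shows "(Y_norm \<Omega> \<alpha> (\<lambda>x. u x - uH x))\<^sup>2 \<le> 256 * real (DIM('a) + 1) * (\<sigma>\<^sup>2 + 1) *
    (\<Sum>K\<in>\<T>. (mesh_size K)\<^sup>2 * (ess_sup_on (interior K) \<alpha> + (real_of_ereal (c_v \<Omega> v))\<^sup>2 / lo) * (H2_seminorm (interior K) u)\<^sup>2)"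
proof -
  let ?cv = "real_of_ereal (c_v \<Omega> v)"
  note cv = finite_c_v_bound[OF open_\<Omega> bounded_\<Omega> v_measurable fin]
  interpret advection_diffusion \<Omega> \<alpha> lo hi v ?cv
    using open_\<Omega> bounded_\<Omega> \<alpha>_measurable lo_pos \<alpha>_bounds v_measurable cv(1,2) cv(3)[OF u_H10] by unfold_locales
  obtain I where I: "I \<in> H10 \<Omega>" "b_form \<Omega> \<alpha> v u (\<lambda>x. I x - uH x) = b_form \<Omega> \<alpha> v uH (\<lambda>x. I x - uH x)"
    and e: "\<And>K. K \<in> \<T> \<Longrightarrow> (nrm (interior K) (grad \<Omega> (\<lambda>x. u x - I x)))\<^sup>2 \<le> gradient_bound K"
    by (rule good_approximation) blast
  define \<eta> where "\<eta> x = u x - I x" for x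
  have \<eta>: "\<eta> \<in> H10 \<Omega>" unfolding \<eta>_def[abs_def] by (rule H10_diff[OF open_\<Omega> bounded_\<Omega> u_H10 I(1)])
  have uHH: "uH \<in> H10 \<Omega>" using uH by (simp add: X_H_def)
  let ?E = gradient_bound
  have G: "grad \<Omega> \<eta> \<in> L2 \<Omega>" by (rule H10D(3)[OF \<eta>])
  have eK: "(nrm (interior K) (grad \<Omega> \<eta>))\<^sup>2 \<le> ?E K" if "K \<in> \<T>" for K using e[OF that] by (simp add: \<eta>_def[abs_def])
  have \<alpha>0: "0 \<le> \<alpha> x" "\<alpha> x \<le> hi" if "x \<in> \<Omega>" for x using \<alpha>_bounds[OF that] lo_pos by auto
  have "(nrm \<Omega> (wgrad \<eta>))\<^sup>2 = (\<integral>x. \<alpha> x * (norm (grad \<Omega> \<eta> x))\<^sup>2 \<partial>lebesgue_on \<Omega>)" by (rule wgrad_nrm(3)[OF \<eta>])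
  also have "\<dots> \<le> (\<Sum>K\<in>\<T>. ess_sup_on (interior K) \<alpha> * ?E K)"
    by (rule weighted_integral_le_elements[OF G \<alpha>_measurable _ _ eK, of hi]) (use \<alpha>0 in \<open>auto intro!: AE_I2\<close>)
  finally have 1: "(nrm \<Omega> (wgrad \<eta>))\<^sup>2 \<le> (\<Sum>K\<in>\<T>. ess_sup_on (interior K) \<alpha> * ?E K)" .
  have "(nrm \<Omega> (grad \<Omega> \<eta>))\<^sup>2 \<le> (\<Sum>K\<in>\<T>. (nrm (interior K) (grad \<Omega> \<eta>))\<^sup>2)"
    unfolding nrm_square by (rule integral_le_elements[OF L2_norm_integrable[OF G]]) simp
  also have "\<dots> \<le> (\<Sum>K\<in>\<T>. ?E K)" by (intro sum_mono eK)
  finally have 2: "?cv\<^sup>2 / lo * (nrm \<Omega> (grad \<Omega> \<eta>))\<^sup>2 \<le> ?cv\<^sup>2 / lo * (\<Sum>K\<in>\<T>. ?E K)"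
    by (rule mult_left_mono) (use lo_pos in simp)
  have "(Y_norm \<Omega> \<alpha> (\<lambda>x. u x - uH x))\<^sup>2 \<le> 8 * (nrm \<Omega> (wgrad \<eta>))\<^sup>2 + 2 * (?cv\<^sup>2 / lo * (nrm \<Omega> (grad \<Omega> \<eta>))\<^sup>2)"
    using error_estimate_bounded_multiplier[OF u_H10 uHH I div_v d] by (simp add: \<eta>_def[abs_def])
  also have "\<dots> \<le> 8 * (\<Sum>K\<in>\<T>. ess_sup_on (interior K) \<alpha> * ?E K) + 2 * (?cv\<^sup>2 / lo * (\<Sum>K\<in>\<T>. ?E K))"
    using 1 2 by linarith
  also have "\<dots> = (\<Sum>K\<in>\<T>. 8 * (ess_sup_on (interior K) \<alpha> * ?E K) + 2 * (?cv\<^sup>2 / lo * ?E K))"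
    by (simp only: sum.distrib sum_distrib_left)
  also have "\<dots> \<le> (\<Sum>K\<in>\<T>. 256 * real (DIM('a) + 1) * (\<sigma>\<^sup>2 + 1) *
      ((mesh_size K)\<^sup>2 * (ess_sup_on (interior K) \<alpha> + ?cv\<^sup>2 / lo) * (H2_seminorm (interior K) u)\<^sup>2))"
  proof (rule sum_mono)
    fix K assume K: "K \<in> \<T>"
    let ?A = "ess_sup_on (interior K) \<alpha>" and ?W = "real (DIM('a) + 1) * (mesh_size K)\<^sup>2 * (H2_seminorm (interior K) u)\<^sup>2"
    have A: "0 \<le> ?A" by (rule ess_sup_alpha_nonneg[OF K])
    have c0: "0 \<le> ?cv\<^sup>2 / lo" using lo_pos by simp
    have "8 * (?A * ?E K) + 2 * (?cv\<^sup>2 / lo * ?E K) \<le> 8 * ((?A + ?cv\<^sup>2 / lo) * ?E K)"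
    proof -
      have "0 \<le> ?E K" by (simp add: gradient_bound_def)
      then have "0 \<le> ?cv\<^sup>2 / lo * ?E K" using c0 by (intro mult_nonneg_nonneg)
      moreover have "8 * ((?A + ?cv\<^sup>2 / lo) * ?E K) = 8 * (?A * ?E K) + 8 * (?cv\<^sup>2 / lo * ?E K)" by (simp only: distrib_left distrib_right)
      ultimately show ?thesis by linarith
    qed
    also have "\<dots> = (256 * (?A + ?cv\<^sup>2 / lo) * ?W) * \<sigma>\<^sup>2"
    proof -
      have "8 * (X * (32 * n * s * m * h)) = (256 * X * (n * m * h)) * s" for X n s m h :: real by simp
      then show ?thesis unfolding gradient_bound_def .
    qed
    also have "\<dots> \<le> (256 * (?A + ?cv\<^sup>2 / lo) * ?W) * (\<sigma>\<^sup>2 + 1)"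
      using A c0 by (intro mult_left_mono mult_nonneg_nonneg add_nonneg_nonneg) auto
    finally show "8 * (?A * ?E K) + 2 * (?cv\<^sup>2 / lo * ?E K) \<le> 256 * real (DIM('a) + 1) * (\<sigma>\<^sup>2 + 1) *
      ((mesh_size K)\<^sup>2 * (?A + ?cv\<^sup>2 / lo) * (H2_seminorm (interior K) u)\<^sup>2)" by (simp only: mult_ac)
  qed
  finally show ?thesis by (simp only: sum_distrib_left)
qed

lemma estimate_solenoidal:
  assumes v: "v \<in> Linf \<Omega>" and d: "AE x in lebesgue_on \<Omega>. d x = 0"
  shows "(Y_norm \<Omega> \<alpha> (\<lambda>x. u x - uH x))\<^sup>2 \<le> 256 * real (DIM('a) + 1) * (\<sigma>\<^sup>2 + 1) *
    (\<Sum>K\<in>\<T>. ((mesh_size K)\<^sup>2 * ess_sup_on (interior K) \<alpha>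
      + (mesh_size K)^4 * ess_sup_on (interior K) (\<lambda>x. (norm (v x))\<^sup>2 / \<alpha> x)) * (H2_seminorm (interior K) u)\<^sup>2)"
proof -
  obtain c where c: "c \<ge> 0" "\<And>q. q \<in> H10 \<Omega> \<Longrightarrow> (\<lambda>x. q x *\<^sub>R v x) \<in> L2 \<Omega>"
    "\<And>q. q \<in> H10 \<Omega> \<Longrightarrow> nrm \<Omega> (\<lambda>x. q x *\<^sub>R v x) \<le> c * nrm \<Omega> (grad \<Omega> q)"
    by (rule Linf_advection_bound[OF open_\<Omega> bounded_\<Omega> v]) blast
  interpret advection_diffusion \<Omega> \<alpha> lo hi v c
    using open_\<Omega> bounded_\<Omega> \<alpha>_measurable lo_pos \<alpha>_bounds v_measurable c(2,3,1) by unfold_locales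
  obtain I where I: "I \<in> H10 \<Omega>" "b_form \<Omega> \<alpha> v u (\<lambda>x. I x - uH x) = b_form \<Omega> \<alpha> v uH (\<lambda>x. I x - uH x)"
    and e: "\<And>K. K \<in> \<T> \<Longrightarrow> (nrm (interior K) (\<lambda>x. u x - I x))\<^sup>2 \<le> value_bound K"
      "\<And>K. K \<in> \<T> \<Longrightarrow> (nrm (interior K) (grad \<Omega> (\<lambda>x. u x - I x)))\<^sup>2 \<le> gradient_bound K"
    by (rule good_approximation) blast
  define \<eta> where "\<eta> x = u x - I x" for x
  have \<eta>: "\<eta> \<in> H10 \<Omega>" unfolding \<eta>_def[abs_def] by (rule H10_diff[OF open_\<Omega> bounded_\<Omega> u_H10 I(1)])
  have uHH: "uH \<in> H10 \<Omega>" using uH by (simp add: X_H_def)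
  let ?E = gradient_bound
  let ?E' = value_bound
  have eK: "(nrm (interior K) (grad \<Omega> \<eta>))\<^sup>2 \<le> ?E K" "(nrm (interior K) \<eta>)\<^sup>2 \<le> ?E' K" if "K \<in> \<T>" for K
    using e[OF that] by (simp_all add: \<eta>_def[abs_def])
  have \<alpha>0: "0 \<le> \<alpha> x" "\<alpha> x \<le> hi" if "x \<in> \<Omega>" for x using \<alpha>_bounds[OF that] lo_pos by auto
  let ?w = "\<lambda>x. (norm (v x))\<^sup>2 / \<alpha> x"
  obtain M where M: "AE x in lebesgue_on \<Omega>. norm (v x) \<le> M" using v by (auto simp: Linf_def)
  have wm: "?w \<in> borel_measurable (lebesgue_on \<Omega>)" using v_measurable \<alpha>_measurable by measurable
  have wB: "AE x in lebesgue_on \<Omega>. ?w x \<le> M\<^sup>2 / lo"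
    using M AE_space
  proof eventually_elim
    case (elim x)
    have "(norm (v x))\<^sup>2 \<le> M\<^sup>2" using elim(1) by (rule power_mono) simp
    then show ?case using \<alpha>_bounds[of x] elim(2) lo_pos by (intro frac_le) auto
  qed
  have w0: "0 \<le> ?w x" if "x \<in> \<Omega>" for x using \<alpha>0(1)[OF that] by simp
  have "(nrm \<Omega> (wgrad \<eta>))\<^sup>2 = (\<integral>x. \<alpha> x * (norm (grad \<Omega> \<eta> x))\<^sup>2 \<partial>lebesgue_on \<Omega>)" by (rule wgrad_nrm(3)[OF \<eta>])
  also have "\<dots> \<le> (\<Sum>K\<in>\<T>. ess_sup_on (interior K) \<alpha> * ?E K)"
    by (rule weighted_integral_le_elements[OF H10D(3)[OF \<eta>] \<alpha>_measurable _ _ eK(1), of hi]) (use \<alpha>0 in \<open>auto intro!: AE_I2\<close>)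
  finally have 1: "(nrm \<Omega> (wgrad \<eta>))\<^sup>2 \<le> (\<Sum>K\<in>\<T>. ess_sup_on (interior K) \<alpha> * ?E K)" .
  have "(nrm \<Omega> (\<lambda>x. (\<eta> x / sqrt (\<alpha> x)) *\<^sub>R v x))\<^sup>2 = (\<integral>x. ?w x * (norm (\<eta> x))\<^sup>2 \<partial>lebesgue_on \<Omega>)"
    unfolding nrm_square
    by (intro Bochner_Integration.integral_cong refl) (simp add: \<alpha>0 power_mult_distrib power_divide)
  also have "\<dots> \<le> (\<Sum>K\<in>\<T>. ess_sup_on (interior K) ?w * ?E' K)"
    by (rule weighted_integral_le_elements[OF H10D(1)[OF \<eta>] wm wB w0 eK(2)])
  finally have 2: "(nrm \<Omega> (\<lambda>x. (\<eta> x / sqrt (\<alpha> x)) *\<^sub>R v x))\<^sup>2 \<le> (\<Sum>K\<in>\<T>. ess_sup_on (interior K) ?w * ?E' K)" .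
  have "(Y_norm \<Omega> \<alpha> (\<lambda>x. u x - uH x))\<^sup>2 \<le> 8 * (nrm \<Omega> (wgrad \<eta>))\<^sup>2 + 2 * (nrm \<Omega> (\<lambda>x. (\<eta> x / sqrt (\<alpha> x)) *\<^sub>R v x))\<^sup>2"
    using error_estimate_solenoidal[OF u_H10 uHH I div_v d] by (simp add: \<eta>_def[abs_def])
  also have "\<dots> \<le> 8 * (\<Sum>K\<in>\<T>. ess_sup_on (interior K) \<alpha> * ?E K) + 2 * (\<Sum>K\<in>\<T>. ess_sup_on (interior K) ?w * ?E' K)"
    using 1 2 by linarith
  also have "\<dots> = (\<Sum>K\<in>\<T>. 8 * (ess_sup_on (interior K) \<alpha> * ?E K) + 2 * (ess_sup_on (interior K) ?w * ?E' K))"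
    by (simp only: sum.distrib sum_distrib_left)
  also have "\<dots> \<le> (\<Sum>K\<in>\<T>. 256 * real (DIM('a) + 1) * (\<sigma>\<^sup>2 + 1) *
      (((mesh_size K)\<^sup>2 * ess_sup_on (interior K) \<alpha> + (mesh_size K)^4 * ess_sup_on (interior K) ?w) * (H2_seminorm (interior K) u)\<^sup>2))"
  proof (rule sum_mono)
    fix K assume K: "K \<in> \<T>"
    note sub = open_\<Omega> open_interior element(6)[OF K]
    let ?A = "ess_sup_on (interior K) \<alpha>" and ?B = "ess_sup_on (interior K) ?w"
    let ?S = "256 * real (DIM('a) + 1) * (H2_seminorm (interior K) u)\<^sup>2"
    have A: "0 \<le> ?A" by (rule ess_sup_alpha_nonneg[OF K])
    have "?w \<in> borel_measurable (lebesgue_on (interior K))" using wm sub(3) by (rule measurable_restrict_mono)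
    then have B: "0 \<le> ?B"
      by (rule ess_sup_on_bounds(2)[OF open_interior element(4)[OF K] _ AE_lebesgue_on_subset[OF sub wB]]) (use w0 sub(3) in blast)
    have calc: "8 * (X * (32 * n * s * m * h)) = 256 * n * h * (m * X) * s" "2 * (X * (8 * n * m * h)) = 256 * n * h * (m * X) * (1/16)"
      "256 * n * h * x * s + 256 * n * h * y * s = 256 * n * s * ((x + y) * h)" for X n s m h x y :: real
      by (simp_all add: algebra_simps)
    have "8 * (?A * ?E K) = ?S * ((mesh_size K)\<^sup>2 * ?A) * \<sigma>\<^sup>2" unfolding gradient_bound_def by (rule calc(1))
    also have "\<dots> \<le> ?S * ((mesh_size K)\<^sup>2 * ?A) * (\<sigma>\<^sup>2 + 1)" using A by (intro mult_left_mono) auto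
    finally have a: "8 * (?A * ?E K) \<le> ?S * ((mesh_size K)\<^sup>2 * ?A) * (\<sigma>\<^sup>2 + 1)" .
    have "2 * (?B * ?E' K) = ?S * ((mesh_size K)^4 * ?B) * (1/16)" unfolding value_bound_def by (rule calc(2))
    also have "\<dots> \<le> ?S * ((mesh_size K)^4 * ?B) * (\<sigma>\<^sup>2 + 1)"
    proof (rule mult_left_mono)
      show "1/16 \<le> \<sigma>\<^sup>2 + 1" using zero_le_power2[of \<sigma>] by linarith
    qed (use B in simp)
    finally have b: "2 * (?B * ?E' K) \<le> ?S * ((mesh_size K)^4 * ?B) * (\<sigma>\<^sup>2 + 1)" .
    show "8 * (?A * ?E K) + 2 * (?B * ?E' K) \<le> 256 * real (DIM('a) + 1) * (\<sigma>\<^sup>2 + 1) *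
      (((mesh_size K)\<^sup>2 * ?A + (mesh_size K)^4 * ?B) * (H2_seminorm (interior K) u)\<^sup>2)"
      unfolding calc(3)[symmetric] using a b by (rule add_mono)
  qed
  finally show ?thesis by (simp only: sum_distrib_left)
qed

end

theorem lemma2p7:
  fixes \<Omega> :: "(real^'n) set" and \<sigma> :: real
  assumes "CARD('n) \<in> {1, 2, 3}" and "bounded_lipschitz_domain \<Omega>"
  shows "\<exists>c>0. \<forall>(\<alpha> :: real^'n \<Rightarrow> real) \<alpha>_lo \<alpha>_hi (v :: real^'n \<Rightarrow> real^'n) div_v f \<T> u u\<^sub>H.
    \<alpha> \<in> borel_measurable (lebesgue_on \<Omega>) \<and>
    0 < \<alpha>_lo \<and> (\<forall>x\<in>\<Omega>. \<alpha>_lo \<le> \<alpha> x \<and> \<alpha> x \<le> \<alpha>_hi) \<and>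
    weak_divergence \<Omega> v div_v \<and>
    f \<in> Y_dual \<Omega> \<alpha> \<and>
    simplicial_mesh \<Omega> \<T> \<and> shape_regular \<sigma> \<T> \<and>
    u \<in> X_v \<Omega> \<alpha> v \<and> (\<forall>q\<in>H10 \<Omega>. b_form \<Omega> \<alpha> v u q = f q) \<and>
    u\<^sub>H \<in> X_H \<Omega> \<T> \<and> (\<forall>q\<in>X_H \<Omega> \<T>. b_form \<Omega> \<alpha> v u\<^sub>H q = f q) \<and>
    u \<in> H2 \<Omega>
    \<longrightarrow>
    (c_v \<Omega> v < \<infinity> \<and> (AE x in lebesgue_on \<Omega>. div_v x \<le> 0) \<longrightarrow>
      (Y_norm \<Omega> \<alpha> (\<lambda>x. u x - u\<^sub>H x))\<^sup>2 \<le>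
        c * (\<Sum>\<tau>\<in>\<T>. (mesh_size \<tau>)\<^sup>2
               * (ess_sup_on (interior \<tau>) \<alpha> + (real_of_ereal (c_v \<Omega> v))\<^sup>2 / \<alpha>_lo)
               * (H2_seminorm (interior \<tau>) u)\<^sup>2)) \<and>
    (v \<in> Linf \<Omega> \<and> (AE x in lebesgue_on \<Omega>. div_v x = 0) \<longrightarrow>
      (Y_norm \<Omega> \<alpha> (\<lambda>x. u x - u\<^sub>H x))\<^sup>2 \<le>
        c * (\<Sum>\<tau>\<in>\<T>. ((mesh_size \<tau>)\<^sup>2 * ess_sup_on (interior \<tau>) \<alpha>
               + (mesh_size \<tau>)^4 * ess_sup_on (interior \<tau>) (\<lambda>x. (norm (v x))\<^sup>2 / \<alpha> x))
               * (H2_seminorm (interior \<tau>) u)\<^sup>2))"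
proof (intro exI[of _ "256 * real (DIM(real^'n) + 1) * (\<sigma>\<^sup>2 + 1)"] conjI allI impI; (elim conjE)?)
  show "256 * real (DIM(real^'n) + 1) * (\<sigma>\<^sup>2 + 1) > 0"
    using zero_le_power2[of \<sigma>] by (intro mult_pos_pos) linarith+
next
  fix \<alpha> :: "real^'n \<Rightarrow> real" and lo hi and v :: "real^'n \<Rightarrow> real^'n" and d f \<T> u uH
  assume h: "\<alpha> \<in> borel_measurable (lebesgue_on \<Omega>)" "0 < lo" "\<forall>x\<in>\<Omega>. lo \<le> \<alpha> x \<and> \<alpha> x \<le> hi" "weak_divergence \<Omega> v d"
    "simplicial_mesh \<Omega> \<T>" "shape_regular \<sigma> \<T>" "u \<in> X_v \<Omega> \<alpha> v" "\<forall>q\<in>H10 \<Omega>. b_form \<Omega> \<alpha> v u q = f q"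
    "uH \<in> X_H \<Omega> \<T>" "\<forall>q\<in>X_H \<Omega> \<T>. b_form \<Omega> \<alpha> v uH q = f q" "u \<in> H2 \<Omega>"
  have g: "galerkin_approximation \<Omega> \<T> \<alpha> lo hi v d f \<sigma> u uH"
    using h assms by unfold_locales (auto simp: X_v_def)
  {
    assume "c_v \<Omega> v < \<infinity>" "AE x in lebesgue_on \<Omega>. d x \<le> 0"
    then show "(Y_norm \<Omega> \<alpha> (\<lambda>x. u x - uH x))\<^sup>2 \<le> 256 * real (DIM(real^'n) + 1) * (\<sigma>\<^sup>2 + 1) *
      (\<Sum>\<tau>\<in>\<T>. (mesh_size \<tau>)\<^sup>2 * (ess_sup_on (interior \<tau>) \<alpha> + (real_of_ereal (c_v \<Omega> v))\<^sup>2 / lo) * (H2_seminorm (interior \<tau>) u)\<^sup>2)"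
      by (rule galerkin_approximation.estimate_bounded_multiplier[OF g])
  next
    assume "v \<in> Linf \<Omega>" "AE x in lebesgue_on \<Omega>. d x = 0"
    then show "(Y_norm \<Omega> \<alpha> (\<lambda>x. u x - uH x))\<^sup>2 \<le> 256 * real (DIM(real^'n) + 1) * (\<sigma>\<^sup>2 + 1) *
      (\<Sum>\<tau>\<in>\<T>. ((mesh_size \<tau>)\<^sup>2 * ess_sup_on (interior \<tau>) \<alpha>
        + (mesh_size \<tau>)^4 * ess_sup_on (interior \<tau>) (\<lambda>x. (norm (v x))\<^sup>2 / \<alpha> x)) * (H2_seminorm (interior \<tau>) u)\<^sup>2)"
      by (rule galerkin_approximation.estimate_solenoidal[OF g])
  }
qed

end
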